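(* Let $K$ be a valued field of equicharacteristic zero, let $\ell\geq1$ be an integer, and let $\mathcal{L}$ be a language expanding the language of valued fields such that $\mathrm{Th}_{\mathcal{L}}(K)$ satisfies property (T$\ell$, D). Let $\mathcal{L}'$ be an $\mathrm{RV}$-expansion of $\mathcal{L}$. Then $\mathrm{Th}_{\mathcal{L}'}(K)$ still satisfies property (T$\ell$, D).
   Context: The valuation is written multiplicatively $|\cdot|:K\to\Gamma_K=\Gamma_K^\times\cup\{0\}$. For $\lambda\le1$ in $\Gamma_K^\times$, $\mathrm{RV}_\lambda=(K^\times/(1+\{x:|x|<\lambda\}))\cup\{0\}$, $\mathrm{rv}_\lambda$ the quotient map ($\mathrm{rv}_\lambda(0)=0$), $\mathrm{RV}=\mathrm{RV}_1$. An open ball $B_{<\lambda}(a)=\{x:|x-a|<\lambda\}$ has $\mathrm{rad}_{\mathrm{op}}=\lambda$. An $\mathrm{RV}$-expansion of $\mathcal{L}$ is an expansion by arbitrary predicates on Cartesian powers of $\mathrm{RV}$. A $\lambda$-twisted box in $K^n$ is $\{x:(\mathrm{rv}_\lambda(x_i-c_i(\pi_{<i}(x))))_{i=1}^n=r\}$ with definable center tuple $(c_i)$, $c_i:\pi_{<i}(X)\to K$, and $r\in\mathrm{RV}_\lambda^n$ ($\pi_{<i}$ = projection onto first $i-1$ coordinates); a twisted box if $\lambda=1$. An $A$-definable decomposition of $K^n$ is an $A$-definable $\chi:K^n\to\mathrm{RV}^k$ whose non-empty fibres $\chi^{-1}(\xi)$ are $A\cup\{\xi\}$-definable twisted boxes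 with centers depending definably on $\xi$; a $\lambda$-twisted box of $\chi$ is a $\lambda$-twisted box contained in a fibre of $\chi$ with the same center tuple. A theory satisfies (T$\ell$, D) if for each model $K$ and each $A\subset K\cup\mathrm{RV}$: (T$\ell$) for all $A$-definable $f:K^\ell\to K$ and $\psi:K^\ell\to\mathrm{RV}^{k'}$ there is an $A$-definable decomposition $\chi$ of $K^\ell$ such that $\psi$ is constant on twisted boxes of $\chi$, $f(F)$ is an open ball or singleton for each twisted box $F$ of $\chi$, and for each $\lambda\le1$ and each $\lambda$-twisted box $G$ of $\chi$ inside a twisted box $F$, $f(G)$ is a singleton (if $f(F)$ is) or an open ball of radius $\lambda\,\mathrm{rad}_{\mathrm{op}}f(F)$; (D) for every $A$-definable $f:K\to K$, $\{y:f^{-1}(y)\text{ infinite}\}$ is finite.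
   Formalization: The valuation on K is assumed non-trivial; for trivially valued K (e.g. C, where RV = K) the claim fails, since an RV-predicate can be the graph of a map with infinitely many infinite fibres, which destroys (D). *)

theory Defs
  imports "HOL-Algebra.QuotRing" "HOL-Algebra.Subrings"
begin

section \<open>Terms and formulas over a valued field with its imaginary sort RV\<close>

text \<open>
  A language expanding the language of valued fields (ring operations and a unary predicate for the
  valuation ring) is given by its additional symbols.  Formulas may quantify over and speak about
  the sort RV.  A structure does not choose this sort: it is always interpreted by the quotient RV
  of the valued field, so that RV behaves as an imaginary sort.  Function symbols are maps from
  \<open>K^m\<close> to \<open>K\<close>; relation symbols are relations on \<open>K^m \<times> RV^n\<close>.

  Variables are de Bruijn indices, separately for the two sorts.
\<close>

record ('f, 'r) lang =
  fsyms :: "'f set"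
  farity :: "'f \<Rightarrow> nat"
  rsyms :: "'r set"
  rarity :: "'r \<Rightarrow> nat \<times> nat"

datatype 'f trm =
    Var nat
  | TZero
  | TOne
  | TAdd "'f trm" "'f trm"
  | TMinus "'f trm"
  | TMult "'f trm" "'f trm"
  | Fn 'f "'f trm list"

datatype 'f rvtrm = RVVar nat | Rv "'f trm"

datatype ('f, 'r) form =
    FEq "'f trm" "'f trm"
  | FVal "'f trm"
  | FRVEq "'f rvtrm" "'f rvtrm"
  | FRel 'r "'f trm list" "'f rvtrm list"
  | FNot "('f, 'r) form"
  | FAnd "('f, 'r) form" "('f, 'r) form"
  | FEx "('f, 'r) form"
  | FExRV "('f, 'r) form"

text \<open>
  \<open>wf_form L n m \<phi>\<close>: \<open>\<phi>\<close> is an \<open>L\<close>-formula whose free variables are among the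
  first \<open>n\<close> variables of sort \<open>K\<close> and the first \<open>m\<close> variables of sort RV.
\<close>

primrec wf_trm :: "('f, 'r) lang \<Rightarrow> nat \<Rightarrow> 'f trm \<Rightarrow> bool" where
  "wf_trm L n (Var i) = (i < n)"
| "wf_trm L n TZero = True"
| "wf_trm L n TOne = True"
| "wf_trm L n (TAdd s t) = (wf_trm L n s \<and> wf_trm L n t)"
| "wf_trm L n (TMinus t) = wf_trm L n t"
| "wf_trm L n (TMult s t) = (wf_trm L n s \<and> wf_trm L n t)"
| "wf_trm L n (Fn f ts) =
     (f \<in> fsyms L \<and> length ts = farity L f \<and> list_all (wf_trm L n) ts)"

primrec wf_rvtrm :: "('f, 'r) lang \<Rightarrow> nat \<Rightarrow> nat \<Rightarrow> 'f rvtrm \<Rightarrow> bool" where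
  "wf_rvtrm L n m (RVVar i) = (i < m)"
| "wf_rvtrm L n m (Rv t) = wf_trm L n t"

primrec wf_form :: "('f, 'r) lang \<Rightarrow> nat \<Rightarrow> nat \<Rightarrow> ('f, 'r) form \<Rightarrow> bool" where
  "wf_form L n m (FEq s t) = (wf_trm L n s \<and> wf_trm L n t)"
| "wf_form L n m (FVal t) = wf_trm L n t"
| "wf_form L n m (FRVEq s t) = (wf_rvtrm L n m s \<and> wf_rvtrm L n m t)"
| "wf_form L n m (FRel R ts us) =
     (R \<in> rsyms L \<and> rarity L R = (length ts, length us) \<and>
      list_all (wf_trm L n) ts \<and> list_all (wf_rvtrm L n m) us)"
| "wf_form L n m (FNot \<phi>) = wf_form L n m \<phi>"
| "wf_form L n m (FAnd \<phi> \<psi>) = (wf_form L n m \<phi> \<and> wf_form L n m \<psi>)"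
| "wf_form L n m (FEx \<phi>) = wf_form L (Suc n) m \<phi>"
| "wf_form L n m (FExRV \<phi>) = wf_form L n (Suc m) \<phi>"


section \<open>Valued fields\<close>

text \<open>
  A valued field is a field with a valuation ring \<open>vring\<close>; the symbols of the language are
  interpreted by \<open>ifun\<close> and \<open>irel\<close>.
\<close>

record ('f, 'r, 'u) vstruct = "'u ring" +
  vring :: "'u set"
  ifun :: "'f \<Rightarrow> 'u list \<Rightarrow> 'u"
  irel :: "'r \<Rightarrow> ('u list \<times> 'u set list) set"

definition vring_of :: "('f, 'r, 'u) vstruct \<Rightarrow> ('f, 'r, 'u) vstruct" where
  "vring_of M = M\<lparr>carrier := vring M\<rparr>"

definition max_ideal :: "('f, 'r, 'u) vstruct \<Rightarrow> 'u set" where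
  "max_ideal M = vring M - Units (vring_of M)"

definition residue_field :: "('f, 'r, 'u) vstruct \<Rightarrow> 'u set ring" where
  "residue_field M = vring_of M Quot max_ideal M"

text \<open>
  The valuation is assumed to be non-trivial (i.e. the valuation ring is not the whole field).
\<close>

definition valued_field :: "('f, 'r, 'u) vstruct \<Rightarrow> bool" where
  "valued_field M \<longleftrightarrow> field M \<and> subring (vring M) M \<and>
     (\<forall>x\<in>carrier M - {\<zero>\<^bsub>M\<^esub>}. x \<in> vring M \<or> inv\<^bsub>M\<^esub> x \<in> vring M) \<and>
     vring M \<noteq> carrier M"

definition char_zero :: "('u, 'b) ring_scheme \<Rightarrow> bool" where
  "char_zero R \<longleftrightarrow> (\<forall>n::nat. n > 0 \<longrightarrow> [n] \<cdot>\<^bsub>R\<^esub> \<one>\<^bsub>R\<^esub> \<noteq> \<zero>\<^bsub>R\<^esub>)"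

definition equichar_zero :: "('f, 'r, 'u) vstruct \<Rightarrow> bool" where
  "equichar_zero M \<longleftrightarrow> char_zero M \<and> char_zero (residue_field M)"

text \<open>
  The value \<open>|x|\<close> is the coset of \<open>x\<close> modulo the units of the valuation ring; in particular
  \<open>|0| = {0}\<close>.  So \<open>Gamma_units M\<close> is the quotient of the multiplicative group of the field by the
  units of the valuation ring, written multiplicatively; its multiplication is \<^const>\<open>set_mult\<close>
  and its unit is \<open>vabs M \<one>\<^bsub>M\<^esub>\<close>.
\<close>

definition vabs :: "('f, 'r, 'u) vstruct \<Rightarrow> 'u \<Rightarrow> 'u set" where
  "vabs M x = {x \<otimes>\<^bsub>M\<^esub> u | u. u \<in> Units (vring_of M)}"

definition Gamma_units :: "('f, 'r, 'u) vstruct \<Rightarrow> 'u set set" where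
  "Gamma_units M = vabs M ` (carrier M - {\<zero>\<^bsub>M\<^esub>})"

definition vle :: "('f, 'r, 'u) vstruct \<Rightarrow> 'u set \<Rightarrow> 'u set \<Rightarrow> bool" where
  "vle M \<alpha> \<beta> \<longleftrightarrow> (\<exists>x\<in>\<alpha>. \<exists>y\<in>\<beta>. \<exists>z\<in>vring M. x = z \<otimes>\<^bsub>M\<^esub> y)"

definition vless :: "('f, 'r, 'u) vstruct \<Rightarrow> 'u set \<Rightarrow> 'u set \<Rightarrow> bool" where
  "vless M \<alpha> \<beta> \<longleftrightarrow> vle M \<alpha> \<beta> \<and> \<alpha> \<noteq> \<beta>"

definition open_ball :: "('f, 'r, 'u) vstruct \<Rightarrow> 'u set \<Rightarrow> 'u \<Rightarrow> 'u set" where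
  "open_ball M \<delta> a = {x \<in> carrier M. vless M (vabs M (x \<ominus>\<^bsub>M\<^esub> a)) \<delta>}"

text \<open>\<open>B\<close> is an open ball with \<open>rad_op B = \<delta>\<close>.\<close>

definition is_open_ball :: "('f, 'r, 'u) vstruct \<Rightarrow> 'u set \<Rightarrow> 'u set \<Rightarrow> bool" where
  "is_open_ball M \<delta> B \<longleftrightarrow> \<delta> \<in> Gamma_units M \<and> (\<exists>a\<in>carrier M. B = open_ball M \<delta> a)"

text \<open>
  \<open>rvl M \<delta> x\<close> is the coset of \<open>x\<close> modulo the multiplicative group \<open>1 + {y. |y| < \<delta>}\<close> (for
  \<open>\<delta> \<le> 1\<close>).  For \<open>x = 0\<close> the formula gives \<open>{0}\<close>, the additional element \<open>0\<close> of \<open>RV_\<delta>\<close>.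
\<close>

definition rvl :: "('f, 'r, 'u) vstruct \<Rightarrow> 'u set \<Rightarrow> 'u \<Rightarrow> 'u set" where
  "rvl M \<delta> x = {x \<otimes>\<^bsub>M\<^esub> (\<one>\<^bsub>M\<^esub> \<oplus>\<^bsub>M\<^esub> y) | y. y \<in> carrier M \<and> vless M (vabs M y) \<delta>}"

definition RVl :: "('f, 'r, 'u) vstruct \<Rightarrow> 'u set \<Rightarrow> 'u set set" where
  "RVl M \<delta> = rvl M \<delta> ` carrier M"

definition rv :: "('f, 'r, 'u) vstruct \<Rightarrow> 'u \<Rightarrow> 'u set" where
  "rv M = rvl M (vabs M \<one>\<^bsub>M\<^esub>)"

definition RV :: "('f, 'r, 'u) vstruct \<Rightarrow> 'u set set" where
  "RV M = RVl M (vabs M \<one>\<^bsub>M\<^esub>)"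

definition tuples :: "nat \<Rightarrow> 'u set \<Rightarrow> 'u list set" where
  "tuples n S = {xs. length xs = n \<and> set xs \<subseteq> S}"


section \<open>Structures, satisfaction, theories and expansions\<close>

definition vf_structure :: "('f, 'r) lang \<Rightarrow> ('f, 'r, 'u) vstruct \<Rightarrow> bool" where
  "vf_structure L M \<longleftrightarrow> valued_field M \<and>
     (\<forall>f\<in>fsyms L. \<forall>xs\<in>tuples (farity L f) (carrier M). ifun M f xs \<in> carrier M) \<and>
     (\<forall>R\<in>rsyms L. case rarity L R of (m, n) \<Rightarrow>
        irel M R \<subseteq> tuples m (carrier M) \<times> tuples n (RV M))"

primrec eval :: "('f, 'r, 'u) vstruct \<Rightarrow> 'u list \<Rightarrow> 'f trm \<Rightarrow> 'u" where
  "eval M xs (Var i) = xs ! i"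
| "eval M xs TZero = \<zero>\<^bsub>M\<^esub>"
| "eval M xs TOne = \<one>\<^bsub>M\<^esub>"
| "eval M xs (TAdd s t) = eval M xs s \<oplus>\<^bsub>M\<^esub> eval M xs t"
| "eval M xs (TMinus t) = \<ominus>\<^bsub>M\<^esub> eval M xs t"
| "eval M xs (TMult s t) = eval M xs s \<otimes>\<^bsub>M\<^esub> eval M xs t"
| "eval M xs (Fn f ts) = ifun M f (map (eval M xs) ts)"

primrec rveval :: "('f, 'r, 'u) vstruct \<Rightarrow> 'u list \<Rightarrow> 'u set list \<Rightarrow> 'f rvtrm \<Rightarrow> 'u set" where
  "rveval M xs \<xi>s (RVVar i) = \<xi>s ! i"
| "rveval M xs \<xi>s (Rv t) = rv M (eval M xs t)"

primrec sat :: "('f, 'r, 'u) vstruct \<Rightarrow> 'u list \<Rightarrow> 'u set list \<Rightarrow> ('f, 'r) form \<Rightarrow> bool" where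
  "sat M xs \<xi>s (FEq s t) = (eval M xs s = eval M xs t)"
| "sat M xs \<xi>s (FVal t) = (eval M xs t \<in> vring M)"
| "sat M xs \<xi>s (FRVEq s t) = (rveval M xs \<xi>s s = rveval M xs \<xi>s t)"
| "sat M xs \<xi>s (FRel R ts us) =
     ((map (eval M xs) ts, map (rveval M xs \<xi>s) us) \<in> irel M R)"
| "sat M xs \<xi>s (FNot \<phi>) = (\<not> sat M xs \<xi>s \<phi>)"
| "sat M xs \<xi>s (FAnd \<phi> \<psi>) = (sat M xs \<xi>s \<phi> \<and> sat M xs \<xi>s \<psi>)"
| "sat M xs \<xi>s (FEx \<phi>) = (\<exists>x\<in>carrier M. sat M (x # xs) \<xi>s \<phi>)"
| "sat M xs \<xi>s (FExRV \<phi>) = (\<exists>\<xi>\<in>RV M. sat M xs (\<xi> # \<xi>s) \<phi>)"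

definition Th :: "('f, 'r) lang \<Rightarrow> ('f, 'r, 'u) vstruct \<Rightarrow> ('f, 'r) form set" where
  "Th L M = {\<phi>. wf_form L 0 0 \<phi> \<and> sat M [] [] \<phi>}"

definition is_model :: "('f, 'r) lang \<Rightarrow> ('f, 'r) form set \<Rightarrow> ('f, 'r, 'u) vstruct \<Rightarrow> bool" where
  "is_model L T M \<longleftrightarrow> vf_structure L M \<and> (\<forall>\<phi>\<in>T. sat M [] [] \<phi>)"

text \<open>
  \<open>(L', M')\<close> is an expansion of \<open>(L, M)\<close> by arbitrary predicates on Cartesian powers of RV:
  the new symbols are relation symbols without arguments of sort \<open>K\<close>.
\<close>

definition rv_expansion ::
  "('f, 'r) lang \<Rightarrow> ('f, 'r, 'u) vstruct \<Rightarrow> ('f, 'r) lang \<Rightarrow> ('f, 'r, 'u) vstruct \<Rightarrow> bool" where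
  "rv_expansion L M L' M' \<longleftrightarrow>
     fsyms L' = fsyms L \<and> (\<forall>f\<in>fsyms L. farity L' f = farity L f) \<and>
     rsyms L \<subseteq> rsyms L' \<and> (\<forall>R\<in>rsyms L. rarity L' R = rarity L R) \<and>
     (\<forall>R\<in>rsyms L' - rsyms L. fst (rarity L' R) = 0) \<and>
     vf_structure L' M' \<and> ring.truncate M' = ring.truncate M \<and> vring M' = vring M \<and>
     (\<forall>f\<in>fsyms L. \<forall>xs\<in>tuples (farity L f) (carrier M). ifun M' f xs = ifun M f xs) \<and>
     (\<forall>R\<in>rsyms L. irel M' R = irel M R)"


section \<open>Definable sets, decompositions, and the property (T\<open>\<ell>\<close>, D)\<close>

text \<open>
  \<open>definable L M A n m X\<close>: \<open>X \<subseteq> K^n \<times> RV^m\<close> is definable with parameters from \<open>A\<close>, where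
  \<open>A \<subseteq> K \<union> RV\<close> is encoded as a subset of the disjoint sum.
\<close>

definition definable ::
  "('f, 'r) lang \<Rightarrow> ('f, 'r, 'u) vstruct \<Rightarrow> ('u + 'u set) set \<Rightarrow> nat \<Rightarrow> nat
    \<Rightarrow> ('u list \<times> 'u set list) set \<Rightarrow> bool" where
  "definable L M A n m X \<longleftrightarrow>
     (\<exists>\<phi> a \<alpha>. Inl ` set a \<subseteq> A \<and> Inr ` set \<alpha> \<subseteq> A \<and>
        wf_form L (n + length a) (m + length \<alpha>) \<phi> \<and>
        X = {(x, \<xi>). x \<in> tuples n (carrier M) \<and> \<xi> \<in> tuples m (RV M) \<and>
                     sat M (x @ a) (\<xi> @ \<alpha>) \<phi>})"

definition definable_fun ::
  "('f, 'r) lang \<Rightarrow> ('f, 'r, 'u) vstruct \<Rightarrow> ('u + 'u set) set \<Rightarrow> nat \<Rightarrow> ('u list \<Rightarrow> 'u) \<Rightarrow> bool"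
where
  "definable_fun L M A n f \<longleftrightarrow>
     f \<in> tuples n (carrier M) \<rightarrow> carrier M \<and>
     definable L M A (Suc n) 0 {(x @ [f x], []) | x. x \<in> tuples n (carrier M)}"

definition definable_rvfun ::
  "('f, 'r) lang \<Rightarrow> ('f, 'r, 'u) vstruct \<Rightarrow> ('u + 'u set) set \<Rightarrow> nat \<Rightarrow> nat
    \<Rightarrow> ('u list \<Rightarrow> 'u set list) \<Rightarrow> bool"
where
  "definable_rvfun L M A n k \<psi> \<longleftrightarrow>
     \<psi> \<in> tuples n (carrier M) \<rightarrow> tuples k (RV M) \<and>
     definable L M A n k {(x, \<psi> x) | x. x \<in> tuples n (carrier M)}"

text \<open>
  Coordinates are numbered from \<open>0\<close>, so \<open>take i x\<close> is the projection of \<open>x\<close> to the coordinates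
  preceding the \<open>i\<close>-th one.  The center maps \<open>c i\<close> are total maps from \<open>K^i\<close> to \<open>K\<close>; their
  values outside the projections of the box to the first \<open>i\<close> coordinates do not influence the box,
  and definability is required only on these projections.
\<close>

definition twisted_box ::
  "('f, 'r, 'u) vstruct \<Rightarrow> 'u set \<Rightarrow> nat \<Rightarrow> (nat \<Rightarrow> 'u list \<Rightarrow> 'u) \<Rightarrow> 'u set list \<Rightarrow> 'u list set"
where
  "twisted_box M \<delta> n c r =
     {x \<in> tuples n (carrier M). \<forall>i<n. rvl M \<delta> (x ! i \<ominus>\<^bsub>M\<^esub> c i (take i x)) = r ! i}"

definition fibre ::
  "('f, 'r, 'u) vstruct \<Rightarrow> nat \<Rightarrow> ('u list \<Rightarrow> 'u set list) \<Rightarrow> 'u set list \<Rightarrow> 'u list set"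
where
  "fibre M n \<chi> \<xi> = {x \<in> tuples n (carrier M). \<chi> x = \<xi>}"

text \<open>
  \<open>\<chi>\<close> is an \<open>A\<close>-definable decomposition of \<open>K^n\<close> with center tuples \<open>c \<xi>\<close>.  That the fibre
  over \<open>\<xi>\<close> and its center tuple are definable over \<open>A \<union> {\<xi>}\<close> is implied by the definability over
  \<open>A\<close> of \<open>\<chi>\<close> and of the family \<open>c\<close> (on the projections of the fibres).
\<close>

definition decomposition ::
  "('f, 'r) lang \<Rightarrow> ('f, 'r, 'u) vstruct \<Rightarrow> ('u + 'u set) set \<Rightarrow> nat \<Rightarrow> nat
    \<Rightarrow> ('u list \<Rightarrow> 'u set list) \<Rightarrow> ('u set list \<Rightarrow> nat \<Rightarrow> 'u list \<Rightarrow> 'u) \<Rightarrow> bool"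
where
  "decomposition L M A n k \<chi> c \<longleftrightarrow>
     definable_rvfun L M A n k \<chi> \<and>
     (\<forall>\<xi>\<in>tuples k (RV M). \<forall>i<n. c \<xi> i \<in> tuples i (carrier M) \<rightarrow> carrier M) \<and>
     (\<forall>i<n. definable L M A (Suc i) k
        {(take i x @ [c (\<chi> x) i (take i x)], \<chi> x) | x. x \<in> tuples n (carrier M)}) \<and>
     (\<forall>\<xi>\<in>tuples k (RV M). fibre M n \<chi> \<xi> \<noteq> {} \<longrightarrow>
        (\<exists>r\<in>tuples n (RV M). fibre M n \<chi> \<xi> = twisted_box M (vabs M \<one>\<^bsub>M\<^esub>) n (c \<xi>) r))"

definition property_T ::
  "('f, 'r) lang \<Rightarrow> ('f, 'r, 'u) vstruct \<Rightarrow> ('u + 'u set) set \<Rightarrow> nat \<Rightarrow> bool"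
where
  "property_T L M A l \<longleftrightarrow>
     (\<forall>f k' \<psi>. definable_fun L M A l f \<and> definable_rvfun L M A l k' \<psi> \<longrightarrow>
       (\<exists>k \<chi> c. decomposition L M A l k \<chi> c \<and>
         (\<forall>\<xi>\<in>tuples k (RV M). \<forall>F. F = fibre M l \<chi> \<xi> \<and> F \<noteq> {} \<longrightarrow>
            (\<forall>x\<in>F. \<forall>y\<in>F. \<psi> x = \<psi> y) \<and>
            ((\<exists>y. f ` F = {y}) \<or> (\<exists>\<mu>. is_open_ball M \<mu> (f ` F))) \<and>
            (\<forall>\<delta>\<in>Gamma_units M. vle M \<delta> (vabs M \<one>\<^bsub>M\<^esub>) \<longrightarrow>
              (\<forall>s\<in>tuples l (RVl M \<delta>). \<forall>G. G = twisted_box M \<delta> l (c \<xi>) s \<and> G \<subseteq> F \<longrightarrow>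
                 ((\<exists>y. f ` F = {y}) \<longrightarrow> (\<exists>y. f ` G = {y})) \<and>
                 (\<forall>\<mu>. is_open_ball M \<mu> (f ` F) \<longrightarrow>
                    is_open_ball M (\<delta> <#>\<^bsub>M\<^esub> \<mu>) (f ` G)))))))"

definition property_D ::
  "('f, 'r) lang \<Rightarrow> ('f, 'r, 'u) vstruct \<Rightarrow> ('u + 'u set) set \<Rightarrow> bool"
where
  "property_D L M A \<longleftrightarrow>
     (\<forall>f. definable_fun L M A 1 f \<longrightarrow>
        finite {y \<in> carrier M. infinite {x \<in> carrier M. f [x] = y}})"

text \<open>
  The models of a theory are those whose universe is a set of elements of the type \<open>'u\<close>.
\<close>

definition satisfies_TD ::
  "'u itself \<Rightarrow> ('f, 'r) lang \<Rightarrow> ('f, 'r) form set \<Rightarrow> nat \<Rightarrow> bool"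
where
  "satisfies_TD U L T l \<longleftrightarrow>
     (\<forall>(M :: ('f, 'r, 'u) vstruct) A. is_model L T M \<and> A \<subseteq> Inl ` carrier M \<union> Inr ` RV M \<longrightarrow>
        property_T L M A l \<and> property_D L M A)"

text \<open>
  HOL cannot quantify over all types within a formula.  A conclusion \<open>satisfies_TD TYPE('u) L T l\<close>
  with a type variable \<open>'u\<close> not occurring elsewhere covers all models.  By the downward
  Loewenheim-Skolem theorem (a failure of (T\<open>\<ell>\<close>, D) passes to a suitable elementary substructure
  of cardinality at most that of the set of formulas), assuming
  \<open>satisfies_TD TYPE('f + 'r + nat) L T l\<close> is equivalent to assuming it for every type in place
  of \<open>'f + 'r + nat\<close>.
\<close>

end

theory Submission
  imports Defs
begin

text \<open>The key point is a relative quantifier elimination: every formula of the expansion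
  depends on its field variables only through finitely many \<open>L\<close>-definable maps to RV. For a
  quantifier over the field one prepares, by (T\<open>\<ell>\<close>), the fibres of such maps by centers that
  depend on RV-parameters. The union of these finite sets of centers over all RV-parameters is
  still finite: the value at a point \<open>b\<close> of the monic polynomial with these centers as roots is,
  after pulling back along rv, a function on the field with open fibres, so by (D) it takes finitely
  many values; since their number is bounded independently of \<open>b\<close>, only finitely many polynomials
  occur.
  Hence a set depending on RV-parameters is prepared by finitely many centers which no longer
  depend on them.

  Consequently a function \<open>f\<close> definable in the expansion has the form \<open>f x = g\<^sub>\<eta> x\<close> where
  \<open>\<eta>\<close> is a map to RV controlled by an \<open>L\<close>-definable one and \<open>g\<close> is an \<open>L\<close>-definable family,
  and both properties follow from those of \<open>L\<close>, applied uniformly in \<open>\<eta>\<close>. The uniformity is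
  compactness; since the hypothesis speaks about structures on one fixed type, compactness is
  combined with a downward Loewenheim-Skolem argument in an ultrapower built from Skolem terms.\<close>

text \<open>The new predicates may be arbitrary subsets of powers of RV, so nothing that they define
  can be described; only the amount of a field variable that they see can be controlled. For this,
  the centers preparing a family of sets indexed by RV must be fixed before the index is known. A
  finite set of centers has no definable enumeration, while (D) speaks of single-valued functions
  into the field. The set is therefore replaced by the monic polynomial with these roots, and the
  polynomial by its values at sufficiently many fixed points.

  (D) itself is not first-order, because infinity of a fibre is not. To take a value on a whole open
  ball is first-order, and since balls are infinite, (D) bounds the number of such values;
  compactness makes the bound uniform. Conversely, an infinite fibre of a function of the expansion
  contains a ball, found around a point of the fibre outside finitely many centers.\<close>

section \<open>Valued fields\<close>

text \<open>\<open>vlt\<close> is \<open>|u| < |v|\<close>, and \<open>rveq M d\<close> is equality of \<open>rv\<^bsub>\<lambda>\<^esub>\<close> for \<open>\<lambda> = |d|\<close>; both are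
  stated through divisibility in the valuation ring, hence first-order.\<close>

definition vlt :: "('f, 'r, 'u) vstruct \<Rightarrow> 'u \<Rightarrow> 'u \<Rightarrow> bool" where
  "vlt M u v \<longleftrightarrow> \<not> (\<exists>z\<in>vring M. v = z \<otimes>\<^bsub>M\<^esub> u)"

definition rveq :: "('f, 'r, 'u) vstruct \<Rightarrow> 'u \<Rightarrow> 'u \<Rightarrow> 'u \<Rightarrow> bool" where
  "rveq M d x y \<longleftrightarrow> x = y \<or> vlt M (x \<ominus>\<^bsub>M\<^esub> y) (d \<otimes>\<^bsub>M\<^esub> y)"

text \<open>The radius is given by a field element and not by a value, so that statements about
  balls can be written as formulas without a sort for the value group.\<close>

definition ball :: "('f, 'r, 'u) vstruct \<Rightarrow> 'u \<Rightarrow> 'u \<Rightarrow> 'u set" where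
  "ball M a m = {y \<in> carrier M. vlt M (y \<ominus>\<^bsub>M\<^esub> a) m}"

locale vfield =
  fixes M :: "('f, 'r, 'u) vstruct" (structure)
  assumes valued_field: "valued_field M"
begin

sublocale field M
  using valued_field by (simp add: valued_field_def)

lemma vring_subring: "subring (vring M) M"
  using valued_field by (simp add: valued_field_def)

lemma vring_carrier: "x \<in> vring M \<Longrightarrow> x \<in> carrier M"
  using subringE(1)[OF vring_subring] by blast

lemma vring_closed [simp]:
  "\<zero> \<in> vring M" "\<one> \<in> vring M"
  "x \<in> vring M \<Longrightarrow> \<ominus> x \<in> vring M"
  "x \<in> vring M \<Longrightarrow> y \<in> vring M \<Longrightarrow> x \<oplus> y \<in> vring M"
  "x \<in> vring M \<Longrightarrow> y \<in> vring M \<Longrightarrow> x \<otimes> y \<in> vring M"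
  using subringE[OF vring_subring] by auto

lemma inv_closed: "x \<in> carrier M \<Longrightarrow> x \<noteq> \<zero> \<Longrightarrow> inv x \<in> carrier M"
  by (simp add: field_Units)

lemma inv_left: "x \<in> carrier M \<Longrightarrow> x \<noteq> \<zero> \<Longrightarrow> inv x \<otimes> x = \<one>"
  by (simp add: field_Units)

lemma inv_right: "x \<in> carrier M \<Longrightarrow> x \<noteq> \<zero> \<Longrightarrow> x \<otimes> inv x = \<one>"
  by (simp add: field_Units)

lemma vring_total: "x \<in> carrier M \<Longrightarrow> x \<noteq> \<zero> \<Longrightarrow> x \<in> vring M \<or> inv x \<in> vring M"
  using valued_field by (auto simp: valued_field_def)

lemma Units_vring:
  "Units (vring_of M) = {u. u \<in> vring M \<and> (\<exists>v\<in>vring M. u \<otimes> v = \<one>)}"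
  unfolding Units_def vring_of_def
  by (auto intro: m_comm simp: vring_carrier m_comm)

lemma vlt_iff: "vlt M u v \<longleftrightarrow> \<not> (\<exists>z\<in>vring M. v = z \<otimes> u)"
  by (simp add: vlt_def)

section \<open>Divisibility in the valuation ring and values of field elements\<close>

lemma dv_total:
  assumes "x \<in> carrier M" "y \<in> carrier M"
  shows "(\<exists>z\<in>vring M. x = z \<otimes> y) \<or> (\<exists>z\<in>vring M. y = z \<otimes> x)"
proof (cases "x = \<zero> \<or> y = \<zero>")
  case True
  then show ?thesis using assms vring_closed(1) l_null by metis
next
  case False
  let ?q = "x \<otimes> inv y"
  have q: "?q \<in> carrier M" "?q \<noteq> \<zero>"
    using False assms inv_closed[of y] integral_iff inv_right[of y] by auto
  have eq: "x = ?q \<otimes> y" using False assms by (simp add: m_assoc inv_closed inv_left)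
  have "inv ?q \<otimes> x = (inv ?q \<otimes> ?q) \<otimes> y"
    using q assms eq inv_closed m_assoc by metis
  then have "y = inv ?q \<otimes> x" using q assms by (simp add: inv_left)
  then show ?thesis using vring_total[OF q] eq by blast
qed

lemma dv_trans:
  assumes "\<exists>z\<in>vring M. x = z \<otimes> y" "\<exists>z\<in>vring M. y = z \<otimes> w" "w \<in> carrier M"
  shows "\<exists>z\<in>vring M. x = z \<otimes> w"
  using assms vring_closed(5) m_assoc vring_carrier by metis

lemma vabs_mem: "u \<in> vabs M x \<longleftrightarrow> (\<exists>z\<in>Units (vring_of M). u = x \<otimes> z)"
  by (auto simp: vabs_def)

lemma vle_iff:
  assumes "x \<in> carrier M" "y \<in> carrier M"
  shows "vle M (vabs M x) (vabs M y) \<longleftrightarrow> (\<exists>z\<in>vring M. x = z \<otimes> y)"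
proof
  assume "vle M (vabs M x) (vabs M y)"
  then obtain u v z where uv: "u \<in> Units (vring_of M)" "v \<in> Units (vring_of M)" "z \<in> vring M"
    and e: "x \<otimes> u = z \<otimes> (y \<otimes> v)" unfolding vle_def vabs_def by auto
  obtain u' where u': "u' \<in> vring M" "u \<otimes> u' = \<one>" using uv(1) Units_vring by auto
  have c: "u \<in> carrier M" "u' \<in> carrier M" "v \<in> vring M" "z \<in> carrier M" "v \<in> carrier M"
    using uv u' Units_vring vring_carrier by auto
  have "x = x \<otimes> u \<otimes> u'" using assms c u' by (simp add: m_assoc)
  also have "\<dots> = z \<otimes> (y \<otimes> v) \<otimes> u'" using e by simp
  also have "\<dots> = (z \<otimes> v \<otimes> u') \<otimes> y" using assms c by (simp add: m_ac)
  finally show "\<exists>z\<in>vring M. x = z \<otimes> y"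
    by (intro bexI[of _ "z \<otimes> v \<otimes> u'"]) (simp_all add: uv u' c)
next
  assume "\<exists>z\<in>vring M. x = z \<otimes> y"
  moreover have "x \<in> vabs M x" "y \<in> vabs M y" using assms
    by (auto simp: vabs_mem Units_vring intro!: bexI[of _ \<one>] exI[of _ \<one>])
  ultimately show "vle M (vabs M x) (vabs M y)" unfolding vle_def by blast
qed

text \<open>Unless both elements are zero, cancelling \<open>y\<close> shows that the two
  multipliers are inverse to each other; they are units of the valuation ring, and one coset absorbs
  the other.\<close>

lemma vabs_eqI:
  assumes "x \<in> carrier M" "y \<in> carrier M" "z \<in> vring M" "w \<in> vring M" "x = z \<otimes> y" "y = w \<otimes> x"
  shows "vabs M x \<subseteq> vabs M y"
proof
  fix u assume "u \<in> vabs M x"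
  then obtain v where v: "v \<in> Units (vring_of M)" "u = x \<otimes> v" by (auto simp: vabs_mem)
  show "u \<in> vabs M y"
  proof (cases "y = \<zero>")
    case True
    then have "x = \<zero>" using assms(3,5) vring_carrier r_null by blast
    with True v show ?thesis by (auto simp: vabs_mem)
  next
    case False
    have c: "z \<in> carrier M" "w \<in> carrier M" using assms(3,4) vring_carrier by blast+
    have "\<one> \<otimes> y = (w \<otimes> z) \<otimes> y" using assms(2,5,6) c m_assoc l_one by metis
    then have "w \<otimes> z = \<one>" using False assms(2) c m_rcancel by (metis m_closed one_closed)
    moreover obtain v' where v': "v' \<in> vring M" "v \<otimes> v' = \<one>" "v \<in> vring M" using v Units_vring by auto
    moreover have "(z \<otimes> v) \<otimes> (w \<otimes> v') = (w \<otimes> z) \<otimes> (v \<otimes> v')"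
      using c vring_carrier[OF v'(1)] vring_carrier[OF v'(3)] by (simp add: m_ac)
    ultimately have "(z \<otimes> v) \<otimes> (w \<otimes> v') = \<one>" by simp
    then have "z \<otimes> v \<in> Units (vring_of M)"
      unfolding Units_vring using assms(3,4) v' by (intro CollectI conjI bexI[of _ "w \<otimes> v'"]) simp_all
    moreover have "u = y \<otimes> (z \<otimes> v)"
      unfolding v(2) assms(5) using assms(2) c vring_carrier[OF v'(3)] by (simp add: m_ac)
    ultimately show ?thesis by (auto simp: vabs_mem)
  qed
qed

lemma vabs_eq_iff:
  assumes "x \<in> carrier M" "y \<in> carrier M"
  shows "vabs M x = vabs M y \<longleftrightarrow> (\<exists>z\<in>vring M. x = z \<otimes> y) \<and> (\<exists>z\<in>vring M. y = z \<otimes> x)"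
proof
  assume "vabs M x = vabs M y"
  moreover have "vle M (vabs M x) (vabs M x)"
    using vle_iff[OF assms(1,1)] assms(1) by (metis l_one vring_closed(2))
  ultimately show "(\<exists>z\<in>vring M. x = z \<otimes> y) \<and> (\<exists>z\<in>vring M. y = z \<otimes> x)"
    using vle_iff assms by metis
next
  assume "(\<exists>z\<in>vring M. x = z \<otimes> y) \<and> (\<exists>z\<in>vring M. y = z \<otimes> x)"
  then show "vabs M x = vabs M y" using vabs_eqI assms by (metis subset_antisym)
qed

lemma vless_iff:
  assumes "x \<in> carrier M" "y \<in> carrier M"
  shows "vless M (vabs M x) (vabs M y) \<longleftrightarrow> vlt M x y"
  unfolding vless_def vlt_iff using vle_iff[OF assms] vabs_eq_iff[OF assms] dv_total[OF assms] by blast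

lemma open_ball_eq:
  assumes "m \<in> carrier M" "a \<in> carrier M"
  shows "open_ball M (vabs M m) a = ball M a m"
  unfolding open_ball_def ball_def using assms vless_iff by auto

lemma Gamma_units_iff: "\<mu> \<in> Gamma_units M \<longleftrightarrow> (\<exists>m\<in>carrier M. m \<noteq> \<zero> \<and> \<mu> = vabs M m)"
  unfolding Gamma_units_def by auto

section \<open>The strict order of values, the ultrametric inequality, and leading terms\<close>

lemma vlt_le_trans:
  assumes "vlt M x y" "\<exists>z\<in>vring M. y = z \<otimes> w" "x \<in> carrier M"
  shows "vlt M x w"
  using assms dv_trans unfolding vlt_iff by blast

lemma le_vlt_trans:
  assumes "\<exists>z\<in>vring M. x = z \<otimes> y" "vlt M y w" "y \<in> carrier M"
  shows "vlt M x w"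
  using assms dv_trans unfolding vlt_iff by blast

lemma vlt_imp_le:
  assumes "vlt M x y" "x \<in> carrier M" "y \<in> carrier M"
  shows "\<exists>z\<in>vring M. x = z \<otimes> y"
  using assms dv_total unfolding vlt_iff by blast

lemma vlt_trans:
  assumes "vlt M x y" "vlt M y w" "x \<in> carrier M" "y \<in> carrier M"
  shows "vlt M x w"
  using le_vlt_trans[OF vlt_imp_le[OF assms(1,3,4)] assms(2,4)] .

lemma vlt_irrefl: "x \<in> carrier M \<Longrightarrow> \<not> vlt M x x"
  unfolding vlt_iff using vring_closed(2) l_one by metis

lemma vlt_zero_left: "y \<in> carrier M \<Longrightarrow> vlt M \<zero> y \<longleftrightarrow> y \<noteq> \<zero>"
  unfolding vlt_iff using vring_carrier vring_closed(1) r_null by metis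

lemma vlt_zero_right: "x \<in> carrier M \<Longrightarrow> \<not> vlt M x \<zero>"
  unfolding vlt_iff using vring_closed(1) l_null by metis

lemma le_minus:
  assumes "x \<in> carrier M" "y \<in> carrier M" "\<exists>z\<in>vring M. y = z \<otimes> x"
  shows "\<exists>z\<in>vring M. y = z \<otimes> (\<ominus> x)"
  using assms vring_carrier vring_closed(3) by (metis r_minus l_minus minus_minus a_inv_closed)

lemma vlt_minus [simp]:
  assumes "x \<in> carrier M" "y \<in> carrier M"
  shows "vlt M (\<ominus> x) y \<longleftrightarrow> vlt M x y"
  unfolding vlt_iff using assms le_minus le_minus[of "\<ominus> x" y] by (metis a_inv_closed minus_minus)

lemma vlt_minus_sym:
  assumes "x \<in> carrier M" "y \<in> carrier M" "m \<in> carrier M"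
  shows "vlt M (x \<ominus> y) m \<longleftrightarrow> vlt M (y \<ominus> x) m"
proof -
  have "x \<ominus> y = \<ominus> (y \<ominus> x)" using assms(1,2) by algebra
  then show ?thesis using vlt_minus assms by (metis minus_closed)
qed

lemma vlt_add:
  assumes c: "x \<in> carrier M" "y \<in> carrier M" "w \<in> carrier M" and "vlt M x w" "vlt M y w"
  shows "vlt M (x \<oplus> y) w"
proof -
  have *: "vlt M (x \<oplus> y) w" if h: "\<exists>z\<in>vring M. x = z \<otimes> y" "x \<in> carrier M" "y \<in> carrier M" "vlt M y w" for x y
  proof -
    obtain z where z: "z \<in> vring M" "x = z \<otimes> y" using h(1) by blast
    have "x \<oplus> y = (z \<oplus> \<one>) \<otimes> y" using z that vring_carrier by (simp add: l_distr)
    then have "\<exists>z\<in>vring M. x \<oplus> y = z \<otimes> y" using z vring_closed(2,4) by metis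
    then show ?thesis using le_vlt_trans that by blast
  qed
  show ?thesis
  proof (cases "\<exists>z\<in>vring M. x = z \<otimes> y")
    case True then show ?thesis using * assms by blast
  next
    case False
    then have "\<exists>z\<in>vring M. y = z \<otimes> x" using dv_total c by blast
    then have "vlt M (y \<oplus> x) w" using *[of y x] assms by blast
    then show ?thesis using c by (simp add: a_comm)
  qed
qed

lemma vlt_diff:
  assumes "x \<in> carrier M" "y \<in> carrier M" "w \<in> carrier M" "vlt M x w" "vlt M y w"
  shows "vlt M (x \<ominus> y) w"
  unfolding a_minus_def using assms by (intro vlt_add) auto

lemma vlt_tri:
  assumes "x \<in> carrier M" "y \<in> carrier M" "z \<in> carrier M" "w \<in> carrier M"
    "vlt M (x \<ominus> y) w" "vlt M (y \<ominus> z) w"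
  shows "vlt M (x \<ominus> z) w"
proof -
  have "x \<ominus> z = (x \<ominus> y) \<oplus> (y \<ominus> z)" using assms(1-4) by algebra
  then show ?thesis using vlt_add assms by simp
qed

lemma vlt_mult:
  assumes "x \<in> carrier M" "y \<in> carrier M" "w \<in> carrier M" "w \<noteq> \<zero>"
  shows "vlt M (x \<otimes> w) (y \<otimes> w) \<longleftrightarrow> vlt M x y"
proof -
  have "y \<otimes> w = z \<otimes> (x \<otimes> w) \<longleftrightarrow> y = z \<otimes> x" if "z \<in> vring M" for z
    using assms vring_carrier[OF that] m_rcancel[of w y "z \<otimes> x"] by (simp add: m_assoc)
  then show ?thesis unfolding vlt_iff by blast
qed

text \<open>The hypothesis forces |x| = |y|: if \<open>x\<close> were smaller than \<open>y\<close>,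
  then \<open>y = x - (x - y)\<close> would be smaller than itself. Hence \<open>x\<close> and
  \<open>y\<close> can be exchanged on either side of a comparison.\<close>

lemma vlt_diff_same:
  assumes "x \<in> carrier M" "y \<in> carrier M" "w \<in> carrier M" "vlt M (x \<ominus> y) y"
  shows "vlt M x w \<longleftrightarrow> vlt M y w" "vlt M w x \<longleftrightarrow> vlt M w y"
proof -
  have 1: "\<exists>z\<in>vring M. x = z \<otimes> y"
  proof -
    obtain z where z: "z \<in> vring M" "x \<ominus> y = z \<otimes> y" using vlt_imp_le[OF assms(4)] assms by auto
    have "x = (x \<ominus> y) \<oplus> y" using assms(1,2) by algebra
    then have "x = (z \<oplus> \<one>) \<otimes> y" using z assms vring_carrier by (simp add: l_distr)
    then show ?thesis using z vring_closed(2,4) by blast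
  qed
  have 2: "\<exists>z\<in>vring M. y = z \<otimes> x"
  proof (rule ccontr)
    assume "\<not> ?thesis"
    then have "vlt M x y" by (simp add: vlt_iff)
    then have "vlt M (x \<ominus> (x \<ominus> y)) y" using vlt_diff assms by simp
    moreover have "x \<ominus> (x \<ominus> y) = y" using assms(1,2) by algebra
    ultimately show False using vlt_irrefl assms by simp
  qed
  show "vlt M x w \<longleftrightarrow> vlt M y w" using 1 2 le_vlt_trans assms by blast
  show "vlt M w x \<longleftrightarrow> vlt M w y" using 1 2 vlt_le_trans assms by blast
qed

text \<open>\<open>rveq\<close> measures the difference against its second argument only. The point
  is that |d x| = |d y|, because \<open>x - y\<close> is already smaller than \<open>y\<close> when
  \<open>d\<close> is integral.\<close>

lemma rveq_sym:
  assumes "x \<in> carrier M" "y \<in> carrier M" "d \<in> vring M" "rveq M d x y"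
  shows "rveq M d y x"
proof (cases "x = y")
  case False
  then have *: "vlt M (x \<ominus> y) (d \<otimes> y)" using assms by (simp add: rveq_def)
  have dc: "d \<in> carrier M" using assms vring_carrier by auto
  have d0: "d \<noteq> \<zero>" using * vlt_zero_right assms by fastforce
  have "vlt M (x \<ominus> y) y" using vlt_le_trans[OF *] assms by blast
  have 1: "vlt M (x \<ominus> y) (d \<otimes> x)"
  proof -
    have s: "(d \<otimes> x) \<ominus> (d \<otimes> y) = (x \<ominus> y) \<otimes> d" using assms(1,2) dc by algebra
    have "vlt M ((x \<ominus> y) \<otimes> d) (y \<otimes> d)" using vlt_mult[of "x \<ominus> y" y d] \<open>vlt M (x \<ominus> y) y\<close> assms dc d0 by simp
    then have "vlt M ((d \<otimes> x) \<ominus> (d \<otimes> y)) (d \<otimes> y)" using s assms dc by (simp add: m_comm)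
    then show ?thesis using vlt_diff_same(2)[of "d \<otimes> x" "d \<otimes> y" "x \<ominus> y"] * assms dc by simp
  qed
  then show ?thesis using vlt_minus_sym assms dc by (simp add: rveq_def)
qed (simp add: rveq_def)

lemma rvl_mem:
  assumes "x \<in> carrier M" "d \<in> carrier M"
  shows "u \<in> rvl M (vabs M d) x \<longleftrightarrow> (\<exists>y\<in>carrier M. vlt M y d \<and> u = x \<otimes> (\<one> \<oplus> y))"
  unfolding rvl_def using vless_iff assms by auto

text \<open>Multiplication by a non-zero \<open>x\<close> carries the open ball of radius |d| around
  1 to the one of radius |d x| around \<open>x\<close>. For \<open>x\<close> zero the coset is {0},
  which is why \<open>rveq\<close> has the disjunct \<open>x = y\<close>: nothing is strictly below
  zero.\<close>

lemma rvl_mem':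
  assumes "x \<in> carrier M" "d \<in> vring M" "d \<noteq> \<zero>"
  shows "u \<in> rvl M (vabs M d) x \<longleftrightarrow> u \<in> carrier M \<and> rveq M d u x"
proof -
  have dc: "d \<in> carrier M" using assms vring_carrier by auto
  show ?thesis
  proof (cases "x = \<zero>")
    case True
    then show ?thesis unfolding rvl_mem[OF assms(1) dc] rveq_def
      using assms dc vlt_zero_right vlt_zero_left[of d] by (auto intro!: bexI[of _ \<zero>])
  next
    case False
    have "(\<exists>y\<in>carrier M. vlt M y d \<and> u = x \<otimes> (\<one> \<oplus> y)) \<longleftrightarrow> u \<in> carrier M \<and> vlt M (u \<ominus> x) (d \<otimes> x)"
    proof (intro iffI)
      assume "\<exists>y\<in>carrier M. vlt M y d \<and> u = x \<otimes> (\<one> \<oplus> y)"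
      then obtain y where y: "y \<in> carrier M" "vlt M y d" "u = x \<otimes> (\<one> \<oplus> y)" by auto
      have "u \<ominus> x = y \<otimes> x" unfolding y(3) using y(1) assms(1)
        by (simp add: r_distr a_minus_def) (metis a_comm a_inv_closed add.m_assoc m_closed m_comm r_neg r_zero)
      then show "u \<in> carrier M \<and> vlt M (u \<ominus> x) (d \<otimes> x)" using y assms dc False vlt_mult by simp
    next
      assume u: "u \<in> carrier M \<and> vlt M (u \<ominus> x) (d \<otimes> x)"
      let ?y = "(u \<ominus> x) \<otimes> inv x"
      have yx: "?y \<otimes> x = u \<ominus> x" using u assms(1) False by (simp add: m_assoc inv_closed inv_left)
      have yc: "?y \<in> carrier M" using u assms(1) False inv_closed by simp
      have "x \<otimes> (\<one> \<oplus> ?y) = x \<oplus> ?y \<otimes> x" using yc assms(1) by (simp add: r_distr m_comm)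
      also have "\<dots> = x \<oplus> (u \<ominus> x)" using yx by simp
      also have "\<dots> = u" using conjunct1[OF u] assms(1) by algebra
      finally have "u = x \<otimes> (\<one> \<oplus> ?y)" by simp
      moreover have "vlt M ?y d" using u yx vlt_mult[of ?y d x] yc dc assms(1) False by simp
      ultimately show "\<exists>y\<in>carrier M. vlt M y d \<and> u = x \<otimes> (\<one> \<oplus> y)" using yc by blast
    qed
    moreover have "vlt M (x \<ominus> x) (d \<otimes> x)" using assms dc False vlt_zero_left[of "d \<otimes> x"] integral_iff by (simp add: a_minus_def r_neg)
    ultimately show ?thesis unfolding rvl_mem[OF assms(1) dc] rveq_def using assms(1) by blast
  qed
qed

lemma rveq_trans:
  assumes "x \<in> carrier M" "y \<in> carrier M" "z \<in> carrier M" "d \<in> vring M" "rveq M d x y" "rveq M d y z"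
  shows "rveq M d x z"
proof (cases "x = y \<or> y = z")
  case False
  have dc: "d \<in> carrier M" using assms vring_carrier by auto
  have 1: "vlt M (x \<ominus> y) (d \<otimes> y)" "vlt M (y \<ominus> z) (d \<otimes> z)" using assms False by (auto simp: rveq_def)
  have d0: "d \<noteq> \<zero>" using 1 vlt_zero_right assms by fastforce
  have yz: "vlt M (y \<ominus> z) z" using vlt_le_trans[OF 1(2)] assms by blast
  have s: "(d \<otimes> y) \<ominus> (d \<otimes> z) = (y \<ominus> z) \<otimes> d" using assms(2,3) dc by algebra
  have "vlt M ((y \<ominus> z) \<otimes> d) (z \<otimes> d)" using vlt_mult[of "y \<ominus> z" z d] yz assms dc d0 by simp
  then have "vlt M ((d \<otimes> y) \<ominus> (d \<otimes> z)) (d \<otimes> z)" using s assms dc by (simp add: m_comm)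
  then have "vlt M (x \<ominus> y) (d \<otimes> z)" using 1 vlt_diff_same(2)[of "d \<otimes> y" "d \<otimes> z" "x \<ominus> y"] assms dc by simp
  then show ?thesis using vlt_tri[of x y z "d \<otimes> z"] 1 assms dc by (simp add: rveq_def)
qed (use assms in auto)

lemma rvl_mono:
  assumes "x \<in> carrier M" "y \<in> carrier M" "d \<in> vring M" "d \<noteq> \<zero>" "rveq M d x y"
  shows "rvl M (vabs M d) x \<subseteq> rvl M (vabs M d) y"
proof
  fix u assume "u \<in> rvl M (vabs M d) x"
  then have "u \<in> carrier M" "rveq M d u x" using rvl_mem'[OF assms(1,3,4)] by auto
  then show "u \<in> rvl M (vabs M d) y"
    using rvl_mem'[OF assms(2,3,4)] rveq_trans[OF _ assms(1,2,3) _ assms(5)] by blast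
qed

lemma rvl_eq_iff:
  assumes "x \<in> carrier M" "y \<in> carrier M" "d \<in> vring M" "d \<noteq> \<zero>"
  shows "rvl M (vabs M d) x = rvl M (vabs M d) y \<longleftrightarrow> rveq M d x y"
proof
  assume e: "rvl M (vabs M d) x = rvl M (vabs M d) y"
  have "x \<in> rvl M (vabs M d) x" using rvl_mem' assms by (simp add: rveq_def)
  then show "rveq M d x y" using e rvl_mem' assms by blast
next
  assume "rveq M d x y"
  then show "rvl M (vabs M d) x = rvl M (vabs M d) y"
    using rvl_mono assms rveq_sym[OF assms(1-3)] by (intro subset_antisym) auto
qed

lemma rv_eq_iff:
  assumes "x \<in> carrier M" "y \<in> carrier M"
  shows "rv M x = rv M y \<longleftrightarrow> rveq M \<one> x y"
  unfolding rv_def using rvl_eq_iff assms by simp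

lemma RV_eq: "RV M = rv M ` carrier M"
  by (simp add: RV_def RVl_def rv_def)

lemma rv_in_RV [simp]: "x \<in> carrier M \<Longrightarrow> rv M x \<in> RV M"
  by (simp add: RV_eq)

lemma rveq_one:
  assumes "x \<in> carrier M" "y \<in> carrier M" "d \<in> vring M" "rveq M d x y"
  shows "rveq M \<one> x y"
  using assms vlt_le_trans[of "x \<ominus> y" "d \<otimes> y" y] by (auto simp: rveq_def)

lemma vabs_mult:
  assumes "d \<in> carrier M" "m \<in> carrier M"
  shows "vabs M d <#> vabs M m = vabs M (d \<otimes> m)"
proof (rule subset_antisym; rule subsetI)
  fix w assume "w \<in> vabs M d <#> vabs M m"
  then obtain u v where uv: "u \<in> Units (vring_of M)" "v \<in> Units (vring_of M)" "w = (d \<otimes> u) \<otimes> (m \<otimes> v)"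
    by (auto simp: set_mult_def vabs_mem)
  then obtain u' v' where *: "u' \<in> vring M" "v' \<in> vring M" "u \<otimes> u' = \<one>" "v \<otimes> v' = \<one>" "u \<in> vring M" "v \<in> vring M"
    using Units_vring by auto
  have c: "u \<in> carrier M" "v \<in> carrier M" "u' \<in> carrier M" "v' \<in> carrier M" using * vring_carrier by auto
  have "(u \<otimes> v) \<otimes> (u' \<otimes> v') = (u \<otimes> u') \<otimes> (v \<otimes> v')" using c by (simp add: m_ac)
  then have "u \<otimes> v \<in> Units (vring_of M)" using * Units_vring by auto
  moreover have "w = (d \<otimes> m) \<otimes> (u \<otimes> v)" using uv(3) c assms by (simp add: m_ac)
  ultimately show "w \<in> vabs M (d \<otimes> m)" by (auto simp: vabs_mem)
next
  fix w assume "w \<in> vabs M (d \<otimes> m)"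
  then obtain u where u: "u \<in> Units (vring_of M)" "w = (d \<otimes> m) \<otimes> u" by (auto simp: vabs_mem)
  have c: "u \<in> carrier M" using u Units_vring vring_carrier by auto
  have "w = (d \<otimes> u) \<otimes> (m \<otimes> \<one>)" using u c assms by (simp add: m_ac)
  moreover have "\<one> \<in> Units (vring_of M)" by (auto simp: Units_vring intro!: bexI[of _ \<one>])
  ultimately have "d \<otimes> u \<in> vabs M d" "m \<otimes> \<one> \<in> vabs M m" using u by (auto simp only: vabs_mem)
  then show "w \<in> vabs M d <#> vabs M m" using \<open>w = (d \<otimes> u) \<otimes> (m \<otimes> \<one>)\<close>
    unfolding set_mult_def by blast
qed

lemma is_open_ball_iff:
  "is_open_ball M \<mu> B \<longleftrightarrow> (\<exists>m\<in>carrier M. m \<noteq> \<zero> \<and> \<mu> = vabs M m \<and> (\<exists>a\<in>carrier M. B = ball M a m))"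
  unfolding is_open_ball_def Gamma_units_iff using open_ball_eq by blast

text \<open>Non-triviality of the valuation enters here. It makes open balls infinite, and only then
  does (D) say something about values taken on balls.\<close>

lemma exists_small: "\<exists>e\<in>carrier M. e \<noteq> \<zero> \<and> vlt M e \<one>"
proof -
  obtain x where x: "x \<in> carrier M" "x \<notin> vring M" using valued_field vring_carrier by (auto simp: valued_field_def)
  then have x0: "x \<noteq> \<zero>" by auto
  let ?e = "inv x"
  have e: "?e \<in> carrier M" "?e \<noteq> \<zero>" using x x0 inv_closed inv_right by (auto, metis r_null zero_not_one)
  have "vlt M ?e \<one>" unfolding vlt_iff
  proof
    assume "\<exists>z\<in>vring M. \<one> = z \<otimes> inv x"
    then obtain z where z: "z \<in> vring M" "\<one> = z \<otimes> inv x" by auto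
    then have "x = z" using x x0 e vring_carrier
      by (metis inv_left l_one m_assoc r_one)
    then show False using x z by simp
  qed
  then show ?thesis using e by blast
qed

lemma infinite_ball:
  assumes "m \<in> carrier M" "m \<noteq> \<zero>" "a \<in> carrier M"
  shows "infinite (ball M a m)"
proof -
  obtain e where e: "e \<in> carrier M" "e \<noteq> \<zero>" "vlt M e \<one>" using exists_small by auto
  \<comment> \<open>The points \<open>a + m e^(n+1)\<close> approach \<open>a\<close> with strictly
    decreasing distances. The exponent starts at one because the ball is open: \<open>a + m\<close>
    itself is outside.\<close>
  let ?p = "\<lambda>n::nat. m \<otimes> e [^] Suc n"
  have nz: "e [^] n \<noteq> \<zero>" for n :: nat
    using e by (induction n) (auto simp: integral_iff)
  have c: "?p n \<in> carrier M" for n using e assms by simp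
  have nzp: "?p n \<noteq> \<zero>" for n using nz[of "Suc n"] assms e integral_iff by simp
  have step: "vlt M (e [^] Suc n \<otimes> w) w" if "w \<in> carrier M" "w \<noteq> \<zero>" for n w
  proof -
    have "vlt M (e [^] Suc n) \<one>"
    proof (induction n)
      case 0 then show ?case using e by simp
    next
      case (Suc n)
      have "vlt M (e [^] Suc n \<otimes> e) (\<one> \<otimes> e)"
        using Suc e vlt_mult[of "e [^] Suc n" \<one> e] by (simp del: nat_pow_Suc l_one)
      then show ?case using e vlt_trans[of "e [^] Suc (Suc n)" e \<one>] by simp
    qed
    then show ?thesis using vlt_mult[of "e [^] Suc n" \<one> w] that e by simp
  qed
  have less: "vlt M (?p j) (?p i)" if "i < j" for i j
  proof -
    obtain k where k: "j = Suc (i + k)" using less_imp_Suc_add[OF \<open>i < j\<close>] by blast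
    have "e [^] Suc j = e [^] Suc k \<otimes> e [^] Suc i"
      unfolding k using e(1) by (simp only: nat_pow_mult) (simp add: ac_simps)
    then have "?p j = e [^] Suc k \<otimes> ?p i" using assms(1) e(1)
      by (simp only:) (simp add: m_lcomm del: nat_pow_Suc)
    then show ?thesis using step[OF c nzp] by simp
  qed
  then have neq: "?p i \<noteq> ?p j" if "i < j" for i j using that vlt_irrefl c by metis
  have "inj (\<lambda>n. a \<oplus> ?p n)"
  proof (rule injI)
    fix i j assume "a \<oplus> ?p i = a \<oplus> ?p j"
    then have "?p i = ?p j" using assms c by simp
    then show "i = j" using neq by (metis linorder_neqE_nat)
  qed
  moreover have "range (\<lambda>n. a \<oplus> ?p n) \<subseteq> ball M a m"
  proof clarify
    fix n
    have "(a \<oplus> ?p n) \<ominus> a = ?p n" using assms(3) c[of n]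
      by (simp add: a_minus_def a_comm[of a] a_assoc r_neg del: nat_pow_Suc)
    moreover have "vlt M (?p n) m" using step[of m n] assms e by (simp add: m_comm del: nat_pow_Suc)
    ultimately show "a \<oplus> ?p n \<in> ball M a m" using assms(3) c[of n] unfolding ball_def by (simp del: nat_pow_Suc)
  qed
  ultimately show ?thesis using finite_subset finite_imageD infinite_UNIV_nat by blast
qed

lemma infinite_carrier: "infinite (carrier M)"
proof -
  have "ball M \<zero> \<one> \<subseteq> carrier M" by (auto simp: ball_def)
  moreover have "infinite (ball M \<zero> \<one>)" using infinite_ball by simp
  ultimately show ?thesis using finite_subset by blast
qed

end

section \<open>Simultaneous substitution, and a calculus that builds defining formulas\<close>

section \<open>Definable predicates\<close>

text \<open>\<open>sht\<close> and \<open>shr\<close> lift terms of the two sorts under a field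
  quantifier, \<open>shv\<close> lifts an RV term under an RV quantifier. \<open>sbt\<close>,
  \<open>sbr\<close> and \<open>sb\<close> replace all free variables of both sorts at once, so that
  permuting, dropping and duplicating variables are instances of one operation.\<close>

primrec sht :: "'f trm \<Rightarrow> 'f trm" where
  "sht (Var i) = Var (Suc i)"
| "sht TZero = TZero"
| "sht TOne = TOne"
| "sht (TAdd s t) = TAdd (sht s) (sht t)"
| "sht (TMinus t) = TMinus (sht t)"
| "sht (TMult s t) = TMult (sht s) (sht t)"
| "sht (Fn f ts) = Fn f (map sht ts)"

primrec sbt :: "'f trm list \<Rightarrow> 'f trm \<Rightarrow> 'f trm" where
  "sbt us (Var i) = us ! i"
| "sbt us TZero = TZero"
| "sbt us TOne = TOne"
| "sbt us (TAdd s t) = TAdd (sbt us s) (sbt us t)"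
| "sbt us (TMinus t) = TMinus (sbt us t)"
| "sbt us (TMult s t) = TMult (sbt us s) (sbt us t)"
| "sbt us (Fn f ts) = Fn f (map (sbt us) ts)"

primrec shr :: "'f rvtrm \<Rightarrow> 'f rvtrm" where
  "shr (RVVar i) = RVVar i"
| "shr (Rv t) = Rv (sht t)"

primrec shv :: "'f rvtrm \<Rightarrow> 'f rvtrm" where
  "shv (RVVar i) = RVVar (Suc i)"
| "shv (Rv t) = Rv t"

primrec sbr :: "'f trm list \<Rightarrow> 'f rvtrm list \<Rightarrow> 'f rvtrm \<Rightarrow> 'f rvtrm" where
  "sbr ts us (RVVar i) = us ! i"
| "sbr ts us (Rv t) = Rv (sbt ts t)"

primrec sb :: "'f trm list \<Rightarrow> 'f rvtrm list \<Rightarrow> ('f, 'r) form \<Rightarrow> ('f, 'r) form" where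
  "sb ts us (FEq s t) = FEq (sbt ts s) (sbt ts t)"
| "sb ts us (FVal t) = FVal (sbt ts t)"
| "sb ts us (FRVEq s t) = FRVEq (sbr ts us s) (sbr ts us t)"
| "sb ts us (FRel R ss vs) = FRel R (map (sbt ts) ss) (map (sbr ts us) vs)"
| "sb ts us (FNot \<phi>) = FNot (sb ts us \<phi>)"
| "sb ts us (FAnd \<phi> \<psi>) = FAnd (sb ts us \<phi>) (sb ts us \<psi>)"
| "sb ts us (FEx \<phi>) = FEx (sb (Var 0 # map sht ts) (map shr us) \<phi>)"
| "sb ts us (FExRV \<phi>) = FExRV (sb ts (RVVar 0 # map shv us) \<phi>)"

lemma wf_sht: "wf_trm L n t \<Longrightarrow> wf_trm L (Suc n) (sht t)"
  by (induction t) (auto simp: list_all_iff)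

lemma eval_sht [simp]: "eval M (x # xs) (sht t) = eval M xs t"
  by (induction t) (auto simp: comp_def cong: map_cong)

lemma wf_shr: "wf_rvtrm L n m t \<Longrightarrow> wf_rvtrm L (Suc n) m (shr t)"
  by (cases t) (auto simp: wf_sht)

lemma wf_shv: "wf_rvtrm L n m t \<Longrightarrow> wf_rvtrm L n (Suc m) (shv t)"
  by (cases t) auto

lemma rveval_shr [simp]: "rveval M (x # xs) \<xi>s (shr t) = rveval M xs \<xi>s t"
  by (cases t) auto

lemma rveval_shv [simp]: "rveval M xs (\<xi> # \<xi>s) (shv t) = rveval M xs \<xi>s t"
  by (cases t) auto

lemma wf_sbt:
  "wf_trm L n t \<Longrightarrow> length ts = n \<Longrightarrow> list_all (wf_trm L n') ts \<Longrightarrow> wf_trm L n' (sbt ts t)"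
  by (induction t) (auto simp: list_all_iff)

lemma eval_sbt:
  "wf_trm L n t \<Longrightarrow> length ts = n \<Longrightarrow> eval M xs (sbt ts t) = eval M (map (eval M xs) ts) t"
  by (induction t) (auto simp: list_all_iff comp_def cong: map_cong)

lemma wf_sbr:
  "wf_rvtrm L n m t \<Longrightarrow> length ts = n \<Longrightarrow> list_all (wf_trm L n') ts \<Longrightarrow> length us = m \<Longrightarrow>
   list_all (wf_rvtrm L n' m') us \<Longrightarrow> wf_rvtrm L n' m' (sbr ts us t)"
  by (cases t) (auto simp: list_all_iff wf_sbt)

lemma rveval_sbr:
  "wf_rvtrm L n m t \<Longrightarrow> length ts = n \<Longrightarrow> length us = m \<Longrightarrow>
   rveval M xs \<xi>s (sbr ts us t) = rveval M (map (eval M xs) ts) (map (rveval M xs \<xi>s) us) t"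
  by (cases t) (auto simp: eval_sbt)

lemma wf_sb:
  "wf_form L n m \<phi> \<Longrightarrow> length ts = n \<Longrightarrow> list_all (wf_trm L n') ts \<Longrightarrow> length us = m \<Longrightarrow>
   list_all (wf_rvtrm L n' m') us \<Longrightarrow> wf_form L n' m' (sb ts us \<phi>)"
proof (induction \<phi> arbitrary: n m n' m' ts us)
  case (FRel R ss vs)
  then show ?case by (auto simp: list_all_iff intro!: wf_sbt wf_sbr)
next
  case (FEx \<phi>)
  then show ?case by (auto simp: list_all_iff intro!: FEx.IH[of "Suc n" m] wf_sht wf_shr)
next
  case (FExRV \<phi>)
  then show ?case by (auto simp: list_all_iff intro!: FExRV.IH[of n "Suc m"] wf_shv)
qed (auto intro: wf_sbt wf_sbr)

lemma sat_sb:
  "wf_form L n m \<phi> \<Longrightarrow> length ts = n \<Longrightarrow> length us = m \<Longrightarrow>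
   sat M xs \<xi>s (sb ts us \<phi>) = sat M (map (eval M xs) ts) (map (rveval M xs \<xi>s) us) \<phi>"
proof (induction \<phi> arbitrary: n m ts us xs \<xi>s)
  case (FRel R ss vs)
  have "map (eval M xs) (map (sbt ts) ss) = map (eval M (map (eval M xs) ts)) ss"
    using FRel.prems by (auto simp: list_all_iff intro: eval_sbt)
  moreover have "rveval M xs \<xi>s (sbr ts us u) = rveval M (map (eval M xs) ts) (map (rveval M xs \<xi>s) us) u"
    if "u \<in> set vs" for u
    by (rule rveval_sbr[of L n m]) (use FRel.prems that in \<open>simp_all add: list_all_iff\<close>)
  then have "map (rveval M xs \<xi>s) (map (sbr ts us) vs) =
      map (rveval M (map (eval M xs) ts) (map (rveval M xs \<xi>s) us)) vs" by simp
  ultimately show ?case by (simp only: sb.simps sat.simps)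
next
  case (FEx \<phi>)
  have "sat M (x # xs) \<xi>s (sb (Var 0 # map sht ts) (map shr us) \<phi>) =
      sat M (x # map (eval M xs) ts) (map (rveval M xs \<xi>s) us) \<phi>" for x
    using FEx.IH[of "Suc n" m "Var 0 # map sht ts" "map shr us"] FEx.prems by (simp add: comp_def)
  then show ?case by simp
next
  case (FExRV \<phi>)
  have "sat M xs (\<xi> # \<xi>s) (sb ts (RVVar 0 # map shv us) \<phi>) =
      sat M (map (eval M xs) ts) (\<xi> # map (rveval M xs \<xi>s) us) \<phi>" for \<xi>
    using FExRV.IH[of n "Suc m" ts "RVVar 0 # map shv us"] FExRV.prems by (simp add: comp_def)
  then show ?case by simp
qed (auto simp: eval_sbt rveval_sbr)

abbreviation FTrue :: "('f, 'r) form" where "FTrue \<equiv> FEq TZero TZero"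
abbreviation FImp :: "('f, 'r) form \<Rightarrow> ('f, 'r) form \<Rightarrow> ('f, 'r) form" where
  "FImp \<phi> \<psi> \<equiv> FNot (FAnd \<phi> (FNot \<psi>))"

primrec FConj :: "('f, 'r) form list \<Rightarrow> ('f, 'r) form" where
  "FConj [] = FTrue"
| "FConj (\<phi> # \<phi>s) = FAnd \<phi> (FConj \<phi>s)"

primrec FExs :: "nat \<Rightarrow> ('f, 'r) form \<Rightarrow> ('f, 'r) form" where
  "FExs 0 \<phi> = \<phi>"
| "FExs (Suc p) \<phi> = FExs p (FEx \<phi>)"

primrec FExRVs :: "nat \<Rightarrow> ('f, 'r) form \<Rightarrow> ('f, 'r) form" where
  "FExRVs 0 \<phi> = \<phi>"
| "FExRVs (Suc p) \<phi> = FExRVs p (FExRV \<phi>)"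

lemma tuples_0 [simp]: "xs \<in> tuples 0 S \<longleftrightarrow> xs = []"
  by (auto simp: tuples_def)

lemma tuples_Suc: "xs \<in> tuples (Suc n) S \<longleftrightarrow> (\<exists>x\<in>S. \<exists>ys\<in>tuples n S. xs = x # ys)"
  by (cases xs) (auto simp: tuples_def)

lemma tuples_Cons [simp]: "x # xs \<in> tuples (Suc n) S \<longleftrightarrow> x \<in> S \<and> xs \<in> tuples n S"
  by (auto simp: tuples_def)

lemma tuples_length: "xs \<in> tuples n S \<Longrightarrow> length xs = n"
  by (simp add: tuples_def)

lemma tuples_set: "xs \<in> tuples n S \<Longrightarrow> set xs \<subseteq> S"
  by (simp add: tuples_def)

lemma tuples_nth: "xs \<in> tuples n S \<Longrightarrow> i < n \<Longrightarrow> xs ! i \<in> S"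
  by (auto simp: tuples_def)

lemma tuples_append: "xs \<in> tuples n S \<Longrightarrow> ys \<in> tuples m S \<Longrightarrow> xs @ ys \<in> tuples (n + m) S"
  by (auto simp: tuples_def)

lemma tuples_snoc: "xs \<in> tuples n S \<Longrightarrow> y \<in> S \<Longrightarrow> xs @ [y] \<in> tuples (Suc n) S"
  by (auto simp: tuples_def)

lemma tuples_take: "xs \<in> tuples n S \<Longrightarrow> i \<le> n \<Longrightarrow> take i xs \<in> tuples i S"
  using set_take_subset by (fastforce simp: tuples_def)

lemma tuples_drop: "xs \<in> tuples n S \<Longrightarrow> drop i xs \<in> tuples (n - i) S"
  using set_drop_subset by (fastforce simp: tuples_def)

lemma tuples_take_add: "xs \<in> tuples (n + m) S \<Longrightarrow> take n xs \<in> tuples n S"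
  by (rule tuples_take) auto

lemma tuples_drop_add: "xs \<in> tuples (n + m) S \<Longrightarrow> drop n xs \<in> tuples m S"
  using tuples_drop[of xs "n + m" S n] by simp

lemma bex_tuples_Suc: "(\<exists>zs\<in>tuples (Suc p) S. Q zs) \<longleftrightarrow> (\<exists>ys\<in>tuples p S. \<exists>x\<in>S. Q (x # ys))"
  unfolding Bex_def tuples_Suc by blast

lemma ball_tuples_Suc: "(\<forall>zs\<in>tuples (Suc p) S. Q zs) \<longleftrightarrow> (\<forall>ys\<in>tuples p S. \<forall>x\<in>S. Q (x # ys))"
  unfolding Ball_def tuples_Suc by blast

text \<open>The formula is an explicit argument, so that the rules below can assemble it by
  unification from the shape of \<open>P\<close>. Formulas assembled in this way do not mention
  \<open>M\<close> and can serve structures on different types. \<open>tm\<close>,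
  \<open>tms\<close> and \<open>rts\<close> do the same for terms, tuples of terms and tuples of RV
  terms.\<close>

definition defs :: "('f, 'r) lang \<Rightarrow> ('f, 'r, 'u) vstruct \<Rightarrow> ('f, 'r) form \<Rightarrow> nat \<Rightarrow> nat \<Rightarrow>
    ('u list \<Rightarrow> 'u set list \<Rightarrow> bool) \<Rightarrow> bool" where
  "defs L M \<phi> n m P \<longleftrightarrow> wf_form L n m \<phi> \<and>
     (\<forall>xs\<in>tuples n (carrier M). \<forall>\<xi>s\<in>tuples m (RV M). P xs \<xi>s \<longleftrightarrow> sat M xs \<xi>s \<phi>)"

definition tm :: "('f, 'r) lang \<Rightarrow> ('f, 'r, 'u) vstruct \<Rightarrow> 'f trm \<Rightarrow> nat \<Rightarrow> ('u list \<Rightarrow> 'u) \<Rightarrow> bool" where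
  "tm L M t n e \<longleftrightarrow> wf_trm L n t \<and> (\<forall>xs\<in>tuples n (carrier M). e xs = eval M xs t)"

definition tms :: "('f, 'r) lang \<Rightarrow> ('f, 'r, 'u) vstruct \<Rightarrow> 'f trm list \<Rightarrow> nat \<Rightarrow> nat \<Rightarrow>
    ('u list \<Rightarrow> 'u list) \<Rightarrow> bool" where
  "tms L M ts n p e \<longleftrightarrow> length ts = p \<and> list_all (wf_trm L n) ts \<and>
     (\<forall>xs\<in>tuples n (carrier M). e xs = map (eval M xs) ts)"

definition rts :: "('f, 'r) lang \<Rightarrow> ('f, 'r, 'u) vstruct \<Rightarrow> 'f rvtrm list \<Rightarrow> nat \<Rightarrow> nat \<Rightarrow> nat \<Rightarrow>
    ('u list \<Rightarrow> 'u set list \<Rightarrow> 'u set list) \<Rightarrow> bool" where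
  "rts L M us n m q r \<longleftrightarrow> length us = q \<and> list_all (wf_rvtrm L n m) us \<and>
     (\<forall>xs\<in>tuples n (carrier M). \<forall>\<xi>s\<in>tuples m (RV M). r xs \<xi>s = map (rveval M xs \<xi>s) us)"

lemma sat_FConj: "sat M xs \<xi>s (FConj \<phi>s) \<longleftrightarrow> (\<forall>\<phi>\<in>set \<phi>s. sat M xs \<xi>s \<phi>)"
  by (induction \<phi>s) auto

lemma wf_FConj: "wf_form L n m (FConj \<phi>s) \<longleftrightarrow> (\<forall>\<phi>\<in>set \<phi>s. wf_form L n m \<phi>)"
  by (induction \<phi>s) auto

lemma sat_FExs: "sat M xs \<xi>s (FExs p \<phi>) \<longleftrightarrow> (\<exists>zs\<in>tuples p (carrier M). sat M (zs @ xs) \<xi>s \<phi>)"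
  by (induction p arbitrary: \<phi>) (simp_all add: bex_tuples_Suc)

lemma wf_FExs: "wf_form L n m (FExs p \<phi>) \<longleftrightarrow> wf_form L (p + n) m \<phi>"
  by (induction p arbitrary: \<phi>) auto

lemma sat_FExRVs: "sat M xs \<xi>s (FExRVs p \<phi>) \<longleftrightarrow> (\<exists>zs\<in>tuples p (RV M). sat M xs (zs @ \<xi>s) \<phi>)"
  by (induction p arbitrary: \<phi>) (simp_all add: bex_tuples_Suc)

lemma wf_FExRVs: "wf_form L n m (FExRVs p \<phi>) \<longleftrightarrow> wf_form L n (p + m) \<phi>"
  by (induction p arbitrary: \<phi>) auto

lemma tms_id: "tms L M (map Var [0..<n]) n n (\<lambda>xs. xs)"
  by (auto simp: tms_def list_all_iff tuples_def intro!: nth_equalityI)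

lemma tms_take: "tms L M ts n p e \<Longrightarrow> q \<le> p \<Longrightarrow> tms L M (take q ts) n q (\<lambda>xs. take q (e xs))"
  by (auto simp: tms_def list_all_iff take_map dest: in_set_takeD)

lemma tms_drop: "tms L M ts n p e \<Longrightarrow> tms L M (drop q ts) n (p - q) (\<lambda>xs. drop q (e xs))"
  by (auto simp: tms_def list_all_iff drop_map dest: in_set_dropD)

lemma tms_tl: "tms L M ts n p e \<Longrightarrow> tms L M (tl ts) n (p - 1) (\<lambda>xs. tl (e xs))"
  using tms_drop[of L M ts n p e 1] by (simp add: drop_Suc)

lemma tms_append:
  "tms L M ts n p e \<Longrightarrow> tms L M ts' n p' e' \<Longrightarrow> tms L M (ts @ ts') n (p + p') (\<lambda>xs. e xs @ e' xs)"
  by (auto simp: tms_def)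

lemma tms_Cons:
  "tm L M t n e \<Longrightarrow> tms L M ts n p e' \<Longrightarrow> tms L M (t # ts) n (Suc p) (\<lambda>xs. e xs # e' xs)"
  by (auto simp: tms_def tm_def)

lemma tms_Nil: "tms L M [] n 0 (\<lambda>xs. [])"
  by (auto simp: tms_def)

lemma tms_replicate_zero: "tms L M (replicate p TZero) n p (\<lambda>xs. replicate p \<zero>\<^bsub>M\<^esub>)"
  by (auto simp: tms_def list_all_iff)

lemma tm_hd: "tms L M ts n p e \<Longrightarrow> 0 < p \<Longrightarrow> tm L M (hd ts) n (\<lambda>xs. hd (e xs))"
  by (auto simp: tms_def tm_def list_all_iff hd_map)

lemma tm_nth: "tms L M ts n p e \<Longrightarrow> i < p \<Longrightarrow> tm L M (ts ! i) n (\<lambda>xs. e xs ! i)"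
  by (auto simp: tms_def tm_def list_all_iff)

lemma tm_zero: "tm L M TZero n (\<lambda>xs. \<zero>\<^bsub>M\<^esub>)" by (simp add: tm_def)
lemma tm_one: "tm L M TOne n (\<lambda>xs. \<one>\<^bsub>M\<^esub>)" by (simp add: tm_def)
lemma tm_add: "tm L M s n e \<Longrightarrow> tm L M t n e' \<Longrightarrow> tm L M (TAdd s t) n (\<lambda>xs. e xs \<oplus>\<^bsub>M\<^esub> e' xs)"
  by (simp add: tm_def)
lemma tm_mult: "tm L M s n e \<Longrightarrow> tm L M t n e' \<Longrightarrow> tm L M (TMult s t) n (\<lambda>xs. e xs \<otimes>\<^bsub>M\<^esub> e' xs)"
  by (simp add: tm_def)
lemma tm_diff: "tm L M s n e \<Longrightarrow> tm L M t n e' \<Longrightarrow> tm L M (TAdd s (TMinus t)) n (\<lambda>xs. e xs \<ominus>\<^bsub>M\<^esub> e' xs)"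
  by (simp add: tm_def a_minus_def)

lemma rts_id: "rts L M (map RVVar [0..<m]) n m m (\<lambda>xs \<xi>s. \<xi>s)"
  by (auto simp: rts_def list_all_iff tuples_def intro!: nth_equalityI)

lemma rts_take:
  "rts L M us n m q r \<Longrightarrow> k \<le> q \<Longrightarrow> rts L M (take k us) n m k (\<lambda>xs \<xi>s. take k (r xs \<xi>s))"
  by (auto simp: rts_def list_all_iff take_map dest: in_set_takeD)

lemma rts_drop:
  "rts L M us n m q r \<Longrightarrow> rts L M (drop k us) n m (q - k) (\<lambda>xs \<xi>s. drop k (r xs \<xi>s))"
  by (auto simp: rts_def list_all_iff drop_map dest: in_set_dropD)

lemma rts_tl:
  "rts L M us n m q r \<Longrightarrow> rts L M (tl us) n m (q - 1) (\<lambda>xs \<xi>s. tl (r xs \<xi>s))"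
  using rts_drop[of L M us n m q r 1] by (simp add: drop_Suc)

lemma rts_append:
  "rts L M us n m q r \<Longrightarrow> rts L M us' n m q' r' \<Longrightarrow>
   rts L M (us @ us') n m (q + q') (\<lambda>xs \<xi>s. r xs \<xi>s @ r' xs \<xi>s)"
  by (auto simp: rts_def)

lemma rts_Nil: "rts L M [] n m 0 (\<lambda>xs \<xi>s. [])"
  by (auto simp: rts_def)

lemma rts_rv: "tm L M t n e \<Longrightarrow> rts L M us n m q r \<Longrightarrow>
   rts L M (Rv t # us) n m (Suc q) (\<lambda>xs \<xi>s. rv M (e xs) # r xs \<xi>s)"
  by (auto simp: rts_def tm_def)

lemma rts_hd: "rts L M us n m q r \<Longrightarrow> 0 < q \<Longrightarrow> rts L M us' n m q' r' \<Longrightarrow>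
   rts L M (hd us # us') n m (Suc q') (\<lambda>xs \<xi>s. hd (r xs \<xi>s) # r' xs \<xi>s)"
  by (auto simp: rts_def list_all_iff hd_map)

lemma rts_replicate_zero:
  "rts L M (replicate q (Rv TZero)) n m q (\<lambda>xs \<xi>s. replicate q (rv M \<zero>\<^bsub>M\<^esub>))"
  by (auto simp: rts_def list_all_iff)

lemma d_const: "defs L M (if c then FTrue else FNot FTrue) n m (\<lambda>xs \<xi>s. c)"
  by (auto simp: defs_def)

lemma d_not: "defs L M \<phi> n m P \<Longrightarrow> defs L M (FNot \<phi>) n m (\<lambda>xs \<xi>s. \<not> P xs \<xi>s)"
  by (auto simp: defs_def)

lemma d_and:
  "defs L M \<phi> n m P \<Longrightarrow> defs L M \<psi> n m Q \<Longrightarrow> defs L M (FAnd \<phi> \<psi>) n m (\<lambda>xs \<xi>s. P xs \<xi>s \<and> Q xs \<xi>s)"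
  by (auto simp: defs_def)

lemma d_or:
  "defs L M \<phi> n m P \<Longrightarrow> defs L M \<psi> n m Q \<Longrightarrow>
   defs L M (FNot (FAnd (FNot \<phi>) (FNot \<psi>))) n m (\<lambda>xs \<xi>s. P xs \<xi>s \<or> Q xs \<xi>s)"
  by (auto simp: defs_def)

lemma d_imp:
  "defs L M \<phi> n m P \<Longrightarrow> defs L M \<psi> n m Q \<Longrightarrow> defs L M (FImp \<phi> \<psi>) n m (\<lambda>xs \<xi>s. P xs \<xi>s \<longrightarrow> Q xs \<xi>s)"
  by (auto simp: defs_def)

lemma d_iff:
  "defs L M \<phi> n m P \<Longrightarrow> defs L M \<psi> n m Q \<Longrightarrow>
   defs L M (FAnd (FImp \<phi> \<psi>) (FImp \<psi> \<phi>)) n m (\<lambda>xs \<xi>s. P xs \<xi>s \<longleftrightarrow> Q xs \<xi>s)"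
  by (auto simp: defs_def)

text \<open>A bound variable is the first entry of the longer environment. The premise recovers it
  by \<open>hd\<close>, and the old environment by \<open>tl\<close>; the block quantifiers use
  \<open>take\<close> and \<open>drop\<close> instead.\<close>

lemma d_ex:
  "defs L M \<phi> (Suc n) m (\<lambda>ys \<xi>s. P (hd ys) (tl ys) \<xi>s) \<Longrightarrow>
   defs L M (FEx \<phi>) n m (\<lambda>xs \<xi>s. \<exists>x\<in>carrier M. P x xs \<xi>s)"
  by (simp add: defs_def ball_tuples_Suc)

lemma d_all:
  "defs L M \<phi> (Suc n) m (\<lambda>ys \<xi>s. P (hd ys) (tl ys) \<xi>s) \<Longrightarrow>
   defs L M (FNot (FEx (FNot \<phi>))) n m (\<lambda>xs \<xi>s. \<forall>x\<in>carrier M. P x xs \<xi>s)"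
  by (simp add: defs_def ball_tuples_Suc)

lemma d_exs:
  assumes "defs L M \<phi> (p + n) m (\<lambda>ys \<xi>s. P (take p ys) (drop p ys) \<xi>s)"
  shows "defs L M (FExs p \<phi>) n m (\<lambda>xs \<xi>s. \<exists>zs\<in>tuples p (carrier M). P zs xs \<xi>s)"
proof -
  have "P zs xs \<xi>s \<longleftrightarrow> sat M (zs @ xs) \<xi>s \<phi>"
    if "zs \<in> tuples p (carrier M)" "xs \<in> tuples n (carrier M)" "\<xi>s \<in> tuples m (RV M)" for zs xs \<xi>s
    using assms that tuples_append[of zs p "carrier M" xs n] tuples_length[of zs p] unfolding defs_def by fastforce
  then show ?thesis using assms by (auto simp: defs_def sat_FExs wf_FExs)
qed

lemma d_alls:
  "defs L M \<phi> (p + n) m (\<lambda>ys \<xi>s. P (take p ys) (drop p ys) \<xi>s) \<Longrightarrow>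
   defs L M (FNot (FExs p (FNot \<phi>))) n m (\<lambda>xs \<xi>s. \<forall>zs\<in>tuples p (carrier M). P zs xs \<xi>s)"
  using d_not[OF d_exs[OF d_not]] by fastforce

lemma d_exrv:
  "defs L M \<phi> n (Suc m) (\<lambda>xs \<xi>s. P (hd \<xi>s) xs (tl \<xi>s)) \<Longrightarrow>
   defs L M (FExRV \<phi>) n m (\<lambda>xs \<xi>s. \<exists>\<xi>\<in>RV M. P \<xi> xs \<xi>s)"
  by (simp add: defs_def ball_tuples_Suc)

lemma d_exrvs:
  assumes "defs L M \<phi> n (p + m) (\<lambda>xs \<xi>s. P (take p \<xi>s) xs (drop p \<xi>s))"
  shows "defs L M (FExRVs p \<phi>) n m (\<lambda>xs \<xi>s. \<exists>zs\<in>tuples p (RV M). P zs xs \<xi>s)"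
proof -
  have "P zs xs \<xi>s \<longleftrightarrow> sat M xs (zs @ \<xi>s) \<phi>"
    if "zs \<in> tuples p (RV M)" "xs \<in> tuples n (carrier M)" "\<xi>s \<in> tuples m (RV M)" for zs xs \<xi>s
    using assms that tuples_append[of zs p "RV M" \<xi>s m] tuples_length[of zs p] unfolding defs_def by fastforce
  then show ?thesis using assms by (auto simp: defs_def sat_FExRVs wf_FExRVs)
qed

lemma d_allrvs:
  "defs L M \<phi> n (p + m) (\<lambda>xs \<xi>s. P (take p \<xi>s) xs (drop p \<xi>s)) \<Longrightarrow>
   defs L M (FNot (FExRVs p (FNot \<phi>))) n m (\<lambda>xs \<xi>s. \<forall>zs\<in>tuples p (RV M). P zs xs \<xi>s)"
  using d_not[OF d_exrvs[OF d_not]] by fastforce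

lemma d_all_less:
  "(\<And>i. i < l \<Longrightarrow> defs L M (\<phi> i) n m (P i)) \<Longrightarrow>
   defs L M (FConj (map \<phi> [0..<l])) n m (\<lambda>xs \<xi>s. \<forall>i<l. P i xs \<xi>s)"
  by (auto simp: defs_def sat_FConj wf_FConj)

lemma d_ex_less:
  "(\<And>i. i < l \<Longrightarrow> defs L M (\<phi> i) n m (P i)) \<Longrightarrow>
   defs L M (FNot (FConj (map (\<lambda>i. FNot (\<phi> i)) [0..<l]))) n m (\<lambda>xs \<xi>s. \<exists>i<l. P i xs \<xi>s)"
  by (auto simp: defs_def sat_FConj wf_FConj)

lemma d_eq:
  "tm L M s n e \<Longrightarrow> tm L M t n e' \<Longrightarrow> defs L M (FEq s t) n m (\<lambda>xs \<xi>s. e xs = e' xs)"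
  by (auto simp: defs_def tm_def)

lemma d_val: "tm L M s n e \<Longrightarrow> defs L M (FVal s) n m (\<lambda>xs \<xi>s. e xs \<in> vring M)"
  by (auto simp: defs_def tm_def)

lemma d_rveqs:
  assumes "rts L M us n m q r" "rts L M us' n m q' r'" "q = q'"
  shows "defs L M (FConj (map (\<lambda>i. FRVEq (us ! i) (us' ! i)) [0..<q])) n m (\<lambda>xs \<xi>s. r xs \<xi>s = r' xs \<xi>s)"
  unfolding defs_def
proof (intro conjI ballI)
  show "wf_form L n m (FConj (map (\<lambda>i. FRVEq (us ! i) (us' ! i)) [0..<q]))"
    using assms by (simp add: rts_def wf_FConj list_all_length)
  fix xs \<xi>s assume "xs \<in> tuples n (carrier M)" "\<xi>s \<in> tuples m (RV M)"
  then have "r xs \<xi>s = map (rveval M xs \<xi>s) us" "r' xs \<xi>s = map (rveval M xs \<xi>s) us'" "length us = q" "length us' = q"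
    using assms by (simp_all add: rts_def)
  then show "r xs \<xi>s = r' xs \<xi>s \<longleftrightarrow> sat M xs \<xi>s (FConj (map (\<lambda>i. FRVEq (us ! i) (us' ! i)) [0..<q]))"
    by (auto simp: sat_FConj list_eq_iff_nth_eq[of "map _ _"])
qed

text \<open>The quantifier of the formula ranges over the field and \<open>FVal\<close> cuts it down
  to the valuation ring; hence the side condition that the ring lies in the carrier.\<close>

lemma d_vlt:
  "tm L M s n e \<Longrightarrow> tm L M t n e' \<Longrightarrow>
   defs L M (FNot (FEx (FAnd (FVal (Var 0)) (FEq (sht t) (TMult (Var 0) (sht s)))))) n m
     (\<lambda>xs \<xi>s. vlt M (e xs) (e' xs))" if "vring M \<subseteq> carrier M"
  using that by (auto simp: defs_def tm_def vlt_def wf_sht)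

lemma d_distinct:
  assumes "tms L M ts n p e"
  shows "defs L M (FConj (map (\<lambda>i. FConj (map (\<lambda>j. FNot (FEq (ts ! i) (ts ! j))) [0..<i])) [0..<p])) n m
    (\<lambda>xs \<xi>s. distinct (e xs))"
proof -
  have "distinct (e xs) \<longleftrightarrow> (\<forall>i<p. \<forall>j<i. e xs ! i \<noteq> e xs ! j)" if "xs \<in> tuples n (carrier M)" for xs
  proof -
    have "length (e xs) = p" using assms that by (auto simp: tms_def)
    then show ?thesis unfolding distinct_conv_nth by (safe; metis less_trans nat_neq_iff)
  qed
  moreover have "e xs ! i = eval M xs (ts ! i)" if "xs \<in> tuples n (carrier M)" "i < p" for xs i
    using assms that by (simp add: tms_def)
  ultimately show ?thesis using assms
    by (auto simp: defs_def tms_def sat_FConj wf_FConj list_all_length)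
qed

lemma d_self: "wf_form L n m \<phi> \<Longrightarrow> defs L M \<phi> n m (\<lambda>xs \<xi>s. sat M xs \<xi>s \<phi>)"
  by (auto simp: defs_def)

lemma d_cong:
  "defs L M \<phi> n m P \<Longrightarrow>
   (\<And>xs \<xi>s. xs \<in> tuples n (carrier M) \<Longrightarrow> \<xi>s \<in> tuples m (RV M) \<Longrightarrow> Q xs \<xi>s \<longleftrightarrow> P xs \<xi>s) \<Longrightarrow>
   defs L M \<phi> n m Q"
  by (auto simp: defs_def)

locale vstr = vfield M for L :: "('f, 'r) lang" and M :: "('f, 'r, 'u) vstruct" (structure) +
  assumes vfs: "vf_structure L M"
begin

lemma eval_closed:
  assumes "xs \<in> tuples n (carrier M)"
  shows "wf_trm L n t \<Longrightarrow> eval M xs t \<in> carrier M"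
proof (induction t)
  case (Fn f ts)
  then have "map (eval M xs) ts \<in> tuples (farity L f) (carrier M)"
    by (auto simp: tuples_def list_all_iff)
  then show ?case using vfs Fn.prems unfolding vf_structure_def by auto
qed (use assms in \<open>auto simp: tuples_def\<close>)

lemma rveval_closed:
  assumes "xs \<in> tuples n (carrier M)" "\<xi>s \<in> tuples m (RV M)" "wf_rvtrm L n m t"
  shows "rveval M xs \<xi>s t \<in> RV M"
  using assms eval_closed by (cases t) (auto simp: tuples_def)

lemma tms_closed: "tms L M ts n p e \<Longrightarrow> xs \<in> tuples n (carrier M) \<Longrightarrow> e xs \<in> tuples p (carrier M)"
  by (auto simp: tms_def tuples_def list_all_iff intro: eval_closed[unfolded tuples_def])

lemma rts_closed:
  "rts L M us n m q r \<Longrightarrow> xs \<in> tuples n (carrier M) \<Longrightarrow> \<xi>s \<in> tuples m (RV M) \<Longrightarrow> r xs \<xi>s \<in> tuples q (RV M)"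
  by (auto simp: rts_def tuples_def list_all_iff intro: rveval_closed[unfolded tuples_def])

text \<open>This rule calls a formula with other arguments. The arities are matched by the separate
  premises \<open>p = n0\<close> and \<open>q = m0\<close>, which arithmetic discharges, since
  unification would not identify different sums.\<close>

lemma d_sub:
  assumes "defs L M \<phi> n0 m0 P" "tms L M ts n p e" "rts L M us n m q r" "p = n0" "q = m0"
  shows "defs L M (sb ts us \<phi>) n m (\<lambda>xs \<xi>s. P (e xs) (r xs \<xi>s))"
proof -
  have w: "length ts = n0" "length us = m0" "list_all (wf_trm L n) ts" "list_all (wf_rvtrm L n m) us" "wf_form L n0 m0 \<phi>"
    using assms by (auto simp: tms_def rts_def defs_def)
  have "P (e xs) (r xs \<xi>s) \<longleftrightarrow> sat M xs \<xi>s (sb ts us \<phi>)"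
    if "xs \<in> tuples n (carrier M)" "\<xi>s \<in> tuples m (RV M)" for xs \<xi>s
    using assms that sat_sb[OF w(5,1,2)] tms_closed[OF assms(2) that(1)] rts_closed[OF assms(3) that]
    unfolding defs_def tms_def rts_def by auto
  then show ?thesis using wf_sb w unfolding defs_def by metis
qed

lemma vring_subset: "vring M \<subseteq> carrier M"
  using vring_carrier by blast

lemmas d_vlt' = d_vlt[OF vring_subset]

lemmas tm_intros = tms_id tms_take tms_drop tms_tl tms_append tms_Cons tms_Nil tms_replicate_zero
  tm_zero tm_one tm_add tm_mult tm_diff tm_hd tm_nth
  rts_id rts_take rts_drop rts_tl rts_append rts_Nil rts_rv rts_hd rts_replicate_zero

lemmas d_intros = d_const d_not d_and d_or d_imp d_iff d_ex d_all d_exs d_alls d_exrv d_exrvs d_allrvs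
  d_all_less d_ex_less d_eq d_val d_rveqs d_vlt' d_distinct

lemma definableI:
  assumes "defs L M \<phi> (n + p) (m + q) P" "a \<in> tuples p (carrier M)" "\<alpha> \<in> tuples q (RV M)"
    "Inl ` set a \<subseteq> A" "Inr ` set \<alpha> \<subseteq> A"
    "X = {(x, \<xi>). x \<in> tuples n (carrier M) \<and> \<xi> \<in> tuples m (RV M) \<and> P (x @ a) (\<xi> @ \<alpha>)}"
  shows "definable L M A n m X"
  unfolding definable_def
proof (intro exI[of _ \<phi>] exI[of _ a] exI[of _ \<alpha>] conjI)
  have *: "length a = p" "length \<alpha> = q" using assms tuples_length by auto
  show "wf_form L (n + length a) (m + length \<alpha>) \<phi>" using assms(1) * by (simp add: defs_def)
  have "P (x @ a) (\<xi> @ \<alpha>) \<longleftrightarrow> sat M (x @ a) (\<xi> @ \<alpha>) \<phi>"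
    if "x \<in> tuples n (carrier M)" "\<xi> \<in> tuples m (RV M)" for x \<xi>
    using assms(1) that tuples_append[OF that(1) assms(2)] tuples_append[OF that(2) assms(3)]
    by (auto simp: defs_def)
  then show "X = {(x, \<xi>). x \<in> tuples n (carrier M) \<and> \<xi> \<in> tuples m (RV M) \<and> sat M (x @ a) (\<xi> @ \<alpha>) \<phi>}"
    unfolding assms(6) by auto
qed (use assms in auto)

lemma definableE:
  assumes "definable L M A n m X" "A \<subseteq> Inl ` carrier M \<union> Inr ` RV M"
  obtains \<phi> a \<alpha> p q where "a \<in> tuples p (carrier M)" "\<alpha> \<in> tuples q (RV M)"
    "Inl ` set a \<subseteq> A" "Inr ` set \<alpha> \<subseteq> A" "wf_form L (n + p) (m + q) \<phi>"
    "\<And>x \<xi>. x \<in> tuples n (carrier M) \<Longrightarrow> \<xi> \<in> tuples m (RV M) \<Longrightarrow> (x, \<xi>) \<in> X \<longleftrightarrow> sat M (x @ a) (\<xi> @ \<alpha>) \<phi>"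
proof -
  obtain \<phi> a \<alpha> where *: "Inl ` set a \<subseteq> A" "Inr ` set \<alpha> \<subseteq> A" "wf_form L (n + length a) (m + length \<alpha>) \<phi>"
    "X = {(x, \<xi>). x \<in> tuples n (carrier M) \<and> \<xi> \<in> tuples m (RV M) \<and> sat M (x @ a) (\<xi> @ \<alpha>) \<phi>}"
    using assms(1) unfolding definable_def by auto
  have "a \<in> tuples (length a) (carrier M)" "\<alpha> \<in> tuples (length \<alpha>) (RV M)"
    using *(1,2) assms(2) by (auto simp: tuples_def)
  then show thesis using that[of a "length a" \<alpha> "length \<alpha>" \<phi>] * by auto
qed

text \<open>A definition over the entries of \<open>a\<close> and \<open>\<alpha>\<close> may use
  these entries in any order and number. Substituting variables makes \<open>a\<close> and
  \<open>\<alpha>\<close> themselves the parameter tuples, so that they can later be varied.\<close>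

lemma definable_env:
  assumes "definable L M (Inl ` set a \<union> Inr ` set \<alpha>) n m X" "a \<in> tuples p (carrier M)" "\<alpha> \<in> tuples q (RV M)"
  obtains \<phi> where "wf_form L (n + p) (m + q) \<phi>"
    "\<And>x \<xi>. x \<in> tuples n (carrier M) \<Longrightarrow> \<xi> \<in> tuples m (RV M) \<Longrightarrow> (x, \<xi>) \<in> X \<longleftrightarrow> sat M (x @ a) (\<xi> @ \<alpha>) \<phi>"
proof -
  let ?A = "Inl ` set a \<union> Inr ` set \<alpha>"
  have "?A \<subseteq> Inl ` carrier M \<union> Inr ` RV M" using assms(2,3) by (auto simp: tuples_def)
  then obtain \<phi> b \<beta> p' q' where b: "b \<in> tuples p' (carrier M)" "\<beta> \<in> tuples q' (RV M)"
    "Inl ` set b \<subseteq> ?A" "Inr ` set \<beta> \<subseteq> ?A" "wf_form L (n + p') (m + q') \<phi>"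
    "\<And>x \<xi>. x \<in> tuples n (carrier M) \<Longrightarrow> \<xi> \<in> tuples m (RV M) \<Longrightarrow> (x, \<xi>) \<in> X \<longleftrightarrow> sat M (x @ b) (\<xi> @ \<beta>) \<phi>"
    by (rule definableE[OF assms(1)]) (rule that; assumption)
  have lens: "length a = p" "length \<alpha> = q" "length b = p'" "length \<beta> = q'"
    using assms(2,3) b(1,2) tuples_length by auto
  have "set b \<subseteq> set a" "set \<beta> \<subseteq> set \<alpha>" using b(3,4) by auto
  have "b ! j \<in> set a" if "j < p'" for j using \<open>set b \<subseteq> set a\<close> lens that nth_mem by blast
  then have "\<forall>j<p'. \<exists>i<p. b ! j = a ! i" using lens by (fastforce simp: in_set_conv_nth)
  then obtain f where f: "\<And>j. j < p' \<Longrightarrow> f j < p \<and> b ! j = a ! f j" by metis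
  have "\<beta> ! j \<in> set \<alpha>" if "j < q'" for j using \<open>set \<beta> \<subseteq> set \<alpha>\<close> lens that nth_mem by blast
  then have "\<forall>j<q'. \<exists>i<q. \<beta> ! j = \<alpha> ! i" using lens by (fastforce simp: in_set_conv_nth)
  then obtain g where g: "\<And>j. j < q' \<Longrightarrow> g j < q \<and> \<beta> ! j = \<alpha> ! g j" by metis
  let ?ts = "map Var ([0..<n] @ map (\<lambda>j. n + f j) [0..<p'])"
  let ?us = "map RVVar ([0..<m] @ map (\<lambda>j. m + g j) [0..<q'])"
  have wf: "wf_form L (n + p) (m + q) (sb ?ts ?us \<phi>)"
    by (rule wf_sb[OF b(5)]) (auto simp: list_all_iff f g)
  have "sat M (x @ b) (\<xi> @ \<beta>) \<phi> \<longleftrightarrow> sat M (x @ a) (\<xi> @ \<alpha>) (sb ?ts ?us \<phi>)"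
    if "x \<in> tuples n (carrier M)" "\<xi> \<in> tuples m (RV M)" for x \<xi>
  proof -
    have l: "length x = n" "length \<xi> = m" using that tuples_length by auto
    have 1: "map (eval M (x @ a)) ?ts = x @ b"
      using l lens f by (auto intro!: nth_equalityI simp: nth_append)
    have 2: "map (rveval M (x @ a) (\<xi> @ \<alpha>)) ?us = \<xi> @ \<beta>"
      using l lens g by (auto intro!: nth_equalityI simp: nth_append)
    show ?thesis by (subst sat_sb[OF b(5)]) (simp_all only: 1 2, simp_all)
  qed
  then show thesis using that[OF wf] b(6) by auto
qed

end

lemma vstrI: "vf_structure L M \<Longrightarrow> vstr L M"
  by (simp add: vstr_def vstr_axioms_def vfield_def vf_structure_def)

section \<open>Compactness by an ultrapower of Skolem terms\<close>

text \<open>Finer filters are smaller in the order of filters, so an ultrafilter is a minimal proper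
  filter, and Zorn's lemma is applied to the reversed order.\<close>

lemma ex_ultrafilter:
  fixes F :: "'i filter"
  assumes "F \<noteq> bot"
  obtains U where "U \<le> F" "U \<noteq> bot" "\<And>P. eventually P U \<or> eventually (\<lambda>x. \<not> P x) U"
proof -
  let ?A = "{G. G \<le> F \<and> G \<noteq> bot}"
  have "\<exists>m\<in>?A. \<forall>a\<in>?A. a \<le> m \<longrightarrow> a = m"
  proof (rule predicate_Zorn[of ?A "\<lambda>x y. y \<le> x"])
    show "partial_order_on ?A (relation_of (\<lambda>x y. y \<le> x) ?A)"
      by (rule partial_order_on_relation_ofI) auto
    fix C assume C: "C \<in> Chains (relation_of (\<lambda>x y. y \<le> x) ?A)"
    show "\<exists>u\<in>?A. \<forall>a\<in>C. u \<le> a"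
    proof (cases "C = {}")
      case True then show ?thesis using assms by auto
    next
      case False
      have C1: "G \<le> F \<and> G \<noteq> bot" if "G \<in> C" for G
        using C that unfolding Chains_def relation_of_def by blast
      have ch: "G \<le> H \<or> H \<le> G" if "G \<in> C" "H \<in> C" for G H
        using C that unfolding Chains_def relation_of_def by blast
      \<comment> \<open>A chain is directed, so an event of its infimum is already an event of some
        member. If the infimum were trivial, so would be that member.\<close>
      have "eventually P (Inf C) \<longleftrightarrow> (\<exists>b\<in>C. eventually P b)" for P
      proof (rule eventually_Inf_base[OF False])
        fix G H assume "G \<in> C" "H \<in> C"
        then show "\<exists>x\<in>C. x \<le> inf G H" using ch by (metis inf.absorb1 inf.absorb2 order_refl)
      qed
      then have "Inf C \<noteq> bot" using C1 unfolding trivial_limit_def by blast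
      moreover have "Inf C \<le> F" using False C1 by (meson Inf_lower ex_in_conv order_trans)
      ultimately show ?thesis by (auto intro!: bexI[of _ "Inf C"] Inf_lower)
    qed
  qed
  then obtain U where U: "U \<le> F" "U \<noteq> bot" "\<And>a. a \<le> F \<Longrightarrow> a \<noteq> bot \<Longrightarrow> a \<le> U \<Longrightarrow> a = U" by auto
  have "eventually P U \<or> eventually (\<lambda>x. \<not> P x) U" for P
  proof (rule disjCI)
    assume "\<not> eventually (\<lambda>x. \<not> P x) U"
    then have "inf U (principal {x. P x}) \<noteq> bot"
      unfolding trivial_limit_def eventually_inf_principal by simp
    then have "inf U (principal {x. P x}) = U" using U by (meson inf_le1 order_trans)
    then have "U \<le> principal {x. P x}" by (metis inf_le2)
    then show "eventually P U" by (simp add: le_principal)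
  qed
  then show thesis using that U by blast
qed

section \<open>Codes of Skolem terms in the type of the hypothesis\<close>

datatype 'y tr = Nd 'y "'y tr list"

text \<open>Prefix notation in which the label is followed by the number of children, so that no
  code is a proper prefix of another one.\<close>

primrec enc :: "('f + 'r + nat) tr \<Rightarrow> ('f + 'r + nat) list" where
  "enc (Nd y ts) = y # Inr (Inr (length ts)) # concat (map enc ts)"

text \<open>The rests \<open>r\<close> and \<open>r'\<close> are carried along because the codes of
  the children are concatenated: the inner induction splits off one child at a time and treats the
  remaining ones as its rest.\<close>

lemma enc_inj_append: "enc t @ r = enc t' @ r' \<Longrightarrow> t = t' \<and> r = r'"
proof (induction t arbitrary: t' r r')
  case (Nd y ts)
  obtain y' ts' where t': "t' = Nd y' ts'" by (cases t')
  have *: "y = y'" "length ts = length ts'" "concat (map enc ts) @ r = concat (map enc ts') @ r'"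
    using Nd.prems by (auto simp: t')
  have "us = us' \<and> r = r'" if "length us = length us'" "set us \<subseteq> set ts"
    "concat (map enc us) @ r = concat (map enc us') @ r'" for us us'
    using that
  proof (induction us us' rule: list_induct2)
    case (Cons u us u' us')
    have "enc u @ (concat (map enc us) @ r) = enc u' @ (concat (map enc us') @ r')"
      using Cons.prems by simp
    moreover have "u \<in> set ts" using Cons.prems by simp
    ultimately have "u = u'" "concat (map enc us) @ r = concat (map enc us') @ r'" using Nd.IH by blast+
    then show ?case using Cons by simp
  qed simp
  then show ?case using * t' by auto
qed

lemma inj_enc: "inj enc"
  using enc_inj_append[of _ "[]" _ "[]"] by (auto intro: injI)

text \<open>An infinite type admits an injective pairing. Folding it over a list is injective for
  each fixed length, and the length is paired to the result as a tag.\<close>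

lemma ex_inj_list:
  assumes "infinite (UNIV :: 'y set)"
  shows "\<exists>h :: 'y list \<Rightarrow> 'y. inj h"
proof -
  include cardinal_syntax
  have "|UNIV \<times> UNIV :: ('y \<times> 'y) set| \<le>o |UNIV :: 'y set|"
    using card_of_Times_same_infinite[OF assms] ordIso_iff_ordLeq by blast
  then obtain p :: "'y \<times> 'y \<Rightarrow> 'y" where p: "inj p"
    using card_of_ordLeq[of "UNIV \<times> UNIV" "UNIV :: 'y set"] by auto
  obtain i :: "nat \<Rightarrow> 'y" where i: "inj i" using assms infinite_countable_subset by blast
  let ?f = "\<lambda>xs. foldr (\<lambda>x y. p (x, y)) xs (i 0)"
  have "?f xs = ?f ys \<Longrightarrow> xs = ys" if "length xs = length ys" for xs ys
    using that by (induction xs ys rule: list_induct2) (auto dest: injD[OF p])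
  then have "inj (\<lambda>xs. p (i (length xs), ?f xs))"
    by (auto intro!: injI dest!: injD[OF p] injD[OF i])
  then show ?thesis by blast
qed

lemma map_eq_imp_eq:
  assumes "map f xs = map f ys" "\<And>x y. x \<in> set xs \<Longrightarrow> f x = f y \<Longrightarrow> x = y"
  shows "xs = ys"
  using assms
proof (induction xs arbitrary: ys)
  case (Cons x xs)
  then obtain y ys' where ys: "ys = y # ys'" "f x = f y" "map f xs = map f ys'" by (cases ys) auto
  then show ?case using Cons.IH[of ys'] Cons.prems(2)[of x y] Cons.prems(2) by simp
qed simp

abbreviation tnat :: "nat \<Rightarrow> ('f + 'r + nat) tr list \<Rightarrow> ('f + 'r + nat) tr" where
  "tnat k \<equiv> Nd (Inr (Inr k))"

primrec tr_trm :: "'f trm \<Rightarrow> ('f + 'r + nat) tr" where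
  "tr_trm (Var i) = tnat 0 [tnat i []]"
| "tr_trm TZero = tnat 1 []"
| "tr_trm TOne = tnat 2 []"
| "tr_trm (TAdd s t) = tnat 3 [tr_trm s, tr_trm t]"
| "tr_trm (TMinus t) = tnat 4 [tr_trm t]"
| "tr_trm (TMult s t) = tnat 5 [tr_trm s, tr_trm t]"
| "tr_trm (Fn f ts) = tnat 6 (Nd (Inl f) [] # map tr_trm ts)"

lemma tr_trm_inj: "(tr_trm s :: ('f + 'r + nat) tr) = tr_trm t \<Longrightarrow> s = t"
proof (induction s arbitrary: t)
  case (Fn f ts)
  let ?tr = "tr_trm :: 'f trm \<Rightarrow> ('f + 'r + nat) tr"
  obtain ts' where "t = Fn f ts'" "map ?tr ts = map ?tr ts'" using Fn.prems by (cases t) auto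
  then show ?case using map_eq_imp_eq[of ?tr ts ts'] Fn.IH by simp
next
  case (Var i) then show ?case by (cases t) auto
next
  case TZero then show ?case by (cases t) auto
next
  case TOne then show ?case by (cases t) auto
next
  case (TAdd a b) then show ?case by (cases t) auto
next
  case (TMinus a) then show ?case by (cases t) auto
next
  case (TMult a b) then show ?case by (cases t) auto
qed

primrec tr_rvtrm :: "'f rvtrm \<Rightarrow> ('f + 'r + nat) tr" where
  "tr_rvtrm (RVVar i) = tnat 0 [tnat i []]"
| "tr_rvtrm (Rv t) = tnat 1 [tr_trm t]"

lemma tr_rvtrm_inj: "tr_rvtrm s = tr_rvtrm t \<Longrightarrow> s = t"
  by (cases s; cases t) (auto dest: tr_trm_inj)

primrec tr_form :: "('f, 'r) form \<Rightarrow> ('f + 'r + nat) tr" where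
  "tr_form (FEq s t) = tnat 0 [tr_trm s, tr_trm t]"
| "tr_form (FVal t) = tnat 1 [tr_trm t]"
| "tr_form (FRVEq s t) = tnat 2 [tr_rvtrm s, tr_rvtrm t]"
| "tr_form (FRel R ts us) = tnat 3 [Nd (Inr (Inl R)) [], tnat 0 (map tr_trm ts), tnat 0 (map tr_rvtrm us)]"
| "tr_form (FNot \<phi>) = tnat 4 [tr_form \<phi>]"
| "tr_form (FAnd \<phi> \<psi>) = tnat 5 [tr_form \<phi>, tr_form \<psi>]"
| "tr_form (FEx \<phi>) = tnat 6 [tr_form \<phi>]"
| "tr_form (FExRV \<phi>) = tnat 7 [tr_form \<phi>]"

lemma tr_form_inj:
  fixes \<phi> \<psi> :: "('f, 'r) form"
  shows "tr_form \<phi> = tr_form \<psi> \<Longrightarrow> \<phi> = \<psi>"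
proof (induction \<phi> arbitrary: \<psi> rule: form.induct)
  case (FEq s t) then show ?case by (cases \<psi>) (auto dest: tr_trm_inj)
next
  case (FVal t) then show ?case by (cases \<psi>) (auto dest: tr_trm_inj)
next
  case (FRVEq s t) then show ?case by (cases \<psi>) (auto dest: tr_rvtrm_inj)
next
  case (FRel R ts us)
  let ?tt = "tr_trm :: 'f trm \<Rightarrow> ('f + 'r + nat) tr" and ?tr = "tr_rvtrm :: 'f rvtrm \<Rightarrow> ('f + 'r + nat) tr"
  obtain ts' us' where "\<psi> = FRel R ts' us'" "map ?tt ts = map ?tt ts'" "map ?tr us = map ?tr us'"
    using FRel.prems by (cases \<psi>) auto
  then show ?case
    using map_eq_imp_eq[of ?tt ts ts'] map_eq_imp_eq[of ?tr us us'] tr_trm_inj tr_rvtrm_inj by metis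
next
  case (FNot \<phi>) then show ?case by (cases \<psi>) auto
next
  case (FAnd \<phi> \<phi>') then show ?case by (cases \<psi>) auto
next
  case (FEx \<phi>) then show ?case by (cases \<psi>) auto
next
  case (FExRV \<phi>) then show ?case by (cases \<psi>) auto
qed

text \<open>Skolem terms: \<open>SK\<close> and \<open>SR\<close> name witnesses for the quantifiers of the two sorts;
  elements of RV are represented by elements of the field.\<close>

datatype ('f, 'r) sk =
    SV nat
  | SK "('f, 'r) form" "('f, 'r) sk list" "('f, 'r) sk list"
  | SR "('f, 'r) form" "('f, 'r) sk list" "('f, 'r) sk list"

primrec tr_sk :: "('f, 'r) sk \<Rightarrow> ('f + 'r + nat) tr" where
  "tr_sk (SV i) = tnat 0 [tnat i []]"
| "tr_sk (SK \<phi> ts us) = tnat 1 [tr_form \<phi>, tnat 0 (map tr_sk ts), tnat 0 (map tr_sk us)]"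
| "tr_sk (SR \<phi> ts us) = tnat 2 [tr_form \<phi>, tnat 0 (map tr_sk ts), tnat 0 (map tr_sk us)]"

lemma tr_sk_inj:
  fixes s t :: "('f, 'r) sk"
  shows "tr_sk s = tr_sk t \<Longrightarrow> s = t"
proof (induction s arbitrary: t)
  case (SV i) then show ?case by (cases t) auto
next
  case (SK \<phi> ts us)
  obtain \<psi> ts' us' where t: "t = SK \<psi> ts' us'" using SK.prems by (cases t) auto
  have "map tr_sk ts = map tr_sk ts'" "map tr_sk us = map tr_sk us'" "tr_form \<phi> = tr_form \<psi>"
    using SK.prems t by simp_all
  then show ?case unfolding t
    using map_eq_imp_eq[of tr_sk ts ts'] map_eq_imp_eq[of tr_sk us us'] SK.IH tr_form_inj[of \<phi> \<psi>] by simp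
next
  case (SR \<phi> ts us)
  obtain \<psi> ts' us' where t: "t = SR \<psi> ts' us'" using SR.prems by (cases t) auto
  have "map tr_sk ts = map tr_sk ts'" "map tr_sk us = map tr_sk us'" "tr_form \<phi> = tr_form \<psi>"
    using SR.prems t by simp_all
  then show ?case unfolding t
    using map_eq_imp_eq[of tr_sk ts ts'] map_eq_imp_eq[of tr_sk us us'] SR.IH tr_form_inj[of \<phi> \<psi>] by simp
qed

text \<open>The cardinality part of the Loewenheim-Skolem argument: \<open>'f + 'r + nat\<close> has
  enough elements to name all Skolem terms.\<close>

lemma ex_surj_sk: "\<exists>g :: 'f + 'r + nat \<Rightarrow> ('f, 'r) sk. surj g"
proof -
  have "infinite (UNIV :: ('f + 'r + nat) set)"
    by (rule infinite_super[of "range (\<lambda>n. Inr (Inr n))"]) (auto intro!: range_inj_infinite injI)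
  then obtain h :: "('f + 'r + nat) list \<Rightarrow> 'f + 'r + nat" where h: "inj h" using ex_inj_list by blast
  have "inj (\<lambda>s :: ('f, 'r) sk. h (enc (tr_sk s)))"
    using tr_sk_inj by (auto intro!: injI dest!: injD[OF h] injD[OF inj_enc])
  then show ?thesis using inj_imp_surj_inv by blast
qed

section \<open>The structure of named functions modulo an ultrafilter\<close>

primrec skev :: "('f, 'r, 'u) vstruct \<Rightarrow> (nat \<Rightarrow> 'i \<Rightarrow> 'u) \<Rightarrow> ('f, 'r) sk \<Rightarrow> 'i \<Rightarrow> 'u" where
  "skev M v (SV j) = v j"
| "skev M v (SK \<phi> ts us) = (\<lambda>i. SOME x. x \<in> carrier M \<and>
     ((\<exists>y\<in>carrier M. sat M (y # map (\<lambda>g. g i) (map (skev M v) ts)) (map (\<lambda>g. rv M (g i)) (map (skev M v) us)) \<phi>)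
     \<longrightarrow> sat M (x # map (\<lambda>g. g i) (map (skev M v) ts)) (map (\<lambda>g. rv M (g i)) (map (skev M v) us)) \<phi>))"
| "skev M v (SR \<phi> ts us) = (\<lambda>i. SOME x. x \<in> carrier M \<and>
     ((\<exists>y\<in>carrier M. sat M (map (\<lambda>g. g i) (map (skev M v) ts)) (rv M y # map (\<lambda>g. rv M (g i)) (map (skev M v) us)) \<phi>)
     \<longrightarrow> sat M (map (\<lambda>g. g i) (map (skev M v) ts)) (rv M x # map (\<lambda>g. rv M (g i)) (map (skev M v) us)) \<phi>))"

text \<open>An element \<open>t\<close> of \<open>'y\<close> names the function \<open>e t\<close>
  on the index set. Instead of all functions, as in a full ultrapower, only the named ones are used.
  Closure under pointwise witnesses, \<open>skolem\<close> and \<open>skolem_RV\<close>, is what the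
  theorem of Los requires of them, and \<open>'y\<close> can be a small type.\<close>

locale ultra = vstr L M for L :: "('f, 'r) lang" and M :: "('f, 'r, 'u) vstruct" (structure) +
  fixes U :: "'i filter" and e :: "'y \<Rightarrow> 'i \<Rightarrow> 'u"
  assumes nonbot: "U \<noteq> bot"
    and ultra: "\<And>P. eventually P U \<or> eventually (\<lambda>x. \<not> P x) U"
    and e_closed: "\<And>t i. e t i \<in> carrier M"
    and skolem: "\<And>\<phi> ts us. \<exists>t. \<forall>i.
      (\<exists>x\<in>carrier M. sat M (x # map (\<lambda>s. e s i) ts) (map (\<lambda>s. rv M (e s i)) us) \<phi>) \<longrightarrow>
      sat M (e t i # map (\<lambda>s. e s i) ts) (map (\<lambda>s. rv M (e s i)) us) \<phi>"
    and skolem_RV: "\<And>\<phi> ts us. \<exists>t. \<forall>i.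
      (\<exists>x\<in>carrier M. sat M (map (\<lambda>s. e s i) ts) (rv M x # map (\<lambda>s. rv M (e s i)) us) \<phi>) \<longrightarrow>
      sat M (map (\<lambda>s. e s i) ts) (rv M (e t i) # map (\<lambda>s. rv M (e s i)) us) \<phi>"
begin

lemmas e_closed' [simp] = e_closed

lemma ultra_not: "eventually (\<lambda>i. \<not> P i) U \<longleftrightarrow> \<not> eventually P U"
proof
  assume *: "eventually (\<lambda>i. \<not> P i) U"
  show "\<not> eventually P U"
  proof
    assume "eventually P U"
    with * have "eventually (\<lambda>i. False) U" by eventually_elim simp
    then show False using nonbot by simp
  qed
qed (use ultra in blast)

text \<open>A choice of one name in each class modulo \<open>U\<close>: the chosen predicate is the
  same for all members of a class. Passing to the classes themselves would leave the type
  \<open>'y\<close>.\<close>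

definition can :: "'y \<Rightarrow> 'y" where
  "can t = (SOME t'. eventually (\<lambda>i. e t' i = e t i) U)"

definition NC :: "'y set" where "NC = range can"

definition repr :: "('i \<Rightarrow> 'u) \<Rightarrow> 'y" where
  "repr s = (SOME t. t \<in> NC \<and> eventually (\<lambda>i. e t i = s i) U)"

lemma e_can: "eventually (\<lambda>i. e (can t) i = e t i) U"
  unfolding can_def by (rule someI[of _ t]) simp

lemma can_cong:
  assumes "eventually (\<lambda>i. e s i = e t i) U" shows "can s = can t"
proof -
  have "eventually (\<lambda>i. e t' i = e s i) U \<longleftrightarrow> eventually (\<lambda>i. e t' i = e t i) U" for t'
    using assms by (intro eventually_subst) (erule eventually_mono, simp)
  then show ?thesis unfolding can_def by simp
qed

lemma NC_eqI:
  assumes "x \<in> NC" "y \<in> NC" "eventually (\<lambda>i. e x i = e y i) U" shows "x = y"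
proof -
  have "can x = x" if "x \<in> NC" for x using that can_cong[OF e_can] by (auto simp: NC_def)
  then show ?thesis using can_cong[OF assms(3)] assms by metis
qed

lemma NC_eq_iff: "x \<in> NC \<Longrightarrow> y \<in> NC \<Longrightarrow> x = y \<longleftrightarrow> eventually (\<lambda>i. e x i = e y i) U"
  using NC_eqI by auto

lemma can_NC [simp]: "can t \<in> NC" by (simp add: NC_def)

lemma reprI:
  assumes "\<exists>t. eventually (\<lambda>i. e t i = s i) U"
  shows "repr s \<in> NC" "eventually (\<lambda>i. e (repr s) i = s i) U"
proof -
  obtain t where t: "eventually (\<lambda>i. e t i = s i) U" using assms by auto
  have "eventually (\<lambda>i. e (can t) i = s i) U" using t e_can[of t] by eventually_elim simp
  then have "\<exists>t. t \<in> NC \<and> eventually (\<lambda>i. e t i = s i) U" using can_NC by blast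
  then have "repr s \<in> NC \<and> eventually (\<lambda>i. e (repr s) i = s i) U" unfolding repr_def by (rule someI_ex)
  then show "repr s \<in> NC" "eventually (\<lambda>i. e (repr s) i = s i) U" by auto
qed

text \<open>The pointwise value of a term is named because it is the only witness for the formula
  \<open>x = t\<close>, with \<open>t\<close> shifted under the quantifier.\<close>

lemma repr_trm:
  assumes "wf_trm L (length xs) t"
  shows "repr (\<lambda>i. eval M (map (\<lambda>x. e x i) xs) t) \<in> NC"
    "eventually (\<lambda>i. e (repr (\<lambda>i. eval M (map (\<lambda>x. e x i) xs) t)) i = eval M (map (\<lambda>x. e x i) xs) t) U"
proof -
  obtain s where s: "\<forall>i. (\<exists>x\<in>carrier M. sat M (x # map (\<lambda>s. e s i) xs) (map (\<lambda>s. rv M (e s i)) []) (FEq (Var 0) (sht t))) \<longrightarrow>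
      sat M (e s i # map (\<lambda>s. e s i) xs) (map (\<lambda>s. rv M (e s i)) []) (FEq (Var 0) (sht t))"
    using skolem[of xs "[]"] by blast
  have "eval M (map (\<lambda>s. e s i) xs) t \<in> carrier M" for i
    by (rule eval_closed[OF _ assms]) (auto simp: tuples_def)
  then have "e s i = eval M (map (\<lambda>x. e x i) xs) t" for i using s by auto
  then have "\<exists>t'. eventually (\<lambda>i. e t' i = eval M (map (\<lambda>x. e x i) xs) t) U" by (auto intro!: exI[of _ s])
  then show "repr (\<lambda>i. eval M (map (\<lambda>x. e x i) xs) t) \<in> NC"
    "eventually (\<lambda>i. e (repr (\<lambda>i. eval M (map (\<lambda>x. e x i) xs) t)) i = eval M (map (\<lambda>x. e x i) xs) t) U"
    using reprI by auto
qed

text \<open>The relations of \<open>N\<close> involve RV, which is computed inside the structure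
  itself. So the field and its valuation ring are built first, with empty relations;
  \<open>rv_N0\<close> shows that adding the relations does not change RV.\<close>

definition N0 :: "('f, 'r, 'y) vstruct" where
  "N0 = \<lparr>carrier = NC, mult = \<lambda>x y. repr (\<lambda>i. e x i \<otimes> e y i), one = repr (\<lambda>i. \<one>),
     zero = repr (\<lambda>i. \<zero>), add = \<lambda>x y. repr (\<lambda>i. e x i \<oplus> e y i),
     vring = {x \<in> NC. eventually (\<lambda>i. e x i \<in> vring M) U},
     ifun = \<lambda>f xs. repr (\<lambda>i. ifun M f (map (\<lambda>x. e x i) xs)),
     irel = \<lambda>R. {}\<rparr>"

text \<open>An RV tuple is related if some choice of named representatives is related almost
  everywhere. Independence of the choice is shown in the relation case of
  \<open>los\<close>.\<close>

definition N :: "('f, 'r, 'y) vstruct" where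
  "N = N0\<lparr>irel := \<lambda>R. {(xs, map (rv N0) us) | xs us.
     xs \<in> tuples (fst (rarity L R)) NC \<and> us \<in> tuples (snd (rarity L R)) NC \<and>
     eventually (\<lambda>i. (map (\<lambda>x. e x i) xs, map (\<lambda>u. rv M (e u i)) us) \<in> irel M R) U}\<rparr>"

lemma N_simps [simp]:
  "carrier N = NC" "x \<otimes>\<^bsub>N\<^esub> y = repr (\<lambda>i. e x i \<otimes> e y i)" "\<one>\<^bsub>N\<^esub> = repr (\<lambda>i. \<one>)"
  "\<zero>\<^bsub>N\<^esub> = repr (\<lambda>i. \<zero>)" "x \<oplus>\<^bsub>N\<^esub> y = repr (\<lambda>i. e x i \<oplus> e y i)"
  "vring N = {x \<in> NC. eventually (\<lambda>i. e x i \<in> vring M) U}"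
  "ifun N f xs = repr (\<lambda>i. ifun M f (map (\<lambda>x. e x i) xs))"
  by (simp_all add: N_def N0_def)

lemma rv_N0: "rv N0 = rv N"
proof -
  have 1: "vring_of N = (vring_of N0)\<lparr>irel := irel N\<rparr>" by (simp add: vring_of_def N_def)
  have 2: "Units (vring_of N) = Units (vring_of N0)" unfolding 1 by (simp add: Units_def)
  have 3: "vabs N = vabs N0" by (rule ext) (simp only: vabs_def 2, simp add: N_def)
  have 4: "vle N = vle N0" by (intro ext) (simp add: vle_def N_def)
  have 5: "vless N = vless N0" by (intro ext) (simp only: vless_def 4)
  have "rvl N = rvl N0" by (intro ext) (simp only: rvl_def 3 5, simp add: N_def)
  moreover have "\<one>\<^bsub>N\<^esub> = \<one>\<^bsub>N0\<^esub>" by (simp add: N_def)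
  ultimately show ?thesis by (simp only: rv_def 3)
qed

lemma irel_N: "irel N R = {(xs, map (rv N) us) | xs us.
     xs \<in> tuples (fst (rarity L R)) NC \<and> us \<in> tuples (snd (rarity L R)) NC \<and>
     eventually (\<lambda>i. (map (\<lambda>x. e x i) xs, map (\<lambda>u. rv M (e u i)) us) \<in> irel M R) U}"
  unfolding rv_N0[symmetric] by (simp add: N_def)

lemma N_add: "repr (\<lambda>i. e x i \<oplus> e y i) \<in> NC" "eventually (\<lambda>i. e (repr (\<lambda>i. e x i \<oplus> e y i)) i = e x i \<oplus> e y i) U"
  using repr_trm[of "[x, y]" "TAdd (Var 0) (Var 1)"] by auto

lemma N_mult: "repr (\<lambda>i. e x i \<otimes> e y i) \<in> NC" "eventually (\<lambda>i. e (repr (\<lambda>i. e x i \<otimes> e y i)) i = e x i \<otimes> e y i) U"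
  using repr_trm[of "[x, y]" "TMult (Var 0) (Var 1)"] by auto

lemma N_minus: "repr (\<lambda>i. \<ominus> e x i) \<in> NC" "eventually (\<lambda>i. e (repr (\<lambda>i. \<ominus> e x i)) i = \<ominus> e x i) U"
  using repr_trm[of "[x]" "TMinus (Var 0)"] by auto

lemma N_zero: "repr (\<lambda>i. \<zero>) \<in> NC" "eventually (\<lambda>i. e (repr (\<lambda>i. \<zero>)) i = \<zero>) U"
  using repr_trm[of "[]" TZero] by auto

lemma N_one: "repr (\<lambda>i. \<one>) \<in> NC" "eventually (\<lambda>i. e (repr (\<lambda>i. \<one>)) i = \<one>) U"
  using repr_trm[of "[]" TOne] by auto

lemmas N_closed [simp] = N_add(1) N_mult(1) N_minus(1) N_zero(1) N_one(1)

lemma N_cring: "cring N"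
proof (rule cringI)
  show "abelian_group N"
  proof (rule abelian_groupI; simp)
    fix x y z
    show "repr (\<lambda>i. e (repr (\<lambda>i. e x i \<oplus> e y i)) i \<oplus> e z i) = repr (\<lambda>i. e x i \<oplus> e (repr (\<lambda>i. e y i \<oplus> e z i)) i)"
      using N_add(2)[of x y] N_add(2)[of y z] N_add(2)[of "repr (\<lambda>i. e x i \<oplus> e y i)" z]
        N_add(2)[of x "repr (\<lambda>i. e y i \<oplus> e z i)"]
      by (intro NC_eqI; simp; eventually_elim) (simp add: a_assoc)
    show "repr (\<lambda>i. e x i \<oplus> e y i) = repr (\<lambda>i. e y i \<oplus> e x i)" by (simp add: a_comm)
  next
    fix x assume x: "x \<in> NC"
    show "repr (\<lambda>i. e (repr (\<lambda>i. \<zero>)) i \<oplus> e x i) = x"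
      using N_add(2)[of "repr (\<lambda>i. \<zero>)" x] N_zero(2)
      by (intro NC_eqI; simp add: x; eventually_elim) simp
    show "\<exists>y\<in>NC. repr (\<lambda>i. e y i \<oplus> e x i) = repr (\<lambda>i. \<zero>)"
    proof (rule bexI[of _ "repr (\<lambda>i. \<ominus> e x i)"])
      show "repr (\<lambda>i. e (repr (\<lambda>i. \<ominus> e x i)) i \<oplus> e x i) = repr (\<lambda>i. \<zero>)"
        using N_add(2)[of "repr (\<lambda>i. \<ominus> e x i)" x] N_minus(2)[of x] N_zero(2)
        by (intro NC_eqI; simp; eventually_elim) (simp add: l_neg)
    qed simp
  qed
  show "Group.comm_monoid N"
  proof (rule comm_monoidI; simp)
    fix x y z
    show "repr (\<lambda>i. e (repr (\<lambda>i. e x i \<otimes> e y i)) i \<otimes> e z i) = repr (\<lambda>i. e x i \<otimes> e (repr (\<lambda>i. e y i \<otimes> e z i)) i)"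
      using N_mult(2)[of x y] N_mult(2)[of y z] N_mult(2)[of "repr (\<lambda>i. e x i \<otimes> e y i)" z]
        N_mult(2)[of x "repr (\<lambda>i. e y i \<otimes> e z i)"]
      by (intro NC_eqI; simp; eventually_elim) (simp add: m_assoc)
    show "repr (\<lambda>i. e x i \<otimes> e y i) = repr (\<lambda>i. e y i \<otimes> e x i)" by (simp add: m_comm)
  next
    fix x assume x: "x \<in> NC"
    show "repr (\<lambda>i. e (repr (\<lambda>i. \<one>)) i \<otimes> e x i) = x"
      using N_mult(2)[of "repr (\<lambda>i. \<one>)" x] N_one(2)
      by (intro NC_eqI; simp add: x; eventually_elim) simp
  qed
  fix x y z
  show "(x \<oplus>\<^bsub>N\<^esub> y) \<otimes>\<^bsub>N\<^esub> z = x \<otimes>\<^bsub>N\<^esub> z \<oplus>\<^bsub>N\<^esub> y \<otimes>\<^bsub>N\<^esub> z"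
    using N_add(2)[of x y] N_mult(2)[of x z] N_mult(2)[of y z]
      N_mult(2)[of "repr (\<lambda>i. e x i \<oplus> e y i)" z]
      N_add(2)[of "repr (\<lambda>i. e x i \<otimes> e z i)" "repr (\<lambda>i. e y i \<otimes> e z i)"]
    by (intro NC_eqI; simp; eventually_elim) (simp add: l_distr)
qed

lemma skolem_can:
  obtains t where "t \<in> NC" "eventually (\<lambda>i. (\<exists>x\<in>carrier M. sat M (x # map (\<lambda>s. e s i) ts) (map (\<lambda>s. rv M (e s i)) us) \<phi>) \<longrightarrow>
      sat M (e t i # map (\<lambda>s. e s i) ts) (map (\<lambda>s. rv M (e s i)) us) \<phi>) U"
proof -
  obtain t where t: "\<forall>i. (\<exists>x\<in>carrier M. sat M (x # map (\<lambda>s. e s i) ts) (map (\<lambda>s. rv M (e s i)) us) \<phi>) \<longrightarrow>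
      sat M (e t i # map (\<lambda>s. e s i) ts) (map (\<lambda>s. rv M (e s i)) us) \<phi>" using skolem by blast
  let ?P = "\<lambda>i. \<exists>x\<in>carrier M. sat M (x # map (\<lambda>s. e s i) ts) (map (\<lambda>s. rv M (e s i)) us) \<phi>"
  let ?Q = "\<lambda>t i. sat M (e t i # map (\<lambda>s. e s i) ts) (map (\<lambda>s. rv M (e s i)) us) \<phi>"
  show thesis
  proof (rule that[of "can t"])
    show "can t \<in> NC" by simp
  next
    show "eventually (\<lambda>i. ?P i \<longrightarrow> ?Q (can t) i) U" using e_can[of t] by eventually_elim (use t in simp)
  qed
qed

lemma skolem_RV_can:
  obtains t where "t \<in> NC" "eventually (\<lambda>i. (\<exists>x\<in>carrier M. sat M (map (\<lambda>s. e s i) ts) (rv M x # map (\<lambda>s. rv M (e s i)) us) \<phi>) \<longrightarrow>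
      sat M (map (\<lambda>s. e s i) ts) (rv M (e t i) # map (\<lambda>s. rv M (e s i)) us) \<phi>) U"
proof -
  obtain t where t: "\<forall>i. (\<exists>x\<in>carrier M. sat M (map (\<lambda>s. e s i) ts) (rv M x # map (\<lambda>s. rv M (e s i)) us) \<phi>) \<longrightarrow>
      sat M (map (\<lambda>s. e s i) ts) (rv M (e t i) # map (\<lambda>s. rv M (e s i)) us) \<phi>" using skolem_RV by blast
  let ?P = "\<lambda>i. \<exists>x\<in>carrier M. sat M (map (\<lambda>s. e s i) ts) (rv M x # map (\<lambda>s. rv M (e s i)) us) \<phi>"
  let ?Q = "\<lambda>t i. sat M (map (\<lambda>s. e s i) ts) (rv M (e t i) # map (\<lambda>s. rv M (e s i)) us) \<phi>"
  show thesis
  proof (rule that[of "can t"])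
    show "can t \<in> NC" by simp
  next
    show "eventually (\<lambda>i. ?P i \<longrightarrow> ?Q (can t) i) U" using e_can[of t] by eventually_elim (use t in simp)
  qed
qed

text \<open>A Skolem witness for \<open>x z = 1\<close> is an inverse at every index where
  \<open>x\<close> is non-zero, and by the ultrafilter property these indices are almost
  all.\<close>

lemma N_inverse:
  assumes "x \<in> NC" "x \<noteq> repr (\<lambda>i. \<zero>)"
  obtains y where "y \<in> NC" "repr (\<lambda>i. e x i \<otimes> e y i) = repr (\<lambda>i. \<one>)" "eventually (\<lambda>i. e x i \<noteq> \<zero> \<and> e x i \<otimes> e y i = \<one>) U"
proof -
  obtain y where y: "y \<in> NC" "eventually (\<lambda>i. (\<exists>z\<in>carrier M. sat M [z, e x i] [] (FEq (TMult (Var 1) (Var 0)) TOne)) \<longrightarrow>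
      sat M [e y i, e x i] [] (FEq (TMult (Var 1) (Var 0)) TOne)) U"
    using skolem_can[of "[x]" "[]" "FEq (TMult (Var 1) (Var 0)) TOne"] by auto
  have "\<not> eventually (\<lambda>i. e x i = \<zero>) U"
  proof
    assume "eventually (\<lambda>i. e x i = \<zero>) U"
    then have "eventually (\<lambda>i. e x i = e (repr (\<lambda>i. \<zero>)) i) U" using N_zero(2) by eventually_elim simp
    then show False using NC_eqI assms by simp
  qed
  then have "eventually (\<lambda>i. e x i \<noteq> \<zero>) U" using ultra_not by simp
  then have *: "eventually (\<lambda>i. e x i \<noteq> \<zero> \<and> e x i \<otimes> e y i = \<one>) U"
    using y(2)
  proof eventually_elim
    case (elim i)
    then have "\<exists>z\<in>carrier M. e x i \<otimes> z = \<one>" using inv_right inv_closed e_closed by blast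
    then show ?case using elim by simp
  qed
  moreover have "repr (\<lambda>i. e x i \<otimes> e y i) = repr (\<lambda>i. \<one>)"
    using * N_mult(2)[of x y] N_one(2) by (intro NC_eqI; simp; eventually_elim) simp
  ultimately show thesis using that y by blast
qed

lemma N_field: "field N"
proof -
  interpret R: cring N by (rule N_cring)
  show ?thesis
  proof (rule R.cring_fieldI2)
    show "\<zero>\<^bsub>N\<^esub> \<noteq> \<one>\<^bsub>N\<^esub>"
    proof
      assume "\<zero>\<^bsub>N\<^esub> = \<one>\<^bsub>N\<^esub>"
      then have "repr (\<lambda>i. \<zero>) = repr (\<lambda>i. \<one>)" by simp
      then have "eventually (\<lambda>i. e (repr (\<lambda>i. \<zero>)) i = e (repr (\<lambda>i. \<one>)) i) U" by simp
      then have "eventually (\<lambda>i. False) U" using N_zero(2) N_one(2) by eventually_elim simp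
      then show False using nonbot by simp
    qed
    show "\<exists>b\<in>carrier N. a \<otimes>\<^bsub>N\<^esub> b = \<one>\<^bsub>N\<^esub>" if "a \<in> carrier N" "a \<noteq> \<zero>\<^bsub>N\<^esub>" for a
      using N_inverse[of a] that by (metis N_simps(1-4))
  qed
qed

lemma N_uminus: "x \<in> NC \<Longrightarrow> \<ominus>\<^bsub>N\<^esub> x = repr (\<lambda>i. \<ominus> e x i)"
proof -
  assume x: "x \<in> NC"
  interpret R: field N by (rule N_field)
  have "repr (\<lambda>i. \<ominus> e x i) \<oplus>\<^bsub>N\<^esub> x = \<zero>\<^bsub>N\<^esub>"
    using N_add(2)[of "repr (\<lambda>i. \<ominus> e x i)" x] N_minus(2)[of x] N_zero(2) unfolding N_simps
    by (intro NC_eqI; simp; eventually_elim) (simp add: l_neg)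
  then show ?thesis using R.minus_equality[of "repr (\<lambda>i. \<ominus> e x i)" x] x by simp
qed

lemma N_valued_field: "valued_field N"
  unfolding valued_field_def
proof (intro conjI)
  interpret R: field N by (rule N_field)
  show "field N" by (rule N_field)
  show "subring (vring N) N"
  proof (rule R.subringI)
    show "vring N \<subseteq> carrier N" by auto
    show "\<one>\<^bsub>N\<^esub> \<in> vring N" using N_one(2) by (simp, eventually_elim) simp
    show "\<ominus>\<^bsub>N\<^esub> h \<in> vring N" if "h \<in> vring N" for h
    proof -
      have h: "h \<in> NC" "eventually (\<lambda>i. e h i \<in> vring M) U" using that by auto
      then have "eventually (\<lambda>i. e (repr (\<lambda>i. \<ominus> e h i)) i \<in> vring M) U"
        using N_minus(2)[of h] by (auto elim: eventually_elim2)
      then show ?thesis using h by (simp add: N_uminus)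
    qed
    fix h1 h2 assume "h1 \<in> vring N" "h2 \<in> vring N"
    then have h: "h1 \<in> NC" "eventually (\<lambda>i. e h1 i \<in> vring M) U" "h2 \<in> NC" "eventually (\<lambda>i. e h2 i \<in> vring M) U" by auto
    show "h1 \<otimes>\<^bsub>N\<^esub> h2 \<in> vring N" using h(2,4) N_mult(2)[of h1 h2] by (simp, eventually_elim) simp
    show "h1 \<oplus>\<^bsub>N\<^esub> h2 \<in> vring N" using h(2,4) N_add(2)[of h1 h2] by (simp, eventually_elim) simp
  qed
  show "\<forall>x\<in>carrier N - {\<zero>\<^bsub>N\<^esub>}. x \<in> vring N \<or> inv\<^bsub>N\<^esub> x \<in> vring N"
  proof
    fix x assume x: "x \<in> carrier N - {\<zero>\<^bsub>N\<^esub>}"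
    then have x': "x \<in> NC" "x \<noteq> repr (\<lambda>i. \<zero>)" by auto
    obtain y where y: "y \<in> NC" "repr (\<lambda>i. e x i \<otimes> e y i) = repr (\<lambda>i. \<one>)" "eventually (\<lambda>i. e x i \<noteq> \<zero> \<and> e x i \<otimes> e y i = \<one>) U"
      using N_inverse[OF x'] by blast
    have "inv\<^bsub>N\<^esub> x = y" by (rule R.comm_inv_char) (use x' y in auto)
    moreover have "eventually (\<lambda>i. e x i \<notin> vring M \<longrightarrow> e y i \<in> vring M) U"
      using y(3)
    proof eventually_elim
      case (elim i)
      then have "e y i = inv (e x i)" using comm_inv_char[of "e x i" "e y i"] by simp
      then show ?case using vring_total[of "e x i"] elim by auto
    qed
    then have "\<not> eventually (\<lambda>i. e x i \<in> vring M) U \<longrightarrow> eventually (\<lambda>i. e y i \<in> vring M) U"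
      unfolding ultra_not[symmetric] by (auto elim: eventually_elim2)
    ultimately show "x \<in> vring N \<or> inv\<^bsub>N\<^esub> x \<in> vring N" using x' y by auto
  qed
  \<comment> \<open>At every index there is an element outside the valuation ring; a named function
    choosing such elements keeps the valuation of \<open>N\<close> non-trivial.\<close>
  obtain t where t: "t \<in> NC" "eventually (\<lambda>i. (\<exists>z\<in>carrier M. sat M [z] [] (FNot (FVal (Var 0)))) \<longrightarrow>
      sat M [e t i] [] (FNot (FVal (Var 0)))) U"
    using skolem_can[of "[]" "[]" "FNot (FVal (Var 0))"] by auto
  have "\<exists>z\<in>carrier M. z \<notin> vring M" using valued_field vring_carrier by (auto simp: valued_field_def)
  then have "eventually (\<lambda>i. e t i \<notin> vring M) U" using t(2) by simp
  then have "t \<notin> vring N" using ultra_not by simp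
  then show "vring N \<noteq> carrier N" using t by auto
qed

sublocale NV: vfield N
  by (simp add: vfield_def N_valued_field)

lemma N_diff:
  assumes "x \<in> NC" "y \<in> NC"
  shows "x \<ominus>\<^bsub>N\<^esub> y \<in> NC" "eventually (\<lambda>i. e (x \<ominus>\<^bsub>N\<^esub> y) i = e x i \<ominus> e y i) U"
proof -
  show "x \<ominus>\<^bsub>N\<^esub> y \<in> NC" using assms NV.minus_closed by simp
  show "eventually (\<lambda>i. e (x \<ominus>\<^bsub>N\<^esub> y) i = e x i \<ominus> e y i) U"
    using N_add(2)[of x "repr (\<lambda>i. \<ominus> e y i)"] N_minus(2)[of y]
    unfolding a_minus_def N_uminus[OF assms(2)] N_simps by eventually_elim simp
qed

text \<open>A quantifier step of the theorem of Los done by hand: a multiplier that exists almost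
  everywhere is provided by a named witness.\<close>

lemma N_vlt:
  assumes "x \<in> NC" "y \<in> NC"
  shows "vlt N x y \<longleftrightarrow> eventually (\<lambda>i. vlt M (e x i) (e y i)) U"
proof -
  let ?\<phi> = "FAnd (FVal (Var 0)) (FEq (Var 2) (TMult (Var 0) (Var 1)))"
  have "(\<exists>z\<in>vring N. y = z \<otimes>\<^bsub>N\<^esub> x) \<longleftrightarrow> eventually (\<lambda>i. \<exists>z\<in>vring M. e y i = z \<otimes> e x i) U"
  proof
    assume "\<exists>z\<in>vring N. y = z \<otimes>\<^bsub>N\<^esub> x"
    then obtain z where z: "eventually (\<lambda>i. e z i \<in> vring M) U" "y = repr (\<lambda>i. e z i \<otimes> e x i)" by auto
    then show "eventually (\<lambda>i. \<exists>z\<in>vring M. e y i = z \<otimes> e x i) U"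
      using N_mult(2)[of z x] by (auto elim: eventually_elim2)
  next
    assume *: "eventually (\<lambda>i. \<exists>z\<in>vring M. e y i = z \<otimes> e x i) U"
    obtain z where z: "z \<in> NC" "eventually (\<lambda>i. (\<exists>z\<in>carrier M. sat M [z, e x i, e y i] [] ?\<phi>) \<longrightarrow>
      sat M [e z i, e x i, e y i] [] ?\<phi>) U"
      using skolem_can[of "[x, y]" "[]" ?\<phi>] by auto
    have **: "eventually (\<lambda>i. e z i \<in> vring M \<and> e y i = e z i \<otimes> e x i) U"
      using * z(2)
    proof eventually_elim
      case (elim i)
      then show ?case using vring_carrier by auto
    qed
    have "y = repr (\<lambda>i. e z i \<otimes> e x i)"
      using ** N_mult(2)[of z x] by (intro NC_eqI; simp add: assms; eventually_elim) simp
    moreover have "z \<in> vring N" using z ** by (auto elim: eventually_mono)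
    ultimately show "\<exists>z\<in>vring N. y = z \<otimes>\<^bsub>N\<^esub> x" by auto
  qed
  then show ?thesis unfolding vlt_def ultra_not by simp
qed

lemma eventually_disj: "eventually (\<lambda>i. P i \<or> Q i) U \<longleftrightarrow> eventually P U \<or> eventually Q U"
proof
  assume *: "eventually (\<lambda>i. P i \<or> Q i) U"
  show "eventually P U \<or> eventually Q U"
  proof (rule disjCI)
    assume "\<not> eventually Q U"
    then have "eventually (\<lambda>i. \<not> Q i) U" using ultra_not by simp
    with * show "eventually P U" by eventually_elim simp
  qed
qed (auto elim: eventually_mono)

text \<open>Equality of leading terms is a disjunction of an equation and a strict comparison, and
  an ultrafilter commutes with disjunction. So RV of \<open>N\<close> agrees with RV taken
  pointwise.\<close>

lemma N_rv:
  assumes "x \<in> NC" "y \<in> NC"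
  shows "rv N x = rv N y \<longleftrightarrow> eventually (\<lambda>i. rv M (e x i) = rv M (e y i)) U"
proof -
  have "rv N x = rv N y \<longleftrightarrow> x = y \<or> vlt N (x \<ominus>\<^bsub>N\<^esub> y) y"
    using assms by (simp add: NV.rv_eq_iff rveq_def NV.l_one del: N_simps(2,3))
  also have "\<dots> \<longleftrightarrow> eventually (\<lambda>i. e x i = e y i) U \<or> eventually (\<lambda>i. vlt M (e (x \<ominus>\<^bsub>N\<^esub> y) i) (e y i)) U"
    using assms NC_eq_iff N_vlt N_diff by simp
  also have "eventually (\<lambda>i. vlt M (e (x \<ominus>\<^bsub>N\<^esub> y) i) (e y i)) U \<longleftrightarrow> eventually (\<lambda>i. vlt M (e x i \<ominus> e y i) (e y i)) U"
    using N_diff(2)[OF assms] by (intro eventually_subst; eventually_elim) auto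
  also have "eventually (\<lambda>i. e x i = e y i) U \<or> eventually (\<lambda>i. vlt M (e x i \<ominus> e y i) (e y i)) U \<longleftrightarrow>
      eventually (\<lambda>i. rv M (e x i) = rv M (e y i)) U"
    by (simp add: eventually_disj[symmetric] rv_eq_iff rveq_def)
  finally show ?thesis .
qed

lemma N_eval:
  assumes "xs \<in> tuples n NC"
  shows "wf_trm L n t \<Longrightarrow> eval N xs t \<in> NC \<and> eventually (\<lambda>i. e (eval N xs t) i = eval M (map (\<lambda>x. e x i) xs) t) U"
proof (induction t)
  case (Var j)
  then show ?case using assms by (auto simp: tuples_def)
next
  case (TAdd s t)
  then have s: "eventually (\<lambda>i. e (eval N xs s) i = eval M (map (\<lambda>x. e x i) xs) s) U"
    and t: "eventually (\<lambda>i. e (eval N xs t) i = eval M (map (\<lambda>x. e x i) xs) t) U" by simp_all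
  show ?case unfolding eval.simps N_simps
    using N_add(2)[of "eval N xs s" "eval N xs t"] s t by (intro conjI; simp; eventually_elim) simp
next
  case (TMult s t)
  then have s: "eventually (\<lambda>i. e (eval N xs s) i = eval M (map (\<lambda>x. e x i) xs) s) U"
    and t: "eventually (\<lambda>i. e (eval N xs t) i = eval M (map (\<lambda>x. e x i) xs) t) U" by simp_all
  show ?case unfolding eval.simps N_simps
    using N_mult(2)[of "eval N xs s" "eval N xs t"] s t by (intro conjI; simp; eventually_elim) simp
next
  case (TMinus t)
  then have t: "eval N xs t \<in> NC" "eventually (\<lambda>i. e (eval N xs t) i = eval M (map (\<lambda>x. e x i) xs) t) U"
    by simp_all
  show ?case unfolding eval.simps N_uminus[OF t(1)]
    using N_minus(2)[of "eval N xs t"] t(2) by (intro conjI; simp; eventually_elim) simp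
next
  case (Fn f ts)
  let ?ys = "map (eval N xs) ts"
  let ?t = "Fn f (map Var [0..<length ts])"
  have IH: "eval N xs t \<in> NC" "eventually (\<lambda>i. e (eval N xs t) i = eval M (map (\<lambda>x. e x i) xs) t) U" if "t \<in> set ts" for t
    using Fn that by (auto simp: list_all_iff)
  have wf: "wf_trm L (length ?ys) ?t" using Fn.prems by (simp add: list_all_iff)
  have m: "map (eval M ys) (map Var [0..<length ts]) = ys" if "length ys = length ts" for ys
    using that by (auto intro!: nth_equalityI)
  have "eval M (map (\<lambda>x. e x i) ?ys) ?t = ifun M f (map (\<lambda>x. e x i) ?ys)" for i
    using m[of "map (\<lambda>x. e x i) ?ys"] by simp
  then have *: "repr (\<lambda>i. ifun M f (map (\<lambda>x. e x i) ?ys)) \<in> NC"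
    "eventually (\<lambda>i. e (repr (\<lambda>i. ifun M f (map (\<lambda>x. e x i) ?ys))) i = ifun M f (map (\<lambda>x. e x i) ?ys)) U"
    using repr_trm[OF wf] by simp_all
  have "eventually (\<lambda>i. \<forall>t\<in>set ts. e (eval N xs t) i = eval M (map (\<lambda>x. e x i) xs) t) U"
    using IH(2) by (intro eventually_ball_finite) auto
  then have "eventually (\<lambda>i. map (\<lambda>x. e x i) ?ys = map (eval M (map (\<lambda>x. e x i) xs)) ts) U"
    by eventually_elim auto
  with *(2) have "eventually (\<lambda>i. e (repr (\<lambda>i. ifun M f (map (\<lambda>x. e x i) ?ys))) i = eval M (map (\<lambda>x. e x i) xs) (Fn f ts)) U"
    by eventually_elim (simp only: eval.simps)
  then show ?case using *(1) by simp
qed (use N_zero N_one in auto)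

lemma RV_N: "RV N = rv N ` NC"
  using NV.RV_eq by simp

lemma RV_N_tuples: "\<alpha> \<in> tuples q (RV N) \<longleftrightarrow> (\<exists>us\<in>tuples q NC. \<alpha> = map (rv N) us)"
proof -
  have "\<alpha> \<in> lists (rv N ` NC) \<longleftrightarrow> (\<exists>us\<in>lists NC. \<alpha> = map (rv N) us)"
    unfolding lists_image by blast
  then show ?thesis by (auto simp: tuples_def RV_N lists_eq_set)
qed

lemma N_vf_structure: "vf_structure L N"
  unfolding vf_structure_def
proof (intro conjI ballI)
  show "valued_field N" by (rule N_valued_field)
  fix f xs assume f: "f \<in> fsyms L" "xs \<in> tuples (farity L f) (carrier N)"
  let ?t = "Fn f (map Var [0..<length xs])"
  have wf: "wf_trm L (length xs) ?t" using f by (simp add: list_all_iff tuples_length)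
  have "map (eval M ys) (map Var [0..<length xs]) = ys" if "length ys = length xs" for ys
    using that by (auto intro!: nth_equalityI)
  then have "eval M (map (\<lambda>x. e x i) xs) ?t = ifun M f (map (\<lambda>x. e x i) xs)" for i by simp
  then show "ifun N f xs \<in> carrier N" using repr_trm(1)[OF wf] by simp
next
  fix R assume "R \<in> rsyms L"
  show "case rarity L R of (m, n) \<Rightarrow> irel N R \<subseteq> tuples m (carrier N) \<times> tuples n (RV N)"
    unfolding irel_N using RV_N_tuples by (auto split: prod.splits)
qed

text \<open>RV arguments are given through named field representatives \<open>us\<close>, so both
  quantifier steps reduce to finding a named field element, as supplied by \<open>skolem\<close> and
  \<open>skolem_RV\<close>.\<close>

theorem los:
  "wf_form L n m \<phi> \<Longrightarrow> xs \<in> tuples n NC \<Longrightarrow> us \<in> tuples m NC \<Longrightarrow>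
   sat N xs (map (rv N) us) \<phi> \<longleftrightarrow>
   eventually (\<lambda>i. sat M (map (\<lambda>x. e x i) xs) (map (\<lambda>u. rv M (e u i)) us) \<phi>) U"
proof (induction \<phi> arbitrary: n m xs us)
  case (FEq s t)
  have s: "eval N xs s \<in> NC" "eventually (\<lambda>i. e (eval N xs s) i = eval M (map (\<lambda>x. e x i) xs) s) U"
    and t: "eval N xs t \<in> NC" "eventually (\<lambda>i. e (eval N xs t) i = eval M (map (\<lambda>x. e x i) xs) t) U"
    using N_eval FEq by auto
  have "eval N xs s = eval N xs t \<longleftrightarrow> eventually (\<lambda>i. e (eval N xs s) i = e (eval N xs t) i) U"
    using NC_eq_iff s t by simp
  also have "\<dots> \<longleftrightarrow> eventually (\<lambda>i. eval M (map (\<lambda>x. e x i) xs) s = eval M (map (\<lambda>x. e x i) xs) t) U"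
    using s(2) t(2) by (intro eventually_subst; eventually_elim) auto
  finally show ?case by simp
next
  case (FVal t)
  have t: "eval N xs t \<in> NC" "eventually (\<lambda>i. e (eval N xs t) i = eval M (map (\<lambda>x. e x i) xs) t) U"
    using N_eval FVal by auto
  have "eventually (\<lambda>i. e (eval N xs t) i \<in> vring M) U \<longleftrightarrow> eventually (\<lambda>i. eval M (map (\<lambda>x. e x i) xs) t \<in> vring M) U"
    using t(2) by (intro eventually_subst; eventually_elim) auto
  then show ?case using t by simp
next
  case (FRVEq s t)
  have *: "\<exists>y\<in>NC. rveval N xs (map (rv N) us) u = rv N y \<and>
      eventually (\<lambda>i. rveval M (map (\<lambda>x. e x i) xs) (map (\<lambda>u. rv M (e u i)) us) u = rv M (e y i)) U"
    if "wf_rvtrm L n m u" for u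
  proof (cases u)
    case (RVVar j)
    then show ?thesis using that FRVEq.prems(3) by (intro bexI[of _ "us ! j"]) (auto simp: tuples_def)
  next
    case (Rv t)
    then have *: "eval N xs t \<in> NC" "eventually (\<lambda>i. e (eval N xs t) i = eval M (map (\<lambda>x. e x i) xs) t) U"
      using N_eval[OF FRVEq.prems(2)] that by auto
    have "eventually (\<lambda>i. rv M (eval M (map (\<lambda>x. e x i) xs) t) = rv M (e (eval N xs t) i)) U"
      using *(2) by eventually_elim simp
    then show ?thesis using * Rv by (intro bexI[of _ "eval N xs t"]) auto
  qed
  obtain y z where y: "y \<in> NC" "rveval N xs (map (rv N) us) s = rv N y"
      "eventually (\<lambda>i. rveval M (map (\<lambda>x. e x i) xs) (map (\<lambda>u. rv M (e u i)) us) s = rv M (e y i)) U"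
    and z: "z \<in> NC" "rveval N xs (map (rv N) us) t = rv N z"
      "eventually (\<lambda>i. rveval M (map (\<lambda>x. e x i) xs) (map (\<lambda>u. rv M (e u i)) us) t = rv M (e z i)) U"
    using *[of s] *[of t] FRVEq.prems by auto
  have "rv N y = rv N z \<longleftrightarrow> eventually (\<lambda>i. rv M (e y i) = rv M (e z i)) U" using N_rv y z by simp
  also have "\<dots> \<longleftrightarrow> eventually (\<lambda>i. rveval M (map (\<lambda>x. e x i) xs) (map (\<lambda>u. rv M (e u i)) us) s =
      rveval M (map (\<lambda>x. e x i) xs) (map (\<lambda>u. rv M (e u i)) us) t) U"
    using y(3) z(3) by (intro eventually_subst; eventually_elim) simp
  finally show ?case using y z by simp
next
  case (FRel R ts vs)
  let ?ru = "\<lambda>u. case u of RVVar j \<Rightarrow> us ! j | Rv t \<Rightarrow> eval N xs t"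
  have wf: "wf_trm L n t" if "t \<in> set ts" for t using FRel.prems that by (auto simp: list_all_iff)
  have wfr: "wf_rvtrm L n m u" if "u \<in> set vs" for u using FRel.prems that by (auto simp: list_all_iff)
  have ar: "rarity L R = (length ts, length vs)" using FRel.prems by simp
  have T: "eval N xs t \<in> NC" "eventually (\<lambda>i. e (eval N xs t) i = eval M (map (\<lambda>x. e x i) xs) t) U" if "t \<in> set ts" for t
    using N_eval[OF FRel.prems(2) wf[OF that]] by auto
  have V: "?ru u \<in> NC \<and> rveval N xs (map (rv N) us) u = rv N (?ru u) \<and>
      eventually (\<lambda>i. rveval M (map (\<lambda>x. e x i) xs) (map (\<lambda>u. rv M (e u i)) us) u = rv M (e (?ru u) i)) U"
    if "u \<in> set vs" for u
  proof (cases u)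
    case (RVVar j)
    then show ?thesis using wfr[OF that] FRel.prems(3) by (auto simp: tuples_def)
  next
    case (Rv t)
    then have *: "eval N xs t \<in> NC" "eventually (\<lambda>i. e (eval N xs t) i = eval M (map (\<lambda>x. e x i) xs) t) U"
      using N_eval[OF FRel.prems(2)] wfr[OF that] by auto
    have "eventually (\<lambda>i. rv M (eval M (map (\<lambda>x. e x i) xs) t) = rv M (e (eval N xs t) i)) U"
      using *(2) by eventually_elim simp
    then show ?thesis using * Rv by auto
  qed
  have "eventually (\<lambda>i. \<forall>t\<in>set ts. e (eval N xs t) i = eval M (map (\<lambda>x. e x i) xs) t) U"
    using T by (intro eventually_ball_finite) auto
  moreover have "eventually (\<lambda>i. \<forall>u\<in>set vs. rveval M (map (\<lambda>x. e x i) xs) (map (\<lambda>u. rv M (e u i)) us) u = rv M (e (?ru u) i)) U"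
    using V by (intro eventually_ball_finite) auto
  ultimately have ev: "eventually (\<lambda>i. map (\<lambda>x. e x i) (map (eval N xs) ts) = map (eval M (map (\<lambda>x. e x i) xs)) ts \<and>
      map (\<lambda>u. rv M (e u i)) (map ?ru vs) = map (rveval M (map (\<lambda>x. e x i) xs) (map (\<lambda>u. rv M (e u i)) us)) vs) U"
    by eventually_elim auto
  \<comment> \<open>Two tuples of representatives with equal leading terms in \<open>N\<close> have
    equal leading terms in \<open>M\<close> almost everywhere, since a finite intersection of large
    sets is large. Hence the representatives do not matter.\<close>
  have in_iff: "(xs', map (rv N) us') \<in> irel N R \<longleftrightarrow>
      eventually (\<lambda>i. (map (\<lambda>x. e x i) xs', map (\<lambda>u. rv M (e u i)) us') \<in> irel M R) U"
    if c: "xs' \<in> tuples (length ts) NC" "us' \<in> tuples (length vs) NC" for xs' us'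
  proof
    assume "(xs', map (rv N) us') \<in> irel N R"
    then obtain us'' where u: "us'' \<in> tuples (length vs) NC" "map (rv N) us' = map (rv N) us''"
      "eventually (\<lambda>i. (map (\<lambda>x. e x i) xs', map (\<lambda>u. rv M (e u i)) us'') \<in> irel M R) U"
      unfolding irel_N ar by auto
    have l: "length us' = length vs" "length us'' = length vs" using c u tuples_length by auto
    have "eventually (\<lambda>i. rv M (e (us' ! j) i) = rv M (e (us'' ! j) i)) U" if "j < length vs" for j
    proof -
      have "rv N (us' ! j) = rv N (us'' ! j)" using u(2) l that by (metis nth_map)
      then show ?thesis using N_rv[OF tuples_nth[OF c(2) that] tuples_nth[OF u(1) that]] by simp
    qed
    then have "eventually (\<lambda>i. \<forall>j\<in>{..<length vs}. rv M (e (us' ! j) i) = rv M (e (us'' ! j) i)) U"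
      by (intro eventually_ball_finite) auto
    then have "eventually (\<lambda>i. map (\<lambda>u. rv M (e u i)) us' = map (\<lambda>u. rv M (e u i)) us'') U"
      by eventually_elim (auto simp: l list_eq_iff_nth_eq)
    with u(3) show "eventually (\<lambda>i. (map (\<lambda>x. e x i) xs', map (\<lambda>u. rv M (e u i)) us') \<in> irel M R) U"
      by eventually_elim simp
  next
    assume "eventually (\<lambda>i. (map (\<lambda>x. e x i) xs', map (\<lambda>u. rv M (e u i)) us') \<in> irel M R) U"
    then show "(xs', map (rv N) us') \<in> irel N R" unfolding irel_N ar using c by auto
  qed
  have vs: "map (rveval N xs (map (rv N) us)) vs = map (rv N) (map ?ru vs)" using V by auto
  have "sat N xs (map (rv N) us) (FRel R ts vs) \<longleftrightarrow>
      eventually (\<lambda>i. (map (\<lambda>x. e x i) (map (eval N xs) ts), map (\<lambda>u. rv M (e u i)) (map ?ru vs)) \<in> irel M R) U"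
    unfolding sat.simps vs by (rule in_iff) (use T V in \<open>auto simp: tuples_def\<close>)
  also have "\<dots> \<longleftrightarrow> eventually (\<lambda>i. sat M (map (\<lambda>x. e x i) xs) (map (\<lambda>u. rv M (e u i)) us) (FRel R ts vs)) U"
    by (rule eventually_subst, rule eventually_mono[OF ev]) (simp only: sat.simps)
  finally show ?case .
next
  case (FNot \<phi>)
  then show ?case using FNot.IH[OF _ FNot.prems(2,3)] by (simp add: ultra_not)
next
  case (FAnd \<phi> \<psi>)
  then show ?case using FAnd.IH(1)[OF _ FAnd.prems(2,3)] FAnd.IH(2)[OF _ FAnd.prems(2,3)]
    by (simp add: eventually_conj_iff)
next
  case (FEx \<phi>)
  have IH: "sat N (x # xs) (map (rv N) us) \<phi> \<longleftrightarrow>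
     eventually (\<lambda>i. sat M (e x i # map (\<lambda>x. e x i) xs) (map (\<lambda>u. rv M (e u i)) us) \<phi>) U" if "x \<in> NC" for x
    using FEx.IH[of "Suc n" m "x # xs" us] FEx.prems that by simp
  show ?case
  proof
    assume "sat N xs (map (rv N) us) (FEx \<phi>)"
    then obtain x where x: "x \<in> NC" "sat N (x # xs) (map (rv N) us) \<phi>" by auto
    then have "eventually (\<lambda>i. sat M (e x i # map (\<lambda>x. e x i) xs) (map (\<lambda>u. rv M (e u i)) us) \<phi>) U"
      using IH by simp
    then show "eventually (\<lambda>i. sat M (map (\<lambda>x. e x i) xs) (map (\<lambda>u. rv M (e u i)) us) (FEx \<phi>)) U"
      by eventually_elim auto
  next
    assume a: "eventually (\<lambda>i. sat M (map (\<lambda>x. e x i) xs) (map (\<lambda>u. rv M (e u i)) us) (FEx \<phi>)) U"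
    obtain t where t: "t \<in> NC" "eventually (\<lambda>i. (\<exists>x\<in>carrier M. sat M (x # map (\<lambda>s. e s i) xs) (map (\<lambda>s. rv M (e s i)) us) \<phi>) \<longrightarrow>
      sat M (e t i # map (\<lambda>s. e s i) xs) (map (\<lambda>s. rv M (e s i)) us) \<phi>) U" using skolem_can by blast
    have "eventually (\<lambda>i. sat M (e t i # map (\<lambda>s. e s i) xs) (map (\<lambda>s. rv M (e s i)) us) \<phi>) U"
      using a t(2) by eventually_elim simp
    then show "sat N xs (map (rv N) us) (FEx \<phi>)" using IH t(1) by auto
  qed
next
  case (FExRV \<phi>)
  have IH: "sat N xs (rv N x # map (rv N) us) \<phi> \<longleftrightarrow>
     eventually (\<lambda>i. sat M (map (\<lambda>x. e x i) xs) (rv M (e x i) # map (\<lambda>u. rv M (e u i)) us) \<phi>) U" if "x \<in> NC" for x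
    using FExRV.IH[of n "Suc m" xs "x # us"] FExRV.prems that by simp
  show ?case
  proof
    assume "sat N xs (map (rv N) us) (FExRV \<phi>)"
    then obtain x where x: "x \<in> NC" "sat N xs (rv N x # map (rv N) us) \<phi>" by (auto simp: RV_N)
    then have "eventually (\<lambda>i. sat M (map (\<lambda>x. e x i) xs) (rv M (e x i) # map (\<lambda>u. rv M (e u i)) us) \<phi>) U"
      using IH by simp
    then show "eventually (\<lambda>i. sat M (map (\<lambda>x. e x i) xs) (map (\<lambda>u. rv M (e u i)) us) (FExRV \<phi>)) U"
      by eventually_elim auto
  next
    assume a: "eventually (\<lambda>i. sat M (map (\<lambda>x. e x i) xs) (map (\<lambda>u. rv M (e u i)) us) (FExRV \<phi>)) U"
    obtain t where t: "t \<in> NC" "eventually (\<lambda>i. (\<exists>x\<in>carrier M. sat M (map (\<lambda>s. e s i) xs) (rv M x # map (\<lambda>s. rv M (e s i)) us) \<phi>) \<longrightarrow>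
      sat M (map (\<lambda>s. e s i) xs) (rv M (e t i) # map (\<lambda>s. rv M (e s i)) us) \<phi>) U" using skolem_RV_can by blast
    have "eventually (\<lambda>i. sat M (map (\<lambda>s. e s i) xs) (rv M (e t i) # map (\<lambda>s. rv M (e s i)) us) \<phi>) U"
      using a t(2) by eventually_elim (auto simp: RV_eq)
    then show "sat N xs (map (rv N) us) (FExRV \<phi>)" using IH t(1) by (auto simp: RV_N)
  qed
qed

end

text \<open>The index set consists of the finite parts of \<open>\<Sigma>\<close>, each with a
  solution in \<open>M\<close>. Because only the values of Skolem terms are taken, the new structure
  lives on \<open>'f + 'r + nat\<close> whatever the type of \<open>M\<close>.\<close>

theorem compactness:
  fixes M :: "('f, 'r, 'u) vstruct"
  assumes "vf_structure L M" and wf: "\<And>\<sigma>. \<sigma> \<in> \<Sigma> \<Longrightarrow> wf_form L p q \<sigma>"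
    and fs: "\<And>S. finite S \<Longrightarrow> S \<subseteq> \<Sigma> \<Longrightarrow>
      \<exists>a\<in>tuples p (carrier M). \<exists>\<alpha>\<in>tuples q (RV M). \<forall>\<sigma>\<in>S. sat M a \<alpha> \<sigma>"
  shows "\<exists>N :: ('f, 'r, 'f + 'r + nat) vstruct. vf_structure L N \<and>
    (\<forall>\<phi>. wf_form L 0 0 \<phi> \<longrightarrow> sat N [] [] \<phi> = sat M [] [] \<phi>) \<and>
    (\<exists>a\<in>tuples p (carrier N). \<exists>\<alpha>\<in>tuples q (RV N). \<forall>\<sigma>\<in>\<Sigma>. sat N a \<alpha> \<sigma>)"
proof -
  interpret vstr L M using assms(1) by (rule vstrI)
  have "\<exists>a\<in>tuples (p + q) (carrier M). \<forall>\<sigma>\<in>S. sat M (take p a) (map (rv M) (drop p a)) \<sigma>"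
    if "finite S" "S \<subseteq> \<Sigma>" for S
  proof -
    obtain a \<alpha> where a: "a \<in> tuples p (carrier M)" "\<alpha> \<in> tuples q (RV M)" "\<forall>\<sigma>\<in>S. sat M a \<alpha> \<sigma>"
      using fs \<open>finite S\<close> \<open>S \<subseteq> \<Sigma>\<close> by blast
    have "\<alpha> \<in> lists (rv M ` carrier M)" using a(2) by (auto simp: tuples_def RV_eq)
    then obtain us where us: "us \<in> lists (carrier M)" "\<alpha> = map (rv M) us" unfolding lists_image by blast
    then have "us \<in> tuples q (carrier M)" using a(2) by (auto simp: tuples_def)
    then show ?thesis using a us by (intro bexI[of _ "a @ us"]) (auto simp: tuples_append tuples_length)
  qed
  then obtain w where w: "\<And>S. finite S \<Longrightarrow> S \<subseteq> \<Sigma> \<Longrightarrow> w S \<in> tuples (p + q) (carrier M) \<and>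
      (\<forall>\<sigma>\<in>S. sat M (take p (w S)) (map (rv M) (drop p (w S))) \<sigma>)" by metis
  \<comment> \<open>The first \<open>p\<close> functions give the field parameters, the other
    \<open>q\<close> give representatives of the RV parameters. The value zero at irrelevant indices
    keeps everything inside the carrier.\<close>
  define v where "v j S = (if finite S \<and> S \<subseteq> \<Sigma> \<and> j < p + q then w S ! j else \<zero>\<^bsub>M\<^esub>)" for j S
  have v: "v j S \<in> carrier M" for j S unfolding v_def using w[of S] tuples_nth[of "w S" "p + q" "carrier M" j] by auto
  \<comment> \<open>The second factor confines the indices to finite parts of
    \<open>\<Sigma>\<close> also when \<open>\<Sigma>\<close> is empty.\<close>
  define F where "F = inf (INF \<sigma>\<in>\<Sigma>. principal {S. finite S \<and> S \<subseteq> \<Sigma> \<and> \<sigma> \<in> S}) (principal {S. finite S \<and> S \<subseteq> \<Sigma>})"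
  have Fi: "eventually (\<lambda>S. finite S \<and> S \<subseteq> \<Sigma> \<and> \<sigma> \<in> S) F" if "\<sigma> \<in> \<Sigma>" for \<sigma>
  proof -
    have "F \<le> principal {S. finite S \<and> S \<subseteq> \<Sigma> \<and> \<sigma> \<in> S}"
      unfolding F_def using that by (meson INF_lower inf.coboundedI1)
    then show ?thesis by (simp add: le_principal)
  qed
  have F0: "eventually (\<lambda>S. finite S \<and> S \<subseteq> \<Sigma>) F"
    using inf_le2[of "(INF \<sigma>\<in>\<Sigma>. principal {S. finite S \<and> S \<subseteq> \<Sigma> \<and> \<sigma> \<in> S})" "principal {S. finite S \<and> S \<subseteq> \<Sigma>}"]
    unfolding F_def le_principal by simp
  have "F \<noteq> bot"
  proof
    assume "F = bot"
    then have "eventually (\<lambda>S. False) F" by simp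
    then have "eventually (\<lambda>S. S \<notin> {S. finite S \<and> S \<subseteq> \<Sigma>}) (INF \<sigma>\<in>\<Sigma>. principal {S. finite S \<and> S \<subseteq> \<Sigma> \<and> \<sigma> \<in> S})"
      unfolding F_def eventually_inf_principal by simp
    then obtain X where X: "X \<subseteq> \<Sigma>" "finite X"
      "eventually (\<lambda>S. S \<notin> {S. finite S \<and> S \<subseteq> \<Sigma>}) (INF \<sigma>\<in>X. principal {S. finite S \<and> S \<subseteq> \<Sigma> \<and> \<sigma> \<in> S})"
      unfolding eventually_INF[of _ _ \<Sigma>] by blast
    \<comment> \<open>Properness: the intersection belonging to a finite \<open>X\<close> contains
      the index \<open>X\<close> itself.\<close>
    have "(INF \<sigma>\<in>X. principal {S. finite S \<and> S \<subseteq> \<Sigma> \<and> \<sigma> \<in> S}) = principal (\<Inter>\<sigma>\<in>X. {S. finite S \<and> S \<subseteq> \<Sigma> \<and> \<sigma> \<in> S})"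
      by (rule INF_principal_finite) (rule X(2))
    then have "\<forall>S\<in>(\<Inter>\<sigma>\<in>X. {S. finite S \<and> S \<subseteq> \<Sigma> \<and> \<sigma> \<in> S}). S \<notin> {S. finite S \<and> S \<subseteq> \<Sigma>}"
      using X(3) by (simp only: eventually_principal)
    moreover have "X \<in> (\<Inter>\<sigma>\<in>X. {S. finite S \<and> S \<subseteq> \<Sigma> \<and> \<sigma> \<in> S})" using X(1,2) by blast
    ultimately show False using X(1,2) by blast
  qed
  then obtain U where U: "U \<le> F" "U \<noteq> bot" "\<And>P. eventually P U \<or> eventually (\<lambda>x. \<not> P x) U"
    using ex_ultrafilter by blast
  obtain g :: "'f + 'r + nat \<Rightarrow> ('f, 'r) sk" where g: "surj g" using ex_surj_sk by blast
  define e where "e t = skev M v (g t)" for t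
  \<comment> \<open>If \<open>P\<close> has no witness, the implication is vacuous and zero
    satisfies the condition; so the choice made in \<open>skev\<close> always lies in the
    carrier.\<close>
  have some: "\<exists>x. x \<in> carrier M \<and> ((\<exists>y\<in>carrier M. P y) \<longrightarrow> P x)" for P using zero_closed by blast
  have skev_closed: "skev M v s S \<in> carrier M" for s S
  proof (cases s)
    case (SK \<phi> ts us)
    then show ?thesis using someI_ex[OF some] by fastforce
  next
    case (SR \<phi> ts us)
    then show ?thesis using someI_ex[OF some] by fastforce
  qed (simp add: v)
  interpret ultra L M U e
  proof
    show "U \<noteq> bot" "\<And>P. eventually P U \<or> eventually (\<lambda>x. \<not> P x) U" by (fact U)+
    show "e t S \<in> carrier M" for t S by (simp add: e_def skev_closed)
    fix \<phi> :: "('f, 'r) form" and ts us :: "('f + 'r + nat) list"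
    obtain t where t: "g t = SK \<phi> (map g ts) (map g us)" using g by (metis surjD)
    show "\<exists>t. \<forall>i. (\<exists>x\<in>carrier M. sat M (x # map (\<lambda>s. e s i) ts) (map (\<lambda>s. rv M (e s i)) us) \<phi>) \<longrightarrow>
      sat M (e t i # map (\<lambda>s. e s i) ts) (map (\<lambda>s. rv M (e s i)) us) \<phi>"
    proof (intro exI[of _ t] allI)
      fix i
      let ?P = "\<lambda>x. sat M (x # map (\<lambda>s. e s i) ts) (map (\<lambda>s. rv M (e s i)) us) \<phi>"
      have "e t i = (SOME x. x \<in> carrier M \<and> ((\<exists>y\<in>carrier M. ?P y) \<longrightarrow> ?P x))"
        by (simp add: e_def t comp_def)
      then show "(\<exists>x\<in>carrier M. ?P x) \<longrightarrow> ?P (e t i)" using someI_ex[OF some[of ?P]] by simp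
    qed
    obtain t where t: "g t = SR \<phi> (map g ts) (map g us)" using g by (metis surjD)
    show "\<exists>t. \<forall>i. (\<exists>x\<in>carrier M. sat M (map (\<lambda>s. e s i) ts) (rv M x # map (\<lambda>s. rv M (e s i)) us) \<phi>) \<longrightarrow>
      sat M (map (\<lambda>s. e s i) ts) (rv M (e t i) # map (\<lambda>s. rv M (e s i)) us) \<phi>"
    proof (intro exI[of _ t] allI)
      fix i
      let ?P = "\<lambda>x. sat M (map (\<lambda>s. e s i) ts) (rv M x # map (\<lambda>s. rv M (e s i)) us) \<phi>"
      have "e t i = (SOME x. x \<in> carrier M \<and> ((\<exists>y\<in>carrier M. ?P y) \<longrightarrow> ?P x))"
        by (simp add: e_def t comp_def)
      then show "(\<exists>x\<in>carrier M. ?P x) \<longrightarrow> ?P (e t i)" using someI_ex[OF some[of ?P]] by simp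
    qed
  qed
  have "\<forall>j. \<exists>t\<in>NC. eventually (\<lambda>S. e t S = v j S) U"
  proof
    fix j
    obtain t where "g t = SV j" using g by (metis surjD)
    then have "eventually (\<lambda>S. e (can t) S = v j S) U" using e_can[of t] by (simp add: e_def)
    then show "\<exists>t\<in>NC. eventually (\<lambda>S. e t S = v j S) U" using can_NC by blast
  qed
  then obtain t where t: "\<And>j. t j \<in> NC" "\<And>j. eventually (\<lambda>S. e (t j) S = v j S) U" by metis
  have "eventually (\<lambda>S. \<forall>j\<in>{..<p + q}. e (t j) S = v j S) U"
    using t(2) by (intro eventually_ball_finite) auto
  moreover have "eventually (\<lambda>S. finite S \<and> S \<subseteq> \<Sigma>) U" using F0 U(1) by (simp add: le_filter_def)
  ultimately have ev: "eventually (\<lambda>S. finite S \<and> S \<subseteq> \<Sigma> \<and> map (\<lambda>x. e x S) (map t [0..<p]) = take p (w S) \<and>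
      map (\<lambda>x. rv M (e x S)) (map t [p..<p + q]) = map (rv M) (drop p (w S))) U"
  proof eventually_elim
    case (elim S)
    then have l: "length (w S) = p + q" using w tuples_length by blast
    show ?case using elim l by (auto intro!: nth_equalityI simp: v_def)
  qed
  have "sat N (map t [0..<p]) (map (rv N) (map t [p..<p + q])) \<sigma>" if "\<sigma> \<in> \<Sigma>" for \<sigma>
  proof (subst los[OF wf[OF that]])
    show "map t [0..<p] \<in> tuples p NC" "map t [p..<p + q] \<in> tuples q NC" using t by (auto simp: tuples_def)
    have "eventually (\<lambda>S. \<sigma> \<in> S) U"
      using Fi[OF that] U(1) by (auto simp: le_filter_def elim: eventually_mono)
    then show "eventually (\<lambda>S. sat M (map (\<lambda>x. e x S) (map t [0..<p])) (map (\<lambda>u. rv M (e u S)) (map t [p..<p + q])) \<sigma>) U"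
      using ev
    proof eventually_elim
      case (elim S)
      then have "sat M (take p (w S)) (map (rv M) (drop p (w S))) \<sigma>" using w by blast
      then show ?case using elim by (simp only:)
    qed
  qed
  moreover have "map t [0..<p] \<in> tuples p (carrier N)" using t by (auto simp: tuples_def)
  moreover have "map (rv N) (map t [p..<p + q]) \<in> tuples q (RV N)"
    using t by (auto simp: tuples_def RV_N)
  moreover have "sat N [] [] \<phi> = sat M [] [] \<phi>" if "wf_form L 0 0 \<phi>" for \<phi>
    using los[of 0 0 \<phi> "[]" "[]"] that nonbot by auto
  ultimately show ?thesis using N_vf_structure by blast
qed

section \<open>First-order form of (T), with graphs for maps and field elements for radii\<close>

section \<open>The property (T) in terms of field elements\<close>

text \<open>For \<open>d\<close> non-zero in the valuation ring: \<open>x\<close> and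
  \<open>y\<close> lie in a common twisted box of level |d| with center tuple
  \<open>C\<close>.\<close>

definition same :: "('f, 'r, 'u) vstruct \<Rightarrow> nat \<Rightarrow> (nat \<Rightarrow> 'u list \<Rightarrow> 'u) \<Rightarrow> 'u \<Rightarrow> 'u list \<Rightarrow> 'u list \<Rightarrow> bool" where
  "same M l C d x y \<longleftrightarrow>
     (\<forall>i<l. rveq M d (x ! i \<ominus>\<^bsub>M\<^esub> C i (take i x)) (y ! i \<ominus>\<^bsub>M\<^esub> C i (take i y)))"

text \<open>\<open>okb M l F C f \<psi> x0\<close>: \<open>F\<close> is the twisted box with center tuple \<open>C\<close> around \<open>x0\<close>, and it satisfies
  the conditions of (T\<open>\<ell>\<close>) on \<open>F\<close> and its sub-boxes around \<open>x0\<close>, in terms of elements of the field only.\<close>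

definition okb :: "('f, 'r, 'u) vstruct \<Rightarrow> nat \<Rightarrow> 'u list set \<Rightarrow> (nat \<Rightarrow> 'u list \<Rightarrow> 'u) \<Rightarrow>
    ('u list \<Rightarrow> 'u) \<Rightarrow> ('u list \<Rightarrow> 'u set list) \<Rightarrow> 'u list \<Rightarrow> bool" where
  "okb M l F C f \<psi> x0 \<longleftrightarrow>
     F = {x \<in> tuples l (carrier M). same M l C \<one>\<^bsub>M\<^esub> x x0} \<and>
     (\<forall>x\<in>F. \<psi> x = \<psi> x0) \<and>
     ((\<forall>x\<in>F. f x = f x0) \<or> (\<exists>m\<in>carrier M. m \<noteq> \<zero>\<^bsub>M\<^esub> \<and> (\<exists>a\<in>carrier M. f ` F = ball M a m))) \<and>
     (\<forall>m\<in>carrier M. \<forall>a\<in>carrier M. m \<noteq> \<zero>\<^bsub>M\<^esub> \<and> f ` F = ball M a m \<longrightarrow>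
       (\<forall>d\<in>carrier M. d \<in> vring M \<and> d \<noteq> \<zero>\<^bsub>M\<^esub> \<longrightarrow>
         (\<exists>a'\<in>carrier M. f ` {x \<in> tuples l (carrier M). same M l C d x x0} = ball M a' (d \<otimes>\<^bsub>M\<^esub> m))))"

text \<open>Here and in \<open>okR\<close> the centers, \<open>f\<close> and \<open>\<psi>\<close>
  enter only through their graphs. Graphs can be given by formulas, so the condition becomes a
  definable property of the parameters of these formulas.\<close>

definition sameR :: "('f, 'r, 'u) vstruct \<Rightarrow> nat \<Rightarrow> (nat \<Rightarrow> 'u list \<Rightarrow> 'u \<Rightarrow> bool) \<Rightarrow> 'u \<Rightarrow> 'u list \<Rightarrow> 'u list \<Rightarrow> bool" where
  "sameR M l Ce d x y \<longleftrightarrow>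
     (\<forall>i<l. \<exists>u\<in>carrier M. \<exists>v\<in>carrier M. Ce i (take i x) u \<and> Ce i (take i y) v \<and>
       rveq M d (x ! i \<ominus>\<^bsub>M\<^esub> u) (y ! i \<ominus>\<^bsub>M\<^esub> v))"

definition okR :: "('f, 'r, 'u) vstruct \<Rightarrow> nat \<Rightarrow> nat \<Rightarrow> ('u list \<Rightarrow> bool) \<Rightarrow> (nat \<Rightarrow> 'u list \<Rightarrow> 'u \<Rightarrow> bool) \<Rightarrow>
    ('u list \<Rightarrow> 'u \<Rightarrow> bool) \<Rightarrow> ('u list \<Rightarrow> 'u set list \<Rightarrow> bool) \<Rightarrow> 'u list \<Rightarrow> bool" where
  "okR M l k' F Ce Fr Ps x0 \<longleftrightarrow>
     (\<forall>x\<in>tuples l (carrier M). F x \<longleftrightarrow> sameR M l Ce \<one>\<^bsub>M\<^esub> x x0) \<and>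
     (\<forall>x\<in>tuples l (carrier M). F x \<longrightarrow> (\<forall>\<zeta>\<in>tuples k' (RV M). Ps x \<zeta> \<longleftrightarrow> Ps x0 \<zeta>)) \<and>
     ((\<forall>x\<in>tuples l (carrier M). F x \<longrightarrow> (\<forall>y\<in>carrier M. Fr x y \<longleftrightarrow> Fr x0 y)) \<or>
       (\<exists>m\<in>carrier M. m \<noteq> \<zero>\<^bsub>M\<^esub> \<and> (\<exists>a\<in>carrier M. \<forall>y\<in>carrier M.
          (\<exists>x\<in>tuples l (carrier M). F x \<and> Fr x y) \<longleftrightarrow> vlt M (y \<ominus>\<^bsub>M\<^esub> a) m))) \<and>
     (\<forall>m\<in>carrier M. \<forall>a\<in>carrier M. m \<noteq> \<zero>\<^bsub>M\<^esub> \<and>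
        (\<forall>y\<in>carrier M. (\<exists>x\<in>tuples l (carrier M). F x \<and> Fr x y) \<longleftrightarrow> vlt M (y \<ominus>\<^bsub>M\<^esub> a) m) \<longrightarrow>
       (\<forall>d\<in>carrier M. d \<in> vring M \<and> d \<noteq> \<zero>\<^bsub>M\<^esub> \<longrightarrow>
         (\<exists>a'\<in>carrier M. \<forall>y\<in>carrier M.
            (\<exists>x\<in>tuples l (carrier M). sameR M l Ce d x x0 \<and> Fr x y) \<longleftrightarrow> vlt M (y \<ominus>\<^bsub>M\<^esub> a') (d \<otimes>\<^bsub>M\<^esub> m))))"

text \<open>The centers have graphs that are total on all tuples, whereas
  \<open>decomposition\<close> asks for definability only on projections of fibres;
  \<open>T_ok_exists\<close> bridges the difference by extending with zero.\<close>

definition T_ok :: "('f, 'r, 'u) vstruct \<Rightarrow> nat \<Rightarrow> nat \<Rightarrow> nat \<Rightarrow> ('u list \<Rightarrow> 'u \<Rightarrow> bool) \<Rightarrow>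
    ('u list \<Rightarrow> 'u set list \<Rightarrow> bool) \<Rightarrow> ('u list \<Rightarrow> 'u set list \<Rightarrow> bool) \<Rightarrow>
    (nat \<Rightarrow> 'u list \<Rightarrow> 'u \<Rightarrow> 'u set list \<Rightarrow> bool) \<Rightarrow> bool" where
  "T_ok M l k k' Fr Ps Xi Ce \<longleftrightarrow>
     (\<forall>x\<in>tuples l (carrier M). \<exists>\<xi>\<in>tuples k (RV M). \<forall>\<zeta>\<in>tuples k (RV M). Xi x \<zeta> \<longleftrightarrow> \<zeta> = \<xi>) \<and>
     (\<forall>i<l. \<forall>z\<in>tuples i (carrier M). \<forall>\<xi>\<in>tuples k (RV M).
        \<exists>y\<in>carrier M. \<forall>u\<in>carrier M. Ce i z u \<xi> \<longleftrightarrow> u = y) \<and>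
     (\<forall>x0\<in>tuples l (carrier M). \<forall>\<xi>\<in>tuples k (RV M). Xi x0 \<xi> \<longrightarrow>
        okR M l k' (\<lambda>x. Xi x \<xi>) (\<lambda>i z u. Ce i z u \<xi>) Fr Ps x0)"

definition fun_ok :: "('f, 'r, 'u) vstruct \<Rightarrow> nat \<Rightarrow> nat \<Rightarrow> ('u list \<Rightarrow> 'u \<Rightarrow> bool) \<Rightarrow>
    ('u list \<Rightarrow> 'u set list \<Rightarrow> bool) \<Rightarrow> bool" where
  "fun_ok M l k' Fr Ps \<longleftrightarrow>
     (\<forall>x\<in>tuples l (carrier M). \<exists>y\<in>carrier M. \<forall>u\<in>carrier M. Fr x u \<longleftrightarrow> u = y) \<and>
     (\<forall>x\<in>tuples l (carrier M). \<exists>\<xi>\<in>tuples k' (RV M). \<forall>\<zeta>\<in>tuples k' (RV M). Ps x \<zeta> \<longleftrightarrow> \<zeta> = \<xi>)"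

context vstr
begin

\<comment> \<open>The formula is left open and is assembled while the rules follow the structure of
  the unfolded predicate. Only its existence, and its independence of the structure, are used
  later.\<close>
schematic_goal T_ok_defs:
  assumes "wf_form L (l + Suc p) q \<theta>f" "wf_form L (l + p) (k' + q) \<theta>\<psi>" "wf_form L (l + p) (k + q) \<theta>\<chi>"
    and wfc: "\<And>i. i < l \<Longrightarrow> wf_form L (i + Suc p) (k + q) (\<theta>c i)"
  shows "defs L M ?W p q (\<lambda>a \<alpha>. T_ok M l k k' (\<lambda>x y. sat M (x @ y # a) \<alpha> \<theta>f)
    (\<lambda>x \<zeta>. sat M (x @ a) (\<zeta> @ \<alpha>) \<theta>\<psi>) (\<lambda>x \<xi>. sat M (x @ a) (\<xi> @ \<alpha>) \<theta>\<chi>)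
    (\<lambda>i z y \<xi>. sat M (z @ y # a) (\<xi> @ \<alpha>) (\<theta>c i)))"
  unfolding T_ok_def okR_def sameR_def rveq_def
  by (rule d_intros tm_intros d_sub[OF d_self[OF assms(1)]] d_sub[OF d_self[OF assms(2)]] d_sub[OF d_self[OF assms(3)]]
      d_sub[OF d_self[OF wfc]] | (simp; fail))+

schematic_goal fun_ok_defs:
  assumes "wf_form L (l + Suc p) q \<theta>f" "wf_form L (l + p) (k' + q) \<theta>\<psi>"
  shows "defs L M ?W p q (\<lambda>a \<alpha>. fun_ok M l k' (\<lambda>x y. sat M (x @ y # a) \<alpha> \<theta>f)
    (\<lambda>x \<zeta>. sat M (x @ a) (\<zeta> @ \<alpha>) \<theta>\<psi>))"
  unfolding fun_ok_def
  by (rule d_intros tm_intros d_sub[OF d_self[OF assms(1)]] d_sub[OF d_self[OF assms(2)]] | (simp; fail))+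

lemma okR_iff:
  assumes C: "\<And>i z u. i < l \<Longrightarrow> z \<in> tuples i (carrier M) \<Longrightarrow> u \<in> carrier M \<Longrightarrow> Ce i z u \<longleftrightarrow> u = C i z"
    and Cc: "\<And>i z. i < l \<Longrightarrow> z \<in> tuples i (carrier M) \<Longrightarrow> C i z \<in> carrier M"
    and f: "\<And>x u. x \<in> tuples l (carrier M) \<Longrightarrow> u \<in> carrier M \<Longrightarrow> Fr x u \<longleftrightarrow> u = f x"
    and fc: "\<And>x. x \<in> tuples l (carrier M) \<Longrightarrow> f x \<in> carrier M"
    and psi: "\<And>x \<zeta>. x \<in> tuples l (carrier M) \<Longrightarrow> \<zeta> \<in> tuples k' (RV M) \<Longrightarrow> Ps x \<zeta> \<longleftrightarrow> \<zeta> = \<psi> x"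
    and psic: "\<And>x. x \<in> tuples l (carrier M) \<Longrightarrow> \<psi> x \<in> tuples k' (RV M)"
    and x0: "x0 \<in> tuples l (carrier M)"
  shows "okR M l k' F Ce Fr Ps x0 \<longleftrightarrow> okb M l {x \<in> tuples l (carrier M). F x} C f \<psi> x0"
proof -
  have s: "sameR M l Ce d x y \<longleftrightarrow> same M l C d x y" if "x \<in> tuples l (carrier M)" "y \<in> tuples l (carrier M)" for d x y
  proof -
    have "(\<exists>u\<in>carrier M. \<exists>v\<in>carrier M. Ce i (take i x) u \<and> Ce i (take i y) v \<and> rveq M d (x ! i \<ominus> u) (y ! i \<ominus> v)) \<longleftrightarrow>
        rveq M d (x ! i \<ominus> C i (take i x)) (y ! i \<ominus> C i (take i y))" if "i < l" for i
    proof -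
      have t: "take i x \<in> tuples i (carrier M)" "take i y \<in> tuples i (carrier M)"
        using tuples_take[OF _ less_imp_le[OF that]] \<open>x \<in> tuples l _\<close> \<open>y \<in> tuples l _\<close> by blast+
      show ?thesis using C[OF that t(1)] C[OF that t(2)] Cc[OF that t(1)] Cc[OF that t(2)] by auto
    qed
    then show ?thesis unfolding sameR_def same_def by blast
  qed
  have img: "(\<forall>y\<in>carrier M. (\<exists>x\<in>tuples l (carrier M). P x \<and> Fr x y) \<longleftrightarrow> vlt M (y \<ominus> a) m) \<longleftrightarrow>
      f ` {x \<in> tuples l (carrier M). P x} = ball M a m" for P a m
  proof -
    have 1: "(\<exists>x\<in>tuples l (carrier M). P x \<and> Fr x y) \<longleftrightarrow> y \<in> f ` {x \<in> tuples l (carrier M). P x}"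
      if "y \<in> carrier M" for y using f that by auto
    have 2: "f ` {x \<in> tuples l (carrier M). P x} \<subseteq> carrier M" using fc by auto
    show ?thesis unfolding ball_def using 1 2 by (simp add: set_eq_iff subset_iff) blast
  qed
  have 1: "(\<forall>x\<in>tuples l (carrier M). F x \<longleftrightarrow> sameR M l Ce \<one> x x0) \<longleftrightarrow>
      {x \<in> tuples l (carrier M). F x} = {x \<in> tuples l (carrier M). same M l C \<one> x x0}"
    using s[OF _ x0] by auto
  have 2: "(\<forall>x\<in>tuples l (carrier M). F x \<longrightarrow> (\<forall>\<zeta>\<in>tuples k' (RV M). Ps x \<zeta> \<longleftrightarrow> Ps x0 \<zeta>)) \<longleftrightarrow>
      (\<forall>x\<in>{x \<in> tuples l (carrier M). F x}. \<psi> x = \<psi> x0)"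
    using psi psic x0 by (auto; metis)
  have 3: "(\<forall>x\<in>tuples l (carrier M). F x \<longrightarrow> (\<forall>y\<in>carrier M. Fr x y \<longleftrightarrow> Fr x0 y)) \<longleftrightarrow>
      (\<forall>x\<in>{x \<in> tuples l (carrier M). F x}. f x = f x0)"
    using f fc x0 by (auto; metis)
  have 4: "{x \<in> tuples l (carrier M). sameR M l Ce d x x0} = {x \<in> tuples l (carrier M). same M l C d x x0}" for d
    using s[OF _ x0] by auto
  show ?thesis unfolding okR_def okb_def img 1 2 3 4 by (rule refl)
qed

end

text \<open>One and the same formula serves two types of universes: (T) is known for structures on
  the type of the hypothesis, but is to be transferred to a structure on an arbitrary type.\<close>

lemma T_ok_formula:
  fixes L :: "('f, 'r) lang"
  assumes "wf_form L (l + Suc p) q \<theta>f" "wf_form L (l + p) (k' + q) \<theta>\<psi>" "wf_form L (l + p) (k + q) \<theta>\<chi>"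
    and "\<And>i. i < l \<Longrightarrow> wf_form L (i + Suc p) (k + q) (\<theta>c i)"
  shows "\<exists>\<phi>.
    (\<forall>M :: ('f, 'r, 'u) vstruct. vf_structure L M \<longrightarrow>
      defs L M \<phi> p q (\<lambda>a \<alpha>. T_ok M l k k' (\<lambda>x y. sat M (x @ y # a) \<alpha> \<theta>f)
        (\<lambda>x \<zeta>. sat M (x @ a) (\<zeta> @ \<alpha>) \<theta>\<psi>) (\<lambda>x \<xi>. sat M (x @ a) (\<xi> @ \<alpha>) \<theta>\<chi>)
        (\<lambda>i z y \<xi>. sat M (z @ y # a) (\<xi> @ \<alpha>) (\<theta>c i)))) \<and>
    (\<forall>M :: ('f, 'r, 'v) vstruct. vf_structure L M \<longrightarrow>
      defs L M \<phi> p q (\<lambda>a \<alpha>. T_ok M l k k' (\<lambda>x y. sat M (x @ y # a) \<alpha> \<theta>f)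
        (\<lambda>x \<zeta>. sat M (x @ a) (\<zeta> @ \<alpha>) \<theta>\<psi>) (\<lambda>x \<xi>. sat M (x @ a) (\<xi> @ \<alpha>) \<theta>\<chi>)
        (\<lambda>i z y \<xi>. sat M (z @ y # a) (\<xi> @ \<alpha>) (\<theta>c i))))"
  by (rule exI, intro conjI allI impI;
      rule vstr.T_ok_defs[OF vstrI, where l = l and k = k and k' = k' and p = p and q = q
        and \<theta>f = \<theta>f and \<theta>\<psi> = \<theta>\<psi> and \<theta>\<chi> = \<theta>\<chi> and \<theta>c = \<theta>c]; (assumption | fact assms | rule assms))

lemma fun_ok_formula:
  fixes L :: "('f, 'r) lang"
  assumes "wf_form L (l + Suc p) q \<theta>f" "wf_form L (l + p) (k' + q) \<theta>\<psi>"
  shows "\<exists>\<phi>.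
    (\<forall>M :: ('f, 'r, 'u) vstruct. vf_structure L M \<longrightarrow>
      defs L M \<phi> p q (\<lambda>a \<alpha>. fun_ok M l k' (\<lambda>x y. sat M (x @ y # a) \<alpha> \<theta>f)
        (\<lambda>x \<zeta>. sat M (x @ a) (\<zeta> @ \<alpha>) \<theta>\<psi>))) \<and>
    (\<forall>M :: ('f, 'r, 'v) vstruct. vf_structure L M \<longrightarrow>
      defs L M \<phi> p q (\<lambda>a \<alpha>. fun_ok M l k' (\<lambda>x y. sat M (x @ y # a) \<alpha> \<theta>f)
        (\<lambda>x \<zeta>. sat M (x @ a) (\<zeta> @ \<alpha>) \<theta>\<psi>)))"
  by (rule exI, intro conjI allI impI;
      rule vstr.fun_ok_defs[OF vstrI, where l = l and k' = k' and p = p and q = q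
        and \<theta>f = \<theta>f and \<theta>\<psi> = \<theta>\<psi>]; (assumption | fact assms | rule assms))

section \<open>Twisted boxes: passing between values and field elements\<close>

context vfield
begin

text \<open>A twisted box has no hidden constraints: after the prefix \<open>z\<close>, the next
  coordinate can be \<open>r + C j z\<close> with \<open>r\<close> any representative of
  \<open>s ! j\<close>. The induction runs downwards from full length.\<close>

lemma box_fill:
  assumes C: "\<forall>i<l. \<forall>z\<in>tuples i (carrier M). C i z \<in> carrier M"
    and s: "s \<in> tuples l (RVl M \<delta>)" and "j \<le> l" "z \<in> tuples j (carrier M)"
    and "\<forall>i<j. rvl M \<delta> (z ! i \<ominus> C i (take i z)) = s ! i"
  shows "\<exists>x\<in>twisted_box M \<delta> l C s. take j x = z"
  using assms(3-5)
proof (induction j arbitrary: z rule: inc_induct)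
  case base
  then show ?case by (intro bexI[of _ z]) (simp_all add: twisted_box_def tuples_length)
next
  case (step j)
  have "s ! j \<in> RVl M \<delta>" using s step.hyps by (auto intro: tuples_nth)
  then obtain r where r: "r \<in> carrier M" "rvl M \<delta> r = s ! j" by (auto simp: RVl_def)
  have c: "C j z \<in> carrier M" using C step by auto
  let ?z = "z @ [r \<oplus> C j z]"
  have l: "length z = j" by (rule tuples_length[OF step.prems(1)])
  have "(r \<oplus> C j z) \<ominus> C j z = r" using r c by algebra
  then have "\<forall>i<Suc j. rvl M \<delta> (?z ! i \<ominus> C i (take i ?z)) = s ! i"
    using step.prems l r by (auto simp: nth_append less_Suc_eq)
  then obtain x where "x \<in> twisted_box M \<delta> l C s" "take (Suc j) x = ?z"
    using step.IH[of ?z] tuples_snoc[OF step.prems(1)] r c by auto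
  moreover then have "take j x = z" using l by (metis append_eq_conv_conj le_SucI nat_le_linear take_take min.absorb1)
  ultimately show ?case by blast
qed

lemma box_nonempty:
  assumes "\<forall>i<l. \<forall>z\<in>tuples i (carrier M). C i z \<in> carrier M" "s \<in> tuples l (RVl M \<delta>)"
  shows "twisted_box M \<delta> l C s \<noteq> {}"
  using box_fill[OF assms, where j = 0 and z = "[]"] by auto

lemma diff_nth_closed:
  assumes "\<forall>i<l. \<forall>z\<in>tuples i (carrier M). C i z \<in> carrier M" "x \<in> tuples l (carrier M)" "i < l"
  shows "x ! i \<ominus> C i (take i x) \<in> carrier M"
  using assms tuples_nth[OF assms(2,3)] tuples_take[OF assms(2) less_imp_le[OF assms(3)]] by auto

lemma same_iff_rvl:
  assumes C: "\<forall>i<l. \<forall>z\<in>tuples i (carrier M). C i z \<in> carrier M"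
    and "x \<in> tuples l (carrier M)" "y \<in> tuples l (carrier M)" "d \<in> vring M" "d \<noteq> \<zero>"
  shows "same M l C d x y \<longleftrightarrow> (\<forall>i<l. rvl M (vabs M d) (x ! i \<ominus> C i (take i x)) = rvl M (vabs M d) (y ! i \<ominus> C i (take i y)))"
  unfolding same_def using rvl_eq_iff[OF diff_nth_closed[OF C assms(2)] diff_nth_closed[OF C assms(3)] assms(4,5)] by auto

lemma box_around:
  assumes C: "\<forall>i<l. \<forall>z\<in>tuples i (carrier M). C i z \<in> carrier M"
    and "y \<in> tuples l (carrier M)" "d \<in> vring M" "d \<noteq> \<zero>"
    and "\<And>i. i < l \<Longrightarrow> s ! i = rvl M (vabs M d) (y ! i \<ominus> C i (take i y))"
  shows "twisted_box M (vabs M d) l C s = {x \<in> tuples l (carrier M). same M l C d x y}"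
  unfolding twisted_box_def using same_iff_rvl[OF C _ assms(2-4)] assms(5) by auto

lemma same_one:
  assumes C: "\<forall>i<l. \<forall>z\<in>tuples i (carrier M). C i z \<in> carrier M"
    and "x \<in> tuples l (carrier M)" "y \<in> tuples l (carrier M)" "d \<in> vring M" "same M l C d x y"
  shows "same M l C \<one> x y"
  using assms rveq_one[OF diff_nth_closed[OF C assms(2)] diff_nth_closed[OF C assms(3)]] unfolding same_def by auto

lemma delta_le_one:
  "\<delta> \<in> Gamma_units M \<Longrightarrow> vle M \<delta> (vabs M \<one>) \<Longrightarrow> \<exists>d\<in>vring M. d \<noteq> \<zero> \<and> \<delta> = vabs M d"
  using vle_iff[OF _ one_closed] vring_carrier unfolding Gamma_units_iff by (metis r_one)

lemma d_Gamma: "d \<in> vring M \<Longrightarrow> d \<noteq> \<zero> \<Longrightarrow> vabs M d \<in> Gamma_units M \<and> vle M (vabs M d) (vabs M \<one>)"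
  using vle_iff[OF _ one_closed, of d] vring_carrier r_one unfolding Gamma_units_iff by metis

lemma okb_box:
  assumes C: "\<forall>i<l. \<forall>z\<in>tuples i (carrier M). C i z \<in> carrier M"
    and F: "F \<subseteq> tuples l (carrier M)" "x0 \<in> F" and ok: "\<And>x0. x0 \<in> F \<Longrightarrow> okb M l F C f \<psi> x0"
  shows "\<exists>r\<in>tuples l (RV M). F = twisted_box M (vabs M \<one>) l C r"
proof -
  let ?r = "map (\<lambda>i. rv M (x0 ! i \<ominus> C i (take i x0))) [0..<l]"
  have x0: "x0 \<in> tuples l (carrier M)" using F by auto
  have "?r \<in> tuples l (RV M)" using diff_nth_closed[OF C x0] by (auto simp: tuples_def)
  moreover have "twisted_box M (vabs M \<one>) l C ?r = {x \<in> tuples l (carrier M). same M l C \<one> x x0}"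
    by (rule box_around[OF C x0]) (auto simp: rv_def)
  moreover have "F = {x \<in> tuples l (carrier M). same M l C \<one> x x0}"
    using ok[OF F(2)] unfolding okb_def by (elim conjE)
  ultimately show ?thesis by blast
qed

text \<open>The way back to the wording of \<open>property_T\<close>. By \<open>box_nonempty\<close>
  every sub-box has a point, around which the condition \<open>okb\<close> applies.\<close>

lemma okb_body:
  assumes C: "\<forall>i<l. \<forall>z\<in>tuples i (carrier M). C i z \<in> carrier M"
    and F: "F \<subseteq> tuples l (carrier M)" "F \<noteq> {}" and ok: "\<And>x0. x0 \<in> F \<Longrightarrow> okb M l F C f \<psi> x0"
  shows "(\<forall>x\<in>F. \<forall>y\<in>F. \<psi> x = \<psi> y) \<and>
    ((\<exists>y. f ` F = {y}) \<or> (\<exists>\<mu>. is_open_ball M \<mu> (f ` F))) \<and>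
    (\<forall>\<delta>\<in>Gamma_units M. vle M \<delta> (vabs M \<one>) \<longrightarrow>
      (\<forall>s\<in>tuples l (RVl M \<delta>). \<forall>G. G = twisted_box M \<delta> l C s \<and> G \<subseteq> F \<longrightarrow>
         ((\<exists>y. f ` F = {y}) \<longrightarrow> (\<exists>y. f ` G = {y})) \<and>
         (\<forall>\<mu>. is_open_ball M \<mu> (f ` F) \<longrightarrow> is_open_ball M (\<delta> <#> \<mu>) (f ` G))))"
proof (intro conjI ballI allI impI)
  show "\<psi> x = \<psi> y" if "x \<in> F" "y \<in> F" for x y
  proof -
    have "\<forall>x\<in>F. \<psi> x = \<psi> y" using ok[OF that(2)] unfolding okb_def by (elim conjE)
    then show ?thesis using that by blast
  qed
  obtain x0 where x0: "x0 \<in> F" using F by auto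
  have "(\<forall>x\<in>F. f x = f x0) \<or> (\<exists>m\<in>carrier M. m \<noteq> \<zero> \<and> (\<exists>a\<in>carrier M. f ` F = ball M a m))"
    using ok[OF x0] unfolding okb_def by (elim conjE)
  then show "(\<exists>y. f ` F = {y}) \<or> (\<exists>\<mu>. is_open_ball M \<mu> (f ` F))"
  proof
    assume "\<forall>x\<in>F. f x = f x0"
    then have "f ` F = {f x0}" using x0 by blast
    then show ?thesis by blast
  next
    assume "\<exists>m\<in>carrier M. m \<noteq> \<zero> \<and> (\<exists>a\<in>carrier M. f ` F = ball M a m)"
    then show ?thesis unfolding is_open_ball_iff by blast
  qed
next
  fix \<delta> s G
  assume d: "\<delta> \<in> Gamma_units M" "vle M \<delta> (vabs M \<one>)" and s: "s \<in> tuples l (RVl M \<delta>)"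
    and G: "G = twisted_box M \<delta> l C s \<and> G \<subseteq> F"
  obtain x0 where x0: "x0 \<in> G" using box_nonempty[OF C s] G by auto
  show "\<exists>y. f ` G = {y}" if h: "\<exists>y. f ` F = {y}"
  proof -
    obtain y where y: "f ` F = {y}" using h by blast
    then have "f x = y" if "x \<in> G" for x using G that by blast
    then show ?thesis using x0 by (intro exI[of _ y]) auto
  qed
  fix \<mu> assume "is_open_ball M \<mu> (f ` F)"
  then obtain m a where m: "m \<in> carrier M" "m \<noteq> \<zero>" "\<mu> = vabs M m" "a \<in> carrier M" "f ` F = ball M a m"
    by (auto simp: is_open_ball_iff)
  obtain d where d: "d \<in> vring M" "d \<noteq> \<zero>" "\<delta> = vabs M d" using delta_le_one d by blast
  have dc: "d \<in> carrier M" using d vring_carrier by auto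
  have "G = {x \<in> tuples l (carrier M). same M l C d x x0}"
    using box_around[OF C _ d(1,2), of x0 s] G x0 unfolding d(3) by (auto simp: twisted_box_def)
  moreover have H: "\<forall>m\<in>carrier M. \<forall>a\<in>carrier M. m \<noteq> \<zero> \<and> f ` F = ball M a m \<longrightarrow>
       (\<forall>d\<in>carrier M. d \<in> vring M \<and> d \<noteq> \<zero> \<longrightarrow>
         (\<exists>a'\<in>carrier M. f ` {x \<in> tuples l (carrier M). same M l C d x x0} = ball M a' (d \<otimes> m)))"
    using ok[of x0] x0 G unfolding okb_def by blast
  ultimately obtain a' where a': "a' \<in> carrier M" "f ` G = ball M a' (d \<otimes> m)"
    using H[rule_format, OF m(1,4) conjI[OF m(2,5)] dc conjI[OF d(1,2)]] by blast
  show "is_open_ball M (\<delta> <#> \<mu>) (f ` G)"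
    unfolding is_open_ball_iff d(3) m(3) vabs_mult[OF dc m(1)]
  proof (rule bexI[of _ "d \<otimes> m"], intro conjI)
    show "d \<otimes> m \<noteq> \<zero>" using integral_iff[OF dc m(1)] d(2) m(2) by blast
    show "\<exists>a\<in>carrier M. f ` G = ball M a (d \<otimes> m)" using a' by blast
  qed (use dc m(1) in simp_all)
qed

text \<open>The center tuple may change from \<open>C0\<close> to \<open>C\<close> as long as both
  agree on the projections of \<open>F\<close>. This allows replacing the given centers by ones
  definable on all tuples.\<close>

lemma body_okb:
  assumes C0: "\<forall>i<l. \<forall>z\<in>tuples i (carrier M). C0 i z \<in> carrier M"
    and C: "\<forall>i<l. \<forall>z\<in>tuples i (carrier M). C i z \<in> carrier M"
    and r: "r \<in> tuples l (RV M)" and F: "F = twisted_box M (vabs M \<one>) l C0 r"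
    and CC: "\<And>i x. i < l \<Longrightarrow> x \<in> F \<Longrightarrow> C i (take i x) = C0 i (take i x)"
    and body: "(\<forall>x\<in>F. \<forall>y\<in>F. \<psi> x = \<psi> y) \<and>
    ((\<exists>y. f ` F = {y}) \<or> (\<exists>\<mu>. is_open_ball M \<mu> (f ` F))) \<and>
    (\<forall>\<delta>\<in>Gamma_units M. vle M \<delta> (vabs M \<one>) \<longrightarrow>
      (\<forall>s\<in>tuples l (RVl M \<delta>). \<forall>G. G = twisted_box M \<delta> l C0 s \<and> G \<subseteq> F \<longrightarrow>
         ((\<exists>y. f ` F = {y}) \<longrightarrow> (\<exists>y. f ` G = {y})) \<and>
         (\<forall>\<mu>. is_open_ball M \<mu> (f ` F) \<longrightarrow> is_open_ball M (\<delta> <#> \<mu>) (f ` G))))"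
    and x0: "x0 \<in> F"
  shows "okb M l F C f \<psi> x0"
proof -
  have x0c: "x0 \<in> tuples l (carrier M)" using x0 F by (auto simp: twisted_box_def)
  have r0: "r ! i = rvl M (vabs M \<one>) (x0 ! i \<ominus> C0 i (take i x0))" if "i < l" for i
    using x0 that F by (auto simp: twisted_box_def)
  have F0: "F = {x \<in> tuples l (carrier M). same M l C0 \<one> x x0}"
    unfolding F using box_around[OF C0 x0c _ _ r0] by simp
  have rl: "r \<in> tuples l (RVl M (vabs M \<one>))" using r by (simp add: RV_def)
  have sm: "same M l C d x x0 \<longleftrightarrow> same M l C0 d x x0" if "x \<in> F" for d x
    unfolding same_def using CC that x0 by auto
  \<comment> \<open>Outside the projections of \<open>F\<close> the tuples \<open>C\<close> and
    \<open>C0\<close> may differ, so membership is proved one coordinate at a time: the prefix of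
    \<open>x\<close> is a prefix of some point of \<open>F\<close>, where both centers agree, and
    \<open>box_fill\<close> extends it by one more coordinate.\<close>
  have inF: "x \<in> F" if x: "x \<in> tuples l (carrier M)" "same M l C \<one> x x0" for x
  proof -
    have "\<exists>w\<in>F. take i w = take i x" if "i \<le> l" for i
      using that
    proof (induction i)
      case 0 then show ?case using x0 by auto
    next
      case (Suc i)
      have P: "rvl M (vabs M \<one>) (x ! j \<ominus> C0 j (take j x)) = r ! j" if "j \<le> i" for j
      proof -
        obtain w where w: "w \<in> F" "take i w = take i x" using Suc by auto
        have tj: "take j w = take j x" using w(2) that by (metis min.absorb1 take_take)
        have "C j (take j x) = C0 j (take j x)" using CC[of j w] w(1) tj that Suc.prems by auto
        moreover have "rvl M (vabs M \<one>) (x ! j \<ominus> C j (take j x)) = rvl M (vabs M \<one>) (x0 ! j \<ominus> C j (take j x0))"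
          using same_iff_rvl[OF C x(1) x0c, of \<one>] x(2) that Suc.prems by auto
        ultimately show ?thesis using r0[of j] CC[of j x0] x0 that Suc.prems by auto
      qed
      have "take (Suc i) x \<in> tuples (Suc i) (carrier M)" using tuples_take[OF x(1)] Suc.prems by auto
      moreover have "\<forall>j<Suc i. rvl M (vabs M \<one>) (take (Suc i) x ! j \<ominus> C0 j (take j (take (Suc i) x))) = r ! j"
        using P by (auto simp: less_Suc_eq_le min_def)
      ultimately show ?case using box_fill[OF C0 rl Suc.prems] F by auto
    qed
    from this[of l] obtain w where w: "w \<in> F" "take l w = take l x" by auto
    moreover have "w \<in> tuples l (carrier M)" using w F by (auto simp: twisted_box_def)
    ultimately show ?thesis using x tuples_length by (metis order_refl take_all)
  qed
  have FC: "F = {x \<in> tuples l (carrier M). same M l C \<one> x x0}"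
    using inF sm F0 by auto
  have GC: "{x \<in> tuples l (carrier M). same M l C d x x0} = {x \<in> tuples l (carrier M). same M l C0 d x x0}"
    and GF: "{x \<in> tuples l (carrier M). same M l C0 d x x0} \<subseteq> F" if "d \<in> vring M" for d
  proof -
    show g: "{x \<in> tuples l (carrier M). same M l C0 d x x0} \<subseteq> F"
      using same_one[OF C0 _ x0c that] F0 by auto
    have "{x \<in> tuples l (carrier M). same M l C d x x0} \<subseteq> F"
      using same_one[OF C _ x0c that] FC by auto
    then show "{x \<in> tuples l (carrier M). same M l C d x x0} = {x \<in> tuples l (carrier M). same M l C0 d x x0}"
      using g sm by blast
  qed
  show ?thesis unfolding okb_def
  proof (intro conjI ballI impI)
    show "F = {x \<in> tuples l (carrier M). same M l C \<one> x x0}" by (rule FC)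
    show "\<psi> x = \<psi> x0" if "x \<in> F" for x using body that x0 by blast
    have "(\<exists>y. f ` F = {y}) \<or> (\<exists>\<mu>. is_open_ball M \<mu> (f ` F))" using body by blast
    then show "(\<forall>x\<in>F. f x = f x0) \<or> (\<exists>m\<in>carrier M. m \<noteq> \<zero> \<and> (\<exists>a\<in>carrier M. f ` F = ball M a m))"
    proof
      assume "\<exists>y. f ` F = {y}"
      then have "\<forall>x\<in>F. f x = f x0" using x0 by (metis imageI singletonD)
      then show ?thesis ..
    next
      assume "\<exists>\<mu>. is_open_ball M \<mu> (f ` F)"
      then show ?thesis unfolding is_open_ball_iff by blast
    qed
    fix m a d
    assume m: "m \<in> carrier M" "a \<in> carrier M" "m \<noteq> \<zero> \<and> f ` F = ball M a m" and d: "d \<in> carrier M" "d \<in> vring M \<and> d \<noteq> \<zero>"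
    let ?G = "{x \<in> tuples l (carrier M). same M l C0 d x x0}"
    let ?s = "map (\<lambda>i. rvl M (vabs M d) (x0 ! i \<ominus> C0 i (take i x0))) [0..<l]"
    have s: "?s \<in> tuples l (RVl M (vabs M d))"
      using diff_nth_closed[OF C0 x0c] by (auto simp: tuples_def RVl_def)
    have G: "?G = twisted_box M (vabs M d) l C0 ?s"
      using box_around[OF C0 x0c, of d ?s] d by auto
    have "is_open_ball M (vabs M m) (f ` F)" using m by (auto simp: is_open_ball_iff)
    moreover have "vabs M d \<in> Gamma_units M" "vle M (vabs M d) (vabs M \<one>)" using d_Gamma d by auto
    moreover have "?G \<subseteq> F" using GF d by blast
    ultimately have "is_open_ball M (vabs M d <#> vabs M m) (f ` ?G)" using body s G by blast
    then obtain n a' where n: "n \<in> carrier M" "vabs M (d \<otimes> m) = vabs M n" "a' \<in> carrier M" "f ` ?G = ball M a' n"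
      unfolding vabs_mult[OF d(1) m(1)] is_open_ball_iff by blast
    \<comment> \<open>The radius element is known only up to its value, and a ball depends on that
      value alone.\<close>
    have "ball M a' n = ball M a' (d \<otimes> m)"
      using open_ball_eq[OF n(1,3)] open_ball_eq[OF _ n(3), of "d \<otimes> m"] d m n(2) by simp
    then show "\<exists>a'\<in>carrier M. f ` {x \<in> tuples l (carrier M). same M l C d x x0} = ball M a' (d \<otimes> m)"
      using GC d n by auto
  qed
qed

end

section \<open>Decompositions as formulas in a fixed tuple of parameters\<close>

lemma choice_less: "(\<And>i. i < l \<Longrightarrow> \<exists>x. P i x) \<Longrightarrow> \<exists>f. \<forall>i<l :: nat. P i (f i)"
  by metis

text \<open>Evaluates a definition by cases in which the \<open>j\<close>-th case applies when
  \<open>j\<close> is the first index passing a test; \<open>j0\<close> is that index and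
  \<open>H\<close> says that it exists.\<close>

lemma ex_less_eq:
  assumes "\<And>j. j < r \<and> P j \<and> Q j \<longleftrightarrow> H \<and> j = j0"
  shows "(\<exists>j<r :: nat. (P j \<and> Q j) \<and> R j) \<longleftrightarrow> H \<and> R j0"
proof -
  have "(\<exists>j<r. (P j \<and> Q j) \<and> R j) \<longleftrightarrow> (\<exists>j. (j < r \<and> P j \<and> Q j) \<and> R j)" by blast
  also have "\<dots> \<longleftrightarrow> H \<and> R j0" unfolding assms by blast
  finally show ?thesis .
qed

context vstr
begin

text \<open>(T) is applied over the set of entries of \<open>a\<close> and \<open>\<alpha>\<close>.
  Its answer is expressed by formulas in exactly these tuples, so that the formulas can be evaluated
  at other parameters.\<close>

lemma T_ok_exists:
  assumes T: "property_T L M (Inl ` set a \<union> Inr ` set \<alpha>) l"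
    and a: "a \<in> tuples p (carrier M)" and \<alpha>: "\<alpha> \<in> tuples q (RV M)"
    and wf: "wf_form L (l + Suc p) q \<theta>f" "wf_form L (l + p) (k' + q) \<theta>\<psi>"
    and fok: "fun_ok M l k' (\<lambda>x y. sat M (x @ y # a) \<alpha> \<theta>f) (\<lambda>x \<zeta>. sat M (x @ a) (\<zeta> @ \<alpha>) \<theta>\<psi>)"
  shows "\<exists>k \<theta>\<chi> \<theta>c. wf_form L (l + p) (k + q) \<theta>\<chi> \<and> (\<forall>i<l. wf_form L (i + Suc p) (k + q) (\<theta>c i)) \<and>
    T_ok M l k k' (\<lambda>x y. sat M (x @ y # a) \<alpha> \<theta>f)
        (\<lambda>x \<zeta>. sat M (x @ a) (\<zeta> @ \<alpha>) \<theta>\<psi>) (\<lambda>x \<xi>. sat M (x @ a) (\<xi> @ \<alpha>) \<theta>\<chi>)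
        (\<lambda>i z y \<xi>. sat M (z @ y # a) (\<xi> @ \<alpha>) (\<theta>c i))"
proof -
  let ?A = "Inl ` set a \<union> Inr ` set \<alpha>"
  obtain f where f: "\<And>x. x \<in> tuples l (carrier M) \<Longrightarrow> f x \<in> carrier M"
    "\<And>x u. x \<in> tuples l (carrier M) \<Longrightarrow> u \<in> carrier M \<Longrightarrow> sat M (x @ u # a) \<alpha> \<theta>f \<longleftrightarrow> u = f x"
    using fok unfolding fun_ok_def by metis
  obtain \<psi> where \<psi>: "\<And>x. x \<in> tuples l (carrier M) \<Longrightarrow> \<psi> x \<in> tuples k' (RV M)"
    "\<And>x \<zeta>. x \<in> tuples l (carrier M) \<Longrightarrow> \<zeta> \<in> tuples k' (RV M) \<Longrightarrow> sat M (x @ a) (\<zeta> @ \<alpha>) \<theta>\<psi> \<longleftrightarrow> \<zeta> = \<psi> x"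
    using fok unfolding fun_ok_def by metis
  have "definable_fun L M ?A l f"
    unfolding definable_fun_def
  proof (intro conjI)
    show "f \<in> tuples l (carrier M) \<rightarrow> carrier M" using f by auto
    have *: "(x @ [f x], []) \<in> {(x, \<xi>). x \<in> tuples (Suc l) (carrier M) \<and> \<xi> \<in> tuples 0 (RV M) \<and> sat M (x @ a) (\<xi> @ \<alpha>) \<theta>f}"
      if "x \<in> tuples l (carrier M)" for x using that f(2)[OF that f(1)[OF that]] tuples_snoc[OF that f(1)[OF that]] by simp
    have **: "\<exists>x'\<in>tuples l (carrier M). x = x' @ [f x']"
      if "x \<in> tuples (Suc l) (carrier M)" "sat M (x @ a) \<alpha> \<theta>f" for x
    proof -
      have "x \<noteq> []" using that tuples_length by fastforce
      then have e: "x = butlast x @ [last x]" by simp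
      have "butlast x \<in> tuples l (carrier M)" "last x \<in> carrier M"
        using that \<open>x \<noteq> []\<close> by (auto simp: tuples_def dest: in_set_butlastD)
      moreover then have "last x = f (butlast x)" using f(2)[of "butlast x" "last x"] that(2) e
        by (metis append.assoc append_Cons append_Nil)
      ultimately show ?thesis using e by auto
    qed
    show "definable L M ?A (Suc l) 0 {(x @ [f x], []) | x. x \<in> tuples l (carrier M)}"
    proof (rule definableI[where p = p and q = q and a = a and \<alpha> = \<alpha> and \<phi> = \<theta>f and P = "\<lambda>xs \<xi>s. sat M xs \<xi>s \<theta>f"])
      show "defs L M \<theta>f (Suc l + p) (0 + q) (\<lambda>xs \<xi>s. sat M xs \<xi>s \<theta>f)" using d_self[OF wf(1)] by simp
      show "{(x @ [f x], []) | x. x \<in> tuples l (carrier M)} =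
        {(x, \<xi>). x \<in> tuples (Suc l) (carrier M) \<and> \<xi> \<in> tuples 0 (RV M) \<and> sat M (x @ a) (\<xi> @ \<alpha>) \<theta>f}"
        (is "?X = ?Y")
      proof (intro equalityI subsetI)
        fix w assume "w \<in> ?X" then show "w \<in> ?Y" using * by blast
      next
        fix w assume "w \<in> ?Y"
        then obtain x where "w = (x, [])" "x \<in> tuples (Suc l) (carrier M)" "sat M (x @ a) \<alpha> \<theta>f" by auto
        then show "w \<in> ?X" using ** by blast
      qed
    qed (use a \<alpha> in auto)
  qed
  moreover have "definable_rvfun L M ?A l k' \<psi>"
    unfolding definable_rvfun_def
  proof (intro conjI)
    show "\<psi> \<in> tuples l (carrier M) \<rightarrow> tuples k' (RV M)" using \<psi> by auto
    show "definable L M ?A l k' {(x, \<psi> x) | x. x \<in> tuples l (carrier M)}"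
      by (rule definableI[OF d_self[OF wf(2)] a \<alpha>]) (use \<psi> in auto)
  qed
  ultimately have T': "definable_fun L M ?A l f \<and> definable_rvfun L M ?A l k' \<psi>" by (rule conjI)
  let ?B = "\<lambda>c0 F. (\<forall>x\<in>F. \<forall>y\<in>F. \<psi> x = \<psi> y) \<and>
            ((\<exists>y. f ` F = {y}) \<or> (\<exists>\<mu>. is_open_ball M \<mu> (f ` F))) \<and>
            (\<forall>\<delta>\<in>Gamma_units M. vle M \<delta> (vabs M \<one>\<^bsub>M\<^esub>) \<longrightarrow>
              (\<forall>s\<in>tuples l (RVl M \<delta>). \<forall>G. G = twisted_box M \<delta> l c0 s \<and> G \<subseteq> F \<longrightarrow>
                 ((\<exists>y. f ` F = {y}) \<longrightarrow> (\<exists>y. f ` G = {y})) \<and>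
                 (\<forall>\<mu>. is_open_ball M \<mu> (f ` F) \<longrightarrow>
                    is_open_ball M (\<delta> <#>\<^bsub>M\<^esub> \<mu>) (f ` G))))"
  have "\<exists>k \<chi> c. decomposition L M ?A l k \<chi> c \<and>
         (\<forall>\<xi>\<in>tuples k (RV M). \<forall>F. F = fibre M l \<chi> \<xi> \<and> F \<noteq> {} \<longrightarrow> ?B (c \<xi>) F)"
    by (rule T[unfolded property_T_def, THEN spec, THEN spec, THEN spec, THEN mp, OF T'])
  then obtain k \<chi> c0 where dec: "decomposition L M ?A l k \<chi> c0"
    and body0: "\<forall>\<xi>\<in>tuples k (RV M). \<forall>F. F = fibre M l \<chi> \<xi> \<and> F \<noteq> {} \<longrightarrow> ?B (c0 \<xi>) F"
    by (elim exE conjE)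
  have body: "?B (c0 \<xi>) F" if "\<xi> \<in> tuples k (RV M)" "F = fibre M l \<chi> \<xi>" "F \<noteq> {}" for \<xi> F
    by (rule body0[THEN bspec, THEN spec, THEN mp, OF that(1) conjI[OF that(2,3)]])
  have \<chi>: "\<And>x. x \<in> tuples l (carrier M) \<Longrightarrow> \<chi> x \<in> tuples k (RV M)"
    and d\<chi>: "definable L M ?A l k {(x, \<chi> x) | x. x \<in> tuples l (carrier M)}"
    using dec unfolding decomposition_def definable_rvfun_def by auto
  have c0: "\<And>\<xi> i z. \<xi> \<in> tuples k (RV M) \<Longrightarrow> i < l \<Longrightarrow> z \<in> tuples i (carrier M) \<Longrightarrow> c0 \<xi> i z \<in> carrier M"
    using dec unfolding decomposition_def by blast
  have dc: "\<And>i. i < l \<Longrightarrow> definable L M ?A (Suc i) k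
        {(take i x @ [c0 (\<chi> x) i (take i x)], \<chi> x) | x. x \<in> tuples l (carrier M)}"
    using dec unfolding decomposition_def by blast
  have box: "\<And>\<xi>. \<xi> \<in> tuples k (RV M) \<Longrightarrow> fibre M l \<chi> \<xi> \<noteq> {} \<Longrightarrow>
        \<exists>r\<in>tuples l (RV M). fibre M l \<chi> \<xi> = twisted_box M (vabs M \<one>) l (c0 \<xi>) r"
    using dec unfolding decomposition_def by blast
  obtain \<theta>\<chi> where \<theta>\<chi>: "wf_form L (l + p) (k + q) \<theta>\<chi>"
    "\<And>x \<xi>. x \<in> tuples l (carrier M) \<Longrightarrow> \<xi> \<in> tuples k (RV M) \<Longrightarrow> \<xi> = \<chi> x \<longleftrightarrow> sat M (x @ a) (\<xi> @ \<alpha>) \<theta>\<chi>"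
    by (rule definable_env[OF d\<chi> a \<alpha>]) auto
  have "\<exists>\<theta>. wf_form L (Suc i + p) (k + q) \<theta> \<and> (\<forall>z y \<xi>. z \<in> tuples i (carrier M) \<longrightarrow> y \<in> carrier M \<longrightarrow> \<xi> \<in> tuples k (RV M) \<longrightarrow>
      (sat M (z @ y # a) (\<xi> @ \<alpha>) \<theta> \<longleftrightarrow> (\<exists>x\<in>tuples l (carrier M). \<chi> x = \<xi> \<and> take i x = z \<and> y = c0 \<xi> i z)))"
    if i: "i < l" for i
  proof -
    obtain \<theta> where \<theta>: "wf_form L (Suc i + p) (k + q) \<theta>"
      "\<And>x \<xi>. x \<in> tuples (Suc i) (carrier M) \<Longrightarrow> \<xi> \<in> tuples k (RV M) \<Longrightarrow>
         (x, \<xi>) \<in> {(take i x @ [c0 (\<chi> x) i (take i x)], \<chi> x) | x. x \<in> tuples l (carrier M)} \<longleftrightarrow> sat M (x @ a) (\<xi> @ \<alpha>) \<theta>"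
      by (rule definable_env[OF dc[OF i] a \<alpha>]) (rule that; assumption)
    have "sat M (z @ y # a) (\<xi> @ \<alpha>) \<theta> \<longleftrightarrow> (\<exists>x\<in>tuples l (carrier M). \<chi> x = \<xi> \<and> take i x = z \<and> y = c0 \<xi> i z)"
      if "z \<in> tuples i (carrier M)" "y \<in> carrier M" "\<xi> \<in> tuples k (RV M)" for z y \<xi>
      using \<theta>(2)[OF tuples_snoc[OF that(1,2)] that(3)] by auto
    then show ?thesis using \<theta>(1) by blast
  qed
  then have "\<exists>\<theta>0. \<forall>i<l. wf_form L (Suc i + p) (k + q) (\<theta>0 i) \<and> (\<forall>z y \<xi>. z \<in> tuples i (carrier M) \<longrightarrow> y \<in> carrier M \<longrightarrow> \<xi> \<in> tuples k (RV M) \<longrightarrow>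
      (sat M (z @ y # a) (\<xi> @ \<alpha>) (\<theta>0 i) \<longleftrightarrow> (\<exists>x\<in>tuples l (carrier M). \<chi> x = \<xi> \<and> take i x = z \<and> y = c0 \<xi> i z)))"
    by (intro choice_less)
  then obtain \<theta>0 where t0: "\<forall>i<l. wf_form L (Suc i + p) (k + q) (\<theta>0 i) \<and> (\<forall>z y \<xi>. z \<in> tuples i (carrier M) \<longrightarrow> y \<in> carrier M \<longrightarrow> \<xi> \<in> tuples k (RV M) \<longrightarrow>
      (sat M (z @ y # a) (\<xi> @ \<alpha>) (\<theta>0 i) \<longleftrightarrow> (\<exists>x\<in>tuples l (carrier M). \<chi> x = \<xi> \<and> take i x = z \<and> y = c0 \<xi> i z)))"
    by (elim exE)
  have \<theta>0: "\<And>i. i < l \<Longrightarrow> wf_form L (Suc i + p) (k + q) (\<theta>0 i)"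
    "\<And>i z y \<xi>. i < l \<Longrightarrow> z \<in> tuples i (carrier M) \<Longrightarrow> y \<in> carrier M \<Longrightarrow> \<xi> \<in> tuples k (RV M) \<Longrightarrow>
      (sat M (z @ y # a) (\<xi> @ \<alpha>) (\<theta>0 i) \<longleftrightarrow> (\<exists>x\<in>tuples l (carrier M). \<chi> x = \<xi> \<and> take i x = z \<and> y = c0 \<xi> i z))"
    using t0[THEN spec, THEN mp] by simp_all
  \<comment> \<open>Definability of the centers is known only over prefixes of points of the fibre;
    elsewhere they are replaced by zero.\<close>
  define c where "c \<xi> i z = (if \<exists>x\<in>tuples l (carrier M). \<chi> x = \<xi> \<and> take i x = z then c0 \<xi> i z else \<zero>\<^bsub>M\<^esub>)" for \<xi> i z
  have cc: "c \<xi> i z \<in> carrier M" if "\<xi> \<in> tuples k (RV M)" "i < l" "z \<in> tuples i (carrier M)" for \<xi> i z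
    using c0 that by (simp add: c_def)
  have "\<exists>\<theta>. defs L M \<theta> (i + Suc p) (k + q) (\<lambda>xs \<xi>s. sat M xs \<xi>s (\<theta>0 i) \<or>
      (xs ! i = \<zero> \<and> \<not> (\<exists>u\<in>carrier M. sat M (take i xs @ u # drop (Suc i) xs) \<xi>s (\<theta>0 i))))" if "i < l" for i
    by (rule exI, (rule d_intros d_sub[OF d_self[OF \<theta>0(1)[OF that]]] tm_intros | (simp; fail))+)
  then have "\<exists>\<theta>c. \<forall>i<l. defs L M (\<theta>c i) (i + Suc p) (k + q) (\<lambda>xs \<xi>s. sat M xs \<xi>s (\<theta>0 i) \<or>
      (xs ! i = \<zero> \<and> \<not> (\<exists>u\<in>carrier M. sat M (take i xs @ u # drop (Suc i) xs) \<xi>s (\<theta>0 i))))"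
    by (intro choice_less)
  then obtain \<theta>c where \<theta>c: "\<And>i. i < l \<Longrightarrow> defs L M (\<theta>c i) (i + Suc p) (k + q) (\<lambda>xs \<xi>s. sat M xs \<xi>s (\<theta>0 i) \<or>
      (xs ! i = \<zero> \<and> \<not> (\<exists>u\<in>carrier M. sat M (take i xs @ u # drop (Suc i) xs) \<xi>s (\<theta>0 i))))"
    by blast
  have sc: "sat M (z @ y # a) (\<xi> @ \<alpha>) (\<theta>c i) \<longleftrightarrow> y = c \<xi> i z"
    if "i < l" "z \<in> tuples i (carrier M)" "y \<in> carrier M" "\<xi> \<in> tuples k (RV M)" for i z y \<xi>
  proof -
    have l: "length z = i" using that tuples_length by blast
    have "z @ y # a \<in> tuples (i + Suc p) (carrier M)" "\<xi> @ \<alpha> \<in> tuples (k + q) (RV M)"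
      using that a tuples_append[OF that(2), of "y # a" "Suc p"] tuples_append[OF that(4) \<alpha>] by simp_all
    moreover have "(z @ y # a) ! i = y" "take i (z @ y # a) = z" "drop (Suc i) (z @ y # a) = a"
      using l by (auto simp: nth_append)
    ultimately have "sat M (z @ y # a) (\<xi> @ \<alpha>) (\<theta>c i) \<longleftrightarrow> sat M (z @ y # a) (\<xi> @ \<alpha>) (\<theta>0 i) \<or>
      (y = \<zero> \<and> \<not> (\<exists>u\<in>carrier M. sat M (z @ u # a) (\<xi> @ \<alpha>) (\<theta>0 i)))"
      using \<theta>c[OF that(1)] unfolding defs_def by metis
    also have "\<dots> \<longleftrightarrow> y = c \<xi> i z"
      using \<theta>0(2)[OF that(1,2) _ that(4)] that c0[OF that(4,1,2)] unfolding c_def by auto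
    finally show ?thesis .
  qed
  have "T_ok M l k k' (\<lambda>x y. sat M (x @ y # a) \<alpha> \<theta>f)
        (\<lambda>x \<zeta>. sat M (x @ a) (\<zeta> @ \<alpha>) \<theta>\<psi>) (\<lambda>x \<xi>. sat M (x @ a) (\<xi> @ \<alpha>) \<theta>\<chi>)
        (\<lambda>i z y \<xi>. sat M (z @ y # a) (\<xi> @ \<alpha>) (\<theta>c i))"
    unfolding T_ok_def
  proof (intro conjI ballI allI impI)
    fix x assume x: "x \<in> tuples l (carrier M)"
    show "\<exists>\<xi>\<in>tuples k (RV M). \<forall>\<zeta>\<in>tuples k (RV M). sat M (x @ a) (\<zeta> @ \<alpha>) \<theta>\<chi> \<longleftrightarrow> \<zeta> = \<xi>"
      using \<theta>\<chi>(2)[OF x] \<chi>[OF x] by blast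
  next
    fix i z \<xi> assume *: "i < l" "z \<in> tuples i (carrier M)" "\<xi> \<in> tuples k (RV M)"
    show "\<exists>y\<in>carrier M. \<forall>u\<in>carrier M. sat M (z @ u # a) (\<xi> @ \<alpha>) (\<theta>c i) \<longleftrightarrow> u = y"
      using sc[OF *(1,2) _ *(3)] cc[OF *(3,1,2)] by blast
  next
    fix x0 \<xi> assume x0: "x0 \<in> tuples l (carrier M)" and \<xi>: "\<xi> \<in> tuples k (RV M)" and s: "sat M (x0 @ a) (\<xi> @ \<alpha>) \<theta>\<chi>"
    have \<xi>0: "\<xi> = \<chi> x0" using \<theta>\<chi>(2)[OF x0 \<xi>] s by simp
    let ?F = "fibre M l \<chi> \<xi>"
    have F: "{x \<in> tuples l (carrier M). sat M (x @ a) (\<xi> @ \<alpha>) \<theta>\<chi>} = ?F"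
      unfolding fibre_def using \<theta>\<chi>(2)[OF _ \<xi>] by auto
    have x0F: "x0 \<in> ?F" using x0 \<xi>0 by (simp add: fibre_def)
    obtain r where r: "r \<in> tuples l (RV M)" "?F = twisted_box M (vabs M \<one>) l (c0 \<xi>) r"
      using box[OF \<xi>] x0F by blast
    have C0: "\<forall>i<l. \<forall>z\<in>tuples i (carrier M). c0 \<xi> i z \<in> carrier M" using c0[OF \<xi>] by blast
    have C: "\<forall>i<l. \<forall>z\<in>tuples i (carrier M). c \<xi> i z \<in> carrier M" using cc[OF \<xi>] by blast
    have CC: "c \<xi> i (take i x) = c0 \<xi> i (take i x)" if "x \<in> ?F" for i x
      using that unfolding c_def fibre_def by auto
    have "okb M l ?F (c \<xi>) f \<psi> x0"
      by (rule body_okb[OF C0 C r(1,2) CC body[OF \<xi> refl] x0F]) (use x0F in auto)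
    then show "okR M l k' (\<lambda>x. sat M (x @ a) (\<xi> @ \<alpha>) \<theta>\<chi>) (\<lambda>i z u. sat M (z @ u # a) (\<xi> @ \<alpha>) (\<theta>c i))
        (\<lambda>x y. sat M (x @ y # a) \<alpha> \<theta>f) (\<lambda>x \<zeta>. sat M (x @ a) (\<zeta> @ \<alpha>) \<theta>\<psi>) x0"
      by (subst okR_iff[where C = "c \<xi>" and f = f and \<psi> = \<psi>]) (use sc cc \<xi> f \<psi> x0 F in auto)
  qed
  moreover have "\<forall>i<l. wf_form L (i + Suc p) (k + q) (\<theta>c i)" using \<theta>c by (auto simp: defs_def)
  ultimately show ?thesis using \<theta>\<chi>(1) by blast
qed

end

section \<open>Uniformity in parameters\<close>

text \<open>Nothing is assumed about \<open>M\<close> itself, whose universe may have any type. The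
  properties are available only in elementarily equivalent structures on
  \<open>'f + 'r + nat\<close> and reach \<open>M\<close> through compactness.\<close>

locale td_model = vstr L M for L :: "('f, 'r) lang" and M :: "('f, 'r, 'u) vstruct" (structure) +
  fixes l :: nat
  assumes l_ge_1: "l \<ge> 1"
    and TD: "\<And>(N :: ('f, 'r, 'f + 'r + nat) vstruct) A. vf_structure L N \<Longrightarrow>
      (\<And>\<phi>. wf_form L 0 0 \<phi> \<Longrightarrow> sat N [] [] \<phi> = sat M [] [] \<phi>) \<Longrightarrow>
      A \<subseteq> Inl ` carrier N \<union> Inr ` RV N \<Longrightarrow> property_T L N A l \<and> property_D L N A"
begin

text \<open>If no finite set of indices sufficed, the negations of all \<open>W j\<close> would be
  finitely satisfiable in \<open>M\<close>, and \<open>compactness\<close> would realise them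
  together in a structure where \<open>ex\<close> forbids it.\<close>

lemma uniform:
  assumes wf: "\<And>j. j \<in> J \<Longrightarrow> wf_form L p q (W j)"
    and ex: "\<And>(N :: ('f, 'r, 'f + 'r + nat) vstruct) a \<alpha>. vf_structure L N \<Longrightarrow>
      (\<And>A. A \<subseteq> Inl ` carrier N \<union> Inr ` RV N \<Longrightarrow> property_T L N A l \<and> property_D L N A) \<Longrightarrow>
      a \<in> tuples p (carrier N) \<Longrightarrow> \<alpha> \<in> tuples q (RV N) \<Longrightarrow> \<exists>j\<in>J. sat N a \<alpha> (W j)"
  shows "\<exists>J0\<subseteq>J. finite J0 \<and> (\<forall>a\<in>tuples p (carrier M). \<forall>\<alpha>\<in>tuples q (RV M). \<exists>j\<in>J0. sat M a \<alpha> (W j))"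
proof (rule ccontr)
  assume neg: "\<not> ?thesis"
  let ?\<Sigma> = "(\<lambda>j. FNot (W j)) ` J"
  have "\<exists>N :: ('f, 'r, 'f + 'r + nat) vstruct. vf_structure L N \<and>
    (\<forall>\<phi>. wf_form L 0 0 \<phi> \<longrightarrow> sat N [] [] \<phi> = sat M [] [] \<phi>) \<and>
    (\<exists>a\<in>tuples p (carrier N). \<exists>\<alpha>\<in>tuples q (RV N). \<forall>\<sigma>\<in>?\<Sigma>. sat N a \<alpha> \<sigma>)"
  proof (rule compactness[OF vfs])
    show "wf_form L p q \<sigma>" if "\<sigma> \<in> ?\<Sigma>" for \<sigma> using that wf by auto
    fix S assume "finite S" "S \<subseteq> ?\<Sigma>"
    then obtain J0 where J0: "J0 \<subseteq> J" "finite J0" "S = (\<lambda>j. FNot (W j)) ` J0" by (meson finite_subset_image)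
    have "\<not> (\<forall>a\<in>tuples p (carrier M). \<forall>\<alpha>\<in>tuples q (RV M). \<exists>j\<in>J0. sat M a \<alpha> (W j))"
      using neg J0(1,2) by simp
    then obtain a \<alpha> where "a \<in> tuples p (carrier M)" "\<alpha> \<in> tuples q (RV M)" "\<forall>j\<in>J0. \<not> sat M a \<alpha> (W j)"
      by blast
    then show "\<exists>a\<in>tuples p (carrier M). \<exists>\<alpha>\<in>tuples q (RV M). \<forall>\<sigma>\<in>S. sat M a \<alpha> \<sigma>" using J0 by auto
  qed
  then obtain N :: "('f, 'r, 'f + 'r + nat) vstruct" and a \<alpha> where N: "vf_structure L N"
    "\<And>\<phi>. wf_form L 0 0 \<phi> \<Longrightarrow> sat N [] [] \<phi> = sat M [] [] \<phi>" "a \<in> tuples p (carrier N)" "\<alpha> \<in> tuples q (RV N)"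
    "\<forall>j\<in>J. \<not> sat N a \<alpha> (W j)" by auto
  show False using ex[OF N(1) TD[OF N(1,2)] N(3,4)] N(5) by blast
qed

text \<open>All possible formulas for a decomposition and its centers are candidates. Compactness
  leaves finitely many of them, and a definition by cases on the parameters merges these into a
  single \<open>\<chi>\<close> and \<open>c\<close>.\<close>

lemma uniform_T:
  assumes wf: "wf_form L (l + Suc p) q \<theta>f" "wf_form L (l + p) (k' + q) \<theta>\<psi>"
  shows "\<exists>K \<chi> c. (\<exists>\<phi>. defs L M \<phi> (l + p) (K + q) (\<lambda>xs \<xi>s. take K \<xi>s = \<chi> (drop l xs) (drop K \<xi>s) (take l xs))) \<and>
    (\<forall>i<l. \<exists>\<phi>. defs L M \<phi> (i + Suc p) (K + q)
       (\<lambda>xs \<xi>s. xs ! i = c (drop (Suc i) xs) (drop K \<xi>s) (take K \<xi>s) i (take i xs))) \<and>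
    (\<forall>a\<in>tuples p (carrier M). \<forall>\<alpha>\<in>tuples q (RV M).
       (\<forall>x\<in>tuples l (carrier M). \<chi> a \<alpha> x \<in> tuples K (RV M)) \<and>
       (\<forall>\<xi>\<in>tuples K (RV M). \<forall>i<l. \<forall>z\<in>tuples i (carrier M). c a \<alpha> \<xi> i z \<in> carrier M) \<and>
       (\<forall>f \<psi>. (\<forall>x\<in>tuples l (carrier M). f x \<in> carrier M \<and> \<psi> x \<in> tuples k' (RV M) \<and>
            (\<forall>u\<in>carrier M. sat M (x @ u # a) \<alpha> \<theta>f \<longleftrightarrow> u = f x) \<and>
            (\<forall>\<zeta>\<in>tuples k' (RV M). sat M (x @ a) (\<zeta> @ \<alpha>) \<theta>\<psi> \<longleftrightarrow> \<zeta> = \<psi> x)) \<longrightarrow>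
          (\<forall>x0\<in>tuples l (carrier M).
             okb M l {x \<in> tuples l (carrier M). \<chi> a \<alpha> x = \<chi> a \<alpha> x0} (c a \<alpha> (\<chi> a \<alpha> x0)) f \<psi> x0)))"
proof -
  let ?F = "\<lambda>a \<alpha> x y. sat M (x @ y # a) \<alpha> \<theta>f"
  let ?P = "\<lambda>a \<alpha> x \<zeta>. sat M (x @ a) (\<zeta> @ \<alpha>) \<theta>\<psi>"
  let ?T = "\<lambda>k \<theta>\<chi> \<theta>c a \<alpha>. T_ok M l k k' (?F a \<alpha>) (?P a \<alpha>) (\<lambda>x \<xi>. sat M (x @ a) (\<xi> @ \<alpha>) \<theta>\<chi>)
        (\<lambda>i z y \<xi>. sat M (z @ y # a) (\<xi> @ \<alpha>) (\<theta>c i))"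
  define J where "J = {(k, \<theta>\<chi>, \<theta>c). wf_form L (l + p) (k + q) \<theta>\<chi> \<and> (\<forall>i<l. wf_form L (i + Suc p) (k + q) (\<theta>c i :: ('f, 'r) form))}"
  let ?A = "\<lambda>j \<phi>. \<forall>M :: ('f, 'r, 'u) vstruct. vf_structure L M \<longrightarrow>
      defs L M \<phi> p q (\<lambda>a \<alpha>. T_ok M l (fst j) k' (\<lambda>x y. sat M (x @ y # a) \<alpha> \<theta>f)
        (\<lambda>x \<zeta>. sat M (x @ a) (\<zeta> @ \<alpha>) \<theta>\<psi>) (\<lambda>x \<xi>. sat M (x @ a) (\<xi> @ \<alpha>) (fst (snd j)))
        (\<lambda>i z y \<xi>. sat M (z @ y # a) (\<xi> @ \<alpha>) (snd (snd j) i)))"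
  let ?B = "\<lambda>j \<phi>. \<forall>M :: ('f, 'r, 'f + 'r + nat) vstruct. vf_structure L M \<longrightarrow>
      defs L M \<phi> p q (\<lambda>a \<alpha>. T_ok M l (fst j) k' (\<lambda>x y. sat M (x @ y # a) \<alpha> \<theta>f)
        (\<lambda>x \<zeta>. sat M (x @ a) (\<zeta> @ \<alpha>) \<theta>\<psi>) (\<lambda>x \<xi>. sat M (x @ a) (\<xi> @ \<alpha>) (fst (snd j)))
        (\<lambda>i z y \<xi>. sat M (z @ y # a) (\<xi> @ \<alpha>) (snd (snd j) i)))"
  have "\<forall>j\<in>J. \<exists>\<phi>. ?A j \<phi> \<and> ?B j \<phi>"
    by (intro ballI T_ok_formula) (use wf in \<open>auto simp: J_def\<close>)
  from bchoice[OF this] obtain W where W0: "\<forall>j\<in>J. ?A j (W j) \<and> ?B j (W j)" by (elim exE)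
  have WA: "?A j (W j)" if "j \<in> J" for j by (rule conjunct1[OF bspec[OF W0 that]])
  have WB: "?B j (W j)" if "j \<in> J" for j by (rule conjunct2[OF bspec[OF W0 that]])
  obtain \<phi>0 where \<phi>0: "\<And>M :: ('f, 'r, 'u) vstruct. vf_structure L M \<Longrightarrow>
      defs L M \<phi>0 p q (\<lambda>a \<alpha>. fun_ok M l k' (\<lambda>x y. sat M (x @ y # a) \<alpha> \<theta>f) (\<lambda>x \<zeta>. sat M (x @ a) (\<zeta> @ \<alpha>) \<theta>\<psi>))"
    "\<And>M :: ('f, 'r, 'f + 'r + nat) vstruct. vf_structure L M \<Longrightarrow>
      defs L M \<phi>0 p q (\<lambda>a \<alpha>. fun_ok M l k' (\<lambda>x y. sat M (x @ y # a) \<alpha> \<theta>f) (\<lambda>x \<zeta>. sat M (x @ a) (\<zeta> @ \<alpha>) \<theta>\<psi>))"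
    using fun_ok_formula[OF wf] by blast
  \<comment> \<open>\<open>None\<close> takes care of the parameters at which the given formulas do
    not define functions, so that some candidate succeeds at every parameter tuple, as
    \<open>uniform\<close> demands.\<close>
  define W' where "W' o' = (case o' of None \<Rightarrow> FNot \<phi>0 | Some j \<Rightarrow> W j)" for o'
  have wfW: "wf_form L p q (W j)" if "j \<in> J" for j using WA[OF that, THEN spec, THEN mp, OF vfs] by (simp add: defs_def)
  have "\<exists>J0\<subseteq>insert None (Some ` J). finite J0 \<and>
      (\<forall>a\<in>tuples p (carrier M). \<forall>\<alpha>\<in>tuples q (RV M). \<exists>j\<in>J0. sat M a \<alpha> (W' j))"
  proof (rule uniform)
    show "wf_form L p q (W' j)" if "j \<in> insert None (Some ` J)" for j
      using that wfW \<phi>0(1)[OF vfs] by (auto simp: W'_def defs_def)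
    fix N :: "('f, 'r, 'f + 'r + nat) vstruct" and a \<alpha>
    assume N: "vf_structure L N" and td: "\<And>A. A \<subseteq> Inl ` carrier N \<union> Inr ` RV N \<Longrightarrow> property_T L N A l \<and> property_D L N A"
      and a: "a \<in> tuples p (carrier N)" "\<alpha> \<in> tuples q (RV N)"
    interpret N: vstr L N by (rule vstrI[OF N])
    show "\<exists>j\<in>insert None (Some ` J). sat N a \<alpha> (W' j)"
    proof (cases "sat N a \<alpha> \<phi>0")
      case True
      then have fok: "fun_ok N l k' (\<lambda>x y. sat N (x @ y # a) \<alpha> \<theta>f) (\<lambda>x \<zeta>. sat N (x @ a) (\<zeta> @ \<alpha>) \<theta>\<psi>)"
        using \<phi>0(2)[OF N] a by (auto simp: defs_def)
      have "property_T L N (Inl ` set a \<union> Inr ` set \<alpha>) l"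
        using td[of "Inl ` set a \<union> Inr ` set \<alpha>"] a by (auto simp: tuples_def)
      then obtain k \<theta>\<chi> \<theta>c where *: "wf_form L (l + p) (k + q) \<theta>\<chi>" "\<forall>i<l. wf_form L (i + Suc p) (k + q) (\<theta>c i)"
        "T_ok N l k k' (\<lambda>x y. sat N (x @ y # a) \<alpha> \<theta>f)
        (\<lambda>x \<zeta>. sat N (x @ a) (\<zeta> @ \<alpha>) \<theta>\<psi>) (\<lambda>x \<xi>. sat N (x @ a) (\<xi> @ \<alpha>) \<theta>\<chi>)
        (\<lambda>i z y \<xi>. sat N (z @ y # a) (\<xi> @ \<alpha>) (\<theta>c i))"
        using N.T_ok_exists[OF _ a wf fok] by blast
      then have j: "(k, \<theta>\<chi>, \<theta>c) \<in> J" by (simp add: J_def)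
      have "sat N a \<alpha> (W (k, \<theta>\<chi>, \<theta>c))" using WB[OF j, THEN spec, THEN mp, OF N] *(3) a unfolding defs_def by simp
      then show ?thesis using j by (auto simp: W'_def)
    qed (auto simp: W'_def)
  qed
  then obtain J0 where J0: "J0 \<subseteq> insert None (Some ` J)" "finite J0"
    "\<And>a \<alpha>. a \<in> tuples p (carrier M) \<Longrightarrow> \<alpha> \<in> tuples q (RV M) \<Longrightarrow> \<exists>j\<in>J0. sat M a \<alpha> (W' j)" by blast
  obtain js where js: "set js = {j. Some j \<in> J0}"
    using finite_list[OF finite_vimageI[OF J0(2), of Some]] by (auto simp: vimage_def)
  have jsJ: "js ! i \<in> J" if "i < length js" for i
    using J0(1) js nth_mem[OF that] by auto
  let ?r = "length js"
  let ?k = "\<lambda>j. fst (js ! j)" and ?\<chi> = "\<lambda>j. fst (snd (js ! j))" and ?c = "\<lambda>j. snd (snd (js ! j))"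
  let ?\<tau> = "\<lambda>j. W (js ! j)"
  \<comment> \<open>The candidates have codes of different lengths, which are padded to the common
    length \<open>K\<close>; zero is inserted in case there are no candidates.\<close>
  define K where "K = Max (insert 0 (?k ` {..<?r}))"
  have kK: "?k j \<le> K" if "j < ?r" for j unfolding K_def using that by (intro Max_ge) auto
  have Wj: "sat M a \<alpha> (?\<tau> j) \<longleftrightarrow> ?T (?k j) (?\<chi> j) (?c j) a \<alpha>"
    if "j < ?r" "a \<in> tuples p (carrier M)" "\<alpha> \<in> tuples q (RV M)" for j a \<alpha>
    using WA[OF jsJ[OF that(1)], THEN spec, THEN mp, OF vfs] that unfolding defs_def by simp
  have wf\<tau>: "wf_form L p q (?\<tau> j)" if "j < ?r" for j using wfW jsJ that by simp
  have wf\<chi>: "wf_form L (l + p) (?k j + q) (?\<chi> j)" if "j < ?r" for j using jsJ[OF that] by (auto simp: J_def)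
  have wfc: "wf_form L (i + Suc p) (?k j + q) (?c j i)" if "j < ?r" "i < l" for j i using jsJ[OF that(1)] that(2) by (auto simp: J_def)
  define has where "has a \<alpha> = (\<exists>j<?r. sat M a \<alpha> (?\<tau> j))" for a \<alpha>
  \<comment> \<open>The first candidate that works. Taking the first one makes the choice definable
    in the parameters.\<close>
  define jj where "jj a \<alpha> = (LEAST j. j < ?r \<and> sat M a \<alpha> (?\<tau> j))" for a \<alpha>
  have jj: "jj a \<alpha> < ?r" "sat M a \<alpha> (?\<tau> (jj a \<alpha>))" if "has a \<alpha>" for a \<alpha>
    using that LeastI_ex[of "\<lambda>j. j < ?r \<and> sat M a \<alpha> (?\<tau> j)"] unfolding has_def jj_def by auto
  have jj_eq: "j < ?r \<and> sat M a \<alpha> (?\<tau> j) \<and> (\<forall>j'<j. \<not> sat M a \<alpha> (?\<tau> j')) \<longleftrightarrow> has a \<alpha> \<and> j = jj a \<alpha>" for a \<alpha> j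
  proof
    assume *: "j < ?r \<and> sat M a \<alpha> (?\<tau> j) \<and> (\<forall>j'<j. \<not> sat M a \<alpha> (?\<tau> j'))"
    then have "jj a \<alpha> = j" unfolding jj_def by (intro Least_equality) (auto simp: not_less[symmetric])
    then show "has a \<alpha> \<and> j = jj a \<alpha>" using * by (auto simp: has_def)
  next
    assume *: "has a \<alpha> \<and> j = jj a \<alpha>"
    have "\<not> sat M a \<alpha> (?\<tau> j')" if "j' < jj a \<alpha>" for j'
      using not_less_Least[of j' "\<lambda>j. j < ?r \<and> sat M a \<alpha> (?\<tau> j)"] that jj(1)[of a \<alpha>] * unfolding jj_def[symmetric] by auto
    then show "j < ?r \<and> sat M a \<alpha> (?\<tau> j) \<and> (\<forall>j'<j. \<not> sat M a \<alpha> (?\<tau> j'))" using * jj by auto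
  qed
  define \<chi>j where "\<chi>j a \<alpha> x = (THE \<xi>. \<xi> \<in> tuples (?k (jj a \<alpha>)) (RV M) \<and> sat M (x @ a) (\<xi> @ \<alpha>) (?\<chi> (jj a \<alpha>)))" for a \<alpha> x
  define cj where "cj a \<alpha> \<xi> i z = (THE y. y \<in> carrier M \<and> sat M (z @ y # a) (\<xi> @ \<alpha>) (?c (jj a \<alpha>) i))" for a \<alpha> \<xi> i z
  have \<chi>j: "\<chi>j a \<alpha> x \<in> tuples (?k (jj a \<alpha>)) (RV M)"
    "\<And>\<zeta>. \<zeta> \<in> tuples (?k (jj a \<alpha>)) (RV M) \<Longrightarrow> sat M (x @ a) (\<zeta> @ \<alpha>) (?\<chi> (jj a \<alpha>)) \<longleftrightarrow> \<zeta> = \<chi>j a \<alpha> x"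
    if h: "has a \<alpha>" "a \<in> tuples p (carrier M)" "\<alpha> \<in> tuples q (RV M)" "x \<in> tuples l (carrier M)" for a \<alpha> x
  proof -
    have T: "?T (?k (jj a \<alpha>)) (?\<chi> (jj a \<alpha>)) (?c (jj a \<alpha>)) a \<alpha>"
      using Wj[OF jj(1)[OF h(1)] h(2,3)] jj(2)[OF h(1)] by simp
    obtain \<xi> where \<xi>: "\<xi> \<in> tuples (?k (jj a \<alpha>)) (RV M)"
      "\<And>\<zeta>. \<zeta> \<in> tuples (?k (jj a \<alpha>)) (RV M) \<Longrightarrow> sat M (x @ a) (\<zeta> @ \<alpha>) (?\<chi> (jj a \<alpha>)) \<longleftrightarrow> \<zeta> = \<xi>"
      using T[unfolded T_ok_def, THEN conjunct1, THEN bspec, OF h(4)] by blast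
    then have "\<chi>j a \<alpha> x = \<xi>" unfolding \<chi>j_def by (intro the_equality) auto
    then show "\<chi>j a \<alpha> x \<in> tuples (?k (jj a \<alpha>)) (RV M)"
      "\<And>\<zeta>. \<zeta> \<in> tuples (?k (jj a \<alpha>)) (RV M) \<Longrightarrow> sat M (x @ a) (\<zeta> @ \<alpha>) (?\<chi> (jj a \<alpha>)) \<longleftrightarrow> \<zeta> = \<chi>j a \<alpha> x"
      using \<xi> by auto
  qed
  have cj: "cj a \<alpha> \<xi> i z \<in> carrier M"
    "\<And>u. u \<in> carrier M \<Longrightarrow> sat M (z @ u # a) (\<xi> @ \<alpha>) (?c (jj a \<alpha>) i) \<longleftrightarrow> u = cj a \<alpha> \<xi> i z"
    if h: "has a \<alpha>" "a \<in> tuples p (carrier M)" "\<alpha> \<in> tuples q (RV M)" "\<xi> \<in> tuples (?k (jj a \<alpha>)) (RV M)" "i < l"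
      "z \<in> tuples i (carrier M)" for a \<alpha> \<xi> i z
  proof -
    have T: "?T (?k (jj a \<alpha>)) (?\<chi> (jj a \<alpha>)) (?c (jj a \<alpha>)) a \<alpha>"
      using Wj[OF jj(1)[OF h(1)] h(2,3)] jj(2)[OF h(1)] by simp
    obtain y where y: "y \<in> carrier M" "\<And>u. u \<in> carrier M \<Longrightarrow> sat M (z @ u # a) (\<xi> @ \<alpha>) (?c (jj a \<alpha>) i) \<longleftrightarrow> u = y"
      using T[unfolded T_ok_def, THEN conjunct2, THEN conjunct1, THEN spec, THEN mp, OF h(5), THEN bspec, OF h(6), THEN bspec, OF h(4)]
      by blast
    then have "cj a \<alpha> \<xi> i z = y" unfolding cj_def by (intro the_equality) auto
    then show "cj a \<alpha> \<xi> i z \<in> carrier M"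
      "\<And>u. u \<in> carrier M \<Longrightarrow> sat M (z @ u # a) (\<xi> @ \<alpha>) (?c (jj a \<alpha>) i) \<longleftrightarrow> u = cj a \<alpha> \<xi> i z"
      using y by auto
  qed
  let ?O = "\<lambda>n. replicate n (rv M \<zero>)"
  have O: "?O n \<in> tuples n (RV M)" for n by (auto simp: tuples_def)
  \<comment> \<open>For fixed parameters the index \<open>jj a \<alpha>\<close> is fixed and the
    padding constant, so the fibres are those of the chosen candidate.\<close>
  define \<chi> where "\<chi> a \<alpha> x = (if has a \<alpha> then \<chi>j a \<alpha> x @ ?O (K - ?k (jj a \<alpha>)) else ?O K)" for a \<alpha> x
  define c where "c a \<alpha> \<xi> i z = (if has a \<alpha> then cj a \<alpha> (take (?k (jj a \<alpha>)) \<xi>) i z else \<zero>\<^bsub>M\<^esub>)" for a \<alpha> \<xi> i z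
  have "\<exists>\<phi>. defs L M \<phi> (l + p) (K + q) (\<lambda>xs \<xi>s.
      (\<exists>j<?r. (sat M (drop l xs) (drop K \<xi>s) (?\<tau> j) \<and> (\<forall>j'<j. \<not> sat M (drop l xs) (drop K \<xi>s) (?\<tau> j'))) \<and>
         drop (?k j) (take K \<xi>s) = ?O (K - ?k j) \<and>
         sat M (take l xs @ drop l xs) (take (?k j) \<xi>s @ drop K \<xi>s) (?\<chi> j)) \<or>
      ((\<forall>j<?r. \<not> sat M (drop l xs) (drop K \<xi>s) (?\<tau> j)) \<and> take K \<xi>s = ?O K))"
    by (rule exI, (rule d_intros d_sub[OF d_self[OF wf\<tau>]] d_sub[OF d_self[OF wf\<chi>]] tm_intros kK le_trans[OF kK] | assumption | (simp; fail))+)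
  then obtain \<phi>\<chi> where \<phi>\<chi>: "defs L M \<phi>\<chi> (l + p) (K + q) (\<lambda>xs \<xi>s.
      (\<exists>j<?r. (sat M (drop l xs) (drop K \<xi>s) (?\<tau> j) \<and> (\<forall>j'<j. \<not> sat M (drop l xs) (drop K \<xi>s) (?\<tau> j'))) \<and>
         drop (?k j) (take K \<xi>s) = ?O (K - ?k j) \<and>
         sat M (take l xs @ drop l xs) (take (?k j) \<xi>s @ drop K \<xi>s) (?\<chi> j)) \<or>
      ((\<forall>j<?r. \<not> sat M (drop l xs) (drop K \<xi>s) (?\<tau> j)) \<and> take K \<xi>s = ?O K))" by blast
  have D1: "defs L M \<phi>\<chi> (l + p) (K + q) (\<lambda>xs \<xi>s. take K \<xi>s = \<chi> (drop l xs) (drop K \<xi>s) (take l xs))"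
  proof (rule d_cong[OF \<phi>\<chi>])
    fix xs \<xi>s assume xs: "xs \<in> tuples (l + p) (carrier M)" and \<xi>s: "\<xi>s \<in> tuples (K + q) (RV M)"
    define a \<alpha> x \<xi> where "a = drop l xs" "\<alpha> = drop K \<xi>s" "x = take l xs" "\<xi> = take K \<xi>s"
    note defs' = a_\<alpha>_x_\<xi>_def
    have c: "a \<in> tuples p (carrier M)" "\<alpha> \<in> tuples q (RV M)" "x \<in> tuples l (carrier M)" "\<xi> \<in> tuples K (RV M)"
      unfolding defs' using tuples_drop_add[OF xs] tuples_drop_add[OF \<xi>s] tuples_take_add[OF xs] tuples_take_add[OF \<xi>s] by auto
    have tk: "take (?k j) \<xi>s = take (?k j) \<xi>" if "j < ?r" for j
      using kK[OF that] by (simp add: defs' min_def)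
    have "(\<exists>j<?r. (sat M a \<alpha> (?\<tau> j) \<and> (\<forall>j'<j. \<not> sat M a \<alpha> (?\<tau> j'))) \<and>
         drop (?k j) \<xi> = ?O (K - ?k j) \<and> sat M (x @ a) (take (?k j) \<xi> @ \<alpha>) (?\<chi> j)) \<longleftrightarrow>
       has a \<alpha> \<and> drop (?k (jj a \<alpha>)) \<xi> = ?O (K - ?k (jj a \<alpha>)) \<and> sat M (x @ a) (take (?k (jj a \<alpha>)) \<xi> @ \<alpha>) (?\<chi> (jj a \<alpha>))"
      by (rule ex_less_eq[OF jj_eq])
    also have "\<dots> \<longleftrightarrow> has a \<alpha> \<and> \<xi> = \<chi>j a \<alpha> x @ ?O (K - ?k (jj a \<alpha>))"
    proof (cases "has a \<alpha>")
      case True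
      have t: "take (?k (jj a \<alpha>)) \<xi> \<in> tuples (?k (jj a \<alpha>)) (RV M)"
        using tuples_take[OF c(4) kK[OF jj(1)[OF True]]] .
      have "length (\<chi>j a \<alpha> x) = ?k (jj a \<alpha>)" using \<chi>j(1)[OF True c(1-3)] tuples_length by blast
      then have "\<xi> = \<chi>j a \<alpha> x @ ?O (K - ?k (jj a \<alpha>)) \<longleftrightarrow> take (?k (jj a \<alpha>)) \<xi> = \<chi>j a \<alpha> x \<and> drop (?k (jj a \<alpha>)) \<xi> = ?O (K - ?k (jj a \<alpha>))"
        by (metis append_eq_conv_conj append_take_drop_id)
      then show ?thesis using \<chi>j(2)[OF True c(1-3) t] by blast
    qed simp
    finally have 1: "(\<exists>j<?r. (sat M a \<alpha> (?\<tau> j) \<and> (\<forall>j'<j. \<not> sat M a \<alpha> (?\<tau> j'))) \<and>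
         drop (?k j) \<xi> = ?O (K - ?k j) \<and> sat M (x @ a) (take (?k j) \<xi> @ \<alpha>) (?\<chi> j)) \<longleftrightarrow>
       has a \<alpha> \<and> \<xi> = \<chi>j a \<alpha> x @ ?O (K - ?k (jj a \<alpha>))" .
    have 2: "(\<exists>j<?r. (sat M a \<alpha> (?\<tau> j) \<and> (\<forall>j'<j. \<not> sat M a \<alpha> (?\<tau> j'))) \<and>
         drop (?k j) \<xi> = ?O (K - ?k j) \<and> sat M (x @ a) (take (?k j) \<xi>s @ \<alpha>) (?\<chi> j)) \<longleftrightarrow>
        (\<exists>j<?r. (sat M a \<alpha> (?\<tau> j) \<and> (\<forall>j'<j. \<not> sat M a \<alpha> (?\<tau> j'))) \<and>
         drop (?k j) \<xi> = ?O (K - ?k j) \<and> sat M (x @ a) (take (?k j) \<xi> @ \<alpha>) (?\<chi> j))"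
      using tk by metis
    have 3: "(\<forall>j<?r. \<not> sat M a \<alpha> (?\<tau> j)) \<longleftrightarrow> \<not> has a \<alpha>" by (auto simp: has_def)
    show "take K \<xi>s = \<chi> (drop l xs) (drop K \<xi>s) (take l xs) \<longleftrightarrow>
      (\<exists>j<?r. (sat M (drop l xs) (drop K \<xi>s) (?\<tau> j) \<and> (\<forall>j'<j. \<not> sat M (drop l xs) (drop K \<xi>s) (?\<tau> j'))) \<and>
         drop (?k j) (take K \<xi>s) = ?O (K - ?k j) \<and>
         sat M (take l xs @ drop l xs) (take (?k j) \<xi>s @ drop K \<xi>s) (?\<chi> j)) \<or>
      ((\<forall>j<?r. \<not> sat M (drop l xs) (drop K \<xi>s) (?\<tau> j)) \<and> take K \<xi>s = ?O K)"
      unfolding defs'[symmetric] 2 1 3 \<chi>_def by auto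
  qed
  have D2: "\<exists>\<phi>. defs L M \<phi> (i + Suc p) (K + q)
       (\<lambda>xs \<xi>s. xs ! i = c (drop (Suc i) xs) (drop K \<xi>s) (take K \<xi>s) i (take i xs))" if i: "i < l" for i
  proof -
    have "\<exists>\<phi>. defs L M \<phi> (i + Suc p) (K + q) (\<lambda>xs \<xi>s.
      (\<exists>j<?r. (sat M (drop (Suc i) xs) (drop K \<xi>s) (?\<tau> j) \<and> (\<forall>j'<j. \<not> sat M (drop (Suc i) xs) (drop K \<xi>s) (?\<tau> j'))) \<and>
         sat M xs (take (?k j) \<xi>s @ drop K \<xi>s) (?c j i)) \<or>
      ((\<forall>j<?r. \<not> sat M (drop (Suc i) xs) (drop K \<xi>s) (?\<tau> j)) \<and> xs ! i = \<zero>))"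
      by (rule exI, (rule d_intros d_sub[OF d_self[OF wf\<tau>]] d_sub[OF d_self[OF wfc[OF _ i]]] tm_intros kK le_trans[OF kK] | assumption | (simp; fail))+)
    then obtain \<phi> where \<phi>: "defs L M \<phi> (i + Suc p) (K + q) (\<lambda>xs \<xi>s.
      (\<exists>j<?r. (sat M (drop (Suc i) xs) (drop K \<xi>s) (?\<tau> j) \<and> (\<forall>j'<j. \<not> sat M (drop (Suc i) xs) (drop K \<xi>s) (?\<tau> j'))) \<and>
         sat M xs (take (?k j) \<xi>s @ drop K \<xi>s) (?c j i)) \<or>
      ((\<forall>j<?r. \<not> sat M (drop (Suc i) xs) (drop K \<xi>s) (?\<tau> j)) \<and> xs ! i = \<zero>))" by blast
    show ?thesis
    proof (rule exI, rule d_cong[OF \<phi>])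
      fix xs \<xi>s assume xs: "xs \<in> tuples (i + Suc p) (carrier M)" and \<xi>s: "\<xi>s \<in> tuples (K + q) (RV M)"
      define a \<alpha> z \<xi> y where "a = drop (Suc i) xs" "\<alpha> = drop K \<xi>s" "z = take i xs" "\<xi> = take K \<xi>s" "y = xs ! i"
      note defs' = a_\<alpha>_z_\<xi>_y_def
      have c': "a \<in> tuples p (carrier M)" "\<alpha> \<in> tuples q (RV M)" "z \<in> tuples i (carrier M)" "\<xi> \<in> tuples K (RV M)" "y \<in> carrier M"
        unfolding defs' using tuples_drop[OF xs, of "Suc i"] tuples_drop_add[OF \<xi>s] tuples_take_add[OF xs] tuples_take_add[OF \<xi>s]
          tuples_nth[OF xs, of i] by auto
      have xs_eq: "xs = z @ y # a" unfolding defs' using tuples_length[OF xs] by (simp add: id_take_nth_drop[symmetric])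
      have tk: "take (?k j) \<xi>s = take (?k j) \<xi>" if "j < ?r" for j
        using kK[OF that] by (simp add: defs' min_def)
      have "(\<exists>j<?r. (sat M a \<alpha> (?\<tau> j) \<and> (\<forall>j'<j. \<not> sat M a \<alpha> (?\<tau> j'))) \<and> sat M (z @ y # a) (take (?k j) \<xi>s @ \<alpha>) (?c j i)) \<longleftrightarrow>
         has a \<alpha> \<and> sat M (z @ y # a) (take (?k (jj a \<alpha>)) \<xi>s @ \<alpha>) (?c (jj a \<alpha>) i)"
        by (rule ex_less_eq[OF jj_eq])
      also have "\<dots> \<longleftrightarrow> has a \<alpha> \<and> y = cj a \<alpha> (take (?k (jj a \<alpha>)) \<xi>) i z"
      proof (cases "has a \<alpha>")
        case True
        have t: "take (?k (jj a \<alpha>)) \<xi> \<in> tuples (?k (jj a \<alpha>)) (RV M)"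
          using tuples_take[OF c'(4) kK[OF jj(1)[OF True]]] .
        show ?thesis unfolding tk[OF jj(1)[OF True]] using cj(2)[OF True c'(1,2) t i c'(3,5)] by simp
      qed simp
      finally have 1: "(\<exists>j<?r. (sat M a \<alpha> (?\<tau> j) \<and> (\<forall>j'<j. \<not> sat M a \<alpha> (?\<tau> j'))) \<and> sat M (z @ y # a) (take (?k j) \<xi>s @ \<alpha>) (?c j i)) \<longleftrightarrow>
         has a \<alpha> \<and> y = cj a \<alpha> (take (?k (jj a \<alpha>)) \<xi>) i z" .
      have 3: "(\<forall>j<?r. \<not> sat M a \<alpha> (?\<tau> j)) \<longleftrightarrow> \<not> has a \<alpha>" by (auto simp: has_def)
      have "y = c a \<alpha> \<xi> i z \<longleftrightarrow>
         (\<exists>j<?r. (sat M a \<alpha> (?\<tau> j) \<and> (\<forall>j'<j. \<not> sat M a \<alpha> (?\<tau> j'))) \<and> sat M (z @ y # a) (take (?k j) \<xi>s @ \<alpha>) (?c j i)) \<or>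
         ((\<forall>j<?r. \<not> sat M a \<alpha> (?\<tau> j)) \<and> y = \<zero>)"
        unfolding 1 3 c_def by auto
      then show "xs ! i = c (drop (Suc i) xs) (drop K \<xi>s) (take K \<xi>s) i (take i xs) \<longleftrightarrow>
         (\<exists>j<?r. (sat M (drop (Suc i) xs) (drop K \<xi>s) (?\<tau> j) \<and> (\<forall>j'<j. \<not> sat M (drop (Suc i) xs) (drop K \<xi>s) (?\<tau> j'))) \<and>
         sat M xs (take (?k j) \<xi>s @ drop K \<xi>s) (?c j i)) \<or>
      ((\<forall>j<?r. \<not> sat M (drop (Suc i) xs) (drop K \<xi>s) (?\<tau> j)) \<and> xs ! i = \<zero>)"
        unfolding defs'[symmetric] using xs_eq by simp
    qed
  qed
  have D3: "\<chi> a \<alpha> x \<in> tuples K (RV M)"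
    if "a \<in> tuples p (carrier M)" "\<alpha> \<in> tuples q (RV M)" "x \<in> tuples l (carrier M)" for a \<alpha> x
  proof (cases "has a \<alpha>")
    case True
    have "?k (jj a \<alpha>) + (K - ?k (jj a \<alpha>)) = K" using kK[OF jj(1)[OF True]] by simp
    then show ?thesis using tuples_append[OF \<chi>j(1)[OF True that] O] True by (metis \<chi>_def)
  qed (simp add: \<chi>_def O)
  have D4: "c a \<alpha> \<xi> i z \<in> carrier M"
    if "a \<in> tuples p (carrier M)" "\<alpha> \<in> tuples q (RV M)" "\<xi> \<in> tuples K (RV M)" "i < l" "z \<in> tuples i (carrier M)" for a \<alpha> \<xi> i z
  proof (cases "has a \<alpha>")
    case True
    then show ?thesis using cj(1)[OF True that(1,2) tuples_take[OF that(3) kK[OF jj(1)[OF True]]] that(4,5)] by (simp add: c_def)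
  qed (simp add: c_def)
  have D5: "okb M l {x \<in> tuples l (carrier M). \<chi> a \<alpha> x = \<chi> a \<alpha> x0} (c a \<alpha> (\<chi> a \<alpha> x0)) f \<psi> x0"
    if a: "a \<in> tuples p (carrier M)" "\<alpha> \<in> tuples q (RV M)"
      and f\<psi>: "\<forall>x\<in>tuples l (carrier M). f x \<in> carrier M \<and> \<psi> x \<in> tuples k' (RV M) \<and>
            (\<forall>u\<in>carrier M. sat M (x @ u # a) \<alpha> \<theta>f \<longleftrightarrow> u = f x) \<and>
            (\<forall>\<zeta>\<in>tuples k' (RV M). sat M (x @ a) (\<zeta> @ \<alpha>) \<theta>\<psi> \<longleftrightarrow> \<zeta> = \<psi> x)"
      and x0: "x0 \<in> tuples l (carrier M)" for a \<alpha> f \<psi> x0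
  proof -
    have "fun_ok M l k' (?F a \<alpha>) (?P a \<alpha>)" unfolding fun_ok_def using f\<psi> by blast
    then have "sat M a \<alpha> \<phi>0" using \<phi>0(1)[OF vfs] a by (simp add: defs_def)
    then obtain j where "Some j \<in> J0" "sat M a \<alpha> (W j)"
      using J0(3)[OF a] by (auto simp: W'_def split: option.splits)
    then have h: "has a \<alpha>" using js unfolding has_def by (metis in_set_conv_nth mem_Collect_eq)
    let ?j = "jj a \<alpha>"
    let ?\<xi> = "\<chi>j a \<alpha> x0"
    note \<chi>jh = \<chi>j[OF h a] and cjh = cj[OF h a]
    have \<xi>: "?\<xi> \<in> tuples (?k ?j) (RV M)" using \<chi>jh(1)[OF x0] .
    have T: "?T (?k ?j) (?\<chi> ?j) (?c ?j) a \<alpha>" using jj[OF h] Wj[OF _ a] by blast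
    have s0: "sat M (x0 @ a) (?\<xi> @ \<alpha>) (?\<chi> ?j)" using \<chi>jh(2)[OF x0 \<xi>] by simp
    have "okR M l k' (\<lambda>x. sat M (x @ a) (?\<xi> @ \<alpha>) (?\<chi> ?j)) (\<lambda>i z u. sat M (z @ u # a) (?\<xi> @ \<alpha>) (?c ?j i)) (?F a \<alpha>) (?P a \<alpha>) x0"
      using T x0 \<xi> s0 unfolding T_ok_def by blast
    then have "okb M l {x \<in> tuples l (carrier M). sat M (x @ a) (?\<xi> @ \<alpha>) (?\<chi> ?j)} (cj a \<alpha> ?\<xi>) f \<psi> x0"
      by (subst (asm) okR_iff[where C = "cj a \<alpha> ?\<xi>" and f = f and \<psi> = \<psi>]) (use cjh[OF \<xi>] f\<psi> x0 in auto)
    moreover have "{x \<in> tuples l (carrier M). sat M (x @ a) (?\<xi> @ \<alpha>) (?\<chi> ?j)} = {x \<in> tuples l (carrier M). \<chi> a \<alpha> x = \<chi> a \<alpha> x0}"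
      using \<chi>jh(2)[OF _ \<xi>] h by (auto simp: \<chi>_def)
    moreover have "c a \<alpha> (\<chi> a \<alpha> x0) = cj a \<alpha> ?\<xi>"
      using h tuples_length[OF \<xi>] by (intro ext) (simp add: c_def \<chi>_def)
    ultimately show ?thesis by simp
  qed
  show ?thesis
    by (rule exI[of _ K], rule exI[of _ \<chi>], rule exI[of _ c], intro conjI ballI allI impI, rule exI[where x = \<phi>\<chi>], rule D1, erule D2,
        (rule D3; assumption), (rule D4; assumption), (rule D5; assumption))
qed

end

section \<open>Root polynomials and their values at finitely many points\<close>

context vfield
begin

text \<open>Polynomial functions with fewer than \<open>n\<close> coefficients, described by iterated difference quotients;
  this makes the bound on the number of roots immediate.\<close>

primrec polyfun :: "nat \<Rightarrow> ('u \<Rightarrow> 'u) \<Rightarrow> bool" where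
  "polyfun 0 f = (\<forall>x\<in>carrier M. f x = \<zero>)"
| "polyfun (Suc n) f = (\<forall>r\<in>carrier M. f r \<in> carrier M \<and>
     (\<exists>h. polyfun n h \<and> (\<forall>x\<in>carrier M. h x \<in> carrier M \<and> f x = f r \<oplus> (x \<ominus> r) \<otimes> h x)))"

lemma polyfun_SucD:
  "polyfun (Suc n) f \<Longrightarrow> r \<in> carrier M \<Longrightarrow>
   \<exists>h. polyfun n h \<and> (\<forall>x\<in>carrier M. h x \<in> carrier M \<and> f x = f r \<oplus> (x \<ominus> r) \<otimes> h x)"
  by simp

lemma polyfun_closed: "polyfun n f \<Longrightarrow> x \<in> carrier M \<Longrightarrow> f x \<in> carrier M"
  by (cases n) auto

lemma polyfun_Suc: "polyfun n f \<Longrightarrow> polyfun (Suc n) f"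
proof (induction n arbitrary: f)
  case 0
  then show ?case by (auto intro!: exI[of _ "\<lambda>_. \<zero>"])
next
  case (Suc n)
  show ?case unfolding polyfun.simps(2)[of "Suc n"]
  proof (intro ballI conjI)
    fix r assume r: "r \<in> carrier M"
    show "f r \<in> carrier M" using Suc.prems r by auto
    obtain h where "polyfun n h" "\<forall>x\<in>carrier M. h x \<in> carrier M \<and> f x = f r \<oplus> (x \<ominus> r) \<otimes> h x"
      using Suc.prems r by auto
    then show "\<exists>h. polyfun (Suc n) h \<and> (\<forall>x\<in>carrier M. h x \<in> carrier M \<and> f x = f r \<oplus> (x \<ominus> r) \<otimes> h x)"
      using Suc.IH[of h] by blast
  qed
qed

lemma polyfun_mono: "polyfun n f \<Longrightarrow> n \<le> m \<Longrightarrow> polyfun m f"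
proof (induction m)
  case (Suc m)
  then show ?case using polyfun_Suc[of m f] by (cases "n = Suc m") auto
qed simp

lemma polyfun_scale: "c \<in> carrier M \<Longrightarrow> polyfun n f \<Longrightarrow> polyfun n (\<lambda>x. c \<otimes> f x)"
proof (induction n arbitrary: f)
  case (Suc n)
  show ?case unfolding polyfun.simps(2)
  proof (intro ballI conjI)
    fix r assume r: "r \<in> carrier M"
    have fr: "f r \<in> carrier M" using Suc.prems r by auto
    then show "c \<otimes> f r \<in> carrier M" using Suc.prems by simp
    obtain h where h: "polyfun n h" "\<forall>x\<in>carrier M. h x \<in> carrier M \<and> f x = f r \<oplus> (x \<ominus> r) \<otimes> h x"
      using Suc.prems r by auto
    have "c \<otimes> f x = c \<otimes> f r \<oplus> (x \<ominus> r) \<otimes> (c \<otimes> h x)" if "x \<in> carrier M" for x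
    proof -
      have "c \<otimes> (f r \<oplus> (x \<ominus> r) \<otimes> h x) = c \<otimes> f r \<oplus> (x \<ominus> r) \<otimes> (c \<otimes> h x)"
        using Suc.prems(1) fr r that h(2)[rule_format, OF that, THEN conjunct1] by algebra
      then show ?thesis using h(2)[rule_format, OF that] by metis
    qed
    then show "\<exists>h. polyfun n h \<and> (\<forall>x\<in>carrier M. h x \<in> carrier M \<and> c \<otimes> f x = c \<otimes> f r \<oplus> (x \<ominus> r) \<otimes> h x)"
      using Suc.IH[OF Suc.prems(1) h(1)] h(2) Suc.prems(1) by (intro exI[of _ "\<lambda>x. c \<otimes> h x"]) auto
  qed
qed simp

lemma polyfun_add: "polyfun n f \<Longrightarrow> polyfun n g \<Longrightarrow> polyfun n (\<lambda>x. f x \<oplus> g x)"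
proof (induction n arbitrary: f g)
  case (Suc n)
  show ?case unfolding polyfun.simps(2)
  proof (intro ballI conjI)
    fix r assume r: "r \<in> carrier M"
    have fr: "f r \<in> carrier M" "g r \<in> carrier M" using Suc.prems r by auto
    then show "f r \<oplus> g r \<in> carrier M" by simp
    obtain h where h: "polyfun n h" "\<forall>x\<in>carrier M. h x \<in> carrier M \<and> f x = f r \<oplus> (x \<ominus> r) \<otimes> h x"
      using polyfun_SucD[OF Suc.prems(1) r] by blast
    obtain k where k: "polyfun n k" "\<forall>x\<in>carrier M. k x \<in> carrier M \<and> g x = g r \<oplus> (x \<ominus> r) \<otimes> k x"
      using polyfun_SucD[OF Suc.prems(2) r] by blast
    have "f x \<oplus> g x = (f r \<oplus> g r) \<oplus> (x \<ominus> r) \<otimes> (h x \<oplus> k x)" if "x \<in> carrier M" for x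
    proof -
      have "x \<ominus> r \<in> carrier M" using that r by simp
      then have "(f r \<oplus> (x \<ominus> r) \<otimes> h x) \<oplus> (g r \<oplus> (x \<ominus> r) \<otimes> k x) = (f r \<oplus> g r) \<oplus> (x \<ominus> r) \<otimes> (h x \<oplus> k x)"
        using fr h(2)[rule_format, OF that, THEN conjunct1] k(2)[rule_format, OF that, THEN conjunct1]
        by (simp add: r_distr a_ac)
      then show ?thesis
        unfolding h(2)[rule_format, OF that, THEN conjunct2, symmetric] k(2)[rule_format, OF that, THEN conjunct2, symmetric] .
    qed
    then show "\<exists>h. polyfun n h \<and> (\<forall>x\<in>carrier M. h x \<in> carrier M \<and> f x \<oplus> g x = f r \<oplus> g r \<oplus> (x \<ominus> r) \<otimes> h x)"
      using Suc.IH[OF h(1) k(1)] h(2) k(2) by (intro exI[of _ "\<lambda>x. h x \<oplus> k x"]) auto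
  qed
qed simp

text \<open>The product rule for difference quotients: if \<open>h\<close> is the quotient of
  \<open>f\<close> at \<open>r\<close>, then that of \<open>(x - z) f\<close> is
  \<open>f + (r - z) h\<close>.\<close>

lemma polyfun_mult_linear:
  assumes z: "z \<in> carrier M" and f: "polyfun n f"
  shows "polyfun (Suc n) (\<lambda>x. (x \<ominus> z) \<otimes> f x)"
proof (cases n)
  case 0
  then have "polyfun 0 (\<lambda>x. (x \<ominus> z) \<otimes> f x)" using f z by auto
  then show ?thesis using polyfun_Suc 0 by blast
next
  case (Suc m)
  show ?thesis unfolding polyfun.simps(2)
  proof (intro ballI conjI)
    fix r assume r: "r \<in> carrier M"
    have fr: "f r \<in> carrier M" using polyfun_closed f r by auto
    then show "(r \<ominus> z) \<otimes> f r \<in> carrier M" using z r by simp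
    obtain h where h: "polyfun m h" "\<forall>x\<in>carrier M. h x \<in> carrier M \<and> f x = f r \<oplus> (x \<ominus> r) \<otimes> h x"
      using f r Suc by auto
    have "polyfun n (\<lambda>x. f x \<oplus> (r \<ominus> z) \<otimes> h x)"
      using polyfun_add[OF f polyfun_scale[of "r \<ominus> z"]] polyfun_Suc[OF h(1)] Suc r z by simp
    moreover have "f x \<oplus> (r \<ominus> z) \<otimes> h x \<in> carrier M \<and>
        (x \<ominus> z) \<otimes> f x = (r \<ominus> z) \<otimes> f r \<oplus> (x \<ominus> r) \<otimes> (f x \<oplus> (r \<ominus> z) \<otimes> h x)" if x: "x \<in> carrier M" for x
    proof -
      have c: "f x \<in> carrier M" "h x \<in> carrier M" using polyfun_closed[OF f x] h x by auto
      have e: "f x = f r \<oplus> (x \<ominus> r) \<otimes> h x" using h x by blast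
      have "(x \<ominus> z) \<otimes> (f r \<oplus> (x \<ominus> r) \<otimes> h x) =
          (r \<ominus> z) \<otimes> f r \<oplus> (x \<ominus> r) \<otimes> ((f r \<oplus> (x \<ominus> r) \<otimes> h x) \<oplus> (r \<ominus> z) \<otimes> h x)"
        using x z r fr c(2) by algebra
      then show ?thesis using c r z unfolding e[symmetric] by simp
    qed
    ultimately show "\<exists>h. polyfun n h \<and> (\<forall>x\<in>carrier M. h x \<in> carrier M \<and>
        (x \<ominus> z) \<otimes> f x = (r \<ominus> z) \<otimes> f r \<oplus> (x \<ominus> r) \<otimes> h x)" by blast
  qed
qed

text \<open>At a root \<open>r\<close> the difference quotient is the cofactor of
  \<open>x - r\<close>. It vanishes at the other points of \<open>B\<close>, so the induction
  applies to it.\<close>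

lemma polyfun_roots:
  "polyfun n f \<Longrightarrow> B \<subseteq> carrier M \<Longrightarrow> finite B \<Longrightarrow> card B = n \<Longrightarrow> (\<And>b. b \<in> B \<Longrightarrow> f b = \<zero>) \<Longrightarrow>
   x \<in> carrier M \<Longrightarrow> f x = \<zero>"
proof (induction n arbitrary: f B x)
  case (Suc n)
  obtain r where r: "r \<in> B" using Suc.prems(4) by fastforce
  then have rc: "r \<in> carrier M" using Suc.prems by auto
  obtain h where h: "polyfun n h" "\<forall>x\<in>carrier M. h x \<in> carrier M \<and> f x = f r \<oplus> (x \<ominus> r) \<otimes> h x"
    using Suc.prems(1) rc by auto
  have e: "f x = (x \<ominus> r) \<otimes> h x" if "x \<in> carrier M" for x
    using h(2) that rc Suc.prems(5)[OF r] by simp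
  have "h b = \<zero>" if "b \<in> B - {r}" for b
  proof -
    have b: "b \<in> carrier M" "b \<noteq> r" "f b = \<zero>" using that Suc.prems by auto
    then have "b \<ominus> r \<noteq> \<zero>" using rc by (metis r_right_minus_eq)
    then show ?thesis using e[OF b(1)] b h(2) rc integral_iff by (metis minus_closed)
  qed
  then have "h x = \<zero>"
    using Suc.IH[OF h(1), of "B - {r}" x] Suc.prems r by auto
  then show ?case using e[OF Suc.prems(6)] Suc.prems(6) rc by simp
qed simp

declare polyfun.simps(2) [simp del]

text \<open>The value at \<open>b\<close> of the monic polynomial with simple roots exactly at
  \<open>S\<close>: a symmetric expression, which turns an unordered finite set into field
  elements.\<close>

definition rootprod :: "'u set \<Rightarrow> 'u \<Rightarrow> 'u" where
  "rootprod S b = finprod M (\<lambda>z. b \<ominus> z) S"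

lemma rootprod_insert:
  "finite S \<Longrightarrow> S \<subseteq> carrier M \<Longrightarrow> z \<in> carrier M \<Longrightarrow> z \<notin> S \<Longrightarrow> b \<in> carrier M \<Longrightarrow>
   rootprod (insert z S) b = (b \<ominus> z) \<otimes> rootprod S b"
  unfolding rootprod_def by (rule finprod_insert) auto

lemma rootprod_empty: "rootprod {} b = \<one>"
  by (simp add: rootprod_def)

lemma rootprod_closed: "S \<subseteq> carrier M \<Longrightarrow> b \<in> carrier M \<Longrightarrow> rootprod S b \<in> carrier M"
  unfolding rootprod_def by (rule finprod_closed) auto

lemma rootprod_zero_iff:
  "finite S \<Longrightarrow> S \<subseteq> carrier M \<Longrightarrow> b \<in> carrier M \<Longrightarrow> rootprod S b = \<zero> \<longleftrightarrow> b \<in> S"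
proof (induction S rule: finite_induct)
  case (insert z S)
  then show ?case using rootprod_insert[of S z b] rootprod_closed[of S b]
    by (simp add: integral_iff r_right_minus_eq)
qed (simp add: rootprod_empty)

lemma rootprod_list:
  "distinct zs \<Longrightarrow> set zs \<subseteq> carrier M \<Longrightarrow> b \<in> carrier M \<Longrightarrow>
   foldr (\<lambda>z u. (b \<ominus> z) \<otimes> u) zs \<one> = rootprod (set zs) b"
  by (induction zs) (simp_all add: rootprod_empty rootprod_insert)

lemma polyfun_cong: "polyfun n f \<Longrightarrow> (\<And>x. x \<in> carrier M \<Longrightarrow> f x = g x) \<Longrightarrow> polyfun n g"
  by (cases n) (auto simp: polyfun.simps(2))

lemma polyfun_rootprod: "finite S \<Longrightarrow> S \<subseteq> carrier M \<Longrightarrow> polyfun (Suc (card S)) (rootprod S)"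
proof (induction S rule: finite_induct)
  case empty
  have "polyfun 0 (\<lambda>_. \<zero>)" by simp
  then show ?case by (auto simp: rootprod_empty polyfun.simps(2) intro!: exI[of _ "\<lambda>_. \<zero>"])
next
  case (insert z S)
  have "polyfun (Suc (Suc (card S))) (\<lambda>x. (x \<ominus> z) \<otimes> rootprod S x)"
    by (rule polyfun_mult_linear) (use insert in auto)
  moreover have "(x \<ominus> z) \<otimes> rootprod S x = rootprod (insert z S) x" if "x \<in> carrier M" for x
    using rootprod_insert[of S z x] insert.hyps insert.prems that by simp
  ultimately show ?case unfolding card_insert_disjoint[OF insert.hyps] by (rule polyfun_cong)
qed

text \<open>Both polynomials have degree at most \<open>N\<close>, so their difference vanishes
  identically if it vanishes at \<open>N + 1\<close> points; then they have the same roots. The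
  sampling set \<open>B\<close> does not depend on \<open>S\<close> and \<open>S'\<close>.\<close>

lemma rootprod_inj:
  assumes S: "finite S" "S \<subseteq> carrier M" "card S \<le> N" and S': "finite S'" "S' \<subseteq> carrier M" "card S' \<le> N"
    and B: "B \<subseteq> carrier M" "finite B" "card B = Suc N" and e: "\<And>b. b \<in> B \<Longrightarrow> rootprod S b = rootprod S' b"
  shows "S = S'"
proof -
  let ?f = "\<lambda>x. rootprod S x \<oplus> (\<ominus> \<one>) \<otimes> rootprod S' x"
  have "polyfun (Suc N) ?f"
    using polyfun_mono[OF polyfun_rootprod[OF S(1,2)]] polyfun_mono[OF polyfun_rootprod[OF S'(1,2)]] S(3) S'(3)
    by (intro polyfun_add polyfun_scale) auto
  moreover have m: "u \<oplus> (\<ominus> \<one>) \<otimes> v = \<zero> \<longleftrightarrow> u = v" if "u \<in> carrier M" "v \<in> carrier M" for u v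
  proof -
    have "u \<oplus> (\<ominus> \<one>) \<otimes> v = u \<ominus> v" using that by algebra
    then show ?thesis using r_right_minus_eq that by simp
  qed
  moreover have "?f b = \<zero>" if "b \<in> B" for b
    using m[OF rootprod_closed[OF S(2)] rootprod_closed[OF S'(2)]] e[OF that] B(1) that by blast
  ultimately have "?f x = \<zero>" if "x \<in> carrier M" for x
    using polyfun_roots[where f = ?f, OF _ B _ that] by blast
  then have "rootprod S x = rootprod S' x" if "x \<in> carrier M" for x
    using m rootprod_closed[OF S(2)] rootprod_closed[OF S'(2)] that by blast
  then show ?thesis using rootprod_zero_iff[OF S(1,2)] rootprod_zero_iff[OF S'(1,2)] S(2) S'(2)
    by (metis subsetD subsetI subset_antisym)
qed

lemma tuples_of_carrier: "B \<subseteq> carrier M \<Longrightarrow> finite B \<Longrightarrow> \<exists>bs\<in>tuples (card B) (carrier M). distinct bs \<and> set bs = B"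
  using finite_distinct_list[of B] distinct_card by (fastforce simp: tuples_def)

text \<open>Translates a cardinality bound from its first-order form, the absence of
  \<open>n + 1\<close> distinct elements.\<close>

lemma card_le_if_no_tuple:
  assumes "\<not> (\<exists>ys\<in>tuples (Suc n) (carrier M). distinct ys \<and> (\<forall>i<Suc n. ys ! i \<in> Y))" "Y \<subseteq> carrier M"
  shows "finite Y \<and> card Y \<le> n"
proof (rule ccontr)
  assume "\<not> ?thesis"
  then obtain B where B: "B \<subseteq> Y" "finite B" "card B = Suc n"
    by (metis Suc_leI infinite_arbitrarily_large not_le obtain_subset_with_card_n)
  then obtain bs where bs: "bs \<in> tuples (Suc n) (carrier M)" "distinct bs" "set bs = B"
    using tuples_of_carrier[of B] assms(2) by auto
  then have "bs ! i \<in> Y" if "i < Suc n" for i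
    using B(1) nth_mem[of i bs] that tuples_length[OF bs(1)] by auto
  then show False using assms(1) bs by blast
qed

lemma rv_ball: "x \<in> carrier M \<Longrightarrow> x' \<in> carrier M \<Longrightarrow> vlt M (x' \<ominus> x) x \<Longrightarrow> rv M x' = rv M x"
  by (simp add: rv_eq_iff rveq_def)

end

section \<open>Uniform form of (D), and unions of finite sets indexed by RV\<close>

section \<open>Finiteness of unions over RV\<close>

text \<open>A first-order substitute for having an infinite fibre: the function defined by
  \<open>\<phi>\<close> takes the value \<open>y\<close> on a whole open ball.\<close>

definition ball_value :: "('f, 'r, 'u) vstruct \<Rightarrow> ('f, 'r) form \<Rightarrow> 'u list \<Rightarrow> 'u set list \<Rightarrow> 'u \<Rightarrow> bool" where
  "ball_value M \<phi> a \<alpha> y \<longleftrightarrow> (\<exists>b\<in>carrier M. \<exists>m\<in>carrier M. m \<noteq> \<zero>\<^bsub>M\<^esub> \<and>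
     (\<forall>x\<in>carrier M. vlt M (x \<ominus>\<^bsub>M\<^esub> b) m \<longrightarrow> sat M (y # x # a) \<alpha> \<phi>))"

definition D_ok :: "('f, 'r, 'u) vstruct \<Rightarrow> ('f, 'r) form \<Rightarrow> nat \<Rightarrow> 'u list \<Rightarrow> 'u set list \<Rightarrow> bool" where
  "D_ok M \<phi> n a \<alpha> \<longleftrightarrow>
     (\<forall>x\<in>carrier M. \<exists>y\<in>carrier M. \<forall>u\<in>carrier M. sat M (u # x # a) \<alpha> \<phi> \<longleftrightarrow> u = y) \<longrightarrow>
     \<not> (\<exists>ys\<in>tuples (Suc n) (carrier M). distinct ys \<and> (\<forall>i<Suc n. ball_value M \<phi> a \<alpha> (ys ! i)))"

context vstr
begin

schematic_goal D_ok_defs: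
  assumes "wf_form L (Suc (Suc p)) q \<phi>"
  shows "defs L M ?W p q (\<lambda>a \<alpha>. D_ok M \<phi> n a \<alpha>)"
  unfolding D_ok_def ball_value_def
  by (rule d_intros d_sub[OF d_self[OF assms]] tm_intros | (simp; fail))+

text \<open>Open balls are infinite, so every ball value is one of the finitely many values with
  infinite fibre; \<open>n\<close> is their number.\<close>

lemma D_ok_if:
  assumes D: "property_D L M (Inl ` set a \<union> Inr ` set \<alpha>)"
    and a: "a \<in> tuples p (carrier M)" "\<alpha> \<in> tuples q (RV M)" and wf: "wf_form L (Suc (Suc p)) q \<phi>"
  shows "\<exists>n. D_ok M \<phi> n a \<alpha>"
proof (cases "\<forall>x\<in>carrier M. \<exists>y\<in>carrier M. \<forall>u\<in>carrier M. sat M (u # x # a) \<alpha> \<phi> \<longleftrightarrow> u = y")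
  case True
  let ?A = "Inl ` set a \<union> Inr ` set \<alpha>"
  obtain g where g: "\<And>x. x \<in> carrier M \<Longrightarrow> g x \<in> carrier M"
    "\<And>x u. x \<in> carrier M \<Longrightarrow> u \<in> carrier M \<Longrightarrow> sat M (u # x # a) \<alpha> \<phi> \<longleftrightarrow> u = g x" using True by metis
  have "definable_fun L M ?A 1 (\<lambda>xs. g (hd xs))"
    unfolding definable_fun_def
  proof (intro conjI)
    show "(\<lambda>xs. g (hd xs)) \<in> tuples 1 (carrier M) \<rightarrow> carrier M" using g by (auto simp: tuples_Suc)
    \<comment> \<open>\<open>\<phi>\<close> lists the value before the argument, whereas a definable
      function lists it after; the formula is rewritten accordingly.\<close>
    have "\<exists>\<psi>. defs L M \<psi> (Suc 1 + p) (0 + q) (\<lambda>xs \<xi>s. sat M (hd (tl xs) # hd xs # tl (tl xs)) \<xi>s \<phi>)"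
      by (rule exI, (rule d_intros d_sub[OF d_self[OF wf]] tm_intros | (simp; fail))+)
    then obtain \<psi> where \<psi>: "defs L M \<psi> (Suc 1 + p) (0 + q) (\<lambda>xs \<xi>s. sat M (hd (tl xs) # hd xs # tl (tl xs)) \<xi>s \<phi>)" by blast
    show "definable L M ?A (Suc 1) 0 {(x @ [g (hd x)], []) | x. x \<in> tuples 1 (carrier M)}"
    proof (rule definableI[OF \<psi> a])
      have 1: "{(x @ [g (hd x)], []) | x. x \<in> tuples 1 (carrier M)} = {([x, g x], []) | x. x \<in> carrier M}"
        by (auto simp: tuples_Suc)
      have 2: "{(x, \<xi>). x \<in> tuples (Suc 1) (carrier M) \<and> \<xi> \<in> tuples 0 (RV M) \<and>
          sat M (hd (tl (x @ a)) # hd (x @ a) # tl (tl (x @ a))) (\<xi> @ \<alpha>) \<phi>} =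
          {([x, u], []) | x u. x \<in> carrier M \<and> u \<in> carrier M \<and> sat M (u # x # a) \<alpha> \<phi>}"
        by (auto simp: tuples_Suc)
      show "{(x @ [g (hd x)], []) | x. x \<in> tuples 1 (carrier M)} =
        {(x, \<xi>). x \<in> tuples (Suc 1) (carrier M) \<and> \<xi> \<in> tuples 0 (RV M) \<and>
          sat M (hd (tl (x @ a)) # hd (x @ a) # tl (tl (x @ a))) (\<xi> @ \<alpha>) \<phi>}"
        unfolding 1 2 using g by auto
    qed auto
  qed
  then have fin: "finite {y \<in> carrier M. infinite {x \<in> carrier M. g x = y}}" (is "finite ?Y")
    using D unfolding property_D_def by fastforce
  have "y \<in> ?Y" if "y \<in> carrier M" "ball_value M \<phi> a \<alpha> y" for y
  proof -
    obtain b m where bm: "b \<in> carrier M" "m \<in> carrier M" "m \<noteq> \<zero>" "\<forall>x\<in>carrier M. vlt M (x \<ominus> b) m \<longrightarrow> sat M (y # x # a) \<alpha> \<phi>"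
      using \<open>ball_value M \<phi> a \<alpha> y\<close> unfolding ball_value_def by blast
    have "ball M b m \<subseteq> {x \<in> carrier M. g x = y}" using bm(4) g(2) that(1) by (auto simp: ball_def)
    then have "infinite {x \<in> carrier M. g x = y}" using infinite_ball[OF bm(2,3,1)] finite_subset by blast
    then show ?thesis using that by simp
  qed
  then have Y: "{y \<in> carrier M. ball_value M \<phi> a \<alpha> y} \<subseteq> ?Y" by blast
  have "D_ok M \<phi> (card ?Y) a \<alpha>" unfolding D_ok_def
  proof (intro impI notI)
    assume "\<exists>ys\<in>tuples (Suc (card ?Y)) (carrier M). distinct ys \<and> (\<forall>i<Suc (card ?Y). ball_value M \<phi> a \<alpha> (ys ! i))"
    then obtain ys where ys: "ys \<in> tuples (Suc (card ?Y)) (carrier M)" "distinct ys" "\<forall>i<Suc (card ?Y). ball_value M \<phi> a \<alpha> (ys ! i)" by blast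
    have "set ys \<subseteq> ?Y"
    proof
      fix y assume y: "y \<in> set ys"
      then obtain i where "i < Suc (card ?Y)" "y = ys ! i"
        using tuples_length[OF ys(1)] unfolding in_set_conv_nth by metis
      then have "ball_value M \<phi> a \<alpha> y" using ys(3) by blast
      then show "y \<in> ?Y" using Y y tuples_set[OF ys(1)] by blast
    qed
    then have "card (set ys) \<le> card ?Y" using fin by (rule card_mono[rotated])
    then show False using distinct_card[OF ys(2)] tuples_length[OF ys(1)] by simp
  qed
  then show ?thesis by blast
next
  case False
  then show ?thesis unfolding D_ok_def by blast
qed

text \<open>The value of a root polynomial is a term in its listed roots, so its graph can be
  written once the roots are quantified.\<close>

lemma tm_foldr:
  "tms L M ts n j e \<Longrightarrow> tm L M t n b \<Longrightarrow>
   tm L M (foldr (\<lambda>s u. TMult (TAdd t (TMinus s)) u) ts TOne) n (\<lambda>xs. foldr (\<lambda>z u. (b xs \<ominus> z) \<otimes> u) (e xs) \<one>)"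
proof (induction ts arbitrary: j e)
  case Nil
  then show ?case by (auto simp: tms_def tm_def)
next
  case (Cons s ts)
  have "tms L M ts n (j - 1) (\<lambda>xs. tl (e xs))" using tms_tl[OF Cons.prems(1)] by simp
  then have IH: "tm L M (foldr (\<lambda>s u. TMult (TAdd t (TMinus s)) u) ts TOne) n (\<lambda>xs. foldr (\<lambda>z u. (b xs \<ominus> z) \<otimes> u) (tl (e xs)) \<one>)"
    using Cons.IH Cons.prems(2) by blast
  then show ?case using Cons.prems by (auto simp: tm_def tms_def a_minus_def)
qed

end

context td_model
begin

text \<open>By compactness finitely many of the statements \<open>D_ok\<close> with bound
  \<open>n\<close> cover all parameters; the largest of these bounds serves for all.\<close>

lemma uniform_D:
  assumes wf: "wf_form L (Suc (Suc p)) q \<phi>"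
  shows "\<exists>n. \<forall>a\<in>tuples p (carrier M). \<forall>\<alpha>\<in>tuples q (RV M).
    (\<forall>x\<in>carrier M. \<exists>y\<in>carrier M. \<forall>u\<in>carrier M. sat M (u # x # a) \<alpha> \<phi> \<longleftrightarrow> u = y) \<longrightarrow>
    finite {y \<in> carrier M. ball_value M \<phi> a \<alpha> y} \<and> card {y \<in> carrier M. ball_value M \<phi> a \<alpha> y} \<le> n"
proof -
  have "\<exists>W. (\<forall>M :: ('f, 'r, 'u) vstruct. vf_structure L M \<longrightarrow> defs L M W p q (\<lambda>a \<alpha>. D_ok M \<phi> n a \<alpha>)) \<and>
     (\<forall>M :: ('f, 'r, 'f + 'r + nat) vstruct. vf_structure L M \<longrightarrow> defs L M W p q (\<lambda>a \<alpha>. D_ok M \<phi> n a \<alpha>))" for n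
    by (rule exI, intro conjI allI impI; rule vstr.D_ok_defs[OF vstrI]; (assumption | rule wf))
  then obtain W where WA: "\<And>n M. vf_structure L M \<Longrightarrow> defs L (M :: ('f, 'r, 'u) vstruct) (W n) p q (\<lambda>a \<alpha>. D_ok M \<phi> n a \<alpha>)"
    and WB: "\<And>n M. vf_structure L M \<Longrightarrow> defs L (M :: ('f, 'r, 'f + 'r + nat) vstruct) (W n) p q (\<lambda>a \<alpha>. D_ok M \<phi> n a \<alpha>)"
    by metis
  have "\<exists>J0\<subseteq>UNIV. finite J0 \<and> (\<forall>a\<in>tuples p (carrier M). \<forall>\<alpha>\<in>tuples q (RV M). \<exists>j\<in>J0. sat M a \<alpha> (W j))"
  proof (rule uniform)
    show "wf_form L p q (W j)" for j using WA[OF vfs] by (simp add: defs_def)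
    fix N :: "('f, 'r, 'f + 'r + nat) vstruct" and a \<alpha>
    assume N: "vf_structure L N" and td: "\<And>A. A \<subseteq> Inl ` carrier N \<union> Inr ` RV N \<Longrightarrow> property_T L N A l \<and> property_D L N A"
      and a: "a \<in> tuples p (carrier N)" "\<alpha> \<in> tuples q (RV N)"
    have "property_D L N (Inl ` set a \<union> Inr ` set \<alpha>)"
      using td[of "Inl ` set a \<union> Inr ` set \<alpha>"] a by (auto simp: tuples_def)
    then obtain n where "D_ok N \<phi> n a \<alpha>" using vstr.D_ok_if[OF vstrI[OF N] _ a wf] by blast
    then show "\<exists>j\<in>UNIV. sat N a \<alpha> (W j)" using WB[OF N] a unfolding defs_def by blast
  qed
  then obtain J0 where J0: "finite J0" "\<And>a \<alpha>. a \<in> tuples p (carrier M) \<Longrightarrow> \<alpha> \<in> tuples q (RV M) \<Longrightarrow> \<exists>j\<in>J0. sat M a \<alpha> (W j)"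
    by blast
  show ?thesis
  proof (intro exI[of _ "Max J0"] ballI impI)
    fix a \<alpha> assume a: "a \<in> tuples p (carrier M)" "\<alpha> \<in> tuples q (RV M)"
      and f: "\<forall>x\<in>carrier M. \<exists>y\<in>carrier M. \<forall>u\<in>carrier M. sat M (u # x # a) \<alpha> \<phi> \<longleftrightarrow> u = y"
    let ?Y = "{y \<in> carrier M. ball_value M \<phi> a \<alpha> y}"
    obtain n where n: "n \<in> J0" "sat M a \<alpha> (W n)" using J0(2)[OF a] by blast
    then have "D_ok M \<phi> n a \<alpha>" using WA[OF vfs] a unfolding defs_def by blast
    then have "\<not> (\<exists>ys\<in>tuples (Suc n) (carrier M). distinct ys \<and> (\<forall>i<Suc n. ball_value M \<phi> a \<alpha> (ys ! i)))"
      using f unfolding D_ok_def by blast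
    then have "\<not> (\<exists>ys\<in>tuples (Suc n) (carrier M). distinct ys \<and> (\<forall>i<Suc n. ys ! i \<in> ?Y))" by blast
    then have "finite ?Y \<and> card ?Y \<le> n" by (rule card_le_if_no_tuple) auto
    then show "finite ?Y \<and> card ?Y \<le> Max J0" using Max_ge[OF J0(1) n(1)] by linarith
  qed
qed

text \<open>An explicit bound is kept besides finiteness, and uniformly in \<open>a\<close> and
  \<open>\<alpha>\<close>: the lemma is iterated, and its conclusion has the form of its
  hypothesis.\<close>

lemma bounded_union_RV:
  assumes wf: "wf_form L (Suc p) (Suc q) \<phi>"
    and fin: "\<And>a \<alpha> \<zeta>. a \<in> tuples p (carrier M) \<Longrightarrow> \<alpha> \<in> tuples q (RV M) \<Longrightarrow> \<zeta> \<in> RV M \<Longrightarrow>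
      finite {z \<in> carrier M. sat M (z # a) (\<zeta> # \<alpha>) \<phi>} \<and> card {z \<in> carrier M. sat M (z # a) (\<zeta> # \<alpha>) \<phi>} \<le> N"
  shows "\<exists>N'. \<forall>a\<in>tuples p (carrier M). \<forall>\<alpha>\<in>tuples q (RV M).
      finite {z \<in> carrier M. \<exists>\<zeta>\<in>RV M. sat M (z # a) (\<zeta> # \<alpha>) \<phi>} \<and>
      card {z \<in> carrier M. \<exists>\<zeta>\<in>RV M. sat M (z # a) (\<zeta> # \<alpha>) \<phi>} \<le> N'"
proof -
  let ?Z = "\<lambda>a \<alpha> \<zeta>. {z \<in> carrier M. sat M (z # a) (\<zeta> # \<alpha>) \<phi>}"
  \<comment> \<open>The graph of the map sending \<open>x\<close> to the value at \<open>b\<close>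
    of the root polynomial attached to \<open>rv x\<close>. The roots are listed by some distinct
    \<open>zs\<close> of length at most \<open>N\<close>. Treating \<open>b\<close> as a parameter
    gives one bound for all sampling points.\<close>
  have "\<exists>\<gamma>. defs L M \<gamma> (Suc (Suc (Suc p))) q (\<lambda>xs \<xi>s. \<exists>j<Suc N. \<exists>zs\<in>tuples j (carrier M). distinct zs \<and>
      (\<forall>z\<in>carrier M. sat M (z # tl (tl (tl xs))) (rv M (hd (tl xs)) # \<xi>s) \<phi> \<longleftrightarrow> (\<exists>i<j. z = zs ! i)) \<and>
      hd xs = foldr (\<lambda>z u. (hd (tl (tl xs)) \<ominus> z) \<otimes> u) zs \<one>)"
    by (rule exI, (rule d_intros d_sub[OF d_self[OF wf]] tm_foldr tm_intros | (simp; fail))+)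
  then obtain \<gamma> where \<gamma>: "defs L M \<gamma> (Suc (Suc (Suc p))) q (\<lambda>xs \<xi>s. \<exists>j<Suc N. \<exists>zs\<in>tuples j (carrier M). distinct zs \<and>
      (\<forall>z\<in>carrier M. sat M (z # tl (tl (tl xs))) (rv M (hd (tl xs)) # \<xi>s) \<phi> \<longleftrightarrow> (\<exists>i<j. z = zs ! i)) \<and>
      hd xs = foldr (\<lambda>z u. (hd (tl (tl xs)) \<ominus> z) \<otimes> u) zs \<one>)" by blast
  have sat\<gamma>: "sat M (u # x # b # a) \<alpha> \<gamma> \<longleftrightarrow> u = rootprod (?Z a \<alpha> (rv M x)) b"
    if c: "u \<in> carrier M" "x \<in> carrier M" "b \<in> carrier M" "a \<in> tuples p (carrier M)" "\<alpha> \<in> tuples q (RV M)" for u x b a \<alpha>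
  proof -
    let ?S = "?Z a \<alpha> (rv M x)"
    have S: "finite ?S" "card ?S \<le> N" using fin[OF c(4,5) rv_in_RV[OF c(2)]] by auto
    have "u # x # b # a \<in> tuples (Suc (Suc (Suc p))) (carrier M)" using c by simp
    from \<gamma>[unfolded defs_def, THEN conjunct2, THEN bspec, OF this, THEN bspec, OF c(5)]
    have g: "sat M (u # x # b # a) \<alpha> \<gamma> \<longleftrightarrow> (\<exists>j<Suc N. \<exists>zs\<in>tuples j (carrier M). distinct zs \<and>
      (\<forall>z\<in>carrier M. sat M (z # a) (rv M x # \<alpha>) \<phi> \<longleftrightarrow> (\<exists>i<j. z = zs ! i)) \<and>
      u = foldr (\<lambda>z u. (b \<ominus> z) \<otimes> u) zs \<one>)" by simp
    have e: "(\<forall>z\<in>carrier M. sat M (z # a) (rv M x # \<alpha>) \<phi> \<longleftrightarrow> (\<exists>i<j. z = zs ! i)) \<longleftrightarrow> set zs = ?S"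
      if zs: "zs \<in> tuples j (carrier M)" for j zs
    proof -
      have "(\<exists>i<j. z = zs ! i) \<longleftrightarrow> z \<in> set zs" for z using tuples_length[OF zs] by (auto simp: in_set_conv_nth)
      then show ?thesis using tuples_set[OF zs] by auto
    qed
    have f: "foldr (\<lambda>z u. (b \<ominus> z) \<otimes> u) zs \<one> = rootprod (set zs) b"
      if "zs \<in> tuples j (carrier M)" "distinct zs" for j zs
      using rootprod_list[OF that(2) tuples_set[OF that(1)] c(3)] .
    show ?thesis unfolding g
    proof
      assume "\<exists>j<Suc N. \<exists>zs\<in>tuples j (carrier M). distinct zs \<and>
        (\<forall>z\<in>carrier M. sat M (z # a) (rv M x # \<alpha>) \<phi> \<longleftrightarrow> (\<exists>i<j. z = zs ! i)) \<and>
        u = foldr (\<lambda>z u. (b \<ominus> z) \<otimes> u) zs \<one>"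
      then obtain j zs where "zs \<in> tuples j (carrier M)" "distinct zs"
        "\<forall>z\<in>carrier M. sat M (z # a) (rv M x # \<alpha>) \<phi> \<longleftrightarrow> (\<exists>i<j. z = zs ! i)"
        "u = foldr (\<lambda>z u. (b \<ominus> z) \<otimes> u) zs \<one>" by blast
      then show "u = rootprod ?S b" using e f by simp
    next
      assume u: "u = rootprod ?S b"
      obtain zs where zs: "zs \<in> tuples (card ?S) (carrier M)" "distinct zs" "set zs = ?S"
        using tuples_of_carrier[OF _ S(1)] by blast
      show "\<exists>j<Suc N. \<exists>zs\<in>tuples j (carrier M). distinct zs \<and>
        (\<forall>z\<in>carrier M. sat M (z # a) (rv M x # \<alpha>) \<phi> \<longleftrightarrow> (\<exists>i<j. z = zs ! i)) \<and>
        u = foldr (\<lambda>z u. (b \<ominus> z) \<otimes> u) zs \<one>"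
        using zs e[OF zs(1)] f[OF zs(1,2)] u S(2)
        by (intro exI[of _ "card ?S"] conjI bexI[of _ zs]) simp_all
    qed
  qed
  have "wf_form L (Suc (Suc (Suc p))) q \<gamma>" using \<gamma> by (simp add: defs_def)
  from uniform_D[OF this] obtain n where n: "\<forall>a\<in>tuples (Suc p) (carrier M). \<forall>\<alpha>\<in>tuples q (RV M).
    (\<forall>x\<in>carrier M. \<exists>y\<in>carrier M. \<forall>u\<in>carrier M. sat M (u # x # a) \<alpha> \<gamma> \<longleftrightarrow> u = y) \<longrightarrow>
    finite {y \<in> carrier M. ball_value M \<gamma> a \<alpha> y} \<and> card {y \<in> carrier M. ball_value M \<gamma> a \<alpha> y} \<le> n"
    by (elim exE)
  \<comment> \<open>\<open>N + 1\<close> points, as many as \<open>rootprod_inj\<close> asks for to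
    recover a set of at most \<open>N\<close> roots.\<close>
  obtain B where B: "B \<subseteq> carrier M" "finite B" "card B = Suc N"
    using infinite_arbitrarily_large[OF infinite_carrier] by blast
  obtain bs where bs: "bs \<in> tuples (Suc N) (carrier M)" "distinct bs" "set bs = B"
    using tuples_of_carrier[OF B(1,2)] B(3) by auto
  \<comment> \<open>At each of the \<open>N + 1\<close> points of \<open>B\<close> at most
    \<open>n + 1\<close> values occur. A root set is determined by a list of \<open>N + 1\<close>
    such values and has at most \<open>N\<close> elements, whence the bound
    \<open>?v ^ Suc N * N\<close>.\<close>
  let ?v = "Suc N * Suc n"
  show ?thesis
  proof (intro exI[of _ "?v ^ Suc N * N"] ballI)
    fix a \<alpha> assume a: "a \<in> tuples p (carrier M)" and \<alpha>: "\<alpha> \<in> tuples q (RV M)"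
    let ?V = "\<lambda>b. {rootprod (?Z a \<alpha> \<zeta>) b | \<zeta>. \<zeta> \<in> RV M}"
    have Zsub: "?Z a \<alpha> \<zeta> \<subseteq> carrier M" for \<zeta> by auto
    have V: "finite (?V b) \<and> card (?V b) \<le> Suc n" if b: "b \<in> carrier M" for b
    proof -
      let ?Y = "{y \<in> carrier M. ball_value M \<gamma> (b # a) \<alpha> y}"
      have ba: "b # a \<in> tuples (Suc p) (carrier M)" using a b by simp
      have Y: "finite ?Y \<and> card ?Y \<le> n"
      proof (rule n[THEN bspec, OF ba, THEN bspec, OF \<alpha>, THEN mp], intro ballI)
        fix x assume x: "x \<in> carrier M"
        show "\<exists>y\<in>carrier M. \<forall>u\<in>carrier M. sat M (u # x # b # a) \<alpha> \<gamma> \<longleftrightarrow> u = y"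
          using sat\<gamma>[OF _ x b a \<alpha>] rootprod_closed[OF Zsub b] by blast
      qed
      \<comment> \<open>For non-zero \<open>x\<close> the fibre of \<open>rv\<close> through
        \<open>x\<close> is an open ball, so the attached value is a ball value. The fibre over
        \<open>rv 0\<close> is a single point, which accounts for the one additional value.\<close>
      have "?V b \<subseteq> insert (rootprod (?Z a \<alpha> (rv M \<zero>)) b) ?Y"
      proof
        fix y assume "y \<in> ?V b"
        then obtain \<zeta> where "\<zeta> \<in> RV M" and y: "y = rootprod (?Z a \<alpha> \<zeta>) b" by blast
        then obtain x where x: "x \<in> carrier M" "\<zeta> = rv M x" unfolding RV_eq by blast
        have rc: "y \<in> carrier M" unfolding y using rootprod_closed[OF Zsub b] .
        show "y \<in> insert (rootprod (?Z a \<alpha> (rv M \<zero>)) b) ?Y"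
        proof (cases "x = \<zero>")
          case True
          then show ?thesis using x(2) y by simp
        next
          case False
          have "sat M (y # x' # b # a) \<alpha> \<gamma>" if "x' \<in> carrier M" "vlt M (x' \<ominus> x) x" for x'
            using sat\<gamma>[OF rc that(1) b a \<alpha>] rv_ball[OF x(1) that] x(2) y by simp
          then have "ball_value M \<gamma> (b # a) \<alpha> y"
            unfolding ball_value_def using x(1) False by blast
          then show ?thesis using rc by blast
        qed
      qed
      moreover have "finite (insert (rootprod (?Z a \<alpha> (rv M \<zero>)) b) ?Y)" "card (insert (rootprod (?Z a \<alpha> (rv M \<zero>)) b) ?Y) \<le> Suc n"
        using Y card_insert_le_m1[of "Suc n" ?Y] by auto
      ultimately show ?thesis by (meson card_mono finite_subset le_trans)
    qed
    let ?W = "\<Union>b\<in>B. ?V b"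
    have W: "finite ?W" "card ?W \<le> ?v"
    proof -
      show "finite ?W" using V B by blast
      have "card ?W \<le> (\<Sum>b\<in>B. card (?V b))" by (rule card_UN_le[OF B(2)])
      also have "\<dots> \<le> (\<Sum>b\<in>B. Suc n)" using V B(1) by (intro sum_mono) blast
      finally show "card ?W \<le> ?v" using B(3) by simp
    qed
    let ?ZZ = "?Z a \<alpha> ` RV M"
    let ?\<Phi> = "\<lambda>S. map (rootprod S) bs"
    have inj: "inj_on ?\<Phi> ?ZZ"
    proof (rule inj_onI)
      fix S S' assume S: "S \<in> ?ZZ" "S' \<in> ?ZZ" and e: "?\<Phi> S = ?\<Phi> S'"
      have "rootprod S b = rootprod S' b" if "b \<in> B" for b using e bs(3) that by auto
      then show "S = S'" using S fin[OF a \<alpha>] by (intro rootprod_inj[OF _ _ _ _ _ _ B]) auto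
    qed
    have sub: "?\<Phi> ` ?ZZ \<subseteq> {xs. set xs \<subseteq> ?W \<and> length xs = Suc N}"
    proof
      fix xs assume "xs \<in> ?\<Phi> ` ?ZZ"
      then obtain \<zeta> where z: "\<zeta> \<in> RV M" "xs = map (rootprod (?Z a \<alpha> \<zeta>)) bs" by blast
      have "rootprod (?Z a \<alpha> \<zeta>) b \<in> ?W" if "b \<in> B" for b using that z(1) by blast
      then show "xs \<in> {xs. set xs \<subseteq> ?W \<and> length xs = Suc N}"
        using z(2) bs(3) tuples_length[OF bs(1)] by auto
    qed
    have fl: "finite {xs. set xs \<subseteq> ?W \<and> length xs = Suc N}" by (rule finite_lists_length_eq[OF W(1)])
    have "finite ?ZZ" using finite_imageD[OF finite_subset[OF sub fl] inj] .
    have "card ?ZZ = card (?\<Phi> ` ?ZZ)" using card_image[OF inj] by simp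
    also have "\<dots> \<le> card {xs. set xs \<subseteq> ?W \<and> length xs = Suc N}" by (rule card_mono[OF fl sub])
    also have "\<dots> = card ?W ^ Suc N" by (rule card_lists_length_eq[OF W(1)])
    also have "\<dots> \<le> ?v ^ Suc N" using W(2) by (intro power_mono) auto
    finally have cZ: "card ?ZZ \<le> ?v ^ Suc N" .
    have U: "{z \<in> carrier M. \<exists>\<zeta>\<in>RV M. sat M (z # a) (\<zeta> # \<alpha>) \<phi>} = (\<Union>S\<in>?ZZ. S)" by blast
    have "card (\<Union>S\<in>?ZZ. S) \<le> (\<Sum>S\<in>?ZZ. card S)" by (rule card_UN_le[OF \<open>finite ?ZZ\<close>])
    also have "\<dots> \<le> (\<Sum>S\<in>?ZZ. N)" using fin[OF a \<alpha>] by (intro sum_mono) auto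
    also have "\<dots> = card ?ZZ * N" by simp
    also have "\<dots> \<le> ?v ^ Suc N * N" using cZ by (intro mult_right_mono) auto
    finally have "card (\<Union>S\<in>?ZZ. S) \<le> ?v ^ Suc N * N" .
    moreover have "finite (\<Union>S\<in>?ZZ. S)" using \<open>finite ?ZZ\<close> fin[OF a \<alpha>] by auto
    ultimately show "finite {z \<in> carrier M. \<exists>\<zeta>\<in>RV M. sat M (z # a) (\<zeta> # \<alpha>) \<phi>} \<and>
      card {z \<in> carrier M. \<exists>\<zeta>\<in>RV M. sat M (z # a) (\<zeta> # \<alpha>) \<phi>} \<le> ?v ^ Suc N * N"
      unfolding U by blast
  qed
qed

text \<open>The RV variables are removed one at a time, the others staying parameters; this is
  possible because the bounds are uniform in parameters.\<close>

lemma bounded_union: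
  assumes "wf_form L (Suc p) (k + q) \<phi>"
    and "\<And>a \<alpha> \<zeta>. a \<in> tuples p (carrier M) \<Longrightarrow> \<alpha> \<in> tuples q (RV M) \<Longrightarrow> \<zeta> \<in> tuples k (RV M) \<Longrightarrow>
      finite {z \<in> carrier M. sat M (z # a) (\<zeta> @ \<alpha>) \<phi>} \<and> card {z \<in> carrier M. sat M (z # a) (\<zeta> @ \<alpha>) \<phi>} \<le> N"
  shows "\<exists>N'. \<forall>a\<in>tuples p (carrier M). \<forall>\<alpha>\<in>tuples q (RV M).
      finite {z \<in> carrier M. \<exists>\<zeta>\<in>tuples k (RV M). sat M (z # a) (\<zeta> @ \<alpha>) \<phi>} \<and>
      card {z \<in> carrier M. \<exists>\<zeta>\<in>tuples k (RV M). sat M (z # a) (\<zeta> @ \<alpha>) \<phi>} \<le> N'"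
  using assms
proof (induction k arbitrary: \<phi> N)
  case 0
  then show ?case by (intro exI[of _ N]) simp
next
  case (Suc k)
  have wf: "wf_form L (Suc p) (Suc (k + q)) \<phi>" using Suc.prems(1) by simp
  have "\<exists>N'. \<forall>a\<in>tuples p (carrier M). \<forall>\<alpha>\<in>tuples (k + q) (RV M).
      finite {z \<in> carrier M. \<exists>\<zeta>\<in>RV M. sat M (z # a) (\<zeta> # \<alpha>) \<phi>} \<and>
      card {z \<in> carrier M. \<exists>\<zeta>\<in>RV M. sat M (z # a) (\<zeta> # \<alpha>) \<phi>} \<le> N'"
  proof (rule bounded_union_RV[OF wf])
    fix a \<alpha> \<zeta> assume *: "a \<in> tuples p (carrier M)" "\<alpha> \<in> tuples (k + q) (RV M)" "\<zeta> \<in> RV M"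
    have "\<zeta> # take k \<alpha> \<in> tuples (Suc k) (RV M)" "drop k \<alpha> \<in> tuples q (RV M)"
      using tuples_take_add[OF *(2)] tuples_drop_add[OF *(2)] *(3) by auto
    from Suc.prems(2)[OF *(1) this(2,1)]
    show "finite {z \<in> carrier M. sat M (z # a) (\<zeta> # \<alpha>) \<phi>} \<and> card {z \<in> carrier M. sat M (z # a) (\<zeta> # \<alpha>) \<phi>} \<le> N" by simp
  qed
  then obtain N1 where N1: "\<And>a \<alpha>. a \<in> tuples p (carrier M) \<Longrightarrow> \<alpha> \<in> tuples (k + q) (RV M) \<Longrightarrow>
      finite {z \<in> carrier M. sat M (z # a) \<alpha> (FExRV \<phi>)} \<and> card {z \<in> carrier M. sat M (z # a) \<alpha> (FExRV \<phi>)} \<le> N1" by auto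
  have "\<exists>N'. \<forall>a\<in>tuples p (carrier M). \<forall>\<alpha>\<in>tuples q (RV M).
      finite {z \<in> carrier M. \<exists>\<zeta>\<in>tuples k (RV M). sat M (z # a) (\<zeta> @ \<alpha>) (FExRV \<phi>)} \<and>
      card {z \<in> carrier M. \<exists>\<zeta>\<in>tuples k (RV M). sat M (z # a) (\<zeta> @ \<alpha>) (FExRV \<phi>)} \<le> N'"
  proof (rule Suc.IH[where N = N1])
    show "wf_form L (Suc p) (k + q) (FExRV \<phi>)" using wf by simp
  qed (rule N1, assumption, rule tuples_append)
  then show ?case by (simp add: bex_tuples_Suc)
qed

section \<open>From decompositions to finite sets of centers in one variable\<close>

text \<open>Apply (T\<open>\<ell>\<close>) to the indicator function of a subset of the last coordinate axis.\<close>

lemma prepare: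
  assumes wf: "wf_form L (Suc p) q \<theta>"
  shows "\<exists>K \<chi> d. (\<exists>\<phi>. defs L M \<phi> (Suc p) (K + q) (\<lambda>xs \<xi>s. take K \<xi>s = \<chi> (tl xs) (drop K \<xi>s) (hd xs))) \<and>
    (\<exists>\<phi>. defs L M \<phi> (Suc p) (K + q) (\<lambda>xs \<xi>s. hd xs = d (tl xs) (drop K \<xi>s) (take K \<xi>s))) \<and>
    (\<forall>a\<in>tuples p (carrier M). \<forall>\<alpha>\<in>tuples q (RV M).
       (\<forall>x\<in>carrier M. \<chi> a \<alpha> x \<in> tuples K (RV M)) \<and>
       (\<forall>\<xi>\<in>tuples K (RV M). d a \<alpha> \<xi> \<in> carrier M) \<and>
       (\<forall>x\<in>carrier M. \<forall>x'\<in>carrier M.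
          (\<chi> a \<alpha> x' = \<chi> a \<alpha> x \<longleftrightarrow> rveq M \<one> (x' \<ominus> d a \<alpha> (\<chi> a \<alpha> x)) (x \<ominus> d a \<alpha> (\<chi> a \<alpha> x))) \<and>
          (\<chi> a \<alpha> x' = \<chi> a \<alpha> x \<longrightarrow> (sat M (x' # a) \<alpha> \<theta> \<longleftrightarrow> sat M (x # a) \<alpha> \<theta>))))"
proof -
  obtain l' where l: "l = Suc l'" using l_ge_1 by (cases l) auto
  \<comment> \<open>In \<open>x @ u # a\<close> the value \<open>u\<close> stands at position
    \<open>l\<close>, so this defines the zero function; the information is carried by the RV-valued
    map alone.\<close>
  let ?\<theta>f = "FEq (Var l) TZero :: ('f, 'r) form"
  have wff: "wf_form L (l + Suc p) q ?\<theta>f" by simp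
  \<comment> \<open>The indicator takes the values \<open>rv 1\<close> and \<open>rv 0\<close>
    according to the last coordinate, which has index \<open>l'\<close>.\<close>
  let ?P = "\<lambda>xs \<xi>s. (sat M (xs ! l' # drop l xs) (drop 1 \<xi>s) \<theta> \<and> take 1 \<xi>s = [rv M \<one>]) \<or>
      (\<not> sat M (xs ! l' # drop l xs) (drop 1 \<xi>s) \<theta> \<and> take 1 \<xi>s = [rv M \<zero>])"
  have "\<exists>\<phi>. defs L M \<phi> (l + p) (1 + q) ?P"
    by (rule exI, (rule d_intros d_sub[OF d_self[OF wf]] tm_intros | (simp add: l; fail))+)
  then obtain \<theta>\<psi> where \<theta>\<psi>: "defs L M \<theta>\<psi> (l + p) (1 + q) ?P" by blast
  then have wf\<psi>: "wf_form L (l + p) (1 + q) \<theta>\<psi>" by (simp add: defs_def)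
  let ?O = "replicate l' \<zero>"
  have O: "?O \<in> tuples l' (carrier M)" by (auto simp: tuples_def)
  obtain K \<chi>0 c where
    D1: "\<exists>\<phi>. defs L M \<phi> (l + p) (K + q) (\<lambda>xs \<xi>s. take K \<xi>s = \<chi>0 (drop l xs) (drop K \<xi>s) (take l xs))" and
    D2: "\<forall>i<l. \<exists>\<phi>. defs L M \<phi> (i + Suc p) (K + q)
       (\<lambda>xs \<xi>s. xs ! i = c (drop (Suc i) xs) (drop K \<xi>s) (take K \<xi>s) i (take i xs))" and
    D3: "\<forall>a\<in>tuples p (carrier M). \<forall>\<alpha>\<in>tuples q (RV M).
       (\<forall>x\<in>tuples l (carrier M). \<chi>0 a \<alpha> x \<in> tuples K (RV M)) \<and>
       (\<forall>\<xi>\<in>tuples K (RV M). \<forall>i<l. \<forall>z\<in>tuples i (carrier M). c a \<alpha> \<xi> i z \<in> carrier M) \<and>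
       (\<forall>f \<psi>. (\<forall>x\<in>tuples l (carrier M). f x \<in> carrier M \<and> \<psi> x \<in> tuples 1 (RV M) \<and>
            (\<forall>u\<in>carrier M. sat M (x @ u # a) \<alpha> ?\<theta>f \<longleftrightarrow> u = f x) \<and>
            (\<forall>\<zeta>\<in>tuples 1 (RV M). sat M (x @ a) (\<zeta> @ \<alpha>) \<theta>\<psi> \<longleftrightarrow> \<zeta> = \<psi> x)) \<longrightarrow>
          (\<forall>x0\<in>tuples l (carrier M).
             okb M l {x \<in> tuples l (carrier M). \<chi>0 a \<alpha> x = \<chi>0 a \<alpha> x0} (c a \<alpha> (\<chi>0 a \<alpha> x0)) f \<psi> x0))"
    using uniform_T[OF wff wf\<psi>] by (elim exE, elim conjE) (rule that, assumption+)
  define \<chi> where "\<chi> a \<alpha> x = \<chi>0 a \<alpha> (?O @ [x])" for a \<alpha> x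
  define d where "d a \<alpha> \<xi> = c a \<alpha> \<xi> l' ?O" for a \<alpha> \<xi>
  obtain \<phi>1 where \<phi>1: "defs L M \<phi>1 (l + p) (K + q) (\<lambda>xs \<xi>s. take K \<xi>s = \<chi>0 (drop l xs) (drop K \<xi>s) (take l xs))"
    using D1 by blast
  have "\<exists>\<phi>. defs L M \<phi> (Suc p) (K + q) (\<lambda>xs \<xi>s. take K \<xi>s = \<chi>0 (drop l ((?O @ [hd xs]) @ tl xs)) (drop K \<xi>s) (take l ((?O @ [hd xs]) @ tl xs)))"
    by (rule exI, (rule d_sub[OF \<phi>1] tm_intros | (simp add: l; fail))+)
  then have E1: "\<exists>\<phi>. defs L M \<phi> (Suc p) (K + q) (\<lambda>xs \<xi>s. take K \<xi>s = \<chi> (tl xs) (drop K \<xi>s) (hd xs))"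
    by (simp add: l \<chi>_def)
  obtain \<phi>2 where \<phi>2: "defs L M \<phi>2 (l' + Suc p) (K + q)
       (\<lambda>xs \<xi>s. xs ! l' = c (drop (Suc l') xs) (drop K \<xi>s) (take K \<xi>s) l' (take l' xs))" using D2 l by blast
  have "\<exists>\<phi>. defs L M \<phi> (Suc p) (K + q) (\<lambda>xs \<xi>s. (?O @ (hd xs # tl xs)) ! l' =
      c (drop (Suc l') (?O @ (hd xs # tl xs))) (drop K \<xi>s) (take K \<xi>s) l' (take l' (?O @ (hd xs # tl xs))))"
    by (rule exI, (rule d_sub[OF \<phi>2] tm_intros | (simp; fail))+)
  then have E2: "\<exists>\<phi>. defs L M \<phi> (Suc p) (K + q) (\<lambda>xs \<xi>s. hd xs = d (tl xs) (drop K \<xi>s) (take K \<xi>s))"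
    by (simp add: d_def nth_append)
  have E3: "\<chi> a \<alpha> x \<in> tuples K (RV M)" if "a \<in> tuples p (carrier M)" "\<alpha> \<in> tuples q (RV M)" "x \<in> carrier M" for a \<alpha> x
    using D3 that tuples_snoc[OF O that(3)] unfolding \<chi>_def l by blast
  have E4: "d a \<alpha> \<xi> \<in> carrier M" if "a \<in> tuples p (carrier M)" "\<alpha> \<in> tuples q (RV M)" "\<xi> \<in> tuples K (RV M)" for a \<alpha> \<xi>
    using D3 that O unfolding d_def l by blast
  have E5: "(\<chi> a \<alpha> x' = \<chi> a \<alpha> x \<longleftrightarrow> rveq M \<one> (x' \<ominus> d a \<alpha> (\<chi> a \<alpha> x)) (x \<ominus> d a \<alpha> (\<chi> a \<alpha> x))) \<and>
          (\<chi> a \<alpha> x' = \<chi> a \<alpha> x \<longrightarrow> (sat M (x' # a) \<alpha> \<theta> \<longleftrightarrow> sat M (x # a) \<alpha> \<theta>))"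
    if a: "a \<in> tuples p (carrier M)" "\<alpha> \<in> tuples q (RV M)" and x: "x \<in> carrier M" "x' \<in> carrier M" for a \<alpha> x x'
  proof -
    define \<psi> where "\<psi> xs = (if sat M (xs ! l' # a) \<alpha> \<theta> then [rv M \<one>] else [rv M \<zero>])" for xs
    have X: "?O @ [x] \<in> tuples l (carrier M)" "?O @ [x'] \<in> tuples l (carrier M)" using tuples_snoc[OF O] x l by auto
    have "\<forall>x0\<in>tuples l (carrier M).
             okb M l {x \<in> tuples l (carrier M). \<chi>0 a \<alpha> x = \<chi>0 a \<alpha> x0} (c a \<alpha> (\<chi>0 a \<alpha> x0)) (\<lambda>_. \<zero>) \<psi> x0"
    proof (rule D3[THEN bspec, OF a(1), THEN bspec, OF a(2), THEN conjunct2, THEN conjunct2, THEN spec, THEN spec, THEN mp], intro ballI)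
      fix y assume y: "y \<in> tuples l (carrier M)"
      have ly: "length y = l" using tuples_length[OF y] .
      have "sat M (y @ a) (\<zeta> @ \<alpha>) \<theta>\<psi> \<longleftrightarrow> \<zeta> = \<psi> y" if "\<zeta> \<in> tuples 1 (RV M)" for \<zeta>
      proof -
        have "y @ a \<in> tuples (l + p) (carrier M)" "\<zeta> @ \<alpha> \<in> tuples (1 + q) (RV M)"
          using tuples_append y a that by blast+
        then have "sat M (y @ a) (\<zeta> @ \<alpha>) \<theta>\<psi> \<longleftrightarrow> ?P (y @ a) (\<zeta> @ \<alpha>)" using \<theta>\<psi> unfolding defs_def by blast
        also have "\<dots> \<longleftrightarrow> \<zeta> = \<psi> y" using ly l tuples_length[OF that] by (auto simp: \<psi>_def nth_append)
        finally show ?thesis .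
      qed
      moreover have "\<psi> y \<in> tuples 1 (RV M)" by (simp add: \<psi>_def tuples_def)
      moreover have "sat M (y @ u # a) \<alpha> ?\<theta>f \<longleftrightarrow> u = \<zero>" for u using ly by (simp add: nth_append)
      ultimately show "\<zero> \<in> carrier M \<and> \<psi> y \<in> tuples 1 (RV M) \<and>
            (\<forall>u\<in>carrier M. sat M (y @ u # a) \<alpha> ?\<theta>f \<longleftrightarrow> u = \<zero>) \<and>
            (\<forall>\<zeta>\<in>tuples 1 (RV M). sat M (y @ a) (\<zeta> @ \<alpha>) \<theta>\<psi> \<longleftrightarrow> \<zeta> = \<psi> y)"
        using zero_closed by blast
    qed
    then have ok: "okb M l {y \<in> tuples l (carrier M). \<chi>0 a \<alpha> y = \<chi> a \<alpha> x} (c a \<alpha> (\<chi> a \<alpha> x)) (\<lambda>_. \<zero>) \<psi> (?O @ [x])"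
      using X(1) unfolding \<chi>_def by blast
    then have "{y \<in> tuples l (carrier M). \<chi>0 a \<alpha> y = \<chi> a \<alpha> x} = {y \<in> tuples l (carrier M). same M l (c a \<alpha> (\<chi> a \<alpha> x)) \<one> y (?O @ [x])}"
      unfolding okb_def by (elim conjE)
    then have "?O @ [x'] \<in> {y \<in> tuples l (carrier M). \<chi>0 a \<alpha> y = \<chi> a \<alpha> x} \<longleftrightarrow>
        ?O @ [x'] \<in> {y \<in> tuples l (carrier M). same M l (c a \<alpha> (\<chi> a \<alpha> x)) \<one> y (?O @ [x])}"
      by (rule arg_cong)
    then have "\<chi> a \<alpha> x' = \<chi> a \<alpha> x \<longleftrightarrow> same M l (c a \<alpha> (\<chi> a \<alpha> x)) \<one> (?O @ [x']) (?O @ [x])"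
      using X(2) unfolding \<chi>_def[of a \<alpha> x'] by simp
    also have "\<dots> \<longleftrightarrow> rveq M \<one> (x' \<ominus> d a \<alpha> (\<chi> a \<alpha> x)) (x \<ominus> d a \<alpha> (\<chi> a \<alpha> x))"
    proof -
      \<comment> \<open>Points of the axis agree in all earlier coordinates, so the box condition is
        about the last coordinate only, with center at the zero prefix.\<close>
      have "rveq M \<one> ((?O @ [x']) ! i \<ominus> c a \<alpha> (\<chi> a \<alpha> x) i (take i (?O @ [x']))) ((?O @ [x]) ! i \<ominus> c a \<alpha> (\<chi> a \<alpha> x) i (take i (?O @ [x])))"
        if "i < l'" for i using that by (simp add: nth_append rveq_def)
      then show ?thesis unfolding same_def l d_def All_less_Suc by (simp add: nth_append)
    qed
    finally have 1: "\<chi> a \<alpha> x' = \<chi> a \<alpha> x \<longleftrightarrow> rveq M \<one> (x' \<ominus> d a \<alpha> (\<chi> a \<alpha> x)) (x \<ominus> d a \<alpha> (\<chi> a \<alpha> x))" .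
    have "\<forall>y\<in>{y \<in> tuples l (carrier M). \<chi>0 a \<alpha> y = \<chi> a \<alpha> x}. \<psi> y = \<psi> (?O @ [x])"
      using ok unfolding okb_def by (elim conjE)
    then have "\<psi> (?O @ [x']) = \<psi> (?O @ [x])" if "\<chi> a \<alpha> x' = \<chi> a \<alpha> x"
      using X(2) that unfolding \<chi>_def[of a \<alpha> x'] by blast
    moreover have "rv M \<one> \<noteq> rv M \<zero>"
      using rv_eq_iff[of \<one> \<zero>] vlt_zero_right[of "\<one> \<ominus> \<zero>"] by (simp add: rveq_def)
    ultimately show ?thesis using 1 by (auto simp: \<psi>_def nth_append split: if_splits)
  qed
  show ?thesis
    by (rule exI[of _ K], rule exI[of _ \<chi>], rule exI[of _ d], rule conjI[OF E1], rule conjI[OF E2],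
        intro ballI conjI, (rule E3; assumption), (rule E4; assumption),
        (rule E5[THEN conjunct1]; assumption), (rule E5[THEN conjunct2]; assumption))
qed

text \<open>For each code \<open>\<xi>\<close> there is exactly one center, so
  \<open>bounded_union\<close> applies with bound 1 and the codes disappear from the set of
  centers.\<close>

lemma finite_prepare:
  assumes wf: "wf_form L (Suc p) q \<theta>"
  shows "\<exists>\<gamma> N. wf_form L (Suc p) q \<gamma> \<and> (\<forall>a\<in>tuples p (carrier M). \<forall>\<alpha>\<in>tuples q (RV M).
    finite {c \<in> carrier M. sat M (c # a) \<alpha> \<gamma>} \<and> card {c \<in> carrier M. sat M (c # a) \<alpha> \<gamma>} \<le> N \<and>
    (\<forall>x\<in>carrier M. \<forall>x'\<in>carrier M. (\<forall>c\<in>carrier M. sat M (c # a) \<alpha> \<gamma> \<longrightarrow> vlt M (x' \<ominus> x) (x \<ominus> c)) \<longrightarrow>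
       (sat M (x' # a) \<alpha> \<theta> \<longleftrightarrow> sat M (x # a) \<alpha> \<theta>)))"
proof -
  obtain K \<chi> d where
    D2: "\<exists>\<phi>. defs L M \<phi> (Suc p) (K + q) (\<lambda>xs \<xi>s. hd xs = d (tl xs) (drop K \<xi>s) (take K \<xi>s))" and
    D3: "\<forall>a\<in>tuples p (carrier M). \<forall>\<alpha>\<in>tuples q (RV M).
       (\<forall>x\<in>carrier M. \<chi> a \<alpha> x \<in> tuples K (RV M)) \<and>
       (\<forall>\<xi>\<in>tuples K (RV M). d a \<alpha> \<xi> \<in> carrier M) \<and>
       (\<forall>x\<in>carrier M. \<forall>x'\<in>carrier M.
          (\<chi> a \<alpha> x' = \<chi> a \<alpha> x \<longleftrightarrow> rveq M \<one> (x' \<ominus> d a \<alpha> (\<chi> a \<alpha> x)) (x \<ominus> d a \<alpha> (\<chi> a \<alpha> x))) \<and>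
          (\<chi> a \<alpha> x' = \<chi> a \<alpha> x \<longrightarrow> (sat M (x' # a) \<alpha> \<theta> \<longleftrightarrow> sat M (x # a) \<alpha> \<theta>)))"
    using prepare[OF wf] by (elim exE, elim conjE) (rule that, assumption+)
  obtain \<phi> where \<phi>: "defs L M \<phi> (Suc p) (K + q) (\<lambda>xs \<xi>s. hd xs = d (tl xs) (drop K \<xi>s) (take K \<xi>s))" using D2 by blast
  have s\<phi>: "sat M (c # a) (\<xi> @ \<alpha>) \<phi> \<longleftrightarrow> c = d a \<alpha> \<xi>"
    if "a \<in> tuples p (carrier M)" "\<alpha> \<in> tuples q (RV M)" "\<xi> \<in> tuples K (RV M)" "c \<in> carrier M" for a \<alpha> \<xi> c
    using \<phi> that tuples_append[OF that(3,2)] tuples_length[OF that(3)] unfolding defs_def by force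
  let ?\<gamma> = "FExRVs K \<phi>"
  have s\<gamma>: "sat M (c # a) \<alpha> ?\<gamma> \<longleftrightarrow> (\<exists>\<zeta>\<in>tuples K (RV M). sat M (c # a) (\<zeta> @ \<alpha>) \<phi>)" for c a \<alpha>
    by (rule sat_FExRVs)
  have "\<exists>N'. \<forall>a\<in>tuples p (carrier M). \<forall>\<alpha>\<in>tuples q (RV M).
      finite {z \<in> carrier M. \<exists>\<zeta>\<in>tuples K (RV M). sat M (z # a) (\<zeta> @ \<alpha>) \<phi>} \<and>
      card {z \<in> carrier M. \<exists>\<zeta>\<in>tuples K (RV M). sat M (z # a) (\<zeta> @ \<alpha>) \<phi>} \<le> N'"
  proof (rule bounded_union[where N = 1])
    show "wf_form L (Suc p) (K + q) \<phi>" using \<phi> by (simp add: defs_def)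
    fix a \<alpha> \<zeta> assume *: "a \<in> tuples p (carrier M)" "\<alpha> \<in> tuples q (RV M)" "\<zeta> \<in> tuples K (RV M)"
    have "{z \<in> carrier M. sat M (z # a) (\<zeta> @ \<alpha>) \<phi>} \<subseteq> {d a \<alpha> \<zeta>}" using s\<phi>[OF *] by auto
    then show "finite {z \<in> carrier M. sat M (z # a) (\<zeta> @ \<alpha>) \<phi>} \<and> card {z \<in> carrier M. sat M (z # a) (\<zeta> @ \<alpha>) \<phi>} \<le> 1"
      using finite_subset[of _ "{d a \<alpha> \<zeta>}"] card_mono[of "{d a \<alpha> \<zeta>}"] by fastforce
  qed
  then obtain N where N: "\<And>a \<alpha>. a \<in> tuples p (carrier M) \<Longrightarrow> \<alpha> \<in> tuples q (RV M) \<Longrightarrow>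
      finite {c \<in> carrier M. sat M (c # a) \<alpha> ?\<gamma>} \<and> card {c \<in> carrier M. sat M (c # a) \<alpha> ?\<gamma>} \<le> N"
    unfolding s\<gamma> by blast
  have main: "sat M (x' # a) \<alpha> \<theta> \<longleftrightarrow> sat M (x # a) \<alpha> \<theta>"
    if a: "a \<in> tuples p (carrier M)" "\<alpha> \<in> tuples q (RV M)" and x: "x \<in> carrier M" "x' \<in> carrier M"
      and C: "\<forall>c\<in>carrier M. sat M (c # a) \<alpha> ?\<gamma> \<longrightarrow> vlt M (x' \<ominus> x) (x \<ominus> c)" for a \<alpha> x x'
  proof -
    \<comment> \<open>The center of the fibre through \<open>x\<close> is among the collected
      points. A point nearer to \<open>x\<close> than this center has the same leading term relative
      to it and so stays in the fibre.\<close>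
    let ?c = "d a \<alpha> (\<chi> a \<alpha> x)"
    have \<chi>x: "\<chi> a \<alpha> x \<in> tuples K (RV M)" using D3 a x by blast
    then have c: "?c \<in> carrier M" using D3 a by blast
    then have "sat M (?c # a) \<alpha> ?\<gamma>" unfolding s\<gamma> using s\<phi>[OF a \<chi>x c] \<chi>x by blast
    then have "vlt M (x' \<ominus> x) (x \<ominus> ?c)" using C c by blast
    moreover have "(x' \<ominus> ?c) \<ominus> (x \<ominus> ?c) = x' \<ominus> x" using x c by algebra
    ultimately have "rveq M \<one> (x' \<ominus> ?c) (x \<ominus> ?c)" using x c by (simp add: rveq_def)
    then show ?thesis using D3 a x by blast
  qed
  show ?thesis
  proof (rule exI[of _ ?\<gamma>], rule exI[of _ N], intro conjI ballI impI)
    show "wf_form L (Suc p) q ?\<gamma>" using \<phi> by (simp add: defs_def wf_FExRVs)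
  qed (use N main in blast)+
qed

text \<open>A fibre of the decomposition prepared for the finite set \<open>C\<close> that is a ball is disjoint from \<open>C\<close>,
  so that \<open>rv (x - c)\<close> is constant on it for \<open>c \<in> C\<close>.\<close>

lemma code_finite:
  assumes wf: "wf_form L (Suc p) q \<gamma>"
    and fin: "\<And>a \<alpha>. a \<in> tuples p (carrier M) \<Longrightarrow> \<alpha> \<in> tuples q (RV M) \<Longrightarrow> finite {c \<in> carrier M. sat M (c # a) \<alpha> \<gamma>}"
  shows "\<exists>K \<chi>. (\<exists>\<phi>. defs L M \<phi> (Suc p) (K + q) (\<lambda>xs \<xi>s. take K \<xi>s = \<chi> (tl xs) (drop K \<xi>s) (hd xs))) \<and>
    (\<forall>a\<in>tuples p (carrier M). \<forall>\<alpha>\<in>tuples q (RV M).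
       (\<forall>x\<in>carrier M. \<chi> a \<alpha> x \<in> tuples K (RV M)) \<and>
       (\<forall>x\<in>carrier M. \<forall>x'\<in>carrier M. \<chi> a \<alpha> x' = \<chi> a \<alpha> x \<longrightarrow> x' = x \<or>
          (\<forall>c\<in>carrier M. sat M (c # a) \<alpha> \<gamma> \<longrightarrow> vlt M (x' \<ominus> x) (x \<ominus> c))))"
proof -
  obtain K \<chi> d where
    D1: "\<exists>\<phi>. defs L M \<phi> (Suc p) (K + q) (\<lambda>xs \<xi>s. take K \<xi>s = \<chi> (tl xs) (drop K \<xi>s) (hd xs))" and
    D3: "\<forall>a\<in>tuples p (carrier M). \<forall>\<alpha>\<in>tuples q (RV M).
       (\<forall>x\<in>carrier M. \<chi> a \<alpha> x \<in> tuples K (RV M)) \<and>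
       (\<forall>\<xi>\<in>tuples K (RV M). d a \<alpha> \<xi> \<in> carrier M) \<and>
       (\<forall>x\<in>carrier M. \<forall>x'\<in>carrier M.
          (\<chi> a \<alpha> x' = \<chi> a \<alpha> x \<longleftrightarrow> rveq M \<one> (x' \<ominus> d a \<alpha> (\<chi> a \<alpha> x)) (x \<ominus> d a \<alpha> (\<chi> a \<alpha> x))) \<and>
          (\<chi> a \<alpha> x' = \<chi> a \<alpha> x \<longrightarrow> (sat M (x' # a) \<alpha> \<gamma> \<longleftrightarrow> sat M (x # a) \<alpha> \<gamma>)))"
    using prepare[OF wf] by (elim exE, elim conjE) (rule that, assumption+)
  have main: "vlt M (x' \<ominus> x) (x \<ominus> c)"
    if a: "a \<in> tuples p (carrier M)" "\<alpha> \<in> tuples q (RV M)" and x: "x \<in> carrier M" "x' \<in> carrier M"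
      and e: "\<chi> a \<alpha> x' = \<chi> a \<alpha> x" "x' \<noteq> x" and c: "c \<in> carrier M" "sat M (c # a) \<alpha> \<gamma>" for a \<alpha> x x' c
  proof -
    let ?d = "d a \<alpha> (\<chi> a \<alpha> x)"
    have d: "?d \<in> carrier M" using D3 a x by blast
    have fib: "\<chi> a \<alpha> y = \<chi> a \<alpha> x \<longleftrightarrow> y = x \<or> vlt M (y \<ominus> x) (x \<ominus> ?d)" if y: "y \<in> carrier M" for y
    proof -
      have "(y \<ominus> ?d) \<ominus> (x \<ominus> ?d) = y \<ominus> x" using x y d by algebra
      moreover have "y \<ominus> ?d = x \<ominus> ?d \<longleftrightarrow> y = x"
      proof
        assume "y \<ominus> ?d = x \<ominus> ?d"
        then have "(y \<ominus> ?d) \<oplus> ?d = (x \<ominus> ?d) \<oplus> ?d" by simp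
        moreover have "(y \<ominus> ?d) \<oplus> ?d = y" "(x \<ominus> ?d) \<oplus> ?d = x" using x y d by algebra+
        ultimately show "y = x" by simp
      qed simp
      ultimately show ?thesis using D3 a x y d by (simp add: rveq_def)
    qed
    have v: "vlt M (x' \<ominus> x) (x \<ominus> ?d)" using fib[OF x(2)] e by blast
    have xd: "x \<ominus> ?d \<noteq> \<zero>"
    proof
      assume "x \<ominus> ?d = \<zero>"
      then show False using v vlt_zero_right[of "x' \<ominus> x"] x by simp
    qed
    \<comment> \<open>If \<open>c\<close> were in the fibre of \<open>x\<close>, the whole fibre
      would satisfy \<open>\<gamma>\<close>, because the decomposition is prepared for
      \<open>\<gamma>\<close>. But it contains an open ball, and only finitely many points satisfy
      \<open>\<gamma>\<close>.\<close>
    have "\<not> vlt M (c \<ominus> x) (x \<ominus> ?d)"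
    proof
      assume "vlt M (c \<ominus> x) (x \<ominus> ?d)"
      then have "\<chi> a \<alpha> c = \<chi> a \<alpha> x" using fib[OF c(1)] by blast
      then have sx: "sat M (x # a) \<alpha> \<gamma>" using D3 a x c by blast
      have "ball M x (x \<ominus> ?d) \<subseteq> {c \<in> carrier M. sat M (c # a) \<alpha> \<gamma>}"
      proof
        fix y assume "y \<in> ball M x (x \<ominus> ?d)"
        then have y: "y \<in> carrier M" "vlt M (y \<ominus> x) (x \<ominus> ?d)" by (auto simp: ball_def)
        then have "\<chi> a \<alpha> y = \<chi> a \<alpha> x" using fib by blast
        then show "y \<in> {c \<in> carrier M. sat M (c # a) \<alpha> \<gamma>}" using D3 a x y sx by blast
      qed
      then show False using fin[OF a] infinite_ball[of "x \<ominus> ?d" x] xd x d finite_subset by blast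
    qed
    then have "\<exists>z\<in>vring M. x \<ominus> ?d = z \<otimes> (c \<ominus> x)" unfolding vlt_iff by blast
    then have "\<exists>z\<in>vring M. x \<ominus> ?d = z \<otimes> (\<ominus> (c \<ominus> x))" using le_minus[of "c \<ominus> x" "x \<ominus> ?d"] x c d by simp
    moreover have "\<ominus> (c \<ominus> x) = x \<ominus> c" using x c by algebra
    ultimately have "\<exists>z\<in>vring M. x \<ominus> ?d = z \<otimes> (x \<ominus> c)" by simp
    then show ?thesis using vlt_le_trans[OF v] x by simp
  qed
  show ?thesis
    by (rule exI[of _ K], rule exI[of _ \<chi>], rule conjI[OF D1], intro ballI conjI) (use D3 main in blast)+
qed

end

section \<open>Codes in RV for families of definable sets\<close>

context vstr
begin

text \<open>A code: a map to a power of RV definable in \<open>L\<close> without parameters.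
  Parameters needed later are entered as further arguments, so that codes can be uniform in
  them.\<close>

definition dfun :: "nat \<Rightarrow> nat \<Rightarrow> ('u list \<Rightarrow> 'u set list) \<Rightarrow> bool" where
  "dfun n k \<chi> \<longleftrightarrow> (\<forall>x\<in>tuples n (carrier M). \<chi> x \<in> tuples k (RV M)) \<and>
     (\<exists>\<phi>. defs L M \<phi> n k (\<lambda>xs \<xi>s. \<xi>s = \<chi> xs))"

lemma dfun_append:
  assumes "dfun n k \<chi>" "dfun n k' \<chi>'"
  shows "dfun n (k + k') (\<lambda>x. \<chi> x @ \<chi>' x)"
proof -
  obtain \<phi> \<phi>' where \<phi>: "defs L M \<phi> n k (\<lambda>xs \<xi>s. \<xi>s = \<chi> xs)" and \<phi>': "defs L M \<phi>' n k' (\<lambda>xs \<xi>s. \<xi>s = \<chi>' xs)"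
    using assms unfolding dfun_def by blast
  have "\<exists>\<psi>. defs L M \<psi> n (k + k') (\<lambda>xs \<xi>s. take k \<xi>s = \<chi> xs \<and> drop k \<xi>s = \<chi>' xs)"
    by (rule exI, (rule d_and d_sub[OF \<phi>] d_sub[OF \<phi>'] tm_intros | (simp; fail))+)
  then obtain \<psi> where \<psi>: "defs L M \<psi> n (k + k') (\<lambda>xs \<xi>s. take k \<xi>s = \<chi> xs \<and> drop k \<xi>s = \<chi>' xs)" by blast
  have "defs L M \<psi> n (k + k') (\<lambda>xs \<xi>s. \<xi>s = \<chi> xs @ \<chi>' xs)"
  proof (rule d_cong[OF \<psi>])
    fix xs \<xi>s assume "xs \<in> tuples n (carrier M)"
    then have "length (\<chi> xs) = k" using assms(1) tuples_length unfolding dfun_def by blast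
    then show "\<xi>s = \<chi> xs @ \<chi>' xs \<longleftrightarrow> take k \<xi>s = \<chi> xs \<and> drop k \<xi>s = \<chi>' xs"
      by (metis append_eq_conv_conj append_take_drop_id)
  qed
  then show ?thesis using assms tuples_append unfolding dfun_def by blast
qed

lemma dfun_comp:
  assumes "dfun n k \<chi>" "tms L M ts n' n e"
  shows "dfun n' k (\<lambda>x. \<chi> (e x))"
proof -
  obtain \<phi> where \<phi>: "defs L M \<phi> n k (\<lambda>xs \<xi>s. \<xi>s = \<chi> xs)" using assms unfolding dfun_def by blast
  have "\<exists>\<psi>. defs L M \<psi> n' k (\<lambda>xs \<xi>s. \<xi>s = \<chi> (e xs))"
    by (rule exI, rule d_sub[OF \<phi> assms(2) rts_id]) simp_all
  then show ?thesis using assms(1) tms_closed[OF assms(2)] unfolding dfun_def by blast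
qed

end

context vfield
begin

text \<open>Take for \<open>m\<close> an element \<open>x - c\<close> of least value; finiteness of
  \<open>C\<close> provides it.\<close>

lemma isolating_radius:
  assumes "finite C" "C \<subseteq> carrier M" "x \<in> carrier M" "x \<notin> C"
  shows "\<exists>m\<in>carrier M. m \<noteq> \<zero> \<and> (\<forall>c\<in>C. \<forall>u\<in>carrier M. vlt M u m \<longrightarrow> vlt M u (x \<ominus> c))"
  using assms
proof (induction C rule: finite_induct)
  case empty
  then show ?case by (intro bexI[of _ \<one>]) auto
next
  case (insert c C)
  then obtain m where m: "m \<in> carrier M" "m \<noteq> \<zero>" "\<forall>c\<in>C. \<forall>u\<in>carrier M. vlt M u m \<longrightarrow> vlt M u (x \<ominus> c)" by auto
  have c: "c \<in> carrier M" "x \<noteq> c" "x \<in> carrier M" using insert by auto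
  then have n: "x \<ominus> c \<in> carrier M" "x \<ominus> c \<noteq> \<zero>" using r_right_minus_eq by auto
  show ?case
  proof (cases "\<exists>z\<in>vring M. m = z \<otimes> (x \<ominus> c)")
    case True
    have "vlt M u (x \<ominus> c)" if "u \<in> carrier M" "vlt M u m" for u by (rule vlt_le_trans[OF that(2) True that(1)])
    then show ?thesis using m by (intro bexI[of _ m]) auto
  next
    case False
    then have le: "\<exists>z\<in>vring M. x \<ominus> c = z \<otimes> m" using dv_total[OF m(1) n(1)] by blast
    have "vlt M u m" if "u \<in> carrier M" "vlt M u (x \<ominus> c)" for u by (rule vlt_le_trans[OF that(2) le that(1)])
    then show ?thesis using m n by (intro bexI[of _ "x \<ominus> c"]) auto
  qed
qed

text \<open>Every sub-box around \<open>x0\<close> lies in \<open>F\<close>, so \<open>f\<close> and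
  \<open>g\<close> have to agree on \<open>F\<close> only. This allows \<open>f\<close> to be a
  different member of a family on each fibre.\<close>

lemma okb_cong:
  assumes ok: "okb M l F C g \<psi>' x0" and C: "\<forall>i<l. \<forall>z\<in>tuples i (carrier M). C i z \<in> carrier M"
    and x0: "x0 \<in> F" and f: "\<And>x. x \<in> F \<Longrightarrow> f x = g x" and \<psi>: "\<And>x. x \<in> F \<Longrightarrow> \<psi>' x = \<psi>' x0 \<Longrightarrow> \<psi> x = \<psi> x0"
  shows "okb M l F C f \<psi> x0"
proof -
  have F: "F = {x \<in> tuples l (carrier M). same M l C \<one> x x0}" using ok unfolding okb_def by (elim conjE)
  have x0c: "x0 \<in> tuples l (carrier M)" using x0 F by blast
  have 1: "f ` F = g ` F" using f by (rule image_cong[OF refl])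
  have 2: "f ` {x \<in> tuples l (carrier M). same M l C d x x0} = g ` {x \<in> tuples l (carrier M). same M l C d x x0}"
    if "d \<in> vring M" for d
  proof (rule image_cong[OF refl])
    fix x assume "x \<in> {x \<in> tuples l (carrier M). same M l C d x x0}"
    then have "x \<in> F" using same_one[OF C _ x0c that] F by blast
    then show "f x = g x" by (rule f)
  qed
  have 3: "(\<forall>x\<in>F. f x = f x0) \<longleftrightarrow> (\<forall>x\<in>F. g x = g x0)" using f x0 by simp
  show ?thesis unfolding okb_def 1 3
  proof (intro conjI ballI impI)
    have "\<forall>x\<in>F. \<psi>' x = \<psi>' x0" using ok unfolding okb_def by (elim conjE)
    then show "\<psi> x = \<psi> x0" if "x \<in> F" for x using that \<psi> by blast
    show "(\<forall>x\<in>F. g x = g x0) \<or> (\<exists>m\<in>carrier M. m \<noteq> \<zero> \<and> (\<exists>a\<in>carrier M. g ` F = ball M a m))"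
      using ok unfolding okb_def by (elim conjE)
    have H: "\<forall>m\<in>carrier M. \<forall>a\<in>carrier M. m \<noteq> \<zero> \<and> g ` F = ball M a m \<longrightarrow>
       (\<forall>d\<in>carrier M. d \<in> vring M \<and> d \<noteq> \<zero> \<longrightarrow>
         (\<exists>a'\<in>carrier M. g ` {x \<in> tuples l (carrier M). same M l C d x x0} = ball M a' (d \<otimes> m)))"
      using ok unfolding okb_def by (elim conjE)
    fix m a d assume *: "m \<in> carrier M" "a \<in> carrier M" "m \<noteq> \<zero> \<and> g ` F = ball M a m" "d \<in> carrier M" "d \<in> vring M \<and> d \<noteq> \<zero>"
    show "\<exists>a'\<in>carrier M. f ` {x \<in> tuples l (carrier M). same M l C d x x0} = ball M a' (d \<otimes> m)"
      unfolding 2[OF conjunct1[OF *(5)]] by (rule H[rule_format, OF *])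
  qed (rule F)
qed

end

context td_model
begin

text \<open>More centers make the closeness condition stronger. Hence the union of the centers over
  all \<open>\<xi>\<close>, still finite by \<open>bounded_union\<close>, prepares all members of
  the family at once.\<close>

lemma prepare_RV:
  assumes wf: "wf_form L (Suc p) m \<phi>"
  shows "\<exists>\<gamma>. wf_form L (Suc p) 0 \<gamma> \<and> (\<forall>a\<in>tuples p (carrier M).
    finite {c \<in> carrier M. sat M (c # a) [] \<gamma>} \<and>
    (\<forall>x\<in>carrier M. \<forall>x'\<in>carrier M. (\<forall>c\<in>carrier M. sat M (c # a) [] \<gamma> \<longrightarrow> vlt M (x' \<ominus> x) (x \<ominus> c)) \<longrightarrow>
       (\<forall>\<xi>\<in>tuples m (RV M). sat M (x' # a) \<xi> \<phi> \<longleftrightarrow> sat M (x # a) \<xi> \<phi>)))"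
proof -
  obtain \<gamma> N where wf\<gamma>: "wf_form L (Suc p) m \<gamma>" and \<gamma>: "\<forall>a\<in>tuples p (carrier M). \<forall>\<alpha>\<in>tuples m (RV M).
    finite {c \<in> carrier M. sat M (c # a) \<alpha> \<gamma>} \<and> card {c \<in> carrier M. sat M (c # a) \<alpha> \<gamma>} \<le> N \<and>
    (\<forall>x\<in>carrier M. \<forall>x'\<in>carrier M. (\<forall>c\<in>carrier M. sat M (c # a) \<alpha> \<gamma> \<longrightarrow> vlt M (x' \<ominus> x) (x \<ominus> c)) \<longrightarrow>
       (sat M (x' # a) \<alpha> \<phi> \<longleftrightarrow> sat M (x # a) \<alpha> \<phi>))"
    using finite_prepare[OF wf] by (elim exE, elim conjE) (rule that, assumption+)
  have "\<exists>N'. \<forall>a\<in>tuples p (carrier M). \<forall>\<alpha>\<in>tuples 0 (RV M).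
      finite {z \<in> carrier M. \<exists>\<zeta>\<in>tuples m (RV M). sat M (z # a) (\<zeta> @ \<alpha>) \<gamma>} \<and>
      card {z \<in> carrier M. \<exists>\<zeta>\<in>tuples m (RV M). sat M (z # a) (\<zeta> @ \<alpha>) \<gamma>} \<le> N'"
    by (rule bounded_union[where N = N]) (use wf\<gamma> \<gamma> in auto)
  then have fin: "finite {z \<in> carrier M. \<exists>\<zeta>\<in>tuples m (RV M). sat M (z # a) \<zeta> \<gamma>}" if "a \<in> tuples p (carrier M)" for a
    using that by auto
  have s: "sat M (c # a) [] (FExRVs m \<gamma>) \<longleftrightarrow> (\<exists>\<zeta>\<in>tuples m (RV M). sat M (c # a) \<zeta> \<gamma>)" for c a
    using sat_FExRVs[of M "c # a" "[]" m \<gamma>] by simp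
  show ?thesis
  proof (intro exI[of _ "FExRVs m \<gamma>"] conjI ballI impI)
    show "wf_form L (Suc p) 0 (FExRVs m \<gamma>)" using wf\<gamma> by (simp add: wf_FExRVs)
    fix a assume a: "a \<in> tuples p (carrier M)"
    show "finite {c \<in> carrier M. sat M (c # a) [] (FExRVs m \<gamma>)}" unfolding s by (rule fin[OF a])
    fix x x' \<xi> assume x: "x \<in> carrier M" "x' \<in> carrier M" and \<xi>: "\<xi> \<in> tuples m (RV M)"
      and C: "\<forall>c\<in>carrier M. sat M (c # a) [] (FExRVs m \<gamma>) \<longrightarrow> vlt M (x' \<ominus> x) (x \<ominus> c)"
    have "\<forall>c\<in>carrier M. sat M (c # a) \<xi> \<gamma> \<longrightarrow> vlt M (x' \<ominus> x) (x \<ominus> c)" using C \<xi> unfolding s by blast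
    then show "sat M (x' # a) \<xi> \<phi> \<longleftrightarrow> sat M (x # a) \<xi> \<phi>" using \<gamma> a \<xi> x by blast
  qed
qed

text \<open>Induction on the number of field variables. With the others as parameters, the first one
  is coded by its position relative to finitely many centers; what remains to be known about the
  others is again a family indexed by RV, with the code among its indices.\<close>

lemma code_family:
  "wf_form L n m \<phi> \<Longrightarrow> \<exists>k \<chi>. dfun n k \<chi> \<and> (\<forall>x\<in>tuples n (carrier M). \<forall>x'\<in>tuples n (carrier M).
     \<chi> x = \<chi> x' \<longrightarrow> (\<forall>\<xi>\<in>tuples m (RV M). sat M x \<xi> \<phi> \<longleftrightarrow> sat M x' \<xi> \<phi>))"
proof (induction n arbitrary: m \<phi>)
  case 0
  have "defs L M FTrue 0 0 (\<lambda>xs \<xi>s. \<xi>s = [])" by (auto simp: defs_def)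
  then have "dfun 0 0 (\<lambda>_. [])" unfolding dfun_def by auto
  then show ?case by (intro exI[of _ 0] exI[of _ "\<lambda>_. []"]) auto
next
  case (Suc n)
  obtain \<gamma> where wf\<gamma>: "wf_form L (Suc n) 0 \<gamma>" and \<gamma>: "\<forall>a\<in>tuples n (carrier M).
    finite {c \<in> carrier M. sat M (c # a) [] \<gamma>} \<and>
    (\<forall>x\<in>carrier M. \<forall>x'\<in>carrier M. (\<forall>c\<in>carrier M. sat M (c # a) [] \<gamma> \<longrightarrow> vlt M (x' \<ominus> x) (x \<ominus> c)) \<longrightarrow>
       (\<forall>\<xi>\<in>tuples m (RV M). sat M (x' # a) \<xi> \<phi> \<longleftrightarrow> sat M (x # a) \<xi> \<phi>))"
    using prepare_RV[OF Suc.prems] by (elim exE, elim conjE) (rule that, assumption+)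
  have "\<exists>K \<chi>. (\<exists>\<phi>. defs L M \<phi> (Suc n) (K + 0) (\<lambda>xs \<xi>s. take K \<xi>s = \<chi> (tl xs) (drop K \<xi>s) (hd xs))) \<and>
    (\<forall>a\<in>tuples n (carrier M). \<forall>\<alpha>\<in>tuples 0 (RV M).
       (\<forall>x\<in>carrier M. \<chi> a \<alpha> x \<in> tuples K (RV M)) \<and>
       (\<forall>x\<in>carrier M. \<forall>x'\<in>carrier M. \<chi> a \<alpha> x' = \<chi> a \<alpha> x \<longrightarrow> x' = x \<or>
          (\<forall>c\<in>carrier M. sat M (c # a) \<alpha> \<gamma> \<longrightarrow> vlt M (x' \<ominus> x) (x \<ominus> c))))"
    by (rule code_finite[OF wf\<gamma>]) (use \<gamma> in auto)
  then obtain K \<chi>0 where E1: "\<exists>\<phi>. defs L M \<phi> (Suc n) (K + 0) (\<lambda>xs \<xi>s. take K \<xi>s = \<chi>0 (tl xs) (drop K \<xi>s) (hd xs))"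
    and E2: "\<forall>a\<in>tuples n (carrier M). \<forall>\<alpha>\<in>tuples 0 (RV M).
       (\<forall>x\<in>carrier M. \<chi>0 a \<alpha> x \<in> tuples K (RV M)) \<and>
       (\<forall>x\<in>carrier M. \<forall>x'\<in>carrier M. \<chi>0 a \<alpha> x' = \<chi>0 a \<alpha> x \<longrightarrow> x' = x \<or>
          (\<forall>c\<in>carrier M. sat M (c # a) \<alpha> \<gamma> \<longrightarrow> vlt M (x' \<ominus> x) (x \<ominus> c)))"
    by (elim exE, elim conjE) (rule that, assumption+)
  define \<chi>1 where "\<chi>1 xs = \<chi>0 (tl xs) [] (hd xs)" for xs
  obtain \<phi>1 where \<phi>1: "defs L M \<phi>1 (Suc n) (K + 0) (\<lambda>xs \<xi>s. take K \<xi>s = \<chi>0 (tl xs) (drop K \<xi>s) (hd xs))" using E1 by blast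
  have \<phi>1': "defs L M \<phi>1 (Suc n) K (\<lambda>xs \<xi>s. \<xi>s = \<chi>1 xs)"
  proof -
    have "defs L M \<phi>1 (Suc n) K (\<lambda>xs \<xi>s. take K \<xi>s = \<chi>0 (tl xs) (drop K \<xi>s) (hd xs))" using \<phi>1 by simp
    then show ?thesis by (rule d_cong) (simp add: \<chi>1_def tuples_length)
  qed
  have \<chi>1c: "\<chi>1 xs \<in> tuples K (RV M)" if "xs \<in> tuples (Suc n) (carrier M)" for xs
    using E2 that by (auto simp: tuples_Suc \<chi>1_def)
  have d1: "dfun (Suc n) K \<chi>1" unfolding dfun_def using \<phi>1' \<chi>1c by blast
  have key: "sat M (y' # a) \<xi> \<phi> \<longleftrightarrow> sat M (y # a) \<xi> \<phi>"
    if "a \<in> tuples n (carrier M)" "y \<in> carrier M" "y' \<in> carrier M" "\<chi>1 (y' # a) = \<chi>1 (y # a)" "\<xi> \<in> tuples m (RV M)" for a y y' \<xi>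
  proof (cases "y' = y")
    case False
    then have "\<forall>c\<in>carrier M. sat M (c # a) [] \<gamma> \<longrightarrow> vlt M (y' \<ominus> y) (y \<ominus> c)"
      using E2[THEN bspec, OF that(1), THEN bspec, of "[]"] that by (auto simp: \<chi>1_def)
    then show ?thesis using \<gamma>[THEN bspec, OF that(1)] that by blast
  qed simp
  \<comment> \<open>For the remaining coordinates \<open>\<theta>\<close> records which
    \<open>\<xi>\<close> hold at some first coordinate with a given code. By \<open>key\<close>, for
    fixed remaining coordinates, all first coordinates with that code behave alike, so this decides
    \<open>\<phi>\<close>.\<close>
  have "\<exists>\<theta>. defs L M \<theta> n (K + m) (\<lambda>xs \<xi>s. \<exists>y\<in>carrier M. take K \<xi>s = \<chi>1 (y # xs) \<and> sat M (y # xs) (drop K \<xi>s) \<phi>)"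
    by (rule exI, (rule d_intros d_sub[OF \<phi>1'] d_sub[OF d_self[OF Suc.prems]] tm_intros | (simp; fail))+)
  then obtain \<theta> where \<theta>: "defs L M \<theta> n (K + m) (\<lambda>xs \<xi>s. \<exists>y\<in>carrier M. take K \<xi>s = \<chi>1 (y # xs) \<and> sat M (y # xs) (drop K \<xi>s) \<phi>)" by blast
  have s\<theta>: "sat M x (\<eta> @ \<xi>) \<theta> \<longleftrightarrow> (\<exists>y\<in>carrier M. \<eta> = \<chi>1 (y # x) \<and> sat M (y # x) \<xi> \<phi>)"
    if "x \<in> tuples n (carrier M)" "\<eta> \<in> tuples K (RV M)" "\<xi> \<in> tuples m (RV M)" for x \<eta> \<xi>
    using \<theta>[unfolded defs_def, THEN conjunct2, THEN bspec, OF that(1), THEN bspec, OF tuples_append[OF that(2,3)]]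
      tuples_length[OF that(2)] by simp
  have wf\<theta>: "wf_form L n (K + m) \<theta>" using \<theta> by (simp add: defs_def)
  obtain k \<chi>2 where d2: "dfun n k \<chi>2" and \<chi>2: "\<forall>x\<in>tuples n (carrier M). \<forall>x'\<in>tuples n (carrier M).
     \<chi>2 x = \<chi>2 x' \<longrightarrow> (\<forall>\<xi>\<in>tuples (K + m) (RV M). sat M x \<xi> \<theta> \<longleftrightarrow> sat M x' \<xi> \<theta>)"
    using Suc.IH[OF wf\<theta>] by (elim exE, elim conjE) (rule that, assumption+)
  have "tms L M (tl (map Var [0..<Suc n])) (Suc n) n (\<lambda>xs. tl xs)" using tms_tl[OF tms_id, of L M "Suc n"] by simp
  from dfun_append[OF d1 dfun_comp[OF d2 this]]
  have d: "dfun (Suc n) (K + k) (\<lambda>x. \<chi>1 x @ \<chi>2 (tl x))" .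
  have imp: "sat M x' \<xi> \<phi>" if x: "x \<in> tuples (Suc n) (carrier M)" "x' \<in> tuples (Suc n) (carrier M)"
    and e: "\<chi>1 x @ \<chi>2 (tl x) = \<chi>1 x' @ \<chi>2 (tl x')" and \<xi>: "\<xi> \<in> tuples m (RV M)" and s: "sat M x \<xi> \<phi>" for x x' \<xi>
  proof -
    obtain y a y' a' where xy: "x = y # a" "x' = y' # a'" "y \<in> carrier M" "a \<in> tuples n (carrier M)"
      "y' \<in> carrier M" "a' \<in> tuples n (carrier M)" using x by (auto simp: tuples_Suc)
    have l: "length (\<chi>1 x) = K" "length (\<chi>1 x') = K" using \<chi>1c x tuples_length by auto
    then have e1: "\<chi>1 x = \<chi>1 x'" and e2: "\<chi>2 a = \<chi>2 a'" using e xy by auto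
    have "sat M a (\<chi>1 x @ \<xi>) \<theta>" using s\<theta>[OF xy(4) \<chi>1c[OF x(1)] \<xi>] xy s by blast
    then have "sat M a' (\<chi>1 x @ \<xi>) \<theta>" using \<chi>2 xy(4,6) e2 tuples_append[OF \<chi>1c[OF x(1)] \<xi>] by blast
    then obtain y'' where "y'' \<in> carrier M" "\<chi>1 x = \<chi>1 (y'' # a')" "sat M (y'' # a') \<xi> \<phi>"
      using s\<theta>[OF xy(6) \<chi>1c[OF x(1)] \<xi>] by blast
    then show ?thesis using key[OF xy(6,5), of y'' \<xi>] e1 xy \<xi> by simp
  qed
  show ?case
  proof (rule exI[of _ "K + k"], rule exI[of _ "\<lambda>x. \<chi>1 x @ \<chi>2 (tl x)"], intro conjI d ballI impI)
    fix x x' \<xi> assume *: "x \<in> tuples (Suc n) (carrier M)" "x' \<in> tuples (Suc n) (carrier M)"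
      "\<chi>1 x @ \<chi>2 (tl x) = \<chi>1 x' @ \<chi>2 (tl x')" "\<xi> \<in> tuples m (RV M)"
    show "sat M x \<xi> \<phi> \<longleftrightarrow> sat M x' \<xi> \<phi>" using imp[OF *] imp[OF *(2,1) *(3)[symmetric] *(4)] by blast
  qed
qed

end

section \<open>Relative elimination of field quantifiers\<close>

text \<open>Both languages are interpreted in the same structure. The function symbols coincide, so
  terms mean the same in both, and only the relations on RV differ.\<close>

locale td_expansion = td_model L M l for L :: "('f, 'r) lang" and M :: "('f, 'r, 'u) vstruct" (structure) and l +
  fixes L' :: "('f, 'r) lang"
  assumes fsyms_eq: "fsyms L' = fsyms L" and farity_eq: "\<And>f. f \<in> fsyms L \<Longrightarrow> farity L' f = farity L f"
    and rsyms_sub: "rsyms L \<subseteq> rsyms L'" and rarity_eq: "\<And>R. R \<in> rsyms L \<Longrightarrow> rarity L' R = rarity L R"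
    and new_rsyms: "\<And>R. R \<in> rsyms L' - rsyms L \<Longrightarrow> fst (rarity L' R) = 0"
    and vfs': "vf_structure L' M"
begin

sublocale E: vstr L' M
  using vfs' by (rule vstrI)

lemma wf_trm_eq: "wf_trm L' n t \<longleftrightarrow> wf_trm L n t"
  by (induction t) (auto simp: fsyms_eq farity_eq list_all_iff)

lemma wf_rvtrm_eq: "wf_rvtrm L' n m t \<longleftrightarrow> wf_rvtrm L n m t"
  by (cases t) (auto simp: wf_trm_eq)

lemma wf_form_mono: "wf_form L n m \<phi> \<Longrightarrow> wf_form L' n m \<phi>"
  by (induction \<phi> arbitrary: n m)
     (auto simp: wf_trm_eq wf_rvtrm_eq rarity_eq list_all_iff intro: subsetD[OF rsyms_sub])

lemma defs_mono: "defs L M \<phi> n m P \<Longrightarrow> defs L' M \<phi> n m P"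
  by (auto simp: defs_def intro: wf_form_mono)

text \<open>Since the predicates are arbitrary, \<open>\<phi>\<close> is not equivalent to a formula
  of \<open>L\<close>; only its dependence on the field variables is bounded. Stated for all
  \<open>\<xi>\<close> simultaneously, this passes through RV quantifiers directly, and the field
  quantifier is the real step.\<close>

lemma control:
  "wf_form L' n m \<phi> \<Longrightarrow> \<exists>k \<chi>. dfun n k \<chi> \<and> (\<forall>x\<in>tuples n (carrier M). \<forall>x'\<in>tuples n (carrier M).
     \<chi> x = \<chi> x' \<longrightarrow> (\<forall>\<xi>\<in>tuples m (RV M). sat M x \<xi> \<phi> \<longleftrightarrow> sat M x' \<xi> \<phi>))"
proof (induction \<phi> arbitrary: n m)
  case (FEq s t)
  then show ?case by (intro code_family) (simp add: wf_trm_eq)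
next
  case (FVal t)
  then show ?case by (intro code_family) (simp add: wf_trm_eq)
next
  case (FRVEq s t)
  then show ?case by (intro code_family) (simp add: wf_rvtrm_eq)
next
  case (FRel R ts us)
  show ?case
  proof (cases "R \<in> rsyms L")
    case True
    then show ?thesis using FRel
      by (intro code_family) (simp add: wf_trm_eq[abs_def] wf_rvtrm_eq[abs_def] rarity_eq)
  next
    case False
    then have ts: "ts = []" using FRel new_rsyms[of R] by auto
    \<comment> \<open>An argument that is an RV variable does not depend on the field variables. The
      placeholder \<open>Rv TZero\<close> keeps the code at one component per argument.\<close>
    let ?u = "\<lambda>u. case u of RVVar _ \<Rightarrow> Rv TZero | Rv t \<Rightarrow> Rv t"
    let ?\<chi> = "\<lambda>xs. map (rveval M xs []) (map ?u us)"
    have wfu: "wf_rvtrm L n m u" if "u \<in> set us" for u using FRel.prems that by (simp add: list_all_iff wf_rvtrm_eq)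
    have r: "rts L M (map ?u us) n (length us) (length us) (\<lambda>xs \<xi>s. ?\<chi> xs)"
    proof -
      have "wf_rvtrm L n (length us) (?u u)" if "u \<in> set us" for u using wfu[OF that] by (cases u) auto
      moreover have "rveval M xs [] (?u u) = rveval M xs \<xi>s (?u u)" for u xs \<xi>s by (cases u) auto
      ultimately show ?thesis by (simp add: rts_def list_all_iff)
    qed
    have "\<exists>\<psi>. defs L M \<psi> n (length us) (\<lambda>xs \<xi>s. \<xi>s = ?\<chi> xs)"
      by (rule exI, rule d_rveqs[OF rts_id r]) simp
    moreover have "?\<chi> x \<in> tuples (length us) (RV M)" if x: "x \<in> tuples n (carrier M)" for x
    proof -
      have "rveval M x [] (?u u) \<in> RV M" if "u \<in> set us" for u
        using wfu[OF that] eval_closed[OF x] by (cases u) auto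
      then show ?thesis by (auto simp: tuples_def)
    qed
    ultimately have "dfun n (length us) ?\<chi>" unfolding dfun_def by blast
    moreover have m: "map (rveval M x \<xi>) us = map (rveval M x' \<xi>) us" if e: "?\<chi> x = ?\<chi> x'" for x x' \<xi>
    proof -
      have "rveval M x [] (?u u) = rveval M x' [] (?u u)" if "u \<in> set us" for u
        using e that by (simp add: comp_def)
      then have "rveval M x \<xi> u = rveval M x' \<xi> u" if "u \<in> set us" for u
        using that by (cases u) fastforce+
      then show ?thesis by simp
    qed
    ultimately show ?thesis unfolding ts
    proof (intro exI[of _ "length us"] exI[of _ ?\<chi>] conjI ballI impI)
      fix x x' \<xi> assume "?\<chi> x = ?\<chi> x'"
      from m[OF this, of \<xi>] show "sat M x \<xi> (FRel R [] us) \<longleftrightarrow> sat M x' \<xi> (FRel R [] us)"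
        by (simp only: sat.simps list.map(1))
    qed
  qed
next
  case (FNot \<phi>)
  then show ?case by simp
next
  case (FAnd \<phi> \<psi>)
  obtain k \<chi> where a: "dfun n k \<chi>" "\<forall>x\<in>tuples n (carrier M). \<forall>x'\<in>tuples n (carrier M).
     \<chi> x = \<chi> x' \<longrightarrow> (\<forall>\<xi>\<in>tuples m (RV M). sat M x \<xi> \<phi> \<longleftrightarrow> sat M x' \<xi> \<phi>)"
    using FAnd.IH(1)[of n m] FAnd.prems by auto
  obtain k' \<chi>' where b: "dfun n k' \<chi>'" "\<forall>x\<in>tuples n (carrier M). \<forall>x'\<in>tuples n (carrier M).
     \<chi>' x = \<chi>' x' \<longrightarrow> (\<forall>\<xi>\<in>tuples m (RV M). sat M x \<xi> \<psi> \<longleftrightarrow> sat M x' \<xi> \<psi>)"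
    using FAnd.IH(2)[of n m] FAnd.prems by auto
  have *: "\<chi> x = \<chi> x' \<and> \<chi>' x = \<chi>' x'" if "x \<in> tuples n (carrier M)" "x' \<in> tuples n (carrier M)" "\<chi> x @ \<chi>' x = \<chi> x' @ \<chi>' x'" for x x'
  proof -
    have "\<chi> x \<in> tuples k (RV M)" "\<chi> x' \<in> tuples k (RV M)" using a(1) that unfolding dfun_def by blast+
    then show ?thesis using that(3) tuples_length by (metis append_eq_append_conv)
  qed
  have "sat M x \<xi> (FAnd \<phi> \<psi>) \<longleftrightarrow> sat M x' \<xi> (FAnd \<phi> \<psi>)"
    if "x \<in> tuples n (carrier M)" "x' \<in> tuples n (carrier M)" "\<chi> x @ \<chi>' x = \<chi> x' @ \<chi>' x'" "\<xi> \<in> tuples m (RV M)" for x x' \<xi>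
  proof -
    have "sat M x \<xi> \<phi> \<longleftrightarrow> sat M x' \<xi> \<phi>" "sat M x \<xi> \<psi> \<longleftrightarrow> sat M x' \<xi> \<psi>"
      using *[OF that(1-3)] that a(2) b(2) by blast+
    then show ?thesis by simp
  qed
  then show ?case using dfun_append[OF a(1) b(1)] by blast
next
  case (FExRV \<phi>)
  obtain k \<chi> where a: "dfun n k \<chi>" "\<forall>x\<in>tuples n (carrier M). \<forall>x'\<in>tuples n (carrier M).
     \<chi> x = \<chi> x' \<longrightarrow> (\<forall>\<xi>\<in>tuples (Suc m) (RV M). sat M x \<xi> \<phi> \<longleftrightarrow> sat M x' \<xi> \<phi>)"
    using FExRV.IH[of n "Suc m"] FExRV.prems by auto
  show ?case
  proof (rule exI[of _ k], rule exI[of _ \<chi>], intro conjI a(1) ballI impI)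
    fix x x' \<xi> assume x: "x \<in> tuples n (carrier M)" "x' \<in> tuples n (carrier M)" "\<chi> x = \<chi> x'" and \<xi>: "\<xi> \<in> tuples m (RV M)"
    have "sat M x (\<zeta> # \<xi>) \<phi> \<longleftrightarrow> sat M x' (\<zeta> # \<xi>) \<phi>" if "\<zeta> \<in> RV M" for \<zeta>
      using a(2)[THEN bspec, OF x(1), THEN bspec, OF x(2), THEN mp, OF x(3), THEN bspec, of "\<zeta> # \<xi>"] that \<xi> by simp
    then show "sat M x \<xi> (FExRV \<phi>) \<longleftrightarrow> sat M x' \<xi> (FExRV \<phi>)" by auto
  qed
next
  case (FEx \<phi>)
  obtain k \<chi> where a: "dfun (Suc n) k \<chi>" "\<forall>x\<in>tuples (Suc n) (carrier M). \<forall>x'\<in>tuples (Suc n) (carrier M).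
     \<chi> x = \<chi> x' \<longrightarrow> (\<forall>\<xi>\<in>tuples m (RV M). sat M x \<xi> \<phi> \<longleftrightarrow> sat M x' \<xi> \<phi>)"
    using FEx.IH[of "Suc n" m] FEx.prems by auto
  obtain \<psi> where \<psi>: "defs L M \<psi> (Suc n) k (\<lambda>xs \<xi>s. \<xi>s = \<chi> xs)" using a(1) unfolding dfun_def by blast
  \<comment> \<open>The codes of \<open>y # x\<close> for all \<open>y\<close> form a subset of
    RV^k, definable in \<open>L\<close> over \<open>x\<close>. If \<open>x\<close> and
    \<open>x'\<close> have the same subset, each witness \<open>y\<close> for \<open>x\<close> has a
    counterpart \<open>y'\<close> for \<open>x'\<close> with the same code.\<close>
  have "\<exists>\<theta>. defs L M \<theta> n k (\<lambda>xs \<xi>s. \<exists>y\<in>carrier M. \<xi>s = \<chi> (y # xs))"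
    by (rule exI, (rule d_ex d_sub[OF \<psi>] tm_intros | (simp; fail))+)
  then obtain \<theta> where \<theta>: "defs L M \<theta> n k (\<lambda>xs \<xi>s. \<exists>y\<in>carrier M. \<xi>s = \<chi> (y # xs))" by blast
  then have "wf_form L n k \<theta>" by (simp add: defs_def)
  from code_family[OF this] obtain k' \<chi>' where b: "dfun n k' \<chi>'" "\<forall>x\<in>tuples n (carrier M). \<forall>x'\<in>tuples n (carrier M).
     \<chi>' x = \<chi>' x' \<longrightarrow> (\<forall>\<xi>\<in>tuples k (RV M). sat M x \<xi> \<theta> \<longleftrightarrow> sat M x' \<xi> \<theta>)"
    by (elim exE, elim conjE) (rule that, assumption+)
  have imp: "sat M x' \<xi> (FEx \<phi>)" if x: "x \<in> tuples n (carrier M)" "x' \<in> tuples n (carrier M)" "\<chi>' x = \<chi>' x'"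
    and \<xi>: "\<xi> \<in> tuples m (RV M)" and s: "sat M x \<xi> (FEx \<phi>)" for x x' \<xi>
  proof -
    obtain y where y: "y \<in> carrier M" "sat M (y # x) \<xi> \<phi>" using s by auto
    have yx: "y # x \<in> tuples (Suc n) (carrier M)" using y x by simp
    have \<chi>y: "\<chi> (y # x) \<in> tuples k (RV M)" using a(1) yx unfolding dfun_def by blast
    have "sat M x (\<chi> (y # x)) \<theta>" using \<theta> x(1) \<chi>y y(1) unfolding defs_def by blast
    then have "sat M x' (\<chi> (y # x)) \<theta>" using b(2) x \<chi>y by blast
    then obtain y' where y': "y' \<in> carrier M" "\<chi> (y # x) = \<chi> (y' # x')" using \<theta> x(2) \<chi>y unfolding defs_def by blast
    have "y' # x' \<in> tuples (Suc n) (carrier M)" using y' x by simp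
    then have "sat M (y' # x') \<xi> \<phi>" using a(2) yx y'(2) \<xi> y(2) by blast
    then show ?thesis using y' by auto
  qed
  show ?case
  proof (rule exI[of _ k'], rule exI[of _ \<chi>'], intro conjI b(1) ballI impI)
    fix x x' \<xi> assume *: "x \<in> tuples n (carrier M)" "x' \<in> tuples n (carrier M)" "\<chi>' x = \<chi>' x'" "\<xi> \<in> tuples m (RV M)"
    show "sat M x \<xi> (FEx \<phi>) \<longleftrightarrow> sat M x' \<xi> (FEx \<phi>)" using imp[OF *] imp[OF *(2,1) *(3)[symmetric] *(4)] by blast
  qed
qed

end

section \<open>The properties in the expansion\<close>

lemma definable_mono: "definable L M A n m X \<Longrightarrow> A \<subseteq> B \<Longrightarrow> definable L M B n m X"
  unfolding definable_def
proof (elim exE conjE)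
  fix \<phi> a \<alpha>
  assume "A \<subseteq> B" "Inl ` set a \<subseteq> A" "Inr ` set \<alpha> \<subseteq> A" "wf_form L (n + length a) (m + length \<alpha>) \<phi>"
    "X = {(x, \<xi>). x \<in> tuples n (carrier M) \<and> \<xi> \<in> tuples m (RV M) \<and> sat M (x @ a) (\<xi> @ \<alpha>) \<phi>}"
  then show "\<exists>\<phi> a \<alpha>. Inl ` set a \<subseteq> B \<and> Inr ` set \<alpha> \<subseteq> B \<and> wf_form L (n + length a) (m + length \<alpha>) \<phi> \<and>
    X = {(x, \<xi>). x \<in> tuples n (carrier M) \<and> \<xi> \<in> tuples m (RV M) \<and> sat M (x @ a) (\<xi> @ \<alpha>) \<phi>}"
    by (intro exI[of _ \<phi>] exI[of _ a] exI[of _ \<alpha>] conjI) (auto dest: subset_trans)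
qed

lemma definable_finite:
  assumes "definable L M A n m X"
  shows "\<exists>a \<alpha>. Inl ` set a \<union> Inr ` set \<alpha> \<subseteq> A \<and> definable L M (Inl ` set a \<union> Inr ` set \<alpha>) n m X"
proof -
  obtain \<phi> a \<alpha> where *: "Inl ` set a \<subseteq> A" "Inr ` set \<alpha> \<subseteq> A" "wf_form L (n + length a) (m + length \<alpha>) \<phi>"
    "X = {(x, \<xi>). x \<in> tuples n (carrier M) \<and> \<xi> \<in> tuples m (RV M) \<and> sat M (x @ a) (\<xi> @ \<alpha>) \<phi>}"
    using assms unfolding definable_def by (elim exE conjE)
  have "definable L M (Inl ` set a \<union> Inr ` set \<alpha>) n m X"
    unfolding definable_def by (rule exI[of _ \<phi>], rule exI[of _ a], rule exI[of _ \<alpha>]) (use * in simp)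
  then show ?thesis using *(1,2) by blast
qed

context td_model
begin

text \<open>The code \<open>\<eta>\<close> of a point of a graph determines its last coordinate as
  the unique one with that code. The value zero in all other cases makes every member of the family
  a total function, as the uniform forms of (T) and (D) require at all parameters.\<close>

lemma choose_fun:
  assumes "dfun (n + Suc p) k \<chi>"
  shows "\<exists>\<theta> g. wf_form L (n + Suc p) k \<theta> \<and>
    (\<forall>x\<in>tuples n (carrier M). \<forall>a\<in>tuples p (carrier M). \<forall>\<eta>\<in>tuples k (RV M).
       g a \<eta> x \<in> carrier M \<and> (\<forall>u\<in>carrier M. sat M (x @ u # a) \<eta> \<theta> \<longleftrightarrow> u = g a \<eta> x) \<and>
       (\<forall>y0\<in>carrier M. (\<forall>y\<in>carrier M. \<chi> (x @ y # a) = \<eta> \<longleftrightarrow> y = y0) \<longrightarrow> g a \<eta> x = y0))"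
proof -
  obtain \<psi> where \<psi>: "defs L M \<psi> (n + Suc p) k (\<lambda>xs \<xi>s. \<xi>s = \<chi> xs)" using assms unfolding dfun_def by blast
  define uniq where "uniq a \<eta> x y \<longleftrightarrow> \<eta> = \<chi> (x @ y # a) \<and> (\<forall>u\<in>carrier M. \<eta> = \<chi> (x @ u # a) \<longrightarrow> u = y)" for a \<eta> x y
  have "\<exists>\<theta>. defs L M \<theta> (n + Suc p) k (\<lambda>xs \<xi>s.
     (\<xi>s = \<chi> xs \<and> (\<forall>u\<in>carrier M. \<xi>s = \<chi> (take n xs @ u # drop (Suc n) xs) \<longrightarrow> u = xs ! n)) \<or>
     (\<not> (\<exists>y\<in>carrier M. \<xi>s = \<chi> (take n xs @ y # drop (Suc n) xs) \<and>
        (\<forall>u\<in>carrier M. \<xi>s = \<chi> (take n xs @ u # drop (Suc n) xs) \<longrightarrow> u = y)) \<and> xs ! n = \<zero>))"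
    by (rule exI, (rule d_sub[OF \<psi>] d_and d_or d_not d_imp d_all d_ex d_eq tm_intros | (simp; fail))+)
  then obtain \<theta> where \<theta>: "defs L M \<theta> (n + Suc p) k (\<lambda>xs \<xi>s.
     (\<xi>s = \<chi> xs \<and> (\<forall>u\<in>carrier M. \<xi>s = \<chi> (take n xs @ u # drop (Suc n) xs) \<longrightarrow> u = xs ! n)) \<or>
     (\<not> (\<exists>y\<in>carrier M. \<xi>s = \<chi> (take n xs @ y # drop (Suc n) xs) \<and>
        (\<forall>u\<in>carrier M. \<xi>s = \<chi> (take n xs @ u # drop (Suc n) xs) \<longrightarrow> u = y)) \<and> xs ! n = \<zero>))" by blast
  have s: "sat M (x @ y # a) \<eta> \<theta> \<longleftrightarrow> uniq a \<eta> x y \<or> (\<not> (\<exists>u\<in>carrier M. uniq a \<eta> x u) \<and> y = \<zero>)"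
    if "x \<in> tuples n (carrier M)" "y \<in> carrier M" "a \<in> tuples p (carrier M)" "\<eta> \<in> tuples k (RV M)" for x y a \<eta>
  proof -
    have "x @ y # a \<in> tuples (n + Suc p) (carrier M)" using that tuples_append[of x n _ "y # a" "Suc p"] by simp
    from \<theta>[unfolded defs_def, THEN conjunct2, THEN bspec, OF this, THEN bspec, OF that(4)]
    moreover have "(x @ y # a) ! n = y" using nth_append_length[of x y a] tuples_length[OF that(1)] by simp
    ultimately show ?thesis using tuples_length[OF that(1)] unfolding uniq_def by simp
  qed
  define g where "g a \<eta> x = (if \<exists>u\<in>carrier M. uniq a \<eta> x u then (THE u. u \<in> carrier M \<and> uniq a \<eta> x u) else \<zero>\<^bsub>M\<^esub>)" for a \<eta> x
  have u1: "u = y" if "uniq a \<eta> x u" "uniq a \<eta> x y" "u \<in> carrier M" for a \<eta> x u y using that unfolding uniq_def by blast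
  have g1: "g a \<eta> x = y" if "uniq a \<eta> x y" "y \<in> carrier M" for a \<eta> x y
  proof -
    have "(THE u. u \<in> carrier M \<and> uniq a \<eta> x u) = y" by (rule the_equality) (use that u1 in blast)+
    then show ?thesis using that unfolding g_def by auto
  qed
  have g0: "g a \<eta> x = \<zero>" if "\<not> (\<exists>u\<in>carrier M. uniq a \<eta> x u)" for a \<eta> x using that unfolding g_def by simp
  show ?thesis
  proof (rule exI[of _ \<theta>], rule exI[of _ g], intro conjI ballI impI)
    show "wf_form L (n + Suc p) k \<theta>" using \<theta> by (simp add: defs_def)
    fix x a \<eta> assume *: "x \<in> tuples n (carrier M)" "a \<in> tuples p (carrier M)" "\<eta> \<in> tuples k (RV M)"
    show "g a \<eta> x \<in> carrier M" using g1[of a \<eta> x] g0[of a \<eta> x] by (metis zero_closed)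
    show "sat M (x @ u # a) \<eta> \<theta> \<longleftrightarrow> u = g a \<eta> x" if u: "u \<in> carrier M" for u
    proof (cases "\<exists>u\<in>carrier M. uniq a \<eta> x u")
      case True
      then obtain y where y: "y \<in> carrier M" "uniq a \<eta> x y" by blast
      then show ?thesis using s[OF *(1) u *(2,3)] g1[OF y(2,1)] u1[OF _ y(2) u] True by blast
    next
      case False
      then show ?thesis using s[OF *(1) u *(2,3)] g0[OF False] u by auto
    qed
    fix y0 assume "y0 \<in> carrier M" "\<forall>y\<in>carrier M. \<chi> (x @ y # a) = \<eta> \<longleftrightarrow> y = y0"
    then have "uniq a \<eta> x y0" unfolding uniq_def by metis
    then show "g a \<eta> x = y0" using g1 \<open>y0 \<in> carrier M\<close> by blast
  qed
qed

text \<open>This is \<open>prepare_RV\<close> for the graph of \<open>\<chi>\<close>, whose value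
  plays the part of the RV index.\<close>

lemma prepare_dfun:
  assumes "dfun (Suc p) k \<chi>" and a: "a \<in> tuples p (carrier M)"
  shows "\<exists>C. finite C \<and> C \<subseteq> carrier M \<and> (\<forall>x\<in>carrier M. \<forall>x'\<in>carrier M.
    (\<forall>c\<in>C. vlt M (x' \<ominus> x) (x \<ominus> c)) \<longrightarrow> \<chi> (x' # a) = \<chi> (x # a))"
proof -
  obtain \<phi> where \<phi>: "defs L M \<phi> (Suc p) k (\<lambda>xs \<xi>s. \<xi>s = \<chi> xs)" using assms unfolding dfun_def by blast
  then have "wf_form L (Suc p) k \<phi>" by (simp add: defs_def)
  from prepare_RV[OF this] obtain \<gamma> where \<gamma>: "\<forall>a\<in>tuples p (carrier M).
    finite {c \<in> carrier M. sat M (c # a) [] \<gamma>} \<and>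
    (\<forall>x\<in>carrier M. \<forall>x'\<in>carrier M. (\<forall>c\<in>carrier M. sat M (c # a) [] \<gamma> \<longrightarrow> vlt M (x' \<ominus> x) (x \<ominus> c)) \<longrightarrow>
       (\<forall>\<xi>\<in>tuples k (RV M). sat M (x' # a) \<xi> \<phi> \<longleftrightarrow> sat M (x # a) \<xi> \<phi>))"
    by (elim exE, elim conjE) (rule that, assumption+)
  have s: "sat M (x # a) \<xi> \<phi> \<longleftrightarrow> \<xi> = \<chi> (x # a)" if "x \<in> carrier M" "\<xi> \<in> tuples k (RV M)" for x \<xi>
    using \<phi> that a unfolding defs_def by simp
  have "\<chi> (x' # a) = \<chi> (x # a)" if x: "x \<in> carrier M" "x' \<in> carrier M"
    and "\<forall>c\<in>{c \<in> carrier M. sat M (c # a) [] \<gamma>}. vlt M (x' \<ominus> x) (x \<ominus> c)" for x x'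
  proof -
    have c: "\<chi> (x # a) \<in> tuples k (RV M)" using assms x unfolding dfun_def by simp
    then have "sat M (x' # a) (\<chi> (x # a)) \<phi> \<longleftrightarrow> sat M (x # a) (\<chi> (x # a)) \<phi>"
      using \<gamma>[THEN bspec, OF a] that by blast
    then show ?thesis using s[OF x(1) c] s[OF x(2) c] by simp
  qed
  then show ?thesis using \<gamma>[THEN bspec, OF a] by (intro exI[of _ "{c \<in> carrier M. sat M (c # a) [] \<gamma>}"]) blast
qed

end

context td_expansion
begin

text \<open>A function of the expansion is split into an \<open>L\<close>-definable code
  \<open>\<chi>2\<close> of points of the product space and a map \<open>\<eta>\<close> to RV. Only
  \<open>\<eta>\<close> involves the new predicates, and its dependence on \<open>x\<close> is
  controlled by the \<open>L\<close>-definable \<open>\<chi>3\<close>.\<close>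

lemma fun_control:
  assumes f: "definable_fun L' M (Inl ` set a \<union> Inr ` set \<alpha>) n f"
    and a: "a \<in> tuples p (carrier M)" and \<alpha>: "\<alpha> \<in> tuples q (RV M)"
  obtains \<phi> k2 \<chi>2 \<eta> \<phi>\<eta> k3 \<chi>3 where
    "wf_form L' (n + Suc p) q \<phi>"
    "\<And>x y. x \<in> tuples n (carrier M) \<Longrightarrow> y \<in> carrier M \<Longrightarrow> sat M (x @ y # a) \<alpha> \<phi> \<longleftrightarrow> y = f x"
    "dfun (n + Suc p) k2 \<chi>2" "\<And>x. x \<in> tuples n (carrier M) \<Longrightarrow> \<eta> x \<in> tuples k2 (RV M)"
    "\<And>x y. x \<in> tuples n (carrier M) \<Longrightarrow> y \<in> carrier M \<Longrightarrow> \<chi>2 (x @ y # a) = \<eta> x \<longleftrightarrow> y = f x"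
    "wf_form L' (n + p) (k2 + q) \<phi>\<eta>"
    "\<And>x \<xi>. x \<in> tuples n (carrier M) \<Longrightarrow> \<xi> \<in> tuples k2 (RV M) \<Longrightarrow> sat M (x @ a) (\<xi> @ \<alpha>) \<phi>\<eta> \<longleftrightarrow> \<xi> = \<eta> x"
    "dfun (n + p) k3 \<chi>3"
    "\<And>x x'. x \<in> tuples n (carrier M) \<Longrightarrow> x' \<in> tuples n (carrier M) \<Longrightarrow> \<chi>3 (x @ a) = \<chi>3 (x' @ a) \<Longrightarrow> \<eta> x = \<eta> x'"
proof -
  have fc: "f x \<in> carrier M" if "x \<in> tuples n (carrier M)" for x using f that unfolding definable_fun_def by blast
  have df: "definable L' M (Inl ` set a \<union> Inr ` set \<alpha>) (Suc n) 0 {(x @ [f x], []) | x. x \<in> tuples n (carrier M)}"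
    using f unfolding definable_fun_def by blast
  obtain \<phi> where \<phi>: "wf_form L' (Suc n + p) (0 + q) \<phi>"
    "\<And>x \<xi>. x \<in> tuples (Suc n) (carrier M) \<Longrightarrow> \<xi> \<in> tuples 0 (RV M) \<Longrightarrow>
      (x, \<xi>) \<in> {(x @ [f x], []) | x. x \<in> tuples n (carrier M)} \<longleftrightarrow> sat M (x @ a) (\<xi> @ \<alpha>) \<phi>"
    by (rule E.definable_env[OF df a \<alpha>]) (rule that; assumption)
  have wf\<phi>: "wf_form L' (n + Suc p) q \<phi>" using \<phi>(1) by simp
  have s\<phi>: "sat M (x @ y # a) \<alpha> \<phi> \<longleftrightarrow> y = f x" if "x \<in> tuples n (carrier M)" "y \<in> carrier M" for x y
    using \<phi>(2)[OF tuples_snoc[OF that], of "[]"] that by auto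
  obtain k2 \<chi>2 where d2: "dfun (n + Suc p) k2 \<chi>2" and \<chi>2: "\<forall>x\<in>tuples (n + Suc p) (carrier M). \<forall>x'\<in>tuples (n + Suc p) (carrier M).
     \<chi>2 x = \<chi>2 x' \<longrightarrow> (\<forall>\<xi>\<in>tuples q (RV M). sat M x \<xi> \<phi> \<longleftrightarrow> sat M x' \<xi> \<phi>)"
    using control[OF wf\<phi>] by (elim exE, elim conjE) (rule that, assumption+)
  \<comment> \<open>The code of the graph point over \<open>x\<close>. As \<open>\<chi>2\<close>
    controls the formula defining \<open>f\<close>, no other \<open>y\<close> over \<open>x\<close>
    has this code.\<close>
  define \<eta> where "\<eta> x = \<chi>2 (x @ f x # a)" for x
  have xya: "x @ y # a \<in> tuples (n + Suc p) (carrier M)" if "x \<in> tuples n (carrier M)" "y \<in> carrier M" for x y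
    using that a tuples_append[of x n _ "y # a" "Suc p"] by simp
  have \<eta>c: "\<eta> x \<in> tuples k2 (RV M)" if "x \<in> tuples n (carrier M)" for x
    using d2 xya[OF that fc[OF that]] unfolding dfun_def \<eta>_def by blast
  have C1: "\<chi>2 (x @ y # a) = \<eta> x \<longleftrightarrow> y = f x" if x: "x \<in> tuples n (carrier M)" "y \<in> carrier M" for x y
  proof
    assume "\<chi>2 (x @ y # a) = \<eta> x"
    then have "sat M (x @ y # a) \<alpha> \<phi> \<longleftrightarrow> sat M (x @ f x # a) \<alpha> \<phi>"
      using \<chi>2 xya[OF x] xya[OF x(1) fc[OF x(1)]] \<alpha> unfolding \<eta>_def by blast
    then show "y = f x" using s\<phi>[OF x] s\<phi>[OF x(1) fc[OF x(1)]] by simp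
  qed (simp add: \<eta>_def)
  obtain \<psi>2 where \<psi>2: "defs L' M \<psi>2 (n + Suc p) k2 (\<lambda>xs \<xi>s. \<xi>s = \<chi>2 xs)" using d2 defs_mono unfolding dfun_def by blast
  have "\<exists>\<phi>\<eta>. defs L' M \<phi>\<eta> (n + p) (k2 + q) (\<lambda>xs \<xi>s. \<exists>y\<in>carrier M.
      sat M (take n xs @ y # drop n xs) (drop k2 \<xi>s) \<phi> \<and> take k2 \<xi>s = \<chi>2 (take n xs @ y # drop n xs))"
    by (rule exI, (rule d_ex d_and E.d_sub[OF \<psi>2] E.d_sub[OF d_self[OF wf\<phi>]] E.tm_intros | (simp; fail))+)
  then obtain \<phi>\<eta> where \<phi>\<eta>: "defs L' M \<phi>\<eta> (n + p) (k2 + q) (\<lambda>xs \<xi>s. \<exists>y\<in>carrier M.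
      sat M (take n xs @ y # drop n xs) (drop k2 \<xi>s) \<phi> \<and> take k2 \<xi>s = \<chi>2 (take n xs @ y # drop n xs))" by blast
  have s\<eta>: "sat M (x @ a) (\<xi> @ \<alpha>) \<phi>\<eta> \<longleftrightarrow> \<xi> = \<eta> x" if x: "x \<in> tuples n (carrier M)" "\<xi> \<in> tuples k2 (RV M)" for x \<xi>
  proof -
    from \<phi>\<eta>[unfolded defs_def, THEN conjunct2, THEN bspec, OF tuples_append[OF x(1) a], THEN bspec, OF tuples_append[OF x(2) \<alpha>]]
    have "sat M (x @ a) (\<xi> @ \<alpha>) \<phi>\<eta> \<longleftrightarrow> (\<exists>y\<in>carrier M. sat M (x @ y # a) \<alpha> \<phi> \<and> \<xi> = \<chi>2 (x @ y # a))"
      using tuples_length[OF x(1)] tuples_length[OF x(2)] by simp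
    then show ?thesis using s\<phi>[OF x(1)] fc[OF x(1)] unfolding \<eta>_def by auto
  qed
  have wf\<eta>: "wf_form L' (n + p) (k2 + q) \<phi>\<eta>" using \<phi>\<eta> by (simp add: defs_def)
  obtain k3 \<chi>3 where d3: "dfun (n + p) k3 \<chi>3" and \<chi>3: "\<forall>x\<in>tuples (n + p) (carrier M). \<forall>x'\<in>tuples (n + p) (carrier M).
     \<chi>3 x = \<chi>3 x' \<longrightarrow> (\<forall>\<xi>\<in>tuples (k2 + q) (RV M). sat M x \<xi> \<phi>\<eta> \<longleftrightarrow> sat M x' \<xi> \<phi>\<eta>)"
    using control[OF wf\<eta>] by (elim exE, elim conjE) (rule that, assumption+)
  have C3: "\<eta> x = \<eta> x'" if x: "x \<in> tuples n (carrier M)" "x' \<in> tuples n (carrier M)" "\<chi>3 (x @ a) = \<chi>3 (x' @ a)" for x x'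
  proof -
    have "sat M (x @ a) (\<eta> x @ \<alpha>) \<phi>\<eta> \<longleftrightarrow> sat M (x' @ a) (\<eta> x @ \<alpha>) \<phi>\<eta>"
      using \<chi>3 tuples_append[OF x(1) a] tuples_append[OF x(2) a] x(3) tuples_append[OF \<eta>c[OF x(1)] \<alpha>] by blast
    then show ?thesis using s\<eta>[OF x(1) \<eta>c[OF x(1)]] s\<eta>[OF x(2) \<eta>c[OF x(1)]] by simp
  qed
  show thesis by (rule that[OF wf\<phi> s\<phi> d2 \<eta>c C1 wf\<eta> s\<eta> d3 C3])
qed

text \<open>The code \<open>\<eta> x\<close> varies with \<open>x\<close>, while (T) for
  \<open>L\<close> treats one value \<open>\<eta>0\<close> of it as a parameter. The decompositions
  for all \<open>\<eta>0\<close> come from one uniform family, and the right member is used at each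
  point.\<close>

lemma property_T_expansion:
  assumes A: "A \<subseteq> Inl ` carrier M \<union> Inr ` RV M"
  shows "property_T L' M A l"
  unfolding property_T_def
proof (intro allI impI, elim conjE)
  fix f k' \<psi> assume f0: "definable_fun L' M A l f" and \<psi>0: "definable_rvfun L' M A l k' \<psi>"
  have fc: "f x \<in> carrier M" if "x \<in> tuples l (carrier M)" for x using f0 that unfolding definable_fun_def by blast
  have \<psi>c: "\<psi> x \<in> tuples k' (RV M)" if "x \<in> tuples l (carrier M)" for x using \<psi>0 that unfolding definable_rvfun_def by blast
  obtain a1 \<alpha>1 where 1: "Inl ` set a1 \<union> Inr ` set \<alpha>1 \<subseteq> A"
    "definable L' M (Inl ` set a1 \<union> Inr ` set \<alpha>1) (Suc l) 0 {(x @ [f x], []) | x. x \<in> tuples l (carrier M)}"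
    using definable_finite[of L' M A "Suc l" 0] f0 unfolding definable_fun_def by blast
  obtain a2 \<alpha>2 where 2: "Inl ` set a2 \<union> Inr ` set \<alpha>2 \<subseteq> A"
    "definable L' M (Inl ` set a2 \<union> Inr ` set \<alpha>2) l k' {(x, \<psi> x) | x. x \<in> tuples l (carrier M)}"
    using definable_finite[of L' M A l k'] \<psi>0 unfolding definable_rvfun_def by blast
  \<comment> \<open>\<open>f\<close> and \<open>\<psi>\<close> may use different parameters; from
    here on both use the same lists.\<close>
  define a \<alpha> where "a = a1 @ a2" and "\<alpha> = \<alpha>1 @ \<alpha>2"
  define p q where "p = length a" and "q = length \<alpha>"
  let ?A = "Inl ` set a \<union> Inr ` set \<alpha>"
  have AA: "Inl ` set a \<subseteq> A" "Inr ` set \<alpha> \<subseteq> A" using 1 2 unfolding a_def \<alpha>_def by auto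
  have a: "a \<in> tuples p (carrier M)" and \<alpha>: "\<alpha> \<in> tuples q (RV M)"
    using AA A unfolding p_def q_def tuples_def by auto
  have f: "definable_fun L' M ?A l f"
    using fc definable_mono[OF 1(2), of ?A] unfolding definable_fun_def a_def \<alpha>_def by auto
  have d\<psi>: "definable L' M ?A l k' {(x, \<psi> x) | x. x \<in> tuples l (carrier M)}"
    using definable_mono[OF 2(2), of ?A] unfolding a_def \<alpha>_def by auto
  obtain \<phi>f k2 \<chi>2 \<eta> \<phi>\<eta> k3 \<chi>3 where d2: "dfun (l + Suc p) k2 \<chi>2"
    and \<eta>c: "\<And>x. x \<in> tuples l (carrier M) \<Longrightarrow> \<eta> x \<in> tuples k2 (RV M)"
    and C1: "\<And>x y. x \<in> tuples l (carrier M) \<Longrightarrow> y \<in> carrier M \<Longrightarrow> \<chi>2 (x @ y # a) = \<eta> x \<longleftrightarrow> y = f x"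
    and wf\<eta>: "wf_form L' (l + p) (k2 + q) \<phi>\<eta>"
    and s\<eta>: "\<And>x \<xi>. x \<in> tuples l (carrier M) \<Longrightarrow> \<xi> \<in> tuples k2 (RV M) \<Longrightarrow> sat M (x @ a) (\<xi> @ \<alpha>) \<phi>\<eta> \<longleftrightarrow> \<xi> = \<eta> x"
    and d3: "dfun (l + p) k3 \<chi>3"
    and C3: "\<And>x x'. x \<in> tuples l (carrier M) \<Longrightarrow> x' \<in> tuples l (carrier M) \<Longrightarrow> \<chi>3 (x @ a) = \<chi>3 (x' @ a) \<Longrightarrow> \<eta> x = \<eta> x'"
    by (rule fun_control[OF f a \<alpha>]) (rule that; assumption)
  obtain \<phi>\<psi> where wf\<psi>: "wf_form L' (l + p) (k' + q) \<phi>\<psi>"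
    and s\<psi>: "\<And>x \<xi>. x \<in> tuples l (carrier M) \<Longrightarrow> \<xi> \<in> tuples k' (RV M) \<Longrightarrow>
      (x, \<xi>) \<in> {(x, \<psi> x) | x. x \<in> tuples l (carrier M)} \<longleftrightarrow> sat M (x @ a) (\<xi> @ \<alpha>) \<phi>\<psi>"
    by (rule E.definable_env[OF d\<psi> a \<alpha>]) (rule that; assumption)
  obtain k\<psi> \<chi>\<psi> where d\<psi>': "dfun (l + p) k\<psi> \<chi>\<psi>" and \<chi>\<psi>: "\<forall>x\<in>tuples (l + p) (carrier M). \<forall>x'\<in>tuples (l + p) (carrier M).
     \<chi>\<psi> x = \<chi>\<psi> x' \<longrightarrow> (\<forall>\<xi>\<in>tuples (k' + q) (RV M). sat M x \<xi> \<phi>\<psi> \<longleftrightarrow> sat M x' \<xi> \<phi>\<psi>)"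
    using control[OF wf\<psi>] by (elim exE, elim conjE) (rule that, assumption+)
  have C\<psi>: "\<psi> x = \<psi> x'" if x: "x \<in> tuples l (carrier M)" "x' \<in> tuples l (carrier M)" "\<chi>\<psi> (x @ a) = \<chi>\<psi> (x' @ a)" for x x'
  proof -
    have "sat M (x @ a) (\<psi> x @ \<alpha>) \<phi>\<psi> \<longleftrightarrow> sat M (x' @ a) (\<psi> x @ \<alpha>) \<phi>\<psi>"
      using \<chi>\<psi> tuples_append[OF x(1) a] tuples_append[OF x(2) a] x(3) tuples_append[OF \<psi>c[OF x(1)] \<alpha>] by blast
    then show ?thesis using s\<psi>[OF x(1) \<psi>c[OF x(1)]] s\<psi>[OF x(2) \<psi>c[OF x(1)]] x by simp
  qed
  obtain \<theta>f g where wf\<theta>: "wf_form L (l + Suc p) k2 \<theta>f" and g: "\<forall>x\<in>tuples l (carrier M). \<forall>a\<in>tuples p (carrier M). \<forall>\<eta>\<in>tuples k2 (RV M).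
       g a \<eta> x \<in> carrier M \<and> (\<forall>u\<in>carrier M. sat M (x @ u # a) \<eta> \<theta>f \<longleftrightarrow> u = g a \<eta> x) \<and>
       (\<forall>y0\<in>carrier M. (\<forall>y\<in>carrier M. \<chi>2 (x @ y # a) = \<eta> \<longleftrightarrow> y = y0) \<longrightarrow> g a \<eta> x = y0)"
    using choose_fun[OF d2] by (elim exE, elim conjE) (rule that, assumption+)
  have fg: "f x = g a (\<eta> x) x" if x: "x \<in> tuples l (carrier M)" for x
    using g[THEN bspec, OF x, THEN bspec, OF a, THEN bspec, OF \<eta>c[OF x]] C1[OF x] fc[OF x] by metis
  \<comment> \<open>The map to be made constant on boxes. It contains \<open>\<chi>3\<close> so that
    \<open>\<eta>\<close> becomes constant on them, and \<open>\<chi>\<psi>\<close> so that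
    \<open>\<psi>\<close> does.\<close>
  let ?\<psi>' = "\<lambda>x. \<chi>3 (x @ a) @ \<chi>\<psi> (x @ a)"
  obtain \<theta>0 where \<theta>0: "defs L M \<theta>0 (l + p) (k3 + k\<psi>) (\<lambda>xs \<xi>s. \<xi>s = \<chi>3 xs @ \<chi>\<psi> xs)"
    using dfun_append[OF d3 d\<psi>'] unfolding dfun_def by blast
  have \<psi>'c: "?\<psi>' x \<in> tuples (k3 + k\<psi>) (RV M)" if "x \<in> tuples l (carrier M)" for x
    using dfun_append[OF d3 d\<psi>'] tuples_append[OF that a] unfolding dfun_def by blast
  have "\<exists>\<theta>. defs L M \<theta> (l + p) ((k3 + k\<psi>) + k2) (\<lambda>xs \<xi>s. take (k3 + k\<psi>) \<xi>s = \<chi>3 xs @ \<chi>\<psi> xs)"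
    by (rule exI, (rule d_sub[OF \<theta>0] tm_intros | (simp; fail))+)
  then obtain \<theta>\<psi> where \<theta>\<psi>: "defs L M \<theta>\<psi> (l + p) ((k3 + k\<psi>) + k2) (\<lambda>xs \<xi>s. take (k3 + k\<psi>) \<xi>s = \<chi>3 xs @ \<chi>\<psi> xs)" by blast
  have wf\<theta>\<psi>: "wf_form L (l + p) ((k3 + k\<psi>) + k2) \<theta>\<psi>" using \<theta>\<psi> by (simp add: defs_def)
  have s\<theta>\<psi>: "sat M (x @ a) (\<zeta> @ \<eta>0) \<theta>\<psi> \<longleftrightarrow> \<zeta> = ?\<psi>' x"
    if "x \<in> tuples l (carrier M)" "\<zeta> \<in> tuples (k3 + k\<psi>) (RV M)" "\<eta>0 \<in> tuples k2 (RV M)" for x \<zeta> \<eta>0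
    using \<theta>\<psi>[unfolded defs_def, THEN conjunct2, THEN bspec, OF tuples_append[OF that(1) a], THEN bspec, OF tuples_append[OF that(2,3)]]
      tuples_length[OF that(2)] by simp
  obtain K \<chi>4 c4 where
    D1: "\<exists>\<phi>. defs L M \<phi> (l + p) (K + k2) (\<lambda>xs \<xi>s. take K \<xi>s = \<chi>4 (drop l xs) (drop K \<xi>s) (take l xs))" and
    D2: "\<forall>i<l. \<exists>\<phi>. defs L M \<phi> (i + Suc p) (K + k2)
       (\<lambda>xs \<xi>s. xs ! i = c4 (drop (Suc i) xs) (drop K \<xi>s) (take K \<xi>s) i (take i xs))" and
    D3: "\<forall>a\<in>tuples p (carrier M). \<forall>\<alpha>\<in>tuples k2 (RV M).
       (\<forall>x\<in>tuples l (carrier M). \<chi>4 a \<alpha> x \<in> tuples K (RV M)) \<and>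
       (\<forall>\<xi>\<in>tuples K (RV M). \<forall>i<l. \<forall>z\<in>tuples i (carrier M). c4 a \<alpha> \<xi> i z \<in> carrier M) \<and>
       (\<forall>f \<psi>. (\<forall>x\<in>tuples l (carrier M). f x \<in> carrier M \<and> \<psi> x \<in> tuples (k3 + k\<psi>) (RV M) \<and>
            (\<forall>u\<in>carrier M. sat M (x @ u # a) \<alpha> \<theta>f \<longleftrightarrow> u = f x) \<and>
            (\<forall>\<zeta>\<in>tuples (k3 + k\<psi>) (RV M). sat M (x @ a) (\<zeta> @ \<alpha>) \<theta>\<psi> \<longleftrightarrow> \<zeta> = \<psi> x)) \<longrightarrow>
          (\<forall>x0\<in>tuples l (carrier M).
             okb M l {x \<in> tuples l (carrier M). \<chi>4 a \<alpha> x = \<chi>4 a \<alpha> x0} (c4 a \<alpha> (\<chi>4 a \<alpha> x0)) f \<psi> x0))"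
    using uniform_T[OF wf\<theta> wf\<theta>\<psi>] by (elim exE, elim conjE) (rule that, assumption+)
  have \<chi>4c: "\<chi>4 a \<eta>0 x \<in> tuples K (RV M)" if "\<eta>0 \<in> tuples k2 (RV M)" "x \<in> tuples l (carrier M)" for \<eta>0 x
    using D3 a that by blast
  have c4c: "c4 a \<eta>0 \<xi> i z \<in> carrier M" if "\<eta>0 \<in> tuples k2 (RV M)" "\<xi> \<in> tuples K (RV M)" "i < l" "z \<in> tuples i (carrier M)" for \<eta>0 \<xi> i z
    using D3 a that by blast
  have ok4: "okb M l {x \<in> tuples l (carrier M). \<chi>4 a \<eta>0 x = \<chi>4 a \<eta>0 x0} (c4 a \<eta>0 (\<chi>4 a \<eta>0 x0)) (g a \<eta>0) ?\<psi>' x0"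
    if e: "\<eta>0 \<in> tuples k2 (RV M)" and x0: "x0 \<in> tuples l (carrier M)" for \<eta>0 x0
  proof -
    have "\<forall>x\<in>tuples l (carrier M). g a \<eta>0 x \<in> carrier M \<and> ?\<psi>' x \<in> tuples (k3 + k\<psi>) (RV M) \<and>
            (\<forall>u\<in>carrier M. sat M (x @ u # a) \<eta>0 \<theta>f \<longleftrightarrow> u = g a \<eta>0 x) \<and>
            (\<forall>\<zeta>\<in>tuples (k3 + k\<psi>) (RV M). sat M (x @ a) (\<zeta> @ \<eta>0) \<theta>\<psi> \<longleftrightarrow> \<zeta> = ?\<psi>' x)"
    proof (intro ballI conjI)
      fix x assume x: "x \<in> tuples l (carrier M)"
      note gx = g[THEN bspec, OF x, THEN bspec, OF a, THEN bspec, OF e]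
      show "g a \<eta>0 x \<in> carrier M" using gx by (elim conjE)
      show "?\<psi>' x \<in> tuples (k3 + k\<psi>) (RV M)" by (rule \<psi>'c[OF x])
      show "sat M (x @ u # a) \<eta>0 \<theta>f \<longleftrightarrow> u = g a \<eta>0 x" if "u \<in> carrier M" for u using gx that by blast
      show "sat M (x @ a) (\<zeta> @ \<eta>0) \<theta>\<psi> \<longleftrightarrow> \<zeta> = ?\<psi>' x" if "\<zeta> \<in> tuples (k3 + k\<psi>) (RV M)" for \<zeta> by (rule s\<theta>\<psi>[OF x that e])
    qed
    from D3[THEN bspec, OF a, THEN bspec, OF e, THEN conjunct2, THEN conjunct2, THEN spec, THEN spec, THEN mp, OF this] x0
    show ?thesis by blast
  qed
  \<comment> \<open>The decomposition remembers \<open>\<eta> x\<close>, because the centers in its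
    fibres depend on this value.\<close>
  define \<chi> where "\<chi> x = \<eta> x @ \<chi>4 a (\<eta> x) x" for x
  define c where "c \<xi> = c4 a (take k2 \<xi>) (drop k2 \<xi>)" for \<xi>
  have \<chi>c: "\<chi> x \<in> tuples (k2 + K) (RV M)" if "x \<in> tuples l (carrier M)" for x
    unfolding \<chi>_def by (rule tuples_append[OF \<eta>c[OF that] \<chi>4c[OF \<eta>c[OF that] that]])
  have t\<chi>: "take k2 (\<chi> x) = \<eta> x" "drop k2 (\<chi> x) = \<chi>4 a (\<eta> x) x" if "x \<in> tuples l (carrier M)" for x
    using tuples_length[OF \<eta>c[OF that]] unfolding \<chi>_def by simp_all
  have cc: "\<forall>i<l. \<forall>z\<in>tuples i (carrier M). c \<xi> i z \<in> carrier M" if "\<xi> \<in> tuples (k2 + K) (RV M)" for \<xi>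
    unfolding c_def using c4c[OF tuples_take_add[OF that] tuples_drop_add[OF that]] by blast
  \<comment> \<open>On a fibre of the decomposition for the value \<open>\<eta> x0\<close> the map
    \<open>\<eta>\<close> might take other values. It does not, since \<open>\<chi>3\<close> is
    constant there; so recording \<open>\<eta>\<close> does not cut the fibre further and it stays a
    twisted box.\<close>
  have fib: "fibre M l \<chi> (\<chi> x0) = {x \<in> tuples l (carrier M). \<chi>4 a (\<eta> x0) x = \<chi>4 a (\<eta> x0) x0}"
    if x0: "x0 \<in> tuples l (carrier M)" for x0
  proof -
    have "\<chi> x = \<chi> x0 \<longleftrightarrow> \<chi>4 a (\<eta> x0) x = \<chi>4 a (\<eta> x0) x0" if x: "x \<in> tuples l (carrier M)" for x
    proof
      assume "\<chi> x = \<chi> x0"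
      then have "\<eta> x = \<eta> x0" "\<chi>4 a (\<eta> x) x = \<chi>4 a (\<eta> x0) x0" using t\<chi>[OF x] t\<chi>[OF x0] by simp_all
      then show "\<chi>4 a (\<eta> x0) x = \<chi>4 a (\<eta> x0) x0" by simp
    next
      assume e: "\<chi>4 a (\<eta> x0) x = \<chi>4 a (\<eta> x0) x0"
      have "\<forall>x\<in>{x \<in> tuples l (carrier M). \<chi>4 a (\<eta> x0) x = \<chi>4 a (\<eta> x0) x0}. ?\<psi>' x = ?\<psi>' x0"
        using ok4[OF \<eta>c[OF x0] x0] unfolding okb_def by (elim conjE)
      then have "?\<psi>' x = ?\<psi>' x0" using x e by blast
      moreover have "length (\<chi>3 (x @ a)) = k3" "length (\<chi>3 (x0 @ a)) = k3"
        using d3 tuples_append[OF x a] tuples_append[OF x0 a] tuples_length unfolding dfun_def by blast+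
      ultimately have "\<chi>3 (x @ a) = \<chi>3 (x0 @ a)" by simp
      then have "\<eta> x = \<eta> x0" by (rule C3[OF x x0])
      then show "\<chi> x = \<chi> x0" unfolding \<chi>_def using e by simp
    qed
    then show ?thesis unfolding fibre_def by blast
  qed
  have ok: "okb M l (fibre M l \<chi> \<xi>) (c \<xi>) f \<psi> x0" if \<xi>: "\<xi> \<in> tuples (k2 + K) (RV M)" and x0F: "x0 \<in> fibre M l \<chi> \<xi>" for \<xi> x0
  proof -
    have x0: "x0 \<in> tuples l (carrier M)" and e: "\<xi> = \<chi> x0" using x0F by (auto simp: fibre_def)
    let ?F = "fibre M l \<chi> \<xi>"
    have ceq: "c \<xi> = c4 a (\<eta> x0) (\<chi>4 a (\<eta> x0) x0)" unfolding c_def e t\<chi>[OF x0] ..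
    have "okb M l ?F (c \<xi>) (g a (\<eta> x0)) ?\<psi>' x0"
      using ok4[OF \<eta>c[OF x0] x0] unfolding ceq unfolding e fib[OF x0] .
    then show ?thesis
    proof (rule okb_cong[OF _ cc[OF \<xi>] x0F])
      fix x assume "x \<in> ?F"
      then have x: "x \<in> tuples l (carrier M)" "\<chi> x = \<chi> x0" by (auto simp: fibre_def e)
      have "\<eta> x = \<eta> x0" using t\<chi>(1)[OF x(1)] t\<chi>(1)[OF x0] x(2) by simp
      then show "f x = g a (\<eta> x0) x" using fg[OF x(1)] by simp
      assume "?\<psi>' x = ?\<psi>' x0"
      moreover have "length (\<chi>3 (x @ a)) = k3" "length (\<chi>3 (x0 @ a)) = k3"
        using d3 tuples_append[OF x(1) a] tuples_append[OF x0 a] tuples_length unfolding dfun_def by blast+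
      ultimately have "\<chi>\<psi> (x @ a) = \<chi>\<psi> (x0 @ a)" by simp
      then show "\<psi> x = \<psi> x0" by (rule C\<psi>[OF x(1) x0])
    qed
  qed
  have Fsub: "fibre M l \<chi> \<xi> \<subseteq> tuples l (carrier M)" for \<xi> by (auto simp: fibre_def)
  obtain \<phi>4 where \<phi>4: "defs L' M \<phi>4 (l + p) (K + k2) (\<lambda>xs \<xi>s. take K \<xi>s = \<chi>4 (drop l xs) (drop K \<xi>s) (take l xs))"
    using D1 defs_mono by blast
  have wf4: "wf_form L' (l + p) (K + k2) \<phi>4" using \<phi>4 by (simp add: defs_def)
  have s4: "sat M (x @ a) (\<xi> @ \<eta>0) \<phi>4 \<longleftrightarrow> \<xi> = \<chi>4 a \<eta>0 x"
    if "x \<in> tuples l (carrier M)" "\<xi> \<in> tuples K (RV M)" "\<eta>0 \<in> tuples k2 (RV M)" for x \<xi> \<eta>0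
    using \<phi>4[unfolded defs_def, THEN conjunct2, THEN bspec, OF tuples_append[OF that(1) a], THEN bspec, OF tuples_append[OF that(2,3)]]
      tuples_length[OF that(1)] tuples_length[OF that(2)] by simp
  \<comment> \<open>The first block must be \<open>\<eta> x\<close>, and the second block the code
    for that parameter value; the blocks are swapped in the second conjunct because
    \<open>\<phi>4\<close> expects the code before the parameter.\<close>
  let ?P\<chi> = "\<lambda>xs \<xi>s. sat M xs (take k2 \<xi>s @ drop (k2 + K) \<xi>s) \<phi>\<eta> \<and> sat M xs (take K (drop k2 \<xi>s) @ take k2 \<xi>s) \<phi>4"
  have P\<chi>: "?P\<chi> (x @ a) (\<xi> @ \<alpha>) \<longleftrightarrow> \<xi> = \<chi> x" if x: "x \<in> tuples l (carrier M)" and \<xi>: "\<xi> \<in> tuples (k2 + K) (RV M)" for x \<xi>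
  proof -
    have l: "length \<xi> = k2 + K" using tuples_length[OF \<xi>] .
    have t: "take k2 \<xi> \<in> tuples k2 (RV M)" "drop k2 \<xi> \<in> tuples K (RV M)"
      using tuples_take_add[OF \<xi>] tuples_drop_add[OF \<xi>] by auto
    have "?P\<chi> (x @ a) (\<xi> @ \<alpha>) \<longleftrightarrow> sat M (x @ a) (take k2 \<xi> @ \<alpha>) \<phi>\<eta> \<and> sat M (x @ a) (drop k2 \<xi> @ take k2 \<xi>) \<phi>4"
      using l by simp
    also have "\<dots> \<longleftrightarrow> take k2 \<xi> = \<eta> x \<and> drop k2 \<xi> = \<chi>4 a (take k2 \<xi>) x"
      unfolding s\<eta>[OF x t(1)] s4[OF x t(2,1)] ..
    also have "\<dots> \<longleftrightarrow> \<xi> = \<chi> x"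
      unfolding \<chi>_def using t\<chi>[OF x] by (metis append_take_drop_id \<chi>_def)
    finally show ?thesis .
  qed
  have "\<exists>\<phi>. defs L' M \<phi> (l + p) ((k2 + K) + q) ?P\<chi>"
    by (rule exI, (rule d_and E.d_sub[OF d_self[OF wf\<eta>]] E.d_sub[OF d_self[OF wf4]] E.tm_intros | (simp; fail))+)
  then obtain \<phi>\<chi> where \<phi>\<chi>: "defs L' M \<phi>\<chi> (l + p) ((k2 + K) + q) ?P\<chi>" by blast
  have dec1: "definable_rvfun L' M A l (k2 + K) \<chi>"
    unfolding definable_rvfun_def
  proof (intro conjI)
    show "\<chi> \<in> tuples l (carrier M) \<rightarrow> tuples (k2 + K) (RV M)" using \<chi>c by blast
    show "definable L' M A l (k2 + K) {(x, \<chi> x) | x. x \<in> tuples l (carrier M)}"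
    proof (rule E.definableI[OF \<phi>\<chi> a \<alpha> AA], intro equalityI subsetI)
      fix w assume "w \<in> {(x, \<chi> x) | x. x \<in> tuples l (carrier M)}"
      then obtain x where x: "x \<in> tuples l (carrier M)" "w = (x, \<chi> x)" by blast
      then have "?P\<chi> (x @ a) (\<chi> x @ \<alpha>)" using P\<chi>[OF x(1) \<chi>c[OF x(1)]] by blast
      then show "w \<in> {(x, \<xi>). x \<in> tuples l (carrier M) \<and> \<xi> \<in> tuples (k2 + K) (RV M) \<and> ?P\<chi> (x @ a) (\<xi> @ \<alpha>)}"
        using x \<chi>c[OF x(1)] by blast
    next
      fix w assume "w \<in> {(x, \<xi>). x \<in> tuples l (carrier M) \<and> \<xi> \<in> tuples (k2 + K) (RV M) \<and> ?P\<chi> (x @ a) (\<xi> @ \<alpha>)}"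
      then obtain x \<xi> where x: "x \<in> tuples l (carrier M)" "\<xi> \<in> tuples (k2 + K) (RV M)" "?P\<chi> (x @ a) (\<xi> @ \<alpha>)" "w = (x, \<xi>)" by blast
      then have "\<xi> = \<chi> x" using P\<chi>[OF x(1,2)] by blast
      then show "w \<in> {(x, \<chi> x) | x. x \<in> tuples l (carrier M)}" using x by blast
    qed
  qed
  have dec2: "definable L' M A (Suc i) (k2 + K) {(take i x @ [c (\<chi> x) i (take i x)], \<chi> x) | x. x \<in> tuples l (carrier M)}"
    if i: "i < l" for i
  proof -
    obtain \<phi>c where \<phi>c: "defs L' M \<phi>c (i + Suc p) (K + k2)
       (\<lambda>xs \<xi>s. xs ! i = c4 (drop (Suc i) xs) (drop K \<xi>s) (take K \<xi>s) i (take i xs))" using D2 i defs_mono by blast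
    have wfc: "wf_form L' (i + Suc p) (K + k2) \<phi>c" using \<phi>c by (simp add: defs_def)
    have sc: "sat M (z @ y # a) (\<xi> @ \<eta>0) \<phi>c \<longleftrightarrow> y = c4 a \<eta>0 \<xi> i z"
      if h: "z \<in> tuples i (carrier M)" "y \<in> carrier M" "\<xi> \<in> tuples K (RV M)" "\<eta>0 \<in> tuples k2 (RV M)" for z y \<xi> \<eta>0
    proof -
      have "z @ y # a \<in> tuples (i + Suc p) (carrier M)" using h a tuples_append[of z i _ "y # a" "Suc p"] by simp
      from \<phi>c[unfolded defs_def, THEN conjunct2, THEN bspec, OF this, THEN bspec, OF tuples_append[OF h(3,4)]]
      moreover have "(z @ y # a) ! i = y" using nth_append_length[of z y a] tuples_length[OF h(1)] by simp
      ultimately show ?thesis using tuples_length[OF h(1)] tuples_length[OF h(3)] by simp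
    qed
    \<comment> \<open>The center graph is wanted only over projections of fibres. Hence
      \<open>x\<close> is quantified: it must lie in the fibre over the given RV tuple and begin
      with the prefix stored in \<open>zs\<close>.\<close>
    let ?Q = "\<lambda>zs \<xi>s. \<exists>x\<in>tuples l (carrier M). sat M (x @ drop (Suc i) zs) \<xi>s \<phi>\<chi> \<and> (\<forall>j<i. x ! j = zs ! j) \<and>
        sat M zs (take K (drop k2 \<xi>s) @ take k2 \<xi>s) \<phi>c"
    have wf\<chi>: "wf_form L' (l + p) ((k2 + K) + q) \<phi>\<chi>" using \<phi>\<chi> by (simp add: defs_def)
    have "\<exists>\<phi>. defs L' M \<phi> (Suc i + p) ((k2 + K) + q) ?Q"
      using i by - (rule exI, (rule d_and d_exs d_all_less d_eq E.d_sub[OF d_self[OF wf\<chi>]] E.d_sub[OF d_self[OF wfc]] E.tm_intros | (simp; fail))+)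
    then obtain \<phi>Q where \<phi>Q: "defs L' M \<phi>Q (Suc i + p) ((k2 + K) + q) ?Q" by blast
    have s\<chi>: "sat M (x @ a) (\<xi> @ \<alpha>) \<phi>\<chi> \<longleftrightarrow> \<xi> = \<chi> x" if "x \<in> tuples l (carrier M)" "\<xi> \<in> tuples (k2 + K) (RV M)" for x \<xi>
      using \<phi>\<chi>[unfolded defs_def, THEN conjunct2, THEN bspec, OF tuples_append[OF that(1) a], THEN bspec, OF tuples_append[OF that(2) \<alpha>]]
        P\<chi>[OF that] by blast
    have Q: "?Q ((z @ [y]) @ a) (\<xi> @ \<alpha>) \<longleftrightarrow> (\<exists>x\<in>tuples l (carrier M). \<xi> = \<chi> x \<and> z = take i x \<and> y = c (\<chi> x) i (take i x))"
      if z: "z \<in> tuples i (carrier M)" "y \<in> carrier M" "\<xi> \<in> tuples (k2 + K) (RV M)" for z y \<xi>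
    proof -
      have l: "length z = i" "length \<xi> = k2 + K" using tuples_length z by blast+
      have t: "take k2 \<xi> \<in> tuples k2 (RV M)" "drop k2 \<xi> \<in> tuples K (RV M)"
        using tuples_take_add[OF z(3)] tuples_drop_add[OF z(3)] by auto
      have "(\<forall>j<i. x ! j = ((z @ [y]) @ a) ! j) \<longleftrightarrow> z = take i x" if "x \<in> tuples l (carrier M)" for x
        using l(1) i tuples_length[OF that] by (auto simp: list_eq_iff_nth_eq nth_append)
      moreover have "sat M ((z @ [y]) @ a) (take K (drop k2 (\<xi> @ \<alpha>)) @ take k2 (\<xi> @ \<alpha>)) \<phi>c \<longleftrightarrow> y = c \<xi> i z"
        using sc[OF z(1,2) t(2,1)] l unfolding c_def by simp
      moreover have "sat M (x @ drop (Suc i) ((z @ [y]) @ a)) (\<xi> @ \<alpha>) \<phi>\<chi> \<longleftrightarrow> \<xi> = \<chi> x" if "x \<in> tuples l (carrier M)" for x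
        using s\<chi>[OF that z(3)] l by simp
      ultimately show ?thesis by auto
    qed
    show ?thesis
    proof (rule E.definableI[OF \<phi>Q a \<alpha> AA], intro equalityI subsetI)
      fix w assume "w \<in> {(take i x @ [c (\<chi> x) i (take i x)], \<chi> x) | x. x \<in> tuples l (carrier M)}"
      then obtain x where x: "x \<in> tuples l (carrier M)" "w = (take i x @ [c (\<chi> x) i (take i x)], \<chi> x)" by blast
      have z: "take i x \<in> tuples i (carrier M)" using tuples_take[OF x(1)] i by simp
      have y: "c (\<chi> x) i (take i x) \<in> carrier M" using cc[OF \<chi>c[OF x(1)]] i z by blast
      have "?Q ((take i x @ [c (\<chi> x) i (take i x)]) @ a) (\<chi> x @ \<alpha>)" using Q[OF z y \<chi>c[OF x(1)]] x(1) by blast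
      then show "w \<in> {(x, \<xi>). x \<in> tuples (Suc i) (carrier M) \<and> \<xi> \<in> tuples (k2 + K) (RV M) \<and> ?Q (x @ a) (\<xi> @ \<alpha>)}"
        unfolding x(2) using tuples_snoc[OF z y] \<chi>c[OF x(1)] by blast
    next
      fix w assume "w \<in> {(x, \<xi>). x \<in> tuples (Suc i) (carrier M) \<and> \<xi> \<in> tuples (k2 + K) (RV M) \<and> ?Q (x @ a) (\<xi> @ \<alpha>)}"
      then obtain zs \<xi> where w: "zs \<in> tuples (Suc i) (carrier M)" "\<xi> \<in> tuples (k2 + K) (RV M)" "?Q (zs @ a) (\<xi> @ \<alpha>)" "w = (zs, \<xi>)" by blast
      define z y where "z = take i zs" and "y = zs ! i"
      have zs: "zs = z @ [y]" unfolding z_def y_def using tuples_length[OF w(1)] by (metis lessI order_refl take_Suc_conv_app_nth take_all)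
      have zy: "z \<in> tuples i (carrier M)" "y \<in> carrier M"
        unfolding z_def y_def using tuples_take[OF w(1)] tuples_nth[OF w(1)] by auto
      obtain x where "x \<in> tuples l (carrier M)" "\<xi> = \<chi> x" "z = take i x" "y = c (\<chi> x) i (take i x)"
        using Q[OF zy w(2)] w(3) unfolding zs by blast
      then show "w \<in> {(take i x @ [c (\<chi> x) i (take i x)], \<chi> x) | x. x \<in> tuples l (carrier M)}" using w(4) zs by blast
    qed
  qed
  have dec: "decomposition L' M A l (k2 + K) \<chi> c"
    unfolding decomposition_def
  proof (intro conjI dec1 ballI allI impI)
    show "c \<xi> i \<in> tuples i (carrier M) \<rightarrow> carrier M" if "\<xi> \<in> tuples (k2 + K) (RV M)" "i < l" for \<xi> i
      using cc[OF that(1)] that(2) by blast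
    show "definable L' M A (Suc i) (k2 + K) {(take i x @ [c (\<chi> x) i (take i x)], \<chi> x) | x. x \<in> tuples l (carrier M)}"
      if "i < l" for i by (rule dec2[OF that])
    fix \<xi> assume \<xi>: "\<xi> \<in> tuples (k2 + K) (RV M)" "fibre M l \<chi> \<xi> \<noteq> {}"
    then obtain x0 where x0: "x0 \<in> fibre M l \<chi> \<xi>" by blast
    show "\<exists>r\<in>tuples l (RV M). fibre M l \<chi> \<xi> = twisted_box M (vabs M \<one>) l (c \<xi>) r"
      by (rule okb_box[OF cc[OF \<xi>(1)] Fsub x0 ok[OF \<xi>(1)]])
  qed
  have body: "\<forall>\<xi>\<in>tuples (k2 + K) (RV M). \<forall>F. F = fibre M l \<chi> \<xi> \<and> F \<noteq> {} \<longrightarrow>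
            (\<forall>x\<in>F. \<forall>y\<in>F. \<psi> x = \<psi> y) \<and>
            ((\<exists>y. f ` F = {y}) \<or> (\<exists>\<mu>. is_open_ball M \<mu> (f ` F))) \<and>
            (\<forall>\<delta>\<in>Gamma_units M. vle M \<delta> (vabs M \<one>\<^bsub>M\<^esub>) \<longrightarrow>
              (\<forall>s\<in>tuples l (RVl M \<delta>). \<forall>G. G = twisted_box M \<delta> l (c \<xi>) s \<and> G \<subseteq> F \<longrightarrow>
                 ((\<exists>y. f ` F = {y}) \<longrightarrow> (\<exists>y. f ` G = {y})) \<and>
                 (\<forall>\<mu>. is_open_ball M \<mu> (f ` F) \<longrightarrow>
                    is_open_ball M (\<delta> <#>\<^bsub>M\<^esub> \<mu>) (f ` G))))"
  proof (rule ballI, rule allI, rule impI, elim conjE, hypsubst)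
    fix \<xi> assume \<xi>: "\<xi> \<in> tuples (k2 + K) (RV M)" and F: "fibre M l \<chi> \<xi> \<noteq> {}"
    show "(\<forall>x\<in>fibre M l \<chi> \<xi>. \<forall>y\<in>fibre M l \<chi> \<xi>. \<psi> x = \<psi> y) \<and>
            ((\<exists>y. f ` fibre M l \<chi> \<xi> = {y}) \<or> (\<exists>\<mu>. is_open_ball M \<mu> (f ` fibre M l \<chi> \<xi>))) \<and>
            (\<forall>\<delta>\<in>Gamma_units M. vle M \<delta> (vabs M \<one>\<^bsub>M\<^esub>) \<longrightarrow>
              (\<forall>s\<in>tuples l (RVl M \<delta>). \<forall>G. G = twisted_box M \<delta> l (c \<xi>) s \<and> G \<subseteq> fibre M l \<chi> \<xi> \<longrightarrow>
                 ((\<exists>y. f ` fibre M l \<chi> \<xi> = {y}) \<longrightarrow> (\<exists>y. f ` G = {y})) \<and>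
                 (\<forall>\<mu>. is_open_ball M \<mu> (f ` fibre M l \<chi> \<xi>) \<longrightarrow>
                    is_open_ball M (\<delta> <#>\<^bsub>M\<^esub> \<mu>) (f ` G))))"
      by (rule okb_body[OF cc[OF \<xi>] Fsub F ok[OF \<xi>]])
  qed
  show "\<exists>k \<chi> c. decomposition L' M A l k \<chi> c \<and>
         (\<forall>\<xi>\<in>tuples k (RV M). \<forall>F. F = fibre M l \<chi> \<xi> \<and> F \<noteq> {} \<longrightarrow>
            (\<forall>x\<in>F. \<forall>y\<in>F. \<psi> x = \<psi> y) \<and>
            ((\<exists>y. f ` F = {y}) \<or> (\<exists>\<mu>. is_open_ball M \<mu> (f ` F))) \<and>
            (\<forall>\<delta>\<in>Gamma_units M. vle M \<delta> (vabs M \<one>\<^bsub>M\<^esub>) \<longrightarrow>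
              (\<forall>s\<in>tuples l (RVl M \<delta>). \<forall>G. G = twisted_box M \<delta> l (c \<xi>) s \<and> G \<subseteq> F \<longrightarrow>
                 ((\<exists>y. f ` F = {y}) \<longrightarrow> (\<exists>y. f ` G = {y})) \<and>
                 (\<forall>\<mu>. is_open_ball M \<mu> (f ` F) \<longrightarrow>
                    is_open_ball M (\<delta> <#>\<^bsub>M\<^esub> \<mu>) (f ` G)))))"
    by (rule exI[of _ "k2 + K"], rule exI[of _ \<chi>], rule exI[of _ c], rule conjI[OF dec body])
qed

text \<open>A value with infinite fibre is shown to be a ball value of one of the functions
  \<open>g a \<eta>0\<close>. Each of these has boundedly many ball values, and
  \<open>bounded_union\<close> removes the index \<open>\<eta>0\<close>.\<close>

lemma property_D_expansion:
  assumes A: "A \<subseteq> Inl ` carrier M \<union> Inr ` RV M"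
  shows "property_D L' M A"
  unfolding property_D_def
proof (intro allI impI)
  fix f assume f0: "definable_fun L' M A 1 f"
  have fc: "f [x] \<in> carrier M" if "x \<in> carrier M" for x
    using f0 that unfolding definable_fun_def by (auto simp: tuples_Suc)
  obtain a \<alpha> where 1: "Inl ` set a \<union> Inr ` set \<alpha> \<subseteq> A"
    "definable L' M (Inl ` set a \<union> Inr ` set \<alpha>) (Suc 1) 0 {(x @ [f x], []) | x. x \<in> tuples 1 (carrier M)}"
    using definable_finite[of L' M A "Suc 1" 0] f0 unfolding definable_fun_def by blast
  define p q where "p = length a" and "q = length \<alpha>"
  have a: "a \<in> tuples p (carrier M)" and \<alpha>: "\<alpha> \<in> tuples q (RV M)"
    using 1(1) A unfolding p_def q_def tuples_def by auto
  have f: "definable_fun L' M (Inl ` set a \<union> Inr ` set \<alpha>) 1 f"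
    using f0 1(2) unfolding definable_fun_def by blast
  obtain \<phi>f k2 \<chi>2 \<eta> \<phi>\<eta> k3 \<chi>3 where wff: "wf_form L' (1 + Suc p) q \<phi>f"
    and sf: "\<And>x y. x \<in> tuples 1 (carrier M) \<Longrightarrow> y \<in> carrier M \<Longrightarrow> sat M (x @ y # a) \<alpha> \<phi>f \<longleftrightarrow> y = f x"
    and d2: "dfun (1 + Suc p) k2 \<chi>2"
    and \<eta>c: "\<And>x. x \<in> tuples 1 (carrier M) \<Longrightarrow> \<eta> x \<in> tuples k2 (RV M)"
    and C1: "\<And>x y. x \<in> tuples 1 (carrier M) \<Longrightarrow> y \<in> carrier M \<Longrightarrow> \<chi>2 (x @ y # a) = \<eta> x \<longleftrightarrow> y = f x"
    and d3: "dfun (1 + p) k3 \<chi>3"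
    and C3: "\<And>x x'. x \<in> tuples 1 (carrier M) \<Longrightarrow> x' \<in> tuples 1 (carrier M) \<Longrightarrow> \<chi>3 (x @ a) = \<chi>3 (x' @ a) \<Longrightarrow> \<eta> x = \<eta> x'"
    by (rule fun_control[OF f a \<alpha>]) (rule that; assumption)
  have t1: "[x] \<in> tuples 1 (carrier M)" if "x \<in> carrier M" for x using that by (simp add: tuples_def)
  obtain \<theta> g where wf\<theta>: "wf_form L (1 + Suc p) k2 \<theta>" and g: "\<forall>x\<in>tuples 1 (carrier M). \<forall>a\<in>tuples p (carrier M). \<forall>\<eta>\<in>tuples k2 (RV M).
       g a \<eta> x \<in> carrier M \<and> (\<forall>u\<in>carrier M. sat M (x @ u # a) \<eta> \<theta> \<longleftrightarrow> u = g a \<eta> x) \<and>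
       (\<forall>y0\<in>carrier M. (\<forall>y\<in>carrier M. \<chi>2 (x @ y # a) = \<eta> \<longleftrightarrow> y = y0) \<longrightarrow> g a \<eta> x = y0)"
    using choose_fun[OF d2] by (elim exE, elim conjE) (rule that, assumption+)
  have fg: "f [x] = g a (\<eta> [x]) [x]" if x: "x \<in> carrier M" for x
    using g[THEN bspec, OF t1[OF x], THEN bspec, OF a, THEN bspec, OF \<eta>c[OF t1[OF x]]] C1[OF t1[OF x]] fc[OF x] by metis
  have wf\<theta>1: "wf_form L (Suc (Suc p)) k2 \<theta>" using wf\<theta> by simp
  \<comment> \<open>The order of argument and value is exchanged to suit
    \<open>uniform_D\<close>.\<close>
  have "\<exists>\<phi>. defs L M \<phi> (Suc (Suc p)) k2 (\<lambda>xs \<xi>s. sat M (hd (tl xs) # hd xs # tl (tl xs)) \<xi>s \<theta>)"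
    by (rule exI, (rule d_sub[OF d_self[OF wf\<theta>1]] tm_intros | (simp; fail))+)
  then obtain \<phi> where \<phi>: "defs L M \<phi> (Suc (Suc p)) k2 (\<lambda>xs \<xi>s. sat M (hd (tl xs) # hd xs # tl (tl xs)) \<xi>s \<theta>)" by blast
  then have wf\<phi>: "wf_form L (Suc (Suc p)) k2 \<phi>" by (simp add: defs_def)
  have s\<phi>: "sat M (u # x # b) \<eta>0 \<phi> \<longleftrightarrow> u = g b \<eta>0 [x]"
    if "u \<in> carrier M" "x \<in> carrier M" "b \<in> tuples p (carrier M)" "\<eta>0 \<in> tuples k2 (RV M)" for u x b \<eta>0
  proof -
    have "u # x # b \<in> tuples (Suc (Suc p)) (carrier M)" using that by simp
    from \<phi>[unfolded defs_def, THEN conjunct2, THEN bspec, OF this, THEN bspec, OF that(4)]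
    have "sat M (u # x # b) \<eta>0 \<phi> \<longleftrightarrow> sat M ([x] @ u # b) \<eta>0 \<theta>" by simp
    then show ?thesis using g[THEN bspec, OF t1[OF that(2)], THEN bspec, OF that(3), THEN bspec, OF that(4)] that(1) by blast
  qed
  obtain n0 where n0: "\<forall>b\<in>tuples p (carrier M). \<forall>\<eta>0\<in>tuples k2 (RV M).
    (\<forall>x\<in>carrier M. \<exists>y\<in>carrier M. \<forall>u\<in>carrier M. sat M (u # x # b) \<eta>0 \<phi> \<longleftrightarrow> u = y) \<longrightarrow>
    finite {y \<in> carrier M. ball_value M \<phi> b \<eta>0 y} \<and> card {y \<in> carrier M. ball_value M \<phi> b \<eta>0 y} \<le> n0"
    using uniform_D[OF wf\<phi>] by (elim exE)
  have n0': "finite {y \<in> carrier M. ball_value M \<phi> b \<eta>0 y} \<and> card {y \<in> carrier M. ball_value M \<phi> b \<eta>0 y} \<le> n0"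
    if b: "b \<in> tuples p (carrier M)" "\<eta>0 \<in> tuples k2 (RV M)" for b \<eta>0
  proof (rule n0[THEN bspec, OF b(1), THEN bspec, OF b(2), THEN mp], intro ballI)
    fix x assume x: "x \<in> carrier M"
    have "g b \<eta>0 [x] \<in> carrier M" using g t1[OF x] b by blast
    then show "\<exists>y\<in>carrier M. \<forall>u\<in>carrier M. sat M (u # x # b) \<eta>0 \<phi> \<longleftrightarrow> u = y" using s\<phi>[OF _ x b] by blast
  qed
  have "\<exists>\<beta>. defs L M \<beta> (Suc p) (k2 + 0) (\<lambda>xs \<xi>s. ball_value M \<phi> (tl xs) \<xi>s (hd xs))"
    unfolding ball_value_def
    by (rule exI, (rule d_ex d_all d_and d_not d_imp d_eq d_vlt' d_sub[OF d_self[OF wf\<phi>]] tm_intros | (simp; fail))+)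
  then obtain \<beta> where \<beta>: "defs L M \<beta> (Suc p) (k2 + 0) (\<lambda>xs \<xi>s. ball_value M \<phi> (tl xs) \<xi>s (hd xs))" by blast
  have s\<beta>: "sat M (y # b) \<eta>0 \<beta> \<longleftrightarrow> ball_value M \<phi> b \<eta>0 y"
    if "y \<in> carrier M" "b \<in> tuples p (carrier M)" "\<eta>0 \<in> tuples k2 (RV M)" for y b \<eta>0
  proof -
    have "y # b \<in> tuples (Suc p) (carrier M)" "\<eta>0 \<in> tuples (k2 + 0) (RV M)" using that by simp_all
    from \<beta>[unfolded defs_def, THEN conjunct2, THEN bspec, OF this(1), THEN bspec, OF this(2)]
    show ?thesis unfolding list.sel by (rule sym)
  qed
  \<comment> \<open>\<open>bounded_union\<close> wants a bound valid for all parameter tuples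
    \<open>b\<close>, not merely for \<open>a\<close>; this is why \<open>n0\<close> was obtained
    uniformly.\<close>
  have fin: "\<exists>N'. \<forall>b\<in>tuples p (carrier M). \<forall>\<alpha>\<in>tuples 0 (RV M).
      finite {z \<in> carrier M. \<exists>\<zeta>\<in>tuples k2 (RV M). sat M (z # b) (\<zeta> @ \<alpha>) \<beta>} \<and>
      card {z \<in> carrier M. \<exists>\<zeta>\<in>tuples k2 (RV M). sat M (z # b) (\<zeta> @ \<alpha>) \<beta>} \<le> N'"
  proof (rule bounded_union[where N = n0])
    show "wf_form L (Suc p) (k2 + 0) \<beta>" using \<beta> by (simp add: defs_def)
    fix b \<alpha>' \<zeta> assume *: "b \<in> tuples p (carrier M)" "\<alpha>' \<in> tuples 0 (RV M)" "\<zeta> \<in> tuples k2 (RV M)"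
    have "{z \<in> carrier M. sat M (z # b) (\<zeta> @ \<alpha>') \<beta>} = {y \<in> carrier M. ball_value M \<phi> b \<zeta> y}"
      using s\<beta>[OF _ *(1,3)] *(2) by auto
    then show "finite {z \<in> carrier M. sat M (z # b) (\<zeta> @ \<alpha>') \<beta>} \<and> card {z \<in> carrier M. sat M (z # b) (\<zeta> @ \<alpha>') \<beta>} \<le> n0"
      using n0'[OF *(1,3)] by simp
  qed
  have "[] \<in> tuples 0 (RV M)" by simp
  with fin a have "finite {z \<in> carrier M. \<exists>\<zeta>\<in>tuples k2 (RV M). sat M (z # a) (\<zeta> @ []) \<beta>}" by blast
  moreover have "{y \<in> carrier M. infinite {x \<in> carrier M. f [x] = y}} \<subseteq> {z \<in> carrier M. \<exists>\<zeta>\<in>tuples k2 (RV M). sat M (z # a) (\<zeta> @ []) \<beta>}"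
  proof
    fix y assume "y \<in> {y \<in> carrier M. infinite {x \<in> carrier M. f [x] = y}}"
    then have y: "y \<in> carrier M" and inf: "infinite {x \<in> carrier M. f [x] = y}" by auto
    have d3': "dfun (Suc p) k3 \<chi>3" using d3 by simp
    obtain C3' where C3': "finite C3'" "C3' \<subseteq> carrier M" "\<forall>x\<in>carrier M. \<forall>x'\<in>carrier M.
      (\<forall>c\<in>C3'. vlt M (x' \<ominus> x) (x \<ominus> c)) \<longrightarrow> \<chi>3 (x' # a) = \<chi>3 (x # a)"
      using prepare_dfun[OF d3' a] by (elim exE, elim conjE) (rule that, assumption+)
    have wff': "wf_form L' (Suc (Suc p)) q \<phi>f" using wff by simp
    \<comment> \<open>The graph formula is coded a second time, now with the value \<open>y\<close>
      among the parameters and \<open>x\<close> as the variable. The centers \<open>C5\<close>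
      depend on \<open>y\<close>; only their finiteness matters.\<close>
    obtain k5 \<chi>5 where d5: "dfun (Suc (Suc p)) k5 \<chi>5" and \<chi>5: "\<forall>x\<in>tuples (Suc (Suc p)) (carrier M). \<forall>x'\<in>tuples (Suc (Suc p)) (carrier M).
     \<chi>5 x = \<chi>5 x' \<longrightarrow> (\<forall>\<xi>\<in>tuples q (RV M). sat M x \<xi> \<phi>f \<longleftrightarrow> sat M x' \<xi> \<phi>f)"
      using control[OF wff'] by (elim exE, elim conjE) (rule that, assumption+)
    have ya: "y # a \<in> tuples (Suc p) (carrier M)" using y a by simp
    obtain C5 where C5: "finite C5" "C5 \<subseteq> carrier M" "\<forall>x\<in>carrier M. \<forall>x'\<in>carrier M.
      (\<forall>c\<in>C5. vlt M (x' \<ominus> x) (x \<ominus> c)) \<longrightarrow> \<chi>5 (x' # y # a) = \<chi>5 (x # y # a)"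
      using prepare_dfun[OF d5 ya] by (elim exE, elim conjE) (rule that, assumption+)
    \<comment> \<open>An infinite fibre has a point away from all centers. Near it both codes are
      constant: by \<open>\<chi>3\<close> the value of \<open>\<eta>\<close> stays, and by
      \<open>\<chi>5\<close> the value of \<open>f\<close> stays equal to \<open>y\<close>.\<close>
    have "finite (C3' \<union> C5)" using C3'(1) C5(1) by simp
    then have "\<not> {x \<in> carrier M. f [x] = y} \<subseteq> C3' \<union> C5" using inf finite_subset by blast
    then obtain x where x: "x \<in> carrier M" "f [x] = y" "x \<notin> C3' \<union> C5" by blast
    obtain m where m: "m \<in> carrier M" "m \<noteq> \<zero>" "\<forall>c\<in>C3' \<union> C5. \<forall>u\<in>carrier M. vlt M u m \<longrightarrow> vlt M u (x \<ominus> c)"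
      using isolating_radius[of "C3' \<union> C5" x] C3'(1,2) C5(1,2) x by blast
    have "sat M (y # x' # a) (\<eta> [x]) \<phi>" if x': "x' \<in> carrier M" "vlt M (x' \<ominus> x) m" for x'
    proof -
      have v: "vlt M (x' \<ominus> x) (x \<ominus> c)" if "c \<in> C3' \<union> C5" for c using m(3) that x' x(1) by blast
      have "\<chi>3 (x' # a) = \<chi>3 (x # a)" using C3'(3) x(1) x'(1) v by blast
      then have e: "\<eta> [x'] = \<eta> [x]" using C3[OF t1[OF x'(1)] t1[OF x(1)]] by simp
      have "\<chi>5 (x' # y # a) = \<chi>5 (x # y # a)" using C5(3) x(1) x'(1) v by blast
      moreover have "x' # y # a \<in> tuples (Suc (Suc p)) (carrier M)" "x # y # a \<in> tuples (Suc (Suc p)) (carrier M)"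
        using ya x(1) x'(1) by simp_all
      ultimately have "sat M (x' # y # a) \<alpha> \<phi>f \<longleftrightarrow> sat M (x # y # a) \<alpha> \<phi>f" using \<chi>5 \<alpha> by blast
      then have "f [x'] = y" using sf[OF t1[OF x'(1)] y] sf[OF t1[OF x(1)] y] x(2) by simp
      then have "y = g a (\<eta> [x]) [x']" using fg[OF x'(1)] e by simp
      then show ?thesis using s\<phi>[OF y x'(1) a \<eta>c[OF t1[OF x(1)]]] by simp
    qed
    then have "ball_value M \<phi> a (\<eta> [x]) y" unfolding ball_value_def using x(1) m(1,2) by blast
    then have "sat M (y # a) (\<eta> [x] @ []) \<beta>" using s\<beta>[OF y a \<eta>c[OF t1[OF x(1)]]] by simp
    then show "y \<in> {z \<in> carrier M. \<exists>\<zeta>\<in>tuples k2 (RV M). sat M (z # a) (\<zeta> @ []) \<beta>}"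
      using y \<eta>c[OF t1[OF x(1)]] by blast
  qed
  ultimately show "finite {y \<in> carrier M. infinite {x \<in> carrier M. f [x] = y}}" using finite_subset by blast
qed

end

section \<open>Reducts, and the passage to all models of the expanded theory\<close>

lemma sat_reduct:
  fixes K K' :: "('f, 'r, 'a) vstruct"
  assumes eq: "ring.truncate K' = ring.truncate K" "vring K' = vring K"
    and "vf_structure L K"
    and fn: "\<And>f xs. f \<in> fsyms L \<Longrightarrow> xs \<in> tuples (farity L f) (carrier K) \<Longrightarrow> ifun K' f xs = ifun K f xs"
    and rl: "\<And>R. R \<in> rsyms L \<Longrightarrow> irel K' R = irel K R"
  shows "wf_form L n m \<phi> \<Longrightarrow> xs \<in> tuples n (carrier K) \<Longrightarrow> \<xi>s \<in> tuples m (RV K) \<Longrightarrow>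
    sat K' xs \<xi>s \<phi> \<longleftrightarrow> sat K xs \<xi>s \<phi>"
proof -
  interpret vstr L K using assms(3) by (rule vstrI)
  have K': "K' = K\<lparr>ifun := ifun K', irel := irel K'\<rparr>"
    using eq by (cases K; cases K') (simp add: ring.truncate_def)
  have c: "carrier K' = carrier K" "vring K' = vring K" "add K' = add K" "mult K' = mult K" "one K' = one K" "zero K' = zero K"
    by (subst K', simp)+
  have u: "a_inv K' = a_inv K" unfolding a_inv_def m_inv_def by (intro ext) (simp add: c)
  have U: "Units (vring_of K') = Units (vring_of K)" by (simp add: Units_def vring_of_def c)
  have va: "vabs K' = vabs K" by (rule ext) (simp add: vabs_def U c)
  have vl: "vless K' = vless K" by (intro ext) (simp add: vless_def vle_def c)
  \<comment> \<open>RV and its quotient map are computed from the ring and the valuation ring alone,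
    so they are literally the same sets in the expansion.\<close>
  have rv: "rv K' = rv K" by (intro ext) (simp add: rv_def rvl_def va vl c)
  have RV: "RV K' = RV K" by (simp add: RV_def RVl_def rvl_def va vl c)
  have ev: "wf_trm L n t \<Longrightarrow> eval K' xs t = eval K xs t" if xs: "xs \<in> tuples n (carrier K)" for n xs t
  proof (induction t)
    case (Fn f ts)
    then have "map (eval K' xs) ts = map (eval K xs) ts" by (auto simp: list_all_iff)
    moreover have "map (eval K xs) ts \<in> tuples (farity L f) (carrier K)"
      using Fn.prems eval_closed[OF xs] by (auto simp: tuples_def list_all_iff)
    ultimately have "ifun K' f (map (eval K xs) ts) = ifun K f (map (eval K xs) ts)"
      "map (eval K' xs) ts = map (eval K xs) ts" using fn Fn.prems by simp_all
    then show ?case by (simp only: eval.simps)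
  qed (simp_all add: c u)
  have rev: "rveval K' xs \<xi>s t = rveval K xs \<xi>s t" if "xs \<in> tuples n (carrier K)" "wf_rvtrm L n m t" for n m xs \<xi>s t
    using that ev by (cases t) (auto simp: rv)
  show "wf_form L n m \<phi> \<Longrightarrow> xs \<in> tuples n (carrier K) \<Longrightarrow> \<xi>s \<in> tuples m (RV K) \<Longrightarrow>
    sat K' xs \<xi>s \<phi> \<longleftrightarrow> sat K xs \<xi>s \<phi>"
  proof (induction \<phi> arbitrary: n m xs \<xi>s)
    case (FEq s t)
    then show ?case using ev by simp
  next
    case (FVal t)
    then show ?case using ev by (simp add: c)
  next
    case (FRVEq s t)
    then have "rveval K' xs \<xi>s s = rveval K xs \<xi>s s" "rveval K' xs \<xi>s t = rveval K xs \<xi>s t"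
      by (auto intro!: rev[of xs n m])
    then show ?case by simp
  next
    case (FRel R ts us)
    have "map (eval K' xs) ts = map (eval K xs) ts" using FRel ev by (auto simp: list_all_iff)
    moreover have "rveval K' xs \<xi>s u = rveval K xs \<xi>s u" if "u \<in> set us" for u
      by (rule rev[OF FRel.prems(2), of m]) (use FRel.prems(1) that in \<open>simp add: list_all_iff\<close>)
    then have "map (rveval K' xs \<xi>s) us = map (rveval K xs \<xi>s) us" by simp
    moreover have "irel K' R = irel K R" using FRel.prems(1) rl by simp
    ultimately show ?case by (simp only: sat.simps)
  next
    case (FNot \<phi>)
    then show ?case by simp
  next
    case (FAnd \<phi> \<psi>)
    have "sat K' xs \<xi>s \<phi> \<longleftrightarrow> sat K xs \<xi>s \<phi>" "sat K' xs \<xi>s \<psi> \<longleftrightarrow> sat K xs \<xi>s \<psi>"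
      using FAnd.IH(1)[of n m xs \<xi>s] FAnd.IH(2)[of n m xs \<xi>s] FAnd.prems by simp_all
    then show ?case by simp
  next
    case (FEx \<phi>)
    have "sat K' (x # xs) \<xi>s \<phi> \<longleftrightarrow> sat K (x # xs) \<xi>s \<phi>" if "x \<in> carrier K" for x
      by (rule FEx.IH[of "Suc n" m]) (use FEx.prems that in simp_all)
    then show ?case by (simp add: c)
  next
    case (FExRV \<phi>)
    have "sat K' xs (\<xi> # \<xi>s) \<phi> \<longleftrightarrow> sat K xs (\<xi> # \<xi>s) \<phi>" if "\<xi> \<in> RV K" for \<xi>
      by (rule FExRV.IH[of n "Suc m"]) (use FExRV.prems that in simp_all)
    then show ?case by (simp add: RV)
  qed
qed

theorem theorem2p6p1:
  fixes L L' :: "('f, 'r) lang"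
    and K K' :: "('f, 'r, 'a) vstruct"
    and l :: nat
  assumes "vf_structure L K"
    and "equichar_zero K"
    and "l \<ge> 1"
    and "satisfies_TD TYPE('f + 'r + nat) L (Th L K) l"
    and "rv_expansion L K L' K'"
  shows "satisfies_TD TYPE('u) L' (Th L' K') l"
  unfolding satisfies_TD_def
proof (intro allI impI, elim conjE)
  fix M :: "('f, 'r, 'u) vstruct" and A
  assume mod: "is_model L' (Th L' K') M" and A: "A \<subseteq> Inl ` carrier M \<union> Inr ` RV M"
  have ex: "fsyms L' = fsyms L" "\<And>f. f \<in> fsyms L \<Longrightarrow> farity L' f = farity L f" "rsyms L \<subseteq> rsyms L'"
    "\<And>R. R \<in> rsyms L \<Longrightarrow> rarity L' R = rarity L R" "\<And>R. R \<in> rsyms L' - rsyms L \<Longrightarrow> fst (rarity L' R) = 0"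
    "ring.truncate K' = ring.truncate K" "vring K' = vring K"
    "\<And>f xs. f \<in> fsyms L \<Longrightarrow> xs \<in> tuples (farity L f) (carrier K) \<Longrightarrow> ifun K' f xs = ifun K f xs"
    "\<And>R. R \<in> rsyms L \<Longrightarrow> irel K' R = irel K R"
    using assms(5) unfolding rv_expansion_def by blast+
  have vM': "vf_structure L' M" using mod by (simp add: is_model_def)
  have vM: "vf_structure L M"
    unfolding vf_structure_def
  proof (intro conjI ballI)
    show "valued_field M" using vM' by (simp add: vf_structure_def)
    show "ifun M f xs \<in> carrier M" if "f \<in> fsyms L" "xs \<in> tuples (farity L f) (carrier M)" for f xs
      using vM' that ex(1,2) unfolding vf_structure_def by auto
    show "case rarity L R of (m, n) \<Rightarrow> irel M R \<subseteq> tuples m (carrier M) \<times> tuples n (RV M)" if "R \<in> rsyms L" for R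
    proof -
      have "R \<in> rsyms L'" using that ex(3) by blast
      then have "case rarity L' R of (m, n) \<Rightarrow> irel M R \<subseteq> tuples m (carrier M) \<times> tuples n (RV M)"
        using vM'[unfolded vf_structure_def, THEN conjunct2, THEN conjunct2] by (rule bspec[rotated])
      then show ?thesis unfolding ex(4)[OF that] .
    qed
  qed
  have wf_trm: "wf_trm L' n t" if "wf_trm L n t" for n t
    using that ex(1,2) by (induction t) (auto simp: list_all_iff)
  have wf_rvtrm: "wf_rvtrm L' n m t" if "wf_rvtrm L n m t" for n m t
    using that wf_trm by (cases t) auto
  have wf: "wf_form L' n m \<phi>" if "wf_form L n m \<phi>" for n m \<phi>
    using that ex(3,4) by (induction \<phi> arbitrary: n m) (auto simp: list_all_iff intro: wf_trm wf_rvtrm)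
  \<comment> \<open>An \<open>L\<close>-sentence true in \<open>K\<close> is also true in the
    expansion, hence belongs to the theory that \<open>M\<close> satisfies.\<close>
  have Th: "sat M [] [] \<phi>" if "\<phi> \<in> Th L K" for \<phi>
  proof -
    have \<phi>: "wf_form L 0 0 \<phi>" "sat K [] [] \<phi>" using that by (auto simp: Th_def)
    have "sat K' [] [] \<phi> \<longleftrightarrow> sat K [] [] \<phi>"
      by (rule sat_reduct[OF ex(6,7) assms(1) ex(8,9) \<phi>(1)]) simp_all
    then have "\<phi> \<in> Th L' K'" using \<phi> wf by (simp add: Th_def)
    then show ?thesis using mod by (simp add: is_model_def)
  qed
  \<comment> \<open>A structure elementarily equivalent to \<open>M\<close> in \<open>L\<close> is a
    model of the theory of \<open>K\<close>, so the hypothesis on that theory provides the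
    assumption of \<open>td_model\<close>.\<close>
  interpret td_expansion L M l L'
  proof
    show "vf_structure L M" by (rule vM)
    show "valued_field M" using vM by (simp add: vf_structure_def)
    show "1 \<le> l" by (rule assms(3))
    fix N :: "('f, 'r, 'f + 'r + nat) vstruct" and A'
    assume N: "vf_structure L N" "\<And>\<phi>. wf_form L 0 0 \<phi> \<Longrightarrow> sat N [] [] \<phi> = sat M [] [] \<phi>"
      and A': "A' \<subseteq> Inl ` carrier N \<union> Inr ` RV N"
    have "is_model L (Th L K) N"
      unfolding is_model_def using N Th by (auto simp: Th_def)
    then show "property_T L N A' l \<and> property_D L N A'"
      using assms(4) A' unfolding satisfies_TD_def by blast
  qed (use ex vM' in auto)
  show "property_T L' M A l \<and> property_D L' M A"
    using property_T_expansion[OF A] property_D_expansion[OF A] by blast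
qed

end
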